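(* Let $M$ be a compact metrizable space and let $\Gamma\subset\mathsf{Homeo}(M)$ be a non-elementary convergence group. Suppose $(\sigma,\bar\sigma,G)$ is a continuous GPS system for $\Gamma$ with $\delta:=\delta_\sigma(\Gamma)<+\infty$ and $Q_\sigma(\delta)=+\infty$. Let $\mu$ be the unique $\sigma$-Patterson–Sullivan measure of dimension $\delta$ and $\bar\mu$ the unique $\bar\sigma$-Patterson–Sullivan measure of dimension $\delta$. If the BMS measure $m_\Gamma$ is finite and mixing, then $$\lim_{T\to\infty}\delta e^{-\delta T}\sum_{\substack{\gamma\in\Gamma_{\mathrm{lox}}\\ \ell_\sigma(\gamma)\le T}}\mathcal D_{\gamma^-}\otimes\mathcal D_{\gamma^+}=\frac1{\|m_\Gamma\|}e^{\delta G(x,y)}\,\bar\mu(x)\otimes\mu(y)$$ as measures on $M^{(2)}$, where the convergence is in the dual of the space of compactly supported continuous functions on $M^{(2)}$ (i.e. tested against each such function), $\mathcal D_z$ is the unit Dirac mass at $z$, and $\|m_\Gamma\|$ is the total mass of $m_\Gamma$.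
   Context: $M^{(2)}\subset M\times M$ denotes the space of pairs of distinct points. Convergence groups. $\Gamma\subset\mathsf{Homeo}(M)$ is a (discrete) convergence group if for every sequence $\{\gamma_n\}$ of distinct elements of $\Gamma$ there are $x,y\in M$ and a subsequence with $\gamma_{n_j}|_{M\smallsetminus\{y\}}\to x$ locally uniformly. An element $\gamma$ is loxodromic if it has exactly two fixed points $\gamma^+,\gamma^-$ in $M$ and $\gamma^{\pm n}|_{M\smallsetminus\{\gamma^\mp\}}\to\gamma^\pm$ locally uniformly; $\Gamma_{\mathrm{lox}}$ is the set of loxodromic elements of $\Gamma$. The limit set $\Lambda(\Gamma)$ is the set of $x\in M$ for which there are $y\in M$ and $\{\gamma_n\}\subset\Gamma$ with $\gamma_n|_{M\smallsetminus\{y\}}\to x$ locally uniformly; $\Gamma$ is non-elementary if $\#\Lambda(\Gamma)\ge3$. GPS systems. A continuous cocycle is a continuous map $\sigma:\Gamma\times M\to\mathbb R$ ($\Gamma$ discrete) with $\sigma(\alpha\beta,x)=\sigma(\alpha,\beta x)+\sigma(\beta,x)$. Its period is $\ell_\sigma(\gamma)=\sigma(\gamma,\gamma^+)$ if $\gamma$ is loxodromic and $\ell_\sigma(\gamma)=0$ otherwise. $\sigma$ is proper if $\ell_\sigma(\gamma_n)\to+\infty$ for every sequence of distinct loxodromic elements such that $\{(\gamma_n^-,\gamma_n^+)\}$ is relatively compact in $M^{(2)}$. A continuous GPS system is a triple $(\sigma,\bar\sigma,G)$ with $\sigma,\bar\sigma$ continuous proper cocycles and $G:M^{(2)}\to\mathbb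 R$ continuous such that $\bar\sigma(\gamma,x)+\sigma(\gamma,y)=G(\gamma x,\gamma y)-G(x,y)$ for all $\gamma\in\Gamma$, $(x,y)\in M^{(2)}$. Magnitudes and critical exponents. There is a unique topology on $\Gamma\sqcup M$ that is compact metrizable, for which $\Gamma$ (discrete) and $M$ are embedded and $\Gamma$ acts on $\Gamma\sqcup M$ as a convergence group; let $\mathrm d$ be a metric inducing it. For a GPS system, $\sigma$ is expanding (known): there are numbers $\|\gamma\|_\sigma\in\mathbb R$ (magnitudes), unique up to uniformly bounded additive error, such that for every $\epsilon>0$ there is $C>0$ with $\|\gamma\|_\sigma-C\le\sigma(\gamma,x)\le\|\gamma\|_\sigma+C$ whenever $\gamma\in\Gamma$, $x\in M$ and $\mathrm d(x,\gamma^{-1})>\epsilon$. Set $\delta_\sigma(\Gamma)=\limsup_{R\to\infty}\frac1R\log\#\{\gamma\in\Gamma:\|\gamma\|_\sigma\le R\}$ and $Q_\sigma(s)=\sum_{\gamma\in\Gamma}e^{-s\|\gamma\|_\sigma}$. (Likewise for $\bar\sigma$; it is known that $\delta_{\bar\sigma}(\Gamma)=\delta_\sigma(\Gamma)$.) Flow space and BMS measure. Let $\Lambda(\Gamma)^{(2)}$ be the set of pairs of distinct points of $\Lambda(\Gamma)$ and $\tilde U_\Gamma=\Lambda(\Gamma)^{(2)}\times\mathbb R$, with flow $\psi^t(x,y,s)=(x,y,s+t)$ and the (known to be properly discontinuous) action $\gamma(x,y,s)=(\gamma x,\gamma y,s+\sigma(\gamma,y))$. The flow descends to $U_\Gamma=\Gamma\backslash\tilde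 U_\Gamma$. A $\sigma$-Patterson–Sullivan measure of dimension $\beta$ is a probability measure $\mu$ on $M$ such that for all $\gamma\in\Gamma$, $\gamma_*\mu$ and $\mu$ are mutually absolutely continuous and $\frac{d\gamma_*\mu}{d\mu}=e^{-\beta\sigma(\gamma^{-1},\cdot)}$ $\mu$-a.e. When $\delta=\delta_\sigma(\Gamma)<\infty$ and $Q_\sigma(\delta)=+\infty$, existence and uniqueness of $\mu$ and $\bar\mu$ in dimension $\delta$ is known, and both are supported on $\Lambda(\Gamma)$. The measure $\tilde m=e^{\delta G(x,y)}d\bar\mu(x)\otimes d\mu(y)\otimes dt$ on $\tilde U_\Gamma$ is $\Gamma$- and flow-invariant, and the BMS measure $m_\Gamma$ is the quotient measure on $U_\Gamma$: the unique Borel measure with $\int_{U_\Gamma}\big(\sum_{\gamma\in\Gamma}f(\gamma v)\big)dm_\Gamma([v])=\int_{\tilde U_\Gamma}f\,d\tilde m$ for all measurable $f:\tilde U_\Gamma\to[0,+\infty]$. "$m_\Gamma$ is mixing" means $\lim_{t\to\infty}m_\Gamma(A\cap\psi^t(B))=m_\Gamma(A)m_\Gamma(B)/\|m_\Gamma\|$ for all measurable $A,B\subset U_\Gamma$. *)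

theory Defs
  imports "HOL-Probability.Probability"
begin

section \<open>Convergence groups\<close>

text \<open>Locally uniform convergence on \<open>S\<close> of a sequence of maps to the constant \<open>x\<close>. As the limit
  is constant, uniform convergence on \<open>U\<close> only involves the topology of the target: the images of
  \<open>U\<close> are eventually contained in any given neighbourhood of \<open>x\<close>.\<close>

definition loc_unif_to_const ::
  "'a topology \<Rightarrow> 'a set \<Rightarrow> (nat \<Rightarrow> 'a \<Rightarrow> 'a) \<Rightarrow> 'a \<Rightarrow> bool" where
  "loc_unif_to_const T S f x \<longleftrightarrow>
     (\<forall>z\<in>S. \<exists>U. openin (subtopology T S) U \<and> z \<in> U \<and>
        (\<forall>V. openin T V \<and> x \<in> V \<longrightarrow> (\<forall>\<^sub>F n in sequentially. f n ` U \<subseteq> V)))"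

lemma loc_unif_to_const_euclidean:
  fixes x :: "'a :: metric_space"
  shows "loc_unif_to_const euclidean S f x \<longleftrightarrow>
     (\<forall>z\<in>S. \<exists>U. openin (top_of_set S) U \<and> z \<in> U \<and> uniform_limit U f (\<lambda>_. x) sequentially)"
proof -
  have "(\<forall>V. openin euclidean V \<and> x \<in> V \<longrightarrow> (\<forall>\<^sub>F n in sequentially. f n ` U \<subseteq> V)) \<longleftrightarrow>
        uniform_limit U f (\<lambda>_. x) sequentially" (is "?L \<longleftrightarrow> ?R") for U
  proof
    assume L: ?L
    show ?R
      unfolding uniform_limit_iff
    proof (intro allI impI)
      fix e :: real assume "e > 0"
      with L have "\<forall>\<^sub>F n in sequentially. f n ` U \<subseteq> ball x e" by simp
      then show "\<forall>\<^sub>F n in sequentially. \<forall>z\<in>U. dist (f n z) x < e"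
        by (rule eventually_mono) (auto simp: dist_commute image_subset_iff)
    qed
  next
    assume R: ?R
    show ?L
    proof (intro allI impI)
      fix V assume "openin euclidean V \<and> x \<in> V"
      then obtain e where e: "e > 0" "ball x e \<subseteq> V"
        by (auto simp: open_contains_ball)
      from R e(1) have "\<forall>\<^sub>F n in sequentially. \<forall>z\<in>U. dist (f n z) x < e"
        unfolding uniform_limit_iff by blast
      then show "\<forall>\<^sub>F n in sequentially. f n ` U \<subseteq> V"
        by (rule eventually_mono) (use e(2) in \<open>auto simp: dist_commute subset_iff\<close>)
    qed
  qed
  then show ?thesis by (simp add: loc_unif_to_const_def)
qed

definition convergence_action :: "'g set \<Rightarrow> ('g \<Rightarrow> 'a \<Rightarrow> 'a) \<Rightarrow> 'a topology \<Rightarrow> bool" where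
  "convergence_action \<Gamma> \<rho> T \<longleftrightarrow>
     (\<forall>\<gamma>\<in>\<Gamma>. homeomorphic_map T T (\<rho> \<gamma>)) \<and>
     (\<forall>g :: nat \<Rightarrow> 'g. inj g \<and> range g \<subseteq> \<Gamma> \<longrightarrow>
        (\<exists>x\<in>topspace T. \<exists>y\<in>topspace T. \<exists>r. strict_mono r \<and>
           loc_unif_to_const T (topspace T - {y}) (\<lambda>j. \<rho> (g (r j))) x))"

definition convergence_group :: "('m::topological_space \<Rightarrow> 'm) set \<Rightarrow> bool" where
  "convergence_group \<Gamma> \<longleftrightarrow>
     id \<in> \<Gamma> \<and> (\<forall>\<alpha>\<in>\<Gamma>. \<forall>\<beta>\<in>\<Gamma>. \<alpha> \<circ> \<beta> \<in> \<Gamma>) \<and> (\<forall>\<gamma>\<in>\<Gamma>. inv \<gamma> \<in> \<Gamma>) \<and>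
     convergence_action \<Gamma> (\<lambda>\<gamma>. \<gamma>) euclidean"

definition limit_set :: "('m::topological_space \<Rightarrow> 'm) set \<Rightarrow> 'm set" where
  "limit_set \<Gamma> = {x. \<exists>y. \<exists>g. range g \<subseteq> \<Gamma> \<and> loc_unif_to_const euclidean (- {y}) g x}"

definition non_elementary :: "('m::topological_space \<Rightarrow> 'm) set \<Rightarrow> bool" where
  "non_elementary \<Gamma> \<longleftrightarrow> infinite (limit_set \<Gamma>) \<or> card (limit_set \<Gamma>) \<ge> 3"

definition lox_with :: "('m::topological_space \<Rightarrow> 'm) \<Rightarrow> 'm \<Rightarrow> 'm \<Rightarrow> bool" where
  "lox_with \<gamma> p q \<longleftrightarrow> p \<noteq> q \<and> {x. \<gamma> x = x} = {p, q} \<and>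
     loc_unif_to_const euclidean (- {q}) (\<lambda>n. \<gamma> ^^ n) p \<and>
     loc_unif_to_const euclidean (- {p}) (\<lambda>n. inv \<gamma> ^^ n) q"

definition loxodromic :: "('m::topological_space \<Rightarrow> 'm) \<Rightarrow> bool" where
  "loxodromic \<gamma> \<longleftrightarrow> (\<exists>p q. lox_with \<gamma> p q)"

text \<open>The fixed points \<open>\<gamma>\<^sup>+\<close> and \<open>\<gamma>\<^sup>-\<close>; they are well defined for loxodromic \<open>\<gamma>\<close> as soon as the
  Hausdorff space has at least three points.\<close>

definition attracting :: "('m::topological_space \<Rightarrow> 'm) \<Rightarrow> 'm" where
  "attracting \<gamma> = (THE p. \<exists>q. lox_with \<gamma> p q)"

definition repelling :: "('m::topological_space \<Rightarrow> 'm) \<Rightarrow> 'm" where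
  "repelling \<gamma> = (THE q. \<exists>p. lox_with \<gamma> p q)"

section \<open>GPS systems\<close>

definition distinct_pairs :: "'m set \<Rightarrow> ('m \<times> 'm) set" where
  "distinct_pairs S = {(x, y). x \<in> S \<and> y \<in> S \<and> x \<noteq> y}"

definition continuous_cocycle ::
  "('m::topological_space \<Rightarrow> 'm) set \<Rightarrow> (('m \<Rightarrow> 'm) \<Rightarrow> 'm \<Rightarrow> real) \<Rightarrow> bool" where
  "continuous_cocycle \<Gamma> \<sigma> \<longleftrightarrow>
     (\<forall>\<gamma>\<in>\<Gamma>. continuous_on UNIV (\<sigma> \<gamma>)) \<and>
     (\<forall>\<alpha>\<in>\<Gamma>. \<forall>\<beta>\<in>\<Gamma>. \<forall>x. \<sigma> (\<alpha> \<circ> \<beta>) x = \<sigma> \<alpha> (\<beta> x) + \<sigma> \<beta> x)"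

definition period ::
  "(('m::topological_space \<Rightarrow> 'm) \<Rightarrow> 'm \<Rightarrow> real) \<Rightarrow> ('m \<Rightarrow> 'm) \<Rightarrow> real" where
  "period \<sigma> \<gamma> = (if loxodromic \<gamma> then \<sigma> \<gamma> (attracting \<gamma>) else 0)"

definition proper_cocycle ::
  "('m::topological_space \<Rightarrow> 'm) set \<Rightarrow> (('m \<Rightarrow> 'm) \<Rightarrow> 'm \<Rightarrow> real) \<Rightarrow> bool" where
  "proper_cocycle \<Gamma> \<sigma> \<longleftrightarrow>
     (\<forall>g :: nat \<Rightarrow> 'm \<Rightarrow> 'm.
        inj g \<and> (\<forall>n. g n \<in> \<Gamma> \<and> loxodromic (g n)) \<and>
        (\<exists>K. compact K \<and> K \<subseteq> distinct_pairs UNIV \<and>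
             (\<forall>n. (repelling (g n), attracting (g n)) \<in> K))
        \<longrightarrow> filterlim (\<lambda>n. period \<sigma> (g n)) at_top sequentially)"

definition continuous_GPS_system ::
  "('m::topological_space \<Rightarrow> 'm) set \<Rightarrow> (('m \<Rightarrow> 'm) \<Rightarrow> 'm \<Rightarrow> real) \<Rightarrow>
   (('m \<Rightarrow> 'm) \<Rightarrow> 'm \<Rightarrow> real) \<Rightarrow> ('m \<times> 'm \<Rightarrow> real) \<Rightarrow> bool" where
  "continuous_GPS_system \<Gamma> \<sigma> \<sigma>' G \<longleftrightarrow>
     continuous_cocycle \<Gamma> \<sigma> \<and> proper_cocycle \<Gamma> \<sigma> \<and>
     continuous_cocycle \<Gamma> \<sigma>' \<and> proper_cocycle \<Gamma> \<sigma>' \<and>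
     continuous_on (distinct_pairs UNIV) G \<and>
     (\<forall>\<gamma>\<in>\<Gamma>. \<forall>x y. x \<noteq> y \<longrightarrow> \<sigma>' \<gamma> x + \<sigma> \<gamma> y = G (\<gamma> x, \<gamma> y) - G (x, y))"

section \<open>Magnitudes and the critical exponent\<close>

fun compactified_action :: "('m \<Rightarrow> 'm) \<Rightarrow> ('m \<Rightarrow> 'm) + 'm \<Rightarrow> ('m \<Rightarrow> 'm) + 'm" where
  "compactified_action \<gamma> (Inl \<alpha>) = Inl (\<gamma> \<circ> \<alpha>)"
| "compactified_action \<gamma> (Inr x) = Inr (\<gamma> x)"

text \<open>\<open>d\<close> is a metric on the disjoint union of \<open>\<Gamma>\<close> and the space which induces the (unique)
  compact metrizable topology in which both pieces are embedded and on which \<open>\<Gamma>\<close> acts as a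
  convergence group.\<close>

definition compactifying_metric ::
  "('m::topological_space \<Rightarrow> 'm) set \<Rightarrow>
   (('m \<Rightarrow> 'm) + 'm \<Rightarrow> ('m \<Rightarrow> 'm) + 'm \<Rightarrow> real) \<Rightarrow> bool" where
  "compactifying_metric \<Gamma> d \<longleftrightarrow>
     Metric_space (\<Gamma> <+> UNIV) d \<and>
     (let T = Metric_space.mtopology (\<Gamma> <+> UNIV) d in
        compact_space T \<and>
        embedding_map (discrete_topology \<Gamma>) T Inl \<and>
        embedding_map euclidean T Inr \<and>
        convergence_action \<Gamma> compactified_action T)"

definition magnitude_function ::
  "('m::topological_space \<Rightarrow> 'm) set \<Rightarrow> (('m \<Rightarrow> 'm) + 'm \<Rightarrow> ('m \<Rightarrow> 'm) + 'm \<Rightarrow> real) \<Rightarrow>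
   (('m \<Rightarrow> 'm) \<Rightarrow> 'm \<Rightarrow> real) \<Rightarrow> (('m \<Rightarrow> 'm) \<Rightarrow> real) \<Rightarrow> bool" where
  "magnitude_function \<Gamma> d \<sigma> mag \<longleftrightarrow>
     (\<forall>\<epsilon>>0. \<exists>C>0. \<forall>\<gamma>\<in>\<Gamma>. \<forall>x. d (Inr x) (Inl (inv \<gamma>)) > \<epsilon> \<longrightarrow>
        mag \<gamma> - C \<le> \<sigma> \<gamma> x \<and> \<sigma> \<gamma> x \<le> mag \<gamma> + C)"

definition log_card :: "'a set \<Rightarrow> ereal" where
  "log_card A = (if infinite A then \<infinity> else if A = {} then -\<infinity> else ereal (ln (real (card A))))"

definition critical_exponent :: "'g set \<Rightarrow> ('g \<Rightarrow> real) \<Rightarrow> ereal" where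
  "critical_exponent \<Gamma> mag =
     Limsup at_top (\<lambda>R::real. log_card {\<gamma>\<in>\<Gamma>. mag \<gamma> \<le> R} / ereal R)"

definition poincare_series :: "'g set \<Rightarrow> ('g \<Rightarrow> real) \<Rightarrow> real \<Rightarrow> ennreal" where
  "poincare_series \<Gamma> mag s = (\<Sum>\<^sub>\<infinity>\<gamma>\<in>\<Gamma>. ennreal (exp (- s * mag \<gamma>)))"

section \<open>Patterson--Sullivan and BMS measures\<close>

definition PS_measure ::
  "('m::topological_space \<Rightarrow> 'm) set \<Rightarrow> (('m \<Rightarrow> 'm) \<Rightarrow> 'm \<Rightarrow> real) \<Rightarrow> real \<Rightarrow> 'm measure \<Rightarrow> bool"
  where
  "PS_measure \<Gamma> \<sigma> \<beta> \<mu> \<longleftrightarrow>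
     prob_space \<mu> \<and> sets \<mu> = sets borel \<and>
     (\<forall>\<gamma>\<in>\<Gamma>.
        absolutely_continuous \<mu> (distr \<mu> borel \<gamma>) \<and>
        absolutely_continuous (distr \<mu> borel \<gamma>) \<mu> \<and>
        (AE x in \<mu>. RN_deriv \<mu> (distr \<mu> borel \<gamma>) x = ennreal (exp (- \<beta> * \<sigma> (inv \<gamma>) x))))"

definition cover_space :: "('m::topological_space \<Rightarrow> 'm) set \<Rightarrow> ('m \<times> 'm \<times> real) set" where
  "cover_space \<Gamma> = {(x, y, s). (x, y) \<in> distinct_pairs (limit_set \<Gamma>)}"

definition cover_action ::
  "(('m \<Rightarrow> 'm) \<Rightarrow> 'm \<Rightarrow> real) \<Rightarrow> ('m \<Rightarrow> 'm) \<Rightarrow> 'm \<times> 'm \<times> real \<Rightarrow> 'm \<times> 'm \<times> real" where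
  "cover_action \<sigma> \<gamma> = (\<lambda>(x, y, s). (\<gamma> x, \<gamma> y, s + \<sigma> \<gamma> y))"

definition cover_flow :: "real \<Rightarrow> 'm \<times> 'm \<times> real \<Rightarrow> 'm \<times> 'm \<times> real" where
  "cover_flow t = (\<lambda>(x, y, s). (x, y, s + t))"

text \<open>Points of the quotient are the \<open>\<Gamma>\<close>-orbits in \<^term>\<open>cover_space \<Gamma>\<close>. The flow commutes with
  the action, so the descended flow sends an orbit to its image under \<^const>\<open>cover_flow\<close>.\<close>

definition orbit_of ::
  "('m \<Rightarrow> 'm) set \<Rightarrow> (('m \<Rightarrow> 'm) \<Rightarrow> 'm \<Rightarrow> real) \<Rightarrow> 'm \<times> 'm \<times> real \<Rightarrow> ('m \<times> 'm \<times> real) set" where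
  "orbit_of \<Gamma> \<sigma> v = (\<lambda>\<gamma>. cover_action \<sigma> \<gamma> v) ` \<Gamma>"

definition flow_space ::
  "('m::topological_space \<Rightarrow> 'm) set \<Rightarrow> (('m \<Rightarrow> 'm) \<Rightarrow> 'm \<Rightarrow> real) \<Rightarrow> ('m \<times> 'm \<times> real) set set" where
  "flow_space \<Gamma> \<sigma> = orbit_of \<Gamma> \<sigma> ` cover_space \<Gamma>"

definition quotient_flow :: "real \<Rightarrow> ('m \<times> 'm \<times> real) set \<Rightarrow> ('m \<times> 'm \<times> real) set" where
  "quotient_flow t c = cover_flow t ` c"

text \<open>The Borel sigma-algebra of the quotient topology.\<close>

definition flow_space_borel ::
  "('m::topological_space \<Rightarrow> 'm) set \<Rightarrow> (('m \<Rightarrow> 'm) \<Rightarrow> 'm \<Rightarrow> real) \<Rightarrow>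
   ('m \<times> 'm \<times> real) set measure" where
  "flow_space_borel \<Gamma> \<sigma> = sigma (flow_space \<Gamma> \<sigma>)
     {W. W \<subseteq> flow_space \<Gamma> \<sigma> \<and>
         openin (top_of_set (cover_space \<Gamma>)) {v \<in> cover_space \<Gamma>. orbit_of \<Gamma> \<sigma> v \<in> W}}"

definition cover_BMS_measure ::
  "('m::topological_space \<Rightarrow> 'm) set \<Rightarrow> ('m \<times> 'm \<Rightarrow> real) \<Rightarrow> real \<Rightarrow> 'm measure \<Rightarrow> 'm measure \<Rightarrow>
   ('m \<times> 'm \<times> real) measure" where
  "cover_BMS_measure \<Gamma> G \<delta> \<mu>' \<mu> =
     density (restrict_space (\<mu>' \<Otimes>\<^sub>M (\<mu> \<Otimes>\<^sub>M lborel)) (cover_space \<Gamma>))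
       (\<lambda>(x, y, t). ennreal (exp (\<delta> * G (x, y))))"

text \<open>The defining property of the quotient measure. The function \<open>F\<close> on the quotient is the one
  induced by the \<open>\<Gamma>\<close>-invariant function \<open>v \<mapsto> \<Sum>\<^sub>\<gamma> f (\<gamma> v)\<close>.\<close>

definition BMS_measure ::
  "('m::topological_space \<Rightarrow> 'm) set \<Rightarrow> (('m \<Rightarrow> 'm) \<Rightarrow> 'm \<Rightarrow> real) \<Rightarrow> ('m \<times> 'm \<Rightarrow> real) \<Rightarrow> real \<Rightarrow>
   'm measure \<Rightarrow> 'm measure \<Rightarrow> ('m \<times> 'm \<times> real) set measure \<Rightarrow> bool" where
  "BMS_measure \<Gamma> \<sigma> G \<delta> \<mu>' \<mu> m \<longleftrightarrow>
     space m = flow_space \<Gamma> \<sigma> \<and> sets m = sets (flow_space_borel \<Gamma> \<sigma>) \<and>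
     (\<forall>(f :: 'm \<times> 'm \<times> real \<Rightarrow> ennreal) F.
        f \<in> borel_measurable (restrict_space borel (cover_space \<Gamma>)) \<and>
        (\<forall>v\<in>cover_space \<Gamma>. F (orbit_of \<Gamma> \<sigma> v) = (\<Sum>\<^sub>\<infinity>\<gamma>\<in>\<Gamma>. f (cover_action \<sigma> \<gamma> v)))
        \<longrightarrow> (\<integral>\<^sup>+ c. F c \<partial>m) = (\<integral>\<^sup>+ v. f v \<partial>cover_BMS_measure \<Gamma> G \<delta> \<mu>' \<mu>))"

definition mixing :: "('m \<times> 'm \<times> real) set measure \<Rightarrow> bool" where
  "mixing m \<longleftrightarrow>
     (\<forall>A\<in>sets m. \<forall>B\<in>sets m.
        ((\<lambda>t. measure m (A \<inter> quotient_flow t ` B)) \<longlongrightarrow>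
           measure m A * measure m B / measure m (space m)) at_top)"

section \<open>Measures on pairs of distinct points\<close>

text \<open>The sum of the Dirac masses at \<open>(\<gamma>\<^sup>-, \<gamma>\<^sup>+)\<close> over the loxodromic \<open>\<gamma>\<close> with period at most \<open>T\<close>,
  i.e. the image of counting measure. It may have infinite total mass, but is finite on compact
  subsets of the space of distinct pairs if the cocycle is proper.\<close>

definition lox_counting_measure ::
  "('m::topological_space \<Rightarrow> 'm) set \<Rightarrow> (('m \<Rightarrow> 'm) \<Rightarrow> 'm \<Rightarrow> real) \<Rightarrow> real \<Rightarrow> ('m \<times> 'm) measure" where
  "lox_counting_measure \<Gamma> \<sigma> T =
     distr (count_space {\<gamma>\<in>\<Gamma>. loxodromic \<gamma> \<and> period \<sigma> \<gamma> \<le> T})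
       (restrict_space borel (distinct_pairs UNIV)) (\<lambda>\<gamma>. (repelling \<gamma>, attracting \<gamma>))"

definition compactly_supported_on :: "'a::topological_space set \<Rightarrow> ('a \<Rightarrow> real) \<Rightarrow> bool" where
  "compactly_supported_on S f \<longleftrightarrow>
     continuous_on S f \<and> (\<exists>K. compact K \<and> K \<subseteq> S \<and> (\<forall>z\<in>S - K. f z = 0))"

text \<open>Convergence in the dual of the compactly supported continuous functions on \<open>S\<close>.\<close>

definition vague_limit_on ::
  "'a::topological_space set \<Rightarrow> (real \<Rightarrow> 'a measure) \<Rightarrow> 'a measure \<Rightarrow> bool" where
  "vague_limit_on S \<nu> \<nu>\<^sub>0 \<longleftrightarrow>
     (\<forall>f. compactly_supported_on S f \<longrightarrow>
        ((\<lambda>T. integral\<^sup>L (\<nu> T) f) \<longlongrightarrow> integral\<^sup>L \<nu>\<^sub>0 f) at_top)"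

end

theory Submission
  imports Defs
begin

text \<open>
  The proof turns mixing of the flow into counting of closed orbits, in the spirit of Margulis and
  Roblin.

  \<^bold>\<open>Mixing counts group elements.\<close> Let \<open>f\<close> and \<open>h\<close> be continuous functions with compact support on
  the space of triples \<open>(x, y, s)\<close> with \<open>x \<noteq> y\<close>. Their orbit sums descend to the quotient, and unfolding one of the
  two sums in the integral of \<open>F \<cdot> (H \<circ> \<psi>\<^sup>-\<^sup>T)\<close> turns it into the sum over \<open>\<gamma>\<close> of
  \<open>\<integral> f(v) h(\<psi>\<^sup>-\<^sup>T \<gamma> v)\<close>. Hence mixing says that this sum of correlations tends to
  \<open>(\<integral> f) (\<integral> h) / \<parallel>m\<parallel>\<close> (lemma \<open>mixing_test_functions\<close>). Working with orbit sums instead of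
  images of boxes makes stabilizers, and a possible kernel of the action on the limit set, invisible.

  \<^bold>\<open>Product test functions.\<close> Take \<open>f = u(x) v\<^sub>0(y) e\<^sup>-\<^sup>\<delta>\<^sup>G k(s - G)\<close> and
  \<open>h = u\<^sub>0(x) v(y) e\<^sup>-\<^sup>\<delta>\<^sup>G k'(s)\<close>. The transformation rule of the Patterson--Sullivan measures and the
  identity \<open>\<sigma>'(\<gamma>,x) + \<sigma>(\<gamma>,y) = G(\<gamma>x,\<gamma>y) - G(x,y)\<close> make all density factors cancel, and what
  remains of the correlation of \<open>\<gamma>\<close> is an average of \<open>u(x) v(\<gamma>y)\<close> times a function of
  \<open>G(x,y) + \<sigma>(\<gamma>,y) - T\<close> (lemma \<open>correlation_eq\<close>). For all but finitely many of the elements that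
  contribute, \<open>\<gamma>\<close> is loxodromic, \<open>x\<close> is close to the repelling point, \<open>\<gamma>y\<close> is close to the attracting
  point, and \<open>G(x,y) + \<sigma>(\<gamma>,y)\<close> is close to the \<^emph>\<open>shifted period\<close> \<open>\<ell>(\<gamma>) + G(\<gamma>\<^sup>-,\<gamma>\<^sup>+)\<close> (lemma
  \<open>finite_not_well_approximated\<close>). So, up to a constant common to all \<open>\<gamma>\<close>, the correlation of \<open>\<gamma>\<close> is
  \<open>u(\<gamma>\<^sup>-) v(\<gamma>\<^sup>+)\<close> cut off to the elements with shifted period near \<open>T\<close>. The shift absorbs the variation of \<open>G\<close>, so the
  supports may be large; the auxiliary functions \<open>u\<^sub>0\<close> and \<open>v\<^sub>0\<close> can live anywhere away from the
  supports of \<open>v\<close> and \<open>u\<close>.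

  \<^bold>\<open>From windows to the limit measure.\<close> With \<open>k'\<close> close to the exponential on \<open>[-1, 0]\<close> this
  gives the weighted number of elements with shifted period in \<open>(T - 1, T]\<close> (lemma \<open>window_limit\<close>);
  a geometric series gives those with shifted period at most \<open>T\<close> (lemma \<open>shifted_count_limit\<close>).
  On a box on which \<open>G\<close> is nearly a constant \<open>g\<close>, replacing the shifted period by the period
  multiplies the count by nearly \<open>e\<^sup>\<delta>\<^sup>g\<close>, which is the density of the limit measure. A partition of unity
  reduces a general test function to such boxes (lemma \<open>counting_limit_compact\<close>).

  \<^bold>\<open>Dynamics of the group.\<close> All dynamics is expressed by sequences that collapse the
  complement of a point \<open>b\<close> to a point \<open>a\<close>. If \<open>a \<noteq> b\<close>, the elements are eventually loxodromic
  with fixed points close to \<open>a\<close> and \<open>b\<close> (lemma \<open>collapses_imp_loxodromic\<close>); the compactification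
  and the magnitudes show that \<open>\<sigma>\<close> tends to infinity along such a sequence away from \<open>b\<close> (lemma
  \<open>cocycle_at_top\<close>). Three further facts are used: the Patterson--Sullivan measures live on the limit
  set because the Poincare series diverges, they are not point masses, and \<open>\<delta> > 0\<close>. The last
  two hold because a non-elementary group has no finite invariant set (lemma
  \<open>no_finite_invariant_set\<close>).
\<close>

section \<open>Collapsing sequences and loxodromic elements\<close>

text \<open>Locally uniform convergence to the constant \<open>a\<close> off the point \<open>b\<close>, in metric form. One \<open>e\<close> serves
  both as the size of the excluded ball and as the accuracy, which makes the notion symmetric under
  taking inverses.\<close>

definition collapses :: "(nat \<Rightarrow> 'm::metric_space \<Rightarrow> 'm) \<Rightarrow> 'm \<Rightarrow> 'm \<Rightarrow> bool" where
  "collapses g a b \<longleftrightarrow> (\<forall>e>0. \<forall>\<^sub>F n in sequentially. \<forall>z. e \<le> dist z b \<longrightarrow> dist (g n z) a < e)"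

lemma collapsesD:
  assumes "collapses g a b" "e > 0"
  shows "\<forall>\<^sub>F n in sequentially. \<forall>z. e \<le> dist z b \<longrightarrow> dist (g n z) a < e"
  using assms by (auto simp: collapses_def)

text \<open>The complement of a ball around \<open>b\<close> is compact, so finitely many of the open sets on which the
  convergence is uniform cover it.\<close>

lemma loc_unif_to_const_iff_collapses:
  assumes cpt: "compact (UNIV :: 'm::metric_space set)"
  shows "loc_unif_to_const euclidean (- {b}) g a \<longleftrightarrow> collapses g a (b::'m)"
proof
  assume L: "loc_unif_to_const euclidean (- {b}) g a"
  show "collapses g a b"
    unfolding collapses_def
  proof (intro allI impI)
    fix e :: real assume e: "e > 0"
    define K where "K = {z. e \<le> dist z b}"
    have "closed K" unfolding K_def by (intro closed_Collect_le continuous_intros)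
    then have "compact K" using cpt compact_Int_closed[of UNIV K] by simp
    have "\<forall>z\<in>K. \<exists>U. open U \<and> z \<in> U \<and> (\<forall>\<^sub>F n in sequentially. g n ` U \<subseteq> ball a e)"
    proof
      fix z assume "z \<in> K"
      then have "z \<in> - {b}" using e by (auto simp: K_def)
      with L obtain U where U: "openin (top_of_set (- {b})) U" "z \<in> U"
        "\<forall>V. openin euclidean V \<and> a \<in> V \<longrightarrow> (\<forall>\<^sub>F n in sequentially. g n ` U \<subseteq> V)"
        unfolding loc_unif_to_const_def by blast
      have "open U" using U(1) openin_open_trans[of "- {b}" U] by auto
      moreover have "\<forall>\<^sub>F n in sequentially. g n ` U \<subseteq> ball a e"
        using U(3) e by simp
      ultimately show "\<exists>U. open U \<and> z \<in> U \<and> (\<forall>\<^sub>F n in sequentially. g n ` U \<subseteq> ball a e)"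
        using U(2) by blast
    qed
    then obtain U where U: "\<And>z. z \<in> K \<Longrightarrow> open (U z)" "\<And>z. z \<in> K \<Longrightarrow> z \<in> U z"
      "\<And>z. z \<in> K \<Longrightarrow> \<forall>\<^sub>F n in sequentially. g n ` U z \<subseteq> ball a e"
      by metis
    have cover: "K \<subseteq> (\<Union>z\<in>K. U z)" using U(2) by auto
    obtain C where C: "C \<subseteq> K" "finite C" "K \<subseteq> (\<Union>z\<in>C. U z)"
      by (rule compactE_image[OF \<open>compact K\<close> U(1) cover])
    have "\<forall>\<^sub>F n in sequentially. \<forall>z\<in>C. g n ` U z \<subseteq> ball a e"
      using C U(3) by (intro eventually_ball_finite) auto
    then show "\<forall>\<^sub>F n in sequentially. \<forall>z. e \<le> dist z b \<longrightarrow> dist (g n z) a < e"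
    proof (rule eventually_mono, intro allI impI)
      fix n z assume *: "\<forall>z\<in>C. g n ` U z \<subseteq> ball a e" "e \<le> dist z b"
      then have "z \<in> K" by (simp add: K_def)
      with C(3) obtain w where "w \<in> C" "z \<in> U w" by auto
      with * have "g n z \<in> ball a e" by (meson image_subset_iff)
      then show "dist (g n z) a < e" by (simp add: dist_commute)
    qed
  qed
next
  assume R: "collapses g a b"
  show "loc_unif_to_const euclidean (- {b}) g a"
    unfolding loc_unif_to_const_def
  proof
    fix z assume "z \<in> - {b}"
    then have zb: "dist z b > 0" by simp
    define U where "U = ball z (dist z b / 2)"
    have Ub: "U \<subseteq> - {b}" using zb by (auto simp: U_def)
    have far: "dist z b / 2 \<le> dist w b" if "w \<in> U" for w
      using that dist_triangle[of z b w] by (simp add: U_def)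
    show "\<exists>U. openin (top_of_set (- {b})) U \<and> z \<in> U \<and>
        (\<forall>V. openin euclidean V \<and> a \<in> V \<longrightarrow> (\<forall>\<^sub>F n in sequentially. g n ` U \<subseteq> V))"
    proof (intro exI[of _ U] conjI allI impI)
      show "openin (top_of_set (- {b})) U"
        using Ub openin_subset_trans[of UNIV U "- {b}"] by (auto simp: U_def openin_open)
      show "z \<in> U" using zb by (simp add: U_def)
      fix V assume "openin euclidean V \<and> a \<in> V"
      then obtain e where e: "e > 0" "ball a e \<subseteq> V" by (auto simp: open_contains_ball)
      define e' where "e' = min e (dist z b / 2)"
      have "e' > 0" using e zb by (simp add: e'_def)
      from collapsesD[OF R this] show "\<forall>\<^sub>F n in sequentially. g n ` U \<subseteq> V"
      proof (rule eventually_mono)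
        fix n assume *: "\<forall>z. e' \<le> dist z b \<longrightarrow> dist (g n z) a < e'"
        show "g n ` U \<subseteq> V"
        proof
          fix y assume "y \<in> g n ` U"
          then obtain w where "w \<in> U" "y = g n w" by auto
          with far[of w] * have "dist y a < e'" by (auto simp: e'_def)
          then show "y \<in> V" using e by (auto simp: e'_def dist_commute)
        qed
      qed
    qed
  qed
qed

lemma collapses_subseq:
  assumes "collapses g a b" "strict_mono r"
  shows "collapses (\<lambda>n. g (r n)) a b"
  unfolding collapses_def
proof (intro allI impI)
  fix e :: real assume "e > 0"
  from eventually_subseq[OF assms(2) collapsesD[OF assms(1) this]]
  show "\<forall>\<^sub>F n in sequentially. \<forall>z. e \<le> dist z b \<longrightarrow> dist (g (r n) z) a < e" .
qed

text \<open>The contrapositive of the defining implication is the defining implication for the inverses.\<close>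

lemma collapses_inv:
  assumes "collapses g a b" "\<And>n. bij (g n)"
  shows "collapses (\<lambda>n. inv (g n)) b a"
  unfolding collapses_def
proof (intro allI impI)
  fix e :: real assume "e > 0"
  from collapsesD[OF assms(1) this]
  show "\<forall>\<^sub>F n in sequentially. \<forall>z. e \<le> dist z a \<longrightarrow> dist (inv (g n) z) b < e"
  proof (rule eventually_mono, intro allI impI)
    fix n z assume *: "\<forall>z. e \<le> dist z b \<longrightarrow> dist (g n z) a < e" "e \<le> dist z a"
    have "g n (inv (g n) z) = z" using assms(2) by (simp add: bij_is_surj surj_f_inv_f)
    with * show "dist (inv (g n) z) b < e" by (metis not_le)
  qed
qed

lemma collapses_tendsto:
  assumes "collapses g a b" "x \<longlonglongrightarrow> p" "p \<noteq> b"
  shows "(\<lambda>n. g n (x n)) \<longlonglongrightarrow> a"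
proof (rule tendstoI)
  fix e :: real assume e: "e > 0"
  define e' where "e' = min e (dist p b / 2)"
  have e': "e' > 0" using e assms(3) by (simp add: e'_def)
  have "\<forall>\<^sub>F n in sequentially. dist (x n) p < e'"
    using assms(2) e' by (rule tendstoD)
  with collapsesD[OF assms(1) e'] show "\<forall>\<^sub>F n in sequentially. dist (g n (x n)) a < e"
  proof eventually_elim
    case (elim n)
    have "dist p b \<le> dist (x n) p + dist (x n) b"
      by (metis dist_commute dist_triangle)
    then have "e' \<le> dist (x n) b" using elim(2) by (auto simp: e'_def min_def split: if_splits)
    with elim(1) show ?case by (auto simp: e'_def)
  qed
qed

lemma collapses_tendsto_const:
  assumes "collapses g a b" "p \<noteq> b"
  shows "(\<lambda>n. g n p) \<longlonglongrightarrow> a"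
  using collapses_tendsto[OF assms(1) tendsto_const assms(2)] .

text \<open>A common fixed point other than \<open>b\<close> is carried to \<open>a\<close> and stays where it is.\<close>

lemma collapses_fixed:
  assumes "collapses g a b" "\<And>n. g n p = p" "p \<noteq> b"
  shows "a = p"
  using collapses_tendsto_const[OF assms(1,3)] assms(2)
  by (simp add: LIMSEQ_const_iff)

locale compact_convergence_group =
  fixes \<Gamma> :: "('m :: {metric_space, second_countable_topology} \<Rightarrow> 'm) set"
  assumes cpt: "compact (UNIV :: 'm set)"
    and conv: "convergence_group \<Gamma>"
    and nonel: "non_elementary \<Gamma>"
begin

lemma id_in: "id \<in> \<Gamma>" and comp_in: "\<alpha> \<in> \<Gamma> \<Longrightarrow> \<beta> \<in> \<Gamma> \<Longrightarrow> \<alpha> \<circ> \<beta> \<in> \<Gamma>"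
  and inv_in: "\<gamma> \<in> \<Gamma> \<Longrightarrow> inv \<gamma> \<in> \<Gamma>"
  using conv by (auto simp: convergence_group_def)

lemma homeo: "\<gamma> \<in> \<Gamma> \<Longrightarrow> homeomorphic_map euclidean euclidean \<gamma>"
  using conv by (auto simp: convergence_group_def convergence_action_def)

lemma bij_in: "\<gamma> \<in> \<Gamma> \<Longrightarrow> bij \<gamma>"
  using homeomorphic_imp_injective_map[OF homeo, of \<gamma>] homeomorphic_imp_surjective_map[OF homeo, of \<gamma>]
  by (auto simp: bij_def)

lemma inv_apply [simp]: "\<gamma> \<in> \<Gamma> \<Longrightarrow> inv \<gamma> (\<gamma> x) = x" "\<gamma> \<in> \<Gamma> \<Longrightarrow> \<gamma> (inv \<gamma> x) = x"
  using bij_in by (auto simp: bij_def surj_f_inv_f)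

lemma inv_inv [simp]: "\<gamma> \<in> \<Gamma> \<Longrightarrow> inv (inv \<gamma>) = \<gamma>"
  using bij_in inv_inv_eq by blast

lemma inv_comp_id [simp]: "\<gamma> \<in> \<Gamma> \<Longrightarrow> inv \<gamma> \<circ> \<gamma> = id" "\<gamma> \<in> \<Gamma> \<Longrightarrow> \<gamma> \<circ> inv \<gamma> = id"
  by (auto simp: fun_eq_iff)

lemma eq_iff [simp]: "\<gamma> \<in> \<Gamma> \<Longrightarrow> \<gamma> x = \<gamma> y \<longleftrightarrow> x = y"
  by (metis inv_apply(1))

lemma cont_in: "\<gamma> \<in> \<Gamma> \<Longrightarrow> continuous_on UNIV \<gamma>"
  using homeomorphic_imp_continuous_map[OF homeo, of \<gamma>] by simp

lemma isCont_in: "\<gamma> \<in> \<Gamma> \<Longrightarrow> isCont \<gamma> x"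
  using cont_in continuous_on_eq_continuous_at by blast

lemma funpow_in: "\<gamma> \<in> \<Gamma> \<Longrightarrow> \<gamma> ^^ n \<in> \<Gamma>"
  by (induction n) (auto simp: id_in comp_in simp flip: id_def)

lemma inv_funpow: "\<gamma> \<in> \<Gamma> \<Longrightarrow> inv (\<gamma> ^^ n) = inv \<gamma> ^^ n"
  using bij_in inv_fn by metis

lemma loc_unif_iff: "loc_unif_to_const euclidean (- {b}) g a \<longleftrightarrow> collapses g a (b::'m)"
  using loc_unif_to_const_iff_collapses[OF cpt] .

lemma collapsing_subsequence:
  assumes "inj g" "range g \<subseteq> \<Gamma>"
  obtains a b and r :: "nat \<Rightarrow> nat" where "strict_mono r" "collapses (\<lambda>n. g (r n)) a b"
proof -
  have "\<exists>x\<in>topspace euclidean. \<exists>y\<in>topspace euclidean. \<exists>r. strict_mono (r::nat\<Rightarrow>nat) \<and>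
           loc_unif_to_const euclidean (topspace euclidean - {y}) (\<lambda>j. g (r j)) x"
    using conv assms unfolding convergence_group_def convergence_action_def by blast
  then show ?thesis using that by (auto simp: Compl_eq_Diff_UNIV[symmetric] loc_unif_iff)
qed

lemma limit_set_iff: "x \<in> limit_set \<Gamma> \<longleftrightarrow> (\<exists>b g. range g \<subseteq> \<Gamma> \<and> collapses g x b)"
  by (auto simp: limit_set_def loc_unif_iff)

lemma three_limit_points:
  obtains x y z where "x \<in> limit_set \<Gamma>" "y \<in> limit_set \<Gamma>" "z \<in> limit_set \<Gamma>" "x \<noteq> y" "y \<noteq> z" "x \<noteq> z"
proof -
  have "\<exists>S \<subseteq> limit_set \<Gamma>. card S = 3"
    using nonel unfolding non_elementary_def
    by (metis infinite_arbitrarily_large obtain_subset_with_card_n)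
  then obtain S where "S \<subseteq> limit_set \<Gamma>" "card S = 3" by blast
  then show ?thesis using that by (auto simp: card_3_iff)
qed

lemma third_point: obtains c :: 'm where "c \<noteq> a" "c \<noteq> b"
  using three_limit_points by metis

lemma limit_set_not_covered: "\<not> limit_set \<Gamma> \<subseteq> {p, q}"
  by (rule three_limit_points) blast

lemma convergent_subsequence:
  fixes x :: "nat \<Rightarrow> 'm"
  obtains p and r :: "nat \<Rightarrow> nat" where "strict_mono r" "(\<lambda>n. x (r n)) \<longlonglongrightarrow> p"
proof -
  have "seq_compact (UNIV::'m set)" using cpt compact_eq_seq_compact_metric by blast
  then obtain l r where "strict_mono (r :: nat\<Rightarrow>nat)" "(x \<circ> r) \<longlonglongrightarrow> l"
    by (rule seq_compactE[of UNIV x]) auto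
  then show ?thesis using that[of r l] by (simp add: o_def)
qed

lemma collapses_limit_points:
  assumes "range g \<subseteq> \<Gamma>" "collapses g a b"
  shows "a \<in> limit_set \<Gamma>" "b \<in> limit_set \<Gamma>"
proof -
  show "a \<in> limit_set \<Gamma>" using assms by (auto simp: limit_set_iff)
  have "collapses (\<lambda>n. inv (g n)) b a" using assms by (intro collapses_inv) (auto intro: bij_in)
  moreover have "range (\<lambda>n. inv (g n)) \<subseteq> \<Gamma>" using assms inv_in by auto
  ultimately show "b \<in> limit_set \<Gamma>" unfolding limit_set_iff by blast
qed

lemma collapses_inv_in:
  assumes "range g \<subseteq> \<Gamma>" "collapses g a b"
  shows "collapses (\<lambda>n. inv (g n)) b a"
  using assms by (intro collapses_inv) (auto intro: bij_in)

text \<open>A diagonal sequence: from the \<open>k\<close>-th sequence one element is chosen that collapses up to the error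
  \<open>1/(k+1)\<close>, and the excluded points are made convergent by passing to a subsequence.\<close>

lemma closed_limit_set: "closed (limit_set \<Gamma>)"
  unfolding closed_sequential_limits
proof (intro allI impI, elim conjE)
  fix x :: "nat \<Rightarrow> 'm" and l
  assume x: "\<forall>n. x n \<in> limit_set \<Gamma>" "x \<longlonglongrightarrow> l"
  from x(1) have "\<forall>k. \<exists>b g. range g \<subseteq> \<Gamma> \<and> collapses g (x k) b" by (simp add: limit_set_iff)
  then obtain y g where g: "\<And>k. range (g k) \<subseteq> \<Gamma>" "\<And>k. collapses (g k) (x k) (y k)" by metis
  have "\<exists>\<gamma>\<in>\<Gamma>. \<forall>z. inverse (Suc k) \<le> dist z (y k) \<longrightarrow> dist (\<gamma> z) (x k) < inverse (Suc k)" for k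
  proof -
    have "\<forall>\<^sub>F n in sequentially. \<forall>z. inverse (Suc k) \<le> dist z (y k) \<longrightarrow> dist (g k n z) (x k) < inverse (Suc k)"
      by (rule collapsesD[OF g(2)]) simp
    then obtain n where "\<forall>z. inverse (Suc k) \<le> dist z (y k) \<longrightarrow> dist (g k n z) (x k) < inverse (Suc k)"
      by (auto simp: eventually_sequentially)
    moreover have "g k n \<in> \<Gamma>" using g(1)[of k] by auto
    ultimately show ?thesis by blast
  qed
  then obtain h where h: "\<And>k. h k \<in> \<Gamma>"
    "\<And>k z. inverse (Suc k) \<le> dist z (y k) \<Longrightarrow> dist (h k z) (x k) < inverse (Suc k)" by metis
  obtain p r where r: "strict_mono r" "(\<lambda>n. y (r n)) \<longlonglongrightarrow> p"
    using convergent_subsequence by blast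
  have inv0: "(\<lambda>n. inverse (real (Suc (r n)))) \<longlonglongrightarrow> 0"
    using LIMSEQ_subseq_LIMSEQ[OF LIMSEQ_inverse_real_of_nat r(1)] by (simp add: o_def)
  have xr: "(\<lambda>n. x (r n)) \<longlonglongrightarrow> l"
    using LIMSEQ_subseq_LIMSEQ[OF x(2) r(1)] by (simp add: o_def)
  have "collapses (\<lambda>n. h (r n)) l p"
    unfolding collapses_def
  proof (intro allI impI)
    fix e :: real assume "e > 0"
    then have e: "e / 2 > 0" by simp
    from tendstoD[OF inv0 e] tendstoD[OF xr e] tendstoD[OF r(2) e]
    show "\<forall>\<^sub>F n in sequentially. \<forall>z. e \<le> dist z p \<longrightarrow> dist (h (r n) z) l < e"
    proof eventually_elim
      case (elim n)
      show ?case
      proof (intro allI impI)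
        fix z assume z: "e \<le> dist z p"
        have "dist z p \<le> dist z (y (r n)) + dist (y (r n)) p" by (rule dist_triangle)
        with z elim have "inverse (Suc (r n)) \<le> dist z (y (r n))" by (simp add: dist_real_def)
        from h(2)[OF this] have "dist (h (r n) z) (x (r n)) < e/2" using elim(1) by (simp add: dist_real_def)
        then show "dist (h (r n) z) l < e" using elim(2) dist_triangle[of "h (r n) z" l "x (r n)"] by simp
      qed
    qed
  qed
  moreover have "range (\<lambda>n. h (r n)) \<subseteq> \<Gamma>" using h(1) by auto
  ultimately show "l \<in> limit_set \<Gamma>" unfolding limit_set_iff by (intro exI conjI)
qed

text \<open>The set of fixed points determines the pair up to order, and a third point distinguishes the two
  orders: its iterates converge to only one of them.\<close>

lemma lox_with_unique:
  assumes "lox_with \<gamma> p q" "lox_with \<gamma> p' q'"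
  shows "p' = p \<and> q' = (q :: 'm)"
proof (rule ccontr)
  assume neg: "\<not> (p' = p \<and> q' = q)"
  have "{p, q} = {p', q'}" using assms by (simp add: lox_with_def)
  with neg have eq: "p' = q" "q' = p" by (auto simp: doubleton_eq_iff)
  obtain z where z: "z \<noteq> p" "z \<noteq> q" using third_point by blast
  have "collapses (\<lambda>n. \<gamma> ^^ n) p q" "collapses (\<lambda>n. \<gamma> ^^ n) q p"
    using assms eq by (auto simp: lox_with_def loc_unif_iff)
  from collapses_tendsto_const[OF this(1) z(2)] collapses_tendsto_const[OF this(2) z(1)]
  have "p = q" using LIMSEQ_unique by blast
  then show False using assms by (simp add: lox_with_def)
qed

lemma lox_with_eqs:
  assumes "lox_with \<gamma> p q"
  shows "loxodromic \<gamma>" "attracting \<gamma> = p" "repelling \<gamma> = (q::'m)"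
proof -
  show "loxodromic \<gamma>" using assms by (auto simp: loxodromic_def)
  show "attracting \<gamma> = p"
    unfolding attracting_def by (rule the_equality) (use assms lox_with_unique[OF assms] in blast)+
  show "repelling \<gamma> = q"
    unfolding repelling_def by (rule the_equality) (use assms lox_with_unique[OF assms] in blast)+
qed

lemma loxodromicD:
  assumes "loxodromic (\<gamma> :: 'm \<Rightarrow> 'm)"
  shows "lox_with \<gamma> (attracting \<gamma>) (repelling \<gamma>)" "attracting \<gamma> \<noteq> repelling \<gamma>"
    "\<gamma> (attracting \<gamma>) = attracting \<gamma>" "\<gamma> (repelling \<gamma>) = repelling \<gamma>"
    "collapses (\<lambda>n. \<gamma> ^^ n) (attracting \<gamma>) (repelling \<gamma>)"
    "\<gamma> x = x \<Longrightarrow> x = attracting \<gamma> \<or> x = repelling \<gamma>"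
proof -
  obtain p q where pq: "lox_with \<gamma> p q" using assms by (auto simp: loxodromic_def)
  then show *: "lox_with \<gamma> (attracting \<gamma>) (repelling \<gamma>)" using lox_with_eqs by metis
  then have fix': "{x. \<gamma> x = x} = {attracting \<gamma>, repelling \<gamma>}" by (simp add: lox_with_def)
  show "attracting \<gamma> \<noteq> repelling \<gamma>" "collapses (\<lambda>n. \<gamma> ^^ n) (attracting \<gamma>) (repelling \<gamma>)"
    using * by (auto simp: lox_with_def loc_unif_iff)
  show "\<gamma> (attracting \<gamma>) = attracting \<gamma>" "\<gamma> (repelling \<gamma>) = repelling \<gamma>"
    "\<gamma> x = x \<Longrightarrow> x = attracting \<gamma> \<or> x = repelling \<gamma>" using fix' by blast+
qed

text \<open>Ping-pong on two disjoint sets. All accumulation pairs of the powers of \<open>\<gamma>\<close> consist of a fixed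
  point in \<open>V\<close> and a fixed point in \<open>U\<close>. The iterates of a fixed point are constant, so any two
  accumulation pairs coincide; hence the whole sequence of powers converges. The point \<open>c\<close> outside
  both sets prevents \<open>\<gamma>\<close> from having finite order.\<close>

lemma lox_criterion:
  assumes \<gamma>: "\<gamma> \<in> \<Gamma>" and UV: "closed U" "closed V" "U \<inter> V = {}"
    and sub: "\<And>z. z \<notin> U \<Longrightarrow> \<gamma> z \<in> V"
    and pts: "u \<in> U" "v \<in> V" "c \<notin> U" "c \<notin> V"
  obtains p q where "p \<in> V" "q \<in> U" "lox_with \<gamma> p q"
proof -
  have fwd: "(\<gamma> ^^ n) z \<in> V" if "z \<notin> U" "n \<ge> 1" for n z
    using that(2)
  proof (induction n rule: dec_induct)
    case base then show ?case using sub that by simp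
  next
    case (step n) then show ?case using sub UV by auto
  qed
  have sub': "inv \<gamma> z \<in> U" if "z \<notin> V" for z
    using sub[of "inv \<gamma> z"] that \<gamma> by auto
  have bwd: "(inv \<gamma> ^^ n) z \<in> U" if "z \<notin> V" "n \<ge> 1" for n z
    using that(2)
  proof (induction n rule: dec_induct)
    case base then show ?case using sub' that by simp
  next
    case (step n) then show ?case using sub' UV by auto
  qed
  have inj: "inj (\<lambda>n. \<gamma> ^^ n)"
  proof (rule inj_onI)
    have *: False if "\<gamma> ^^ i = \<gamma> ^^ j" "i < j" for i j
    proof -
      have "(\<gamma> ^^ i) c = (\<gamma> ^^ i) ((\<gamma> ^^ (j - i)) c)"
        using that by (metis add_diff_inverse_nat comp_apply funpow_add less_imp_le not_less)
      then have "(\<gamma> ^^ (j - i)) c = c" using funpow_in[OF \<gamma>, of i] by simp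
      then show False using fwd[of c "j - i"] pts \<open>i < j\<close>
        by (metis Suc_leI One_nat_def zero_less_diff)
    qed
    fix i j assume "\<gamma> ^^ i = \<gamma> ^^ j"
    then show "i = j" using *[of i j] *[of j i] by (metis nat_neq_iff)
  qed
  have acc: "a \<in> V \<and> b \<in> U \<and> \<gamma> a = a \<and> \<gamma> b = b"
    if r: "strict_mono r" "collapses (\<lambda>n. \<gamma> ^^ (r n)) a b" for a b and r :: "nat \<Rightarrow> nat"
  proof -
    have ev1: "\<forall>\<^sub>F n in sequentially. 1 \<le> r n"
      using filterlim_subseq[OF r(1)] by (simp add: filterlim_at_top)
    have ri: "collapses (\<lambda>n. inv \<gamma> ^^ (r n)) b a"
      using collapses_inv[OF r(2)] bij_in[OF funpow_in[OF \<gamma>]] by (simp add: inv_funpow[OF \<gamma>])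
    have aV: "a \<in> V"
    proof -
      obtain w where w: "w \<notin> U" "w \<noteq> b" using pts UV by (metis disjoint_iff)
      have "(\<lambda>n. (\<gamma> ^^ r n) w) \<longlonglongrightarrow> a" using collapses_tendsto_const[OF r(2) w(2)] .
      then show ?thesis
        using UV(2) ev1 fwd[OF w(1)] by (intro Lim_in_closed_set[of V _ sequentially]) (auto elim: eventually_mono)
    qed
    have bU: "b \<in> U"
    proof -
      obtain w where w: "w \<notin> V" "w \<noteq> a" using pts UV by (metis disjoint_iff)
      have "(\<lambda>n. (inv \<gamma> ^^ r n) w) \<longlonglongrightarrow> b" using collapses_tendsto_const[OF ri w(2)] .
      then show ?thesis
        using UV(1) ev1 bwd[OF w(1)] by (intro Lim_in_closed_set[of U _ sequentially]) (auto elim: eventually_mono)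
    qed
    have fixg: "\<alpha> a' = a'" if "\<alpha> \<in> \<Gamma>" "collapses (\<lambda>n. \<alpha> ^^ (r n)) a' b'" for \<alpha> a' b'
    proof -
      obtain z where z: "z \<noteq> b'" "z \<noteq> inv \<alpha> b'" using third_point by blast
      then have "\<alpha> z \<noteq> b'" using that(1) by auto
      then have 1: "(\<lambda>n. (\<alpha> ^^ r n) (\<alpha> z)) \<longlonglongrightarrow> a'" using collapses_tendsto_const[OF that(2)] by blast
      have "(\<lambda>n. (\<alpha> ^^ r n) z) \<longlonglongrightarrow> a'" using collapses_tendsto_const[OF that(2) z(1)] .
      then have "(\<lambda>n. \<alpha> ((\<alpha> ^^ r n) z)) \<longlonglongrightarrow> \<alpha> a'" by (rule isCont_tendsto_compose[OF isCont_in[OF that(1)]])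
      then have "(\<lambda>n. (\<alpha> ^^ r n) (\<alpha> z)) \<longlonglongrightarrow> \<alpha> a'" by (simp add: funpow_swap1)
      with 1 show ?thesis using LIMSEQ_unique by blast
    qed
    have "\<gamma> a = a" using fixg[OF \<gamma> r(2)] .
    moreover have "\<gamma> b = b" using fixg[OF inv_in[OF \<gamma>] ri] \<gamma> by (metis inv_apply(2))
    ultimately show ?thesis using aV bU by simp
  qed
  obtain a b r where r: "strict_mono r" "collapses (\<lambda>n. \<gamma> ^^ (r n)) a b"
    by (rule collapsing_subsequence[OF inj]) (auto intro: funpow_in[OF \<gamma>])
  note ab = acc[OF r]
  have fixn: "(\<gamma> ^^ n) a = a" "(\<gamma> ^^ n) b = b" for n using ab by (induction n) auto
  have col: "collapses (\<lambda>n. \<gamma> ^^ n) a b"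
  proof (rule ccontr)
    assume "\<not> ?thesis"
    then obtain e where e: "e > 0" "\<exists>\<^sub>F n in sequentially. \<exists>z. e \<le> dist z b \<and> e \<le> dist ((\<gamma> ^^ n) z) a"
      by (auto simp: collapses_def not_eventually not_less)
    from e(2) have inf: "infinite {n. \<exists>z. e \<le> dist z b \<and> e \<le> dist ((\<gamma> ^^ n) z) a}"
      by (simp add: frequently_cofinite flip: cofinite_eq_sequentially)
    define s where "s = enumerate {n. \<exists>z. e \<le> dist z b \<and> e \<le> dist ((\<gamma> ^^ n) z) a}"
    have s: "strict_mono s" unfolding s_def by (rule strict_mono_enumerate[OF inf])
    have sbad: "\<exists>z. e \<le> dist z b \<and> e \<le> dist ((\<gamma> ^^ s n) z) a" for n
      using enumerate_in_set[OF inf, of n] by (simp add: s_def)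
    have "inj (\<lambda>n. \<gamma> ^^ s n)" using inj_compose[OF inj strict_mono_imp_inj_on[OF s]] by (simp add: o_def)
    moreover have "range (\<lambda>n. \<gamma> ^^ s n) \<subseteq> \<Gamma>" using funpow_in[OF \<gamma>] by auto
    ultimately obtain a' b' t where t: "strict_mono t" "collapses (\<lambda>n. \<gamma> ^^ (s (t n))) a' b'"
      by (rule collapsing_subsequence)
    have a'b': "a' \<in> V \<and> b' \<in> U \<and> \<gamma> a' = a' \<and> \<gamma> b' = b'"
      using acc[of "\<lambda>n. s (t n)" a' b'] t s by (simp add: strict_mono_def)
    have "a' = a" using collapses_fixed[OF t(2), of a] fixn ab a'b' UV by blast
    have "collapses (\<lambda>n. inv (\<gamma> ^^ (s (t n)))) b' a'"
      by (rule collapses_inv[OF t(2)]) (rule bij_in[OF funpow_in[OF \<gamma>]])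
    moreover have "inv (\<gamma> ^^ n) b = b" for n
      using inv_apply(1)[OF funpow_in[OF \<gamma>], of n b] fixn by simp
    moreover have "b \<noteq> a'" using ab a'b' UV by blast
    ultimately have "b' = b" by (rule collapses_fixed)
    from collapsesD[OF t(2) e(1)] obtain n where
      "\<forall>z. e \<le> dist z b' \<longrightarrow> dist ((\<gamma> ^^ s (t n)) z) a' < e"
      by (auto simp: eventually_sequentially)
    with sbad[of "t n"] \<open>a' = a\<close> \<open>b' = b\<close> show False by force
  qed
  have coli: "collapses (\<lambda>n. inv \<gamma> ^^ n) b a"
    using collapses_inv[OF col] bij_in[OF funpow_in[OF \<gamma>]] by (simp add: inv_funpow[OF \<gamma>])
  have "x = a" if "\<gamma> x = x" "x \<noteq> b" for x
  proof -
    have "(\<gamma> ^^ n) x = x" for n using that by (induction n) auto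
    then show ?thesis using collapses_fixed[OF col _ that(2)] by auto
  qed
  then have "{x. \<gamma> x = x} = {a, b}" using ab by auto
  then have "lox_with \<gamma> a b"
    using ab UV col coli by (auto simp: lox_with_def loc_unif_iff)
  then show ?thesis using that ab by blast
qed

text \<open>The closing lemma: small balls around \<open>b\<close> and \<open>a\<close> are eventually in ping-pong position.\<close>

lemma collapses_imp_loxodromic:
  assumes "range g \<subseteq> \<Gamma>" "collapses g a b" "a \<noteq> b"
  shows "\<forall>\<^sub>F n in sequentially. loxodromic (g n)"
    "(\<lambda>n. attracting (g n)) \<longlonglongrightarrow> a" "(\<lambda>n. repelling (g n)) \<longlonglongrightarrow> b"
proof -
  obtain c where c: "c \<noteq> a" "c \<noteq> b" using third_point by blast
  define e0 where "e0 = Min {dist a b, dist c a, dist c b} / 3"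
  have e0: "e0 > 0" "3 * e0 \<le> dist a b" "3 * e0 \<le> dist c a" "3 * e0 \<le> dist c b"
    using assms(3) c by (auto simp: e0_def)
  have main: "\<forall>\<^sub>F n in sequentially. loxodromic (g n) \<and> dist (attracting (g n)) a < e \<and> dist (repelling (g n)) b < e"
    if "e > 0" for e
  proof -
    define e' where "e' = min e0 (e/2)"
    have e': "e' > 0" "e' \<le> e0" "e' < e" using e0 that by (auto simp: e'_def)
    from collapsesD[OF assms(2) e'(1)] show ?thesis
    proof (rule eventually_mono)
      fix n assume n: "\<forall>z. e' \<le> dist z b \<longrightarrow> dist (g n z) a < e'"
      have disj: "cball b e' \<inter> cball a e' = {}"
      proof (rule ccontr)
        assume "\<not> ?thesis"
        then obtain z where "dist b z \<le> e'" "dist a z \<le> e'" by auto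
        then have "dist a b \<le> 2 * e'" using dist_triangle[of a b z] by (simp add: dist_commute)
        then show False using e0 e' by linarith
      qed
      have "g n \<in> \<Gamma>" using assms(1) by auto
      moreover have "g n z \<in> cball a e'" if "z \<notin> cball b e'" for z
        using n that by (auto simp: dist_commute intro: less_imp_le)
      moreover have "c \<notin> cball b e'" "c \<notin> cball a e'" using e0 e' by (auto simp: dist_commute)
      moreover have "b \<in> cball b e'" "a \<in> cball a e'" using e' by auto
      ultimately obtain p q where "p \<in> cball a e'" "q \<in> cball b e'" "lox_with (g n) p q"
        using lox_criterion[of "g n" "cball b e'" "cball a e'" b a c] disj by (metis closed_cball)
      then show "loxodromic (g n) \<and> dist (attracting (g n)) a < e \<and> dist (repelling (g n)) b < e"
        using lox_with_eqs[of "g n" p q] e' by (auto simp: dist_commute)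
    qed
  qed
  show "\<forall>\<^sub>F n in sequentially. loxodromic (g n)"
    by (rule eventually_mono[OF main[of 1]]) auto
  show "(\<lambda>n. attracting (g n)) \<longlonglongrightarrow> a" "(\<lambda>n. repelling (g n)) \<longlonglongrightarrow> b"
    by (rule tendstoI, rule eventually_mono[OF main], auto)+
qed

lemma infinite_collapsing_sequence:
  assumes "infinite S" "S \<subseteq> \<Gamma>"
  obtains g a b where "inj g" "range g \<subseteq> S" "collapses g a b"
proof -
  obtain h :: "nat \<Rightarrow> _" where h: "inj h" "range h \<subseteq> S"
    using infinite_countable_subset[OF assms(1)] by blast
  then have "range h \<subseteq> \<Gamma>" using assms(2) by auto
  then obtain a b r where r: "strict_mono r" "collapses (\<lambda>n. h (r n)) a b"
    by (rule collapsing_subsequence[OF h(1)])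
  show ?thesis
    by (rule that[of "\<lambda>n. h (r n)" a b])
      (use h r inj_compose[OF h(1) strict_mono_imp_inj_on[OF r(1)]] in \<open>auto simp: o_def\<close>)
qed

end

section \<open>Magnitudes and cocycles along collapsing sequences\<close>

lemma frequently_subsequence:
  assumes "\<And>k. \<exists>\<^sub>F n in sequentially. P k n"
  obtains r :: "nat \<Rightarrow> nat" where "strict_mono r" "\<And>k. P k (r k)"
proof -
  have ex: "\<exists>n>m. P k n" for m k
    using assms[of k] by (auto simp: frequently_sequentially) (metis Suc_le_eq)
  have "\<exists>f. \<forall>n. P n (f n) \<and> f n < f (Suc n)"
    by (rule dependent_nat_choice) (use ex in blast)+
  then show ?thesis using that by (auto simp: strict_mono_Suc_iff)
qed

text \<open>The indices at which a value occurs for the first time form an infinite set.\<close>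

lemma injective_subsequence:
  fixes h :: "nat \<Rightarrow> 'a"
  assumes "infinite (range h)"
  obtains r :: "nat \<Rightarrow> nat" where "strict_mono r" "inj (\<lambda>n. h (r n))"
proof -
  define I where "I = {n. \<forall>m<n. h m \<noteq> h n}"
  have "range h \<subseteq> h ` I"
  proof
    fix y assume "y \<in> range h"
    then have ex: "\<exists>n. h n = y" by auto
    obtain n where n: "h n = y" "\<And>m. m < n \<Longrightarrow> h m \<noteq> y"
      using exists_least_iff[of "\<lambda>n. h n = y"] ex by metis
    then have "n \<in> I" unfolding I_def by simp
    with n(1) show "y \<in> h ` I" by (metis imageI)
  qed
  then have inf: "infinite I" using assms finite_surj by blast
  have injI: "inj_on h I"
  proof (rule inj_onI)
    fix m n assume mn: "m \<in> I" "n \<in> I" "h m = h n"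
    then have "\<not> m < n" "\<not> n < m" unfolding I_def by fastforce+
    then show "m = n" by simp
  qed
  have "inj (\<lambda>n. h (enumerate I n))"
    using comp_inj_on[OF strict_mono_imp_inj_on[OF strict_mono_enumerate[OF inf], of UNIV], of h]
      inj_on_subset[OF injI, of "range (enumerate I)"] enumerate_in_set[OF inf] by (auto simp: o_def)
  then show ?thesis using that strict_mono_enumerate[OF inf] by blast
qed

lemma loc_unif_to_const_limitin:
  assumes "loc_unif_to_const T S f x" "x \<in> topspace T" "w \<in> S"
  shows "limitin T (\<lambda>n. f n w) x sequentially"
proof -
  obtain U where U: "w \<in> U" "\<forall>V. openin T V \<and> x \<in> V \<longrightarrow> (\<forall>\<^sub>F n in sequentially. f n ` U \<subseteq> V)"
    using assms unfolding loc_unif_to_const_def by blast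
  show ?thesis
    unfolding limitin_def
  proof (intro conjI allI impI)
    show "x \<in> topspace T" by fact
    fix V assume "openin T V \<and> x \<in> V"
    with U(2) have "\<forall>\<^sub>F n in sequentially. f n ` U \<subseteq> V" by blast
    then show "\<forall>\<^sub>F n in sequentially. f n w \<in> V"
      by (rule eventually_mono) (use U(1) in auto)
  qed
qed

text \<open>The function \<open>mag\<close> gives the magnitudes of \<open>\<sigma>\<close>; for \<open>\<sigma>'\<close> the numbers
  \<open>mag (inv \<gamma>)\<close> take this role, see \<open>dual_cocycle_upper_bound\<close>.\<close>

locale gps_system = compact_convergence_group \<Gamma>
  for \<Gamma> :: "('m :: {metric_space, second_countable_topology} \<Rightarrow> 'm) set" +
  fixes \<sigma> \<sigma>' :: "('m \<Rightarrow> 'm) \<Rightarrow> 'm \<Rightarrow> real"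
    and G :: "'m \<times> 'm \<Rightarrow> real"
    and d :: "('m \<Rightarrow> 'm) + 'm \<Rightarrow> ('m \<Rightarrow> 'm) + 'm \<Rightarrow> real"
    and mag :: "('m \<Rightarrow> 'm) \<Rightarrow> real"
    and \<delta> :: real
  assumes gps: "continuous_GPS_system \<Gamma> \<sigma> \<sigma>' G"
    and compactifying: "compactifying_metric \<Gamma> d"
    and magnitude: "magnitude_function \<Gamma> d \<sigma> mag"
    and exponent: "critical_exponent \<Gamma> mag = ereal \<delta>"
    and divergent: "poincare_series \<Gamma> mag \<delta> = \<infinity>"
begin

lemma cocycle: "continuous_cocycle \<Gamma> \<sigma>" "continuous_cocycle \<Gamma> \<sigma>'"
  and proper: "proper_cocycle \<Gamma> \<sigma>"
  using gps by (auto simp: continuous_GPS_system_def)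

lemma cocycle_cont: "\<gamma> \<in> \<Gamma> \<Longrightarrow> continuous_on UNIV (\<sigma> \<gamma>)" "\<gamma> \<in> \<Gamma> \<Longrightarrow> continuous_on UNIV (\<sigma>' \<gamma>)"
  and cocycle_comp: "\<alpha> \<in> \<Gamma> \<Longrightarrow> \<beta> \<in> \<Gamma> \<Longrightarrow> \<sigma> (\<alpha> \<circ> \<beta>) x = \<sigma> \<alpha> (\<beta> x) + \<sigma> \<beta> x"
    "\<alpha> \<in> \<Gamma> \<Longrightarrow> \<beta> \<in> \<Gamma> \<Longrightarrow> \<sigma>' (\<alpha> \<circ> \<beta>) x = \<sigma>' \<alpha> (\<beta> x) + \<sigma>' \<beta> x"
  using cocycle by (auto simp: continuous_cocycle_def)

lemma cocycle_id: "\<sigma> id x = 0" "\<sigma>' id x = 0"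
  using cocycle_comp[OF id_in id_in, of x] by auto

lemma cocycle_inv: "\<gamma> \<in> \<Gamma> \<Longrightarrow> \<sigma> (inv \<gamma>) (\<gamma> x) = - \<sigma> \<gamma> x" "\<gamma> \<in> \<Gamma> \<Longrightarrow> \<sigma>' (inv \<gamma>) (\<gamma> x) = - \<sigma>' \<gamma> x"
  using cocycle_comp[OF inv_in, of \<gamma> \<gamma> x] cocycle_id by auto

lemma cocycle_inv': "\<gamma> \<in> \<Gamma> \<Longrightarrow> \<sigma> \<gamma> (inv \<gamma> x) = - \<sigma> (inv \<gamma>) x"
  using cocycle_inv(1)[of \<gamma> "inv \<gamma> x"] by simp

lemma gps_eq: "\<gamma> \<in> \<Gamma> \<Longrightarrow> x \<noteq> y \<Longrightarrow> \<sigma>' \<gamma> x + \<sigma> \<gamma> y = G (\<gamma> x, \<gamma> y) - G (x, y)"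
  using gps by (auto simp: continuous_GPS_system_def)

lemma open_distinct_pairs: "open (distinct_pairs (UNIV :: 'm set))"
proof -
  have "distinct_pairs (UNIV :: 'm set) = {z. fst z \<noteq> snd z}" by (auto simp: distinct_pairs_def)
  then show ?thesis by (simp add: open_Collect_neq continuous_on_fst continuous_on_snd)
qed

lemma isCont_G: "x \<noteq> y \<Longrightarrow> isCont G (x, y)"
proof -
  assume "x \<noteq> y"
  then have "(x, y) \<in> distinct_pairs UNIV" by (simp add: distinct_pairs_def)
  moreover have "continuous_on (distinct_pairs UNIV) G" using gps by (simp add: continuous_GPS_system_def)
  ultimately show ?thesis using open_distinct_pairs continuous_on_eq_continuous_at by blast
qed

lemma tendsto_G:
  assumes "(f \<longlongrightarrow> x) F" "(h \<longlongrightarrow> y) F" "x \<noteq> y"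
  shows "((\<lambda>n. G (f n, h n)) \<longlongrightarrow> G (x, y)) F"
  using isCont_tendsto_compose[OF isCont_G[OF assms(3)] tendsto_Pair[OF assms(1,2)]] .

lemma G_bounded:
  assumes "closed A" "closed B" "A \<inter> B = {}"
  obtains C where "C \<ge> 0" "\<And>x y. x \<in> A \<Longrightarrow> y \<in> B \<Longrightarrow> \<bar>G (x, y)\<bar> \<le> C"
proof -
  have "compact A" "compact B" using assms(1,2) cpt compact_Int_closed[of UNIV] by auto
  then have "compact (A \<times> B)" by (rule compact_Times)
  moreover have "continuous_on (A \<times> B) G"
    using assms(3) by (intro continuous_at_imp_continuous_on) (auto intro!: isCont_G)
  ultimately have "bounded (G ` (A \<times> B))" using compact_continuous_image compact_imp_bounded by blast
  then obtain C where "\<And>z. z \<in> A \<times> B \<Longrightarrow> norm (G z) \<le> C" by (auto simp: bounded_iff)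
  then show ?thesis using that[of "max C 0"] by force
qed

lemma cocycle_bounded:
  assumes "\<gamma> \<in> \<Gamma>"
  obtains C where "\<And>x. \<bar>\<sigma> \<gamma> x\<bar> \<le> C" "\<And>x. \<bar>\<sigma>' \<gamma> x\<bar> \<le> C"
proof -
  have "bounded (range (\<sigma> \<gamma>))" "bounded (range (\<sigma>' \<gamma>))"
    using compact_continuous_image[OF cocycle_cont(1)[OF assms] cpt]
      compact_continuous_image[OF cocycle_cont(2)[OF assms] cpt] compact_imp_bounded by blast+
  then obtain C C' where "\<And>x. \<bar>\<sigma> \<gamma> x\<bar> \<le> C" "\<And>x. \<bar>\<sigma>' \<gamma> x\<bar> \<le> C'" by (auto simp: bounded_iff)
  then show ?thesis using that[of "max C C'"] by (meson max.coboundedI1 max.coboundedI2)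
qed

text \<open>In the compactification the inverses of a sequence that collapses off \<open>b\<close> converge to \<open>b\<close>, so they
  stay away from every closed set that avoids \<open>b\<close>. Indeed, by the convergence property for the action on
  the compactification a subsequence of the inverses contracts all of it but one point \<open>y'\<close> to a
  point, which must be \<open>b\<close>. If \<open>y'\<close> is not the identity, the images of the identity, that is, the
  inverses themselves, converge to \<open>b\<close>. If \<open>y'\<close> were the identity, the whole space would be contracted
  to \<open>b\<close>, which is impossible for surjective maps.\<close>

lemma compactification_separates:
  assumes g: "inj g" "range g \<subseteq> \<Gamma>" "collapses g a b" and Y: "closed Y" "b \<notin> Y"
  obtains e where "e > 0" "\<forall>\<^sub>F n in sequentially. \<forall>y\<in>Y. e < d (Inr y) (Inl (inv (g n)))"
proof (rule ccontr)
  assume "\<not> thesis"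
  then have neg: "\<And>e. e > 0 \<Longrightarrow> \<not> (\<forall>\<^sub>F n in sequentially. \<forall>y\<in>Y. e < d (Inr y) (Inl (inv (g n))))"
    using that by blast
  interpret M: Metric_space "\<Gamma> <+> UNIV" d
    using compactifying by (simp add: compactifying_metric_def)
  define T where "T = M.mtopology"
  have act: "convergence_action \<Gamma> compactified_action T"
    and emb: "embedding_map euclidean T Inr"
    using compactifying by (auto simp: compactifying_metric_def Let_def T_def)
  have topT: "topspace T = \<Gamma> <+> UNIV" by (simp add: T_def)
  have haus: "Hausdorff_space T" by (simp add: T_def M.Hausdorff_space_mtopology)
  have contInr: "continuous_map euclidean T Inr"
    using emb by (simp add: embedding_map_def homeomorphic_imp_continuous_map continuous_map_in_subtopology[symmetric])
      (metis continuous_map_in_subtopology homeomorphic_imp_continuous_map)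
  have limInr: "limitin T (\<lambda>n. Inr (f n)) (Inr l) sequentially" if "f \<longlonglongrightarrow> l" for f :: "nat \<Rightarrow> 'm" and l
    using continuous_map_limit[OF contInr, of f l sequentially] that by (simp add: o_def)
  have fr: "\<exists>\<^sub>F n in sequentially. \<exists>y\<in>Y. d (Inr y) (Inl (inv (g n))) \<le> inverse (real (Suc k))" for k
    using neg[of "inverse (real (Suc k))"] by (simp add: not_eventually not_less)
  obtain r0 :: "nat \<Rightarrow> nat" where r0: "strict_mono r0"
    "\<And>k. \<exists>y\<in>Y. d (Inr y) (Inl (inv (g (r0 k)))) \<le> inverse (real (Suc k))"
    by (rule frequently_subsequence[of "\<lambda>k n. \<exists>y\<in>Y. d (Inr y) (Inl (inv (g n))) \<le> inverse (real (Suc k))", OF fr]) blast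
  then obtain y where y: "\<And>k. y k \<in> Y" "\<And>k. d (Inr (y k)) (Inl (inv (g (r0 k)))) \<le> inverse (real (Suc k))"
    by metis
  obtain y0 r1 where r1: "strict_mono r1" "(\<lambda>n. y (r1 n)) \<longlonglongrightarrow> y0" by (rule convergent_subsequence)
  have y0: "y0 \<in> Y" using closed_sequentially[OF Y(1), of "\<lambda>n. y (r1 n)"] r1 y by auto
  have r01: "strict_mono (\<lambda>n. r0 (r1 n))" using r0(1) r1(1) by (simp add: strict_mono_def)
  define h where "h n = inv (g (r0 (r1 n)))" for n
  have "inj h"
  proof (rule injI)
    fix i j assume "h i = h j"
    then have "inv (h i) = inv (h j)" by simp
    then have "g (r0 (r1 i)) = g (r0 (r1 j))" using g(2) by (simp add: h_def image_subset_iff)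
    then have "r0 (r1 i) = r0 (r1 j)" using g(1) by (simp add: inj_eq)
    then show "i = j" using strict_mono_eq[OF r01] by simp
  qed
  moreover have hG: "range h \<subseteq> \<Gamma>" using g(2) inv_in by (auto simp: h_def)
  ultimately obtain x y' r2 where xy: "x \<in> topspace T" "y' \<in> topspace T" and r2: "strict_mono (r2::nat\<Rightarrow>nat)"
    and lu: "loc_unif_to_const T (topspace T - {y'}) (\<lambda>j. compactified_action (h (r2 j))) x"
    using act unfolding convergence_action_def by blast
  define s where "s n = r0 (r1 (r2 n))" for n
  have s: "strict_mono s" using r01 r2 by (simp add: strict_mono_def s_def)
  have hs: "h (r2 n) = inv (g (s n))" for n by (simp add: h_def s_def)
  have gs: "g (s n) \<in> \<Gamma>" for n using g(2) by auto
  have coli: "collapses (\<lambda>n. inv (g (s n))) b a"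
    using collapses_inv_in[of "\<lambda>n. g (s n)"] collapses_subseq[OF g(3) s] gs by auto
  have pt: "limitin T (\<lambda>n. compactified_action (inv (g (s n))) w) x sequentially" if "w \<in> topspace T" "w \<noteq> y'" for w
    using loc_unif_to_const_limitin[OF lu xy(1), of w] that by (simp add: hs)
  have xb: "x = Inr b"
  proof -
    obtain w where w: "w \<noteq> a" "Inr w \<noteq> y'"
    proof (cases y')
      case (Inl q)
      obtain w where "w \<noteq> a" using third_point by blast
      then show ?thesis using that Inl by blast
    next
      case (Inr q)
      obtain w where "w \<noteq> a" "w \<noteq> q" using third_point by blast
      then show ?thesis using that Inr by blast
    qed
    have "limitin T (\<lambda>n. Inr (inv (g (s n)) w)) x sequentially"
      using pt[of "Inr w"] w(2) by (simp add: topT InrI)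
    moreover have "limitin T (\<lambda>n. Inr (inv (g (s n)) w)) (Inr b) sequentially"
      by (rule limInr) (rule collapses_tendsto_const[OF coli w(1)])
    ultimately show ?thesis using limitin_Hausdorff_unique[OF _ _ _ haus] by force
  qed
  show False
  proof (cases "y' = Inl id")
    case False
    have idT: "Inl id \<in> topspace T" using id_in by (simp add: topT InlI)
    have l1: "limitin T (\<lambda>n. Inl (inv (g (s n)))) x sequentially"
      using pt[OF idT] False by (simp add: o_def)
    have "limitin T (\<lambda>n. Inl (inv (g (s n)))) (Inr y0) sequentially"
      unfolding T_def M.limitin_metric
    proof (intro conjI allI impI)
      show "Inr y0 \<in> \<Gamma> <+> UNIV" by (simp add: InrI)
      fix e :: real assume "e > 0"
      then have e2: "e/2 > 0" by simp
      have "limitin M.mtopology (\<lambda>n. Inr (y (r1 (r2 n)))) (Inr y0) sequentially"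
        using limInr[OF LIMSEQ_subseq_LIMSEQ[OF r1(2) r2]] by (simp add: T_def o_def)
      then have 1: "\<forall>\<^sub>F n in sequentially. d (Inr (y (r1 (r2 n)))) (Inr y0) < e/2"
        unfolding M.limitin_metric by (elim conjE allE[of _ "e/2"] impE[OF _ e2]) (erule eventually_mono, blast)
      have "strict_mono (\<lambda>n. r1 (r2 n))" using r1 r2 by (simp add: strict_mono_def)
      from LIMSEQ_subseq_LIMSEQ[OF LIMSEQ_inverse_real_of_nat this]
      have "(\<lambda>n. inverse (real (Suc (r1 (r2 n))))) \<longlonglongrightarrow> 0" by (simp add: o_def)
      from tendstoD[OF this e2] 1
      show "\<forall>\<^sub>F n in sequentially. Inl (inv (g (s n))) \<in> \<Gamma> <+> UNIV \<and> d (Inl (inv (g (s n)))) (Inr y0) < e"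
      proof eventually_elim
        case (elim n)
        have in': "Inl (inv (g (s n))) \<in> \<Gamma> <+> UNIV" using inv_in[OF gs] by (rule InlI)
        have "d (Inl (inv (g (s n)))) (Inr y0) \<le> d (Inl (inv (g (s n)))) (Inr (y (r1 (r2 n)))) + d (Inr (y (r1 (r2 n)))) (Inr y0)"
          using in' by (intro M.triangle) (auto intro: InrI)
        moreover have "d (Inl (inv (g (s n)))) (Inr (y (r1 (r2 n)))) \<le> inverse (real (Suc (r1 (r2 n))))"
          using y(2)[of "r1 (r2 n)"] by (subst M.commute) (simp add: s_def)
        moreover have "inverse (real (Suc (r1 (r2 n)))) < e/2" using elim(1) by (simp add: dist_real_def)
        ultimately have "d (Inl (inv (g (s n)))) (Inr y0) < e" using elim(2) by linarith
        with in' show ?case by simp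
      qed
    qed
    then have "x = Inr y0" using limitin_Hausdorff_unique[OF l1 _ _ haus] by force
    with xb y0 Y(2) show False by simp
  next
    case True
    obtain q where q: "q \<noteq> b" using third_point by blast
    obtain w t where t: "strict_mono (t::nat\<Rightarrow>nat)" "(\<lambda>n. g (s (t n)) q) \<longlonglongrightarrow> w" by (rule convergent_subsequence)
    define V where "V = M.mball (Inr b) (d (Inr b) (Inr q))"
    have dpos: "d (Inr b) (Inr q) > 0" using q by (simp add: M.mdist_pos_eq InrI)
    have V: "openin T V" "Inr b \<in> V" "Inr q \<notin> V" using dpos by (auto simp: V_def T_def InrI)
    have "Inr w \<in> topspace T - {y'}" using True by (auto simp: topT intro: InrI)
    then obtain U where U: "openin (subtopology T (topspace T - {y'})) U" "Inr w \<in> U"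
      "\<forall>V. openin T V \<and> x \<in> V \<longrightarrow> (\<forall>\<^sub>F n in sequentially. compactified_action (h (r2 n)) ` U \<subseteq> V)"
      using lu unfolding loc_unif_to_const_def by blast
    then obtain W where W: "openin T W" "U = W \<inter> (topspace T - {y'})" by (auto simp: openin_subtopology)
    have "\<forall>\<^sub>F n in sequentially. compactified_action (h (r2 n)) ` U \<subseteq> V" using U(3) V xb by blast
    from eventually_subseq[OF t(1) this]
    have 1: "\<forall>\<^sub>F n in sequentially. compactified_action (h (r2 (t n))) ` U \<subseteq> V" .
    have 2: "\<forall>\<^sub>F n in sequentially. Inr (g (s (t n)) q) \<in> W"
      using limInr[OF t(2)] W U(2) by (auto simp: limitin_def)
    from 1 2 have "\<forall>\<^sub>F n in sequentially. False"
    proof eventually_elim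
      case (elim n)
      have "Inr (g (s (t n)) q) \<in> U" using elim(2) W True by (auto simp: topT intro: InrI)
      with elim(1) have "compactified_action (h (r2 (t n))) (Inr (g (s (t n)) q)) \<in> V" by blast
      then show ?case using V(3) gs by (simp add: hs)
    qed
    then show False by simp
  qed
qed

text \<open>A finite critical exponent forces the counting function to be finite.\<close>

lemma finite_mag: "finite {\<gamma>\<in>\<Gamma>. mag \<gamma> \<le> R}"
proof -
  have "Limsup at_top (\<lambda>R::real. log_card {\<gamma>\<in>\<Gamma>. mag \<gamma> \<le> R} / ereal R) < \<infinity>"
    using exponent by (simp add: critical_exponent_def)
  then have "\<forall>\<^sub>F R::real in at_top. log_card {\<gamma>\<in>\<Gamma>. mag \<gamma> \<le> R} / ereal R < \<infinity>"
    by (rule Limsup_lessD)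
  then have "\<forall>\<^sub>F R'::real in at_top. log_card {\<gamma>\<in>\<Gamma>. mag \<gamma> \<le> R'} / ereal R' < \<infinity> \<and> R' > 0 \<and> R' \<ge> R"
    by (intro eventually_conj eventually_gt_at_top eventually_ge_at_top)
  then obtain R' where R': "log_card {\<gamma>\<in>\<Gamma>. mag \<gamma> \<le> R'} / ereal R' < \<infinity>" "R' > 0" "R' \<ge> R"
    using eventually_happens' trivial_limit_at_top_linorder by blast
  then have "finite {\<gamma>\<in>\<Gamma>. mag \<gamma> \<le> R'}" by (auto simp: log_card_def split: if_splits)
  then show ?thesis by (rule finite_subset[rotated]) (use R'(3) in auto)
qed

lemma countable_group: "countable \<Gamma>"
proof -
  have "\<Gamma> = (\<Union>n::nat. {\<gamma>\<in>\<Gamma>. mag \<gamma> \<le> real n})" by (auto simp: real_arch_simple)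
  also have "countable (\<Union>n::nat. {\<gamma>\<in>\<Gamma>. mag \<gamma> \<le> real n})"
    by (rule countable_UN) (simp_all add: countable_finite finite_mag)
  finally show ?thesis .
qed

lemma mag_at_top:
  assumes "inj g" "range g \<subseteq> \<Gamma>"
  shows "\<forall>\<^sub>F n in sequentially. R \<le> mag (g (n::nat))"
proof -
  have "finite (g -` {\<gamma>\<in>\<Gamma>. mag \<gamma> \<le> R})" by (rule finite_vimageI[OF finite_mag assms(1)])
  moreover have "{n. \<not> R \<le> mag (g n)} \<subseteq> g -` {\<gamma>\<in>\<Gamma>. mag \<gamma> \<le> R}" using assms(2) by auto
  ultimately have "finite {n. \<not> R \<le> mag (g n)}" using finite_subset by blast
  then show ?thesis by (simp add: eventually_cofinite flip: cofinite_eq_sequentially)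
qed

lemma cocycle_near_mag:
  assumes "inj g" "range g \<subseteq> \<Gamma>" "collapses g a b" "closed Y" "b \<notin> Y"
  obtains C where "\<forall>\<^sub>F n in sequentially. \<forall>y\<in>Y. mag (g n) - C \<le> \<sigma> (g n) y \<and> \<sigma> (g n) y \<le> mag (g n) + C"
proof -
  obtain e where e: "e > 0" "\<forall>\<^sub>F n in sequentially. \<forall>y\<in>Y. e < d (Inr y) (Inl (inv (g n)))"
    by (rule compactification_separates[OF assms])
  then obtain C where "C > 0" "\<And>\<gamma> x. \<gamma> \<in> \<Gamma> \<Longrightarrow> d (Inr x) (Inl (inv \<gamma>)) > e \<Longrightarrow>
        mag \<gamma> - C \<le> \<sigma> \<gamma> x \<and> \<sigma> \<gamma> x \<le> mag \<gamma> + C"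
    using magnitude[unfolded magnitude_function_def, rule_format, OF e(1)] by metis
  then have "\<forall>\<^sub>F n in sequentially. \<forall>y\<in>Y. mag (g n) - C \<le> \<sigma> (g n) y \<and> \<sigma> (g n) y \<le> mag (g n) + C"
    using assms(2) by (intro eventually_mono[OF e(2)]) (metis range_subsetD)
  then show ?thesis using that by blast
qed

text \<open>Away from \<open>b\<close> the cocycle is comparable to the magnitude, and only finitely many elements have
  bounded magnitude.\<close>

lemma cocycle_at_top:
  assumes "inj g" "range g \<subseteq> \<Gamma>" "collapses g a b" "closed Y" "b \<notin> Y"
  shows "\<forall>\<^sub>F n in sequentially. \<forall>y\<in>Y. R \<le> \<sigma> (g n) y"
proof -
  obtain C where "\<forall>\<^sub>F n in sequentially. \<forall>y\<in>Y. mag (g n) - C \<le> \<sigma> (g n) y \<and> \<sigma> (g n) y \<le> mag (g n) + C"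
    by (rule cocycle_near_mag[OF assms])
  with mag_at_top[OF assms(1,2), of "R + C"] show ?thesis
    by eventually_elim force
qed

lemma inj_inv_sequence: "inj g \<Longrightarrow> range g \<subseteq> \<Gamma> \<Longrightarrow> inj (\<lambda>n. inv (g n))"
  by (rule injI) (metis injD inv_inv range_subsetD)

lemma inv_sequence_in: "range g \<subseteq> \<Gamma> \<Longrightarrow> range (\<lambda>n. inv (g n)) \<subseteq> \<Gamma>"
  using inv_in by auto

section \<open>Absence of finite invariant sets\<close>

text \<open>If \<open>p\<close> were fixed by the whole group, some element \<open>\<alpha>\<close> would be loxodromic with repelling point
  \<open>p\<close>; let \<open>x\<close> be its attracting point. At the fixed point \<open>p\<close> the cocycle \<open>\<sigma>'\<close> is a homomorphism,
  which vanishes on the commutators \<open>\<alpha>\<^sup>n \<beta> \<alpha>\<^sup>-\<^sup>n \<beta>\<^sup>-\<^sup>1\<close>. By the equation for \<open>G\<close> the cocycle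
  \<open>\<sigma>\<close> of these commutators is therefore bounded at \<open>\<beta>x\<close>, because they carry \<open>\<beta>x\<close> to
  \<open>\<alpha>\<^sup>n \<beta>x\<close>, which tends to \<open>x\<close>. If \<open>\<beta>x \<noteq> x\<close>, infinitely many of them are distinct, and
  boundedness contradicts the growth of \<open>\<sigma>\<close>. So the whole group fixes \<open>x\<close> as well, and the limit set has
  at most two points.\<close>

lemma no_global_fixed_point:
  assumes p: "\<And>\<gamma>. \<gamma> \<in> \<Gamma> \<Longrightarrow> \<gamma> p = p"
  shows False
proof -
  have sig: "\<sigma> \<gamma> y = - \<sigma>' \<gamma> p + G (p, \<gamma> y) - G (p, y)" if "\<gamma> \<in> \<Gamma>" "y \<noteq> p" for \<gamma> y
    using gps_eq[of \<gamma> p y] that p by force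
  have hom: "\<sigma>' (\<alpha> \<circ> \<beta>) p = \<sigma>' \<alpha> p + \<sigma>' \<beta> p" if "\<alpha> \<in> \<Gamma>" "\<beta> \<in> \<Gamma>" for \<alpha> \<beta>
    using cocycle_comp(2)[OF that, of p] p[OF that(2)] by simp
  have hominv: "\<sigma>' (inv \<alpha>) p = - \<sigma>' \<alpha> p" if "\<alpha> \<in> \<Gamma>" for \<alpha>
    using cocycle_inv(2)[OF that, of p] p[OF that] by simp
  obtain z where z: "z \<in> limit_set \<Gamma>" "z \<noteq> p" using limit_set_not_covered[of p p] by blast
  then obtain b g where g: "range g \<subseteq> \<Gamma>" "collapses g z b" by (auto simp: limit_set_iff)
  have gn: "g n \<in> \<Gamma>" for n using g(1) by auto
  have bp: "b = p" using collapses_fixed[OF g(2), of p] p gn z(2) by blast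
  have ev: "\<forall>\<^sub>F n in sequentially. loxodromic (g n)" "(\<lambda>n. attracting (g n)) \<longlonglongrightarrow> z"
    using collapses_imp_loxodromic[OF g] bp z(2) by auto
  from ev(1) tendstoD[OF ev(2), of "dist z p"] z(2)
  have "\<forall>\<^sub>F n in sequentially. loxodromic (g n) \<and> dist (attracting (g n)) z < dist z p"
    by (auto intro: eventually_conj)
  then obtain n where n: "loxodromic (g n)" "dist (attracting (g n)) z < dist z p"
    by (auto simp: eventually_sequentially)
  define \<alpha> where "\<alpha> = g n"
  define x where "x = attracting \<alpha>"
  have \<alpha>: "\<alpha> \<in> \<Gamma>" "loxodromic \<alpha>" using gn n by (auto simp: \<alpha>_def)
  have xp: "x \<noteq> p" using n(2) by (auto simp: x_def \<alpha>_def dist_commute)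
  have rp: "repelling \<alpha> = p" using loxodromicD(6)[OF \<alpha>(2) p[OF \<alpha>(1)]] xp by (auto simp: x_def)
  have \<alpha>x: "\<alpha> x = x" using loxodromicD(3)[OF \<alpha>(2)] by (simp add: x_def)
  have col: "collapses (\<lambda>n. \<alpha> ^^ n) x p" using loxodromicD(5)[OF \<alpha>(2)] rp by (simp add: x_def)
  have \<alpha>nx: "(\<alpha> ^^ n) x = x" for n using \<alpha>x by (induction n) auto
  have fixx: "\<beta> x = x" if \<beta>: "\<beta> \<in> \<Gamma>" for \<beta>
  proof (rule ccontr)
    assume ne: "\<beta> x \<noteq> x"
    have \<beta>xp: "\<beta> x \<noteq> p" using xp eq_iff[OF \<beta>, of x p] p[OF \<beta>] by metis
    define h where "h n = (\<alpha> ^^ n) \<circ> (\<beta> \<circ> (inv (\<alpha> ^^ n) \<circ> inv \<beta>))" for n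
    note mem = funpow_in[OF \<alpha>(1)] \<beta> inv_in comp_in
    have hG: "h n \<in> \<Gamma>" for n unfolding h_def by (intro mem)
    have s0: "\<sigma>' (h n) p = 0" for n
      unfolding h_def by (simp add: hom hominv mem)
    have hy: "h n (\<beta> x) = (\<alpha> ^^ n) (\<beta> x)" for n
      using inv_apply(1)[OF funpow_in[OF \<alpha>(1)], of n x] \<alpha>nx[of n] \<beta> by (simp add: h_def)
    have lim: "(\<lambda>n. h n (\<beta> x)) \<longlonglongrightarrow> x" unfolding hy by (rule collapses_tendsto_const[OF col \<beta>xp])
    have "h n (\<beta> x) \<noteq> x" for n
      using ne eq_iff[OF funpow_in[OF \<alpha>(1)], of n "\<beta> x" x] \<alpha>nx[of n] by (simp add: hy)
    have "infinite (range h)"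
    proof
      assume "finite (range h)"
      then have "finite ((\<lambda>\<gamma>. \<gamma> (\<beta> x)) ` range h)" by blast
      then have "finite (range (\<lambda>n. h n (\<beta> x)))" by (simp add: image_image)
      then have "closed (range (\<lambda>n. h n (\<beta> x)))" by (rule finite_imp_closed)
      from closed_sequentially[OF this _ lim] have "x \<in> range (\<lambda>n. h n (\<beta> x))" by auto
      then obtain n where "x = h n (\<beta> x)" by blast
      then show False using \<open>\<And>n. h n (\<beta> x) \<noteq> x\<close>[of n] by simp
    qed
    then obtain r :: "nat \<Rightarrow> nat" where r: "strict_mono r" "inj (\<lambda>n. h (r n))" by (rule injective_subsequence)
    have "range (\<lambda>n. h (r n)) \<subseteq> \<Gamma>" using hG by auto
    then obtain a b r' where r': "strict_mono r'" "collapses (\<lambda>n. h (r (r' n))) a b"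
      by (rule collapsing_subsequence[OF r(2)])
    define k where "k n = h (r (r' n))" for n
    have k: "inj k" "range k \<subseteq> \<Gamma>" "collapses k a b"
      using inj_compose[OF r(2) strict_mono_imp_inj_on[OF r'(1)]] hG r'(2) by (auto simp: k_def[abs_def] o_def)
    have kG: "k n \<in> \<Gamma>" for n using k by auto
    have rr: "strict_mono (\<lambda>n. r (r' n))" using r(1) r'(1) by (simp add: strict_mono_def)
    have limk: "(\<lambda>n. k n (\<beta> x)) \<longlonglongrightarrow> x" using LIMSEQ_subseq_LIMSEQ[OF lim rr] by (simp add: k_def o_def)
    have sk: "\<sigma> (k n) w = G (p, k n w) - G (p, w)" if "w \<noteq> p" for n w
      using sig[OF kG that] s0 by (simp add: k_def)
    have sk': "\<sigma> (inv (k n)) w = G (p, inv (k n) w) - G (p, w)" if "w \<noteq> p" for n w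
      using sig[OF inv_in[OF kG] that] hominv[OF kG] s0 by (simp add: k_def)
    \<comment> \<open>A convergent real sequence is not eventually above every bound.\<close>
    have unb: False if "\<forall>R. \<forall>\<^sub>F n in sequentially. R \<le> f n" "f \<longlonglongrightarrow> l" for f :: "nat \<Rightarrow> real" and l
    proof -
      have "\<forall>\<^sub>F n in sequentially. f n < l + 1" using order_tendstoD(2)[OF that(2)] by simp
      with that(1)[rule_format, of "l + 1"] have "\<forall>\<^sub>F n in sequentially. False" by eventually_elim simp
      then show False by simp
    qed
    show False
    proof (cases "\<beta> x = b")
      case False
      have "(\<lambda>n. k n (\<beta> x)) \<longlonglongrightarrow> a" using collapses_tendsto_const[OF k(3) False] .
      then have "a = x" using limk LIMSEQ_unique by blast
      have big: "\<forall>R. \<forall>\<^sub>F n in sequentially. R \<le> \<sigma> (k n) (\<beta> x)"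
        using cocycle_at_top[OF k, of "{\<beta> x}"] False by auto
      have "(\<lambda>n. \<sigma> (k n) (\<beta> x)) \<longlonglongrightarrow> G (p, x) - G (p, \<beta> x)"
        unfolding sk[OF \<beta>xp] by (intro tendsto_diff tendsto_G tendsto_const limk) (use xp in auto)
      with unb[OF big] show False by blast
    next
      case True
      then have "b \<noteq> p" using \<beta>xp by simp
      then have "a = p" using collapses_fixed[OF k(3), of p] p kG by auto
      have ci: "collapses (\<lambda>n. inv (k n)) b a" by (rule collapses_inv_in[OF k(2,3)])
      have big: "\<forall>R. \<forall>\<^sub>F n in sequentially. R \<le> \<sigma> (inv (k n)) x"
        using cocycle_at_top[OF inj_inv_sequence[OF k(1,2)] inv_sequence_in[OF k(2)] ci, of "{x}"] xp \<open>a = p\<close> by auto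
      have "(\<lambda>n. inv (k n) x) \<longlonglongrightarrow> b" by (rule collapses_tendsto_const[OF ci]) (use xp \<open>a = p\<close> in auto)
      then have "(\<lambda>n. \<sigma> (inv (k n)) x) \<longlonglongrightarrow> G (p, b) - G (p, x)"
        unfolding sk'[OF xp] by (intro tendsto_diff tendsto_G tendsto_const) (use \<open>b \<noteq> p\<close> in auto)
      with unb[OF big] show False by blast
    qed
  qed
  have "limit_set \<Gamma> \<subseteq> {p, x}"
  proof
    fix w assume "w \<in> limit_set \<Gamma>"
    then obtain b g where g: "range g \<subseteq> \<Gamma>" "collapses g w b" by (auto simp: limit_set_iff)
    have "g n \<in> \<Gamma>" for n using g(1) by auto
    then show "w \<in> {p, x}"
      using collapses_fixed[OF g(2), of p] collapses_fixed[OF g(2), of x] p fixx xp by blast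
  qed
  then show False using limit_set_not_covered by blast
qed

text \<open>A collapsing sequence sends every point of \<open>P\<close> other than \<open>b\<close> eventually exactly to its limit, as
  \<open>P\<close> is discrete; by injectivity there is at most one such point. Hence \<open>P\<close> has at most two points, and
  if it has two, every limit point belongs to it.\<close>

lemma no_finite_invariant_set:
  assumes P: "finite P" "P \<noteq> {}" and inv: "\<And>\<gamma> w. \<gamma> \<in> \<Gamma> \<Longrightarrow> w \<in> P \<Longrightarrow> \<gamma> w \<in> P"
  shows False
proof -
  have lim: "z \<in> P \<and> (\<forall>\<^sub>F n in sequentially. g n w = z)"
    if "range g \<subseteq> \<Gamma>" "collapses g z b" "w \<in> P" "w \<noteq> b" for g z b w
  proof -
    have gP: "g n w \<in> P" for n using inv[of "g n" w] that(1,3) by auto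
    have l: "(\<lambda>n. g n w) \<longlonglongrightarrow> z" by (rule collapses_tendsto_const[OF that(2,4)])
    then have "z \<in> P" using closed_sequentially[OF finite_imp_closed[OF P(1)], of "\<lambda>n. g n w"] gP by auto
    obtain e where e: "e > 0" "\<And>x. x \<in> P \<Longrightarrow> x \<noteq> z \<Longrightarrow> e \<le> dist z x"
      using finite_set_avoid[OF P(1), of z] by auto
    from tendstoD[OF l e(1)] have "\<forall>\<^sub>F n in sequentially. g n w = z"
      by (rule eventually_mono) (use e(2) gP in \<open>force simp: dist_commute\<close>)
    with \<open>z \<in> P\<close> show ?thesis by simp
  qed
  have two: False if "range g \<subseteq> \<Gamma>" "collapses g z b" "w \<in> P" "w \<noteq> b" "w' \<in> P" "w' \<noteq> b" "w \<noteq> w'" for g z b w w'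
  proof -
    from lim[OF that(1-4)] lim[OF that(1,2,5,6)]
    have "\<forall>\<^sub>F n in sequentially. g n w = z" "\<forall>\<^sub>F n in sequentially. g n w' = z" by auto
    then have "\<forall>\<^sub>F n in sequentially. False"
    proof eventually_elim
      case (elim n)
      have "g n \<in> \<Gamma>" using that(1) by auto
      then show ?case using elim that(7) by (metis eq_iff)
    qed
    then show False by simp
  qed
  obtain p where p: "p \<in> P" using P(2) by auto
  obtain q where q: "q \<in> P" "q \<noteq> p"
    using no_global_fixed_point[of p] inv p by blast
  have "limit_set \<Gamma> \<subseteq> {p, q}"
  proof
    fix z assume "z \<in> limit_set \<Gamma>"
    then obtain b g where g: "range g \<subseteq> \<Gamma>" "collapses g z b" by (auto simp: limit_set_iff)
    have b: "b = p \<or> b = q" using two[OF g p _ q(1)] q(2) by blast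
    then have "z \<in> P" using lim[OF g p] lim[OF g q(1)] q by blast
    moreover have "P \<subseteq> {p, q}"
    proof
      fix w assume w: "w \<in> P"
      show "w \<in> {p, q}" using two[OF g w _ p] two[OF g w _ q(1)] b q by blast
    qed
    ultimately show "z \<in> {p, q}" by blast
  qed
  then show False using limit_set_not_covered by blast
qed

text \<open>Elements that violate the bound with larger and larger constants must be infinitely many, because
  each single function \<open>\<tau> \<gamma>\<close> is bounded; a collapsing subsequence of them contradicts the hypothesis.\<close>

lemma uniform_upper_bound:
  assumes bdd: "\<And>\<gamma>. \<gamma> \<in> \<Gamma> \<Longrightarrow> \<exists>C. \<forall>x. \<bar>\<tau> \<gamma> x\<bar> \<le> C"
    and ex: "\<And>g a b x. inj g \<Longrightarrow> range g \<subseteq> \<Gamma> \<Longrightarrow> collapses g a b \<Longrightarrow> (\<And>n. x n \<in> K) \<Longrightarrow>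
        \<exists>C. \<exists>\<^sub>F n in sequentially. \<tau> (g n) (x n) \<le> mg (g n) + (C::real)"
  shows "\<exists>C. \<forall>\<gamma>\<in>\<Gamma>. \<forall>x\<in>K. \<tau> \<gamma> x \<le> mg \<gamma> + C"
proof (rule ccontr)
  assume neg: "\<not> ?thesis"
  have "\<exists>\<gamma> x. \<gamma> \<in> \<Gamma> \<and> x \<in> K \<and> \<tau> \<gamma> x > mg \<gamma> + real n" for n
    using neg by (meson not_less)
  then obtain h x where hx: "\<And>n. h n \<in> \<Gamma>" "\<And>n. x n \<in> K" "\<And>n. \<tau> (h n) (x n) > mg (h n) + real n"
    by metis
  obtain B where B: "\<And>\<gamma> x. \<gamma> \<in> \<Gamma> \<Longrightarrow> \<bar>\<tau> \<gamma> x\<bar> \<le> B \<gamma>" using bdd by metis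
  have "infinite (range h)"
  proof
    assume fin: "finite (range h)"
    define C where "C = (MAX \<gamma>\<in>range h. B \<gamma> - mg \<gamma>)"
    have "B (h n) - mg (h n) \<le> C" for n unfolding C_def by (rule Max_ge) (use fin in auto)
    then have "real n \<le> C" for n using hx(3)[of n] B[OF hx(1), of n "x n"] by (smt (verit))
    then show False using reals_Archimedean2[of C] by (meson not_less)
  qed
  then obtain r :: "nat \<Rightarrow> nat" where r: "strict_mono r" "inj (\<lambda>n. h (r n))" by (rule injective_subsequence)
  have "range (\<lambda>n. h (r n)) \<subseteq> \<Gamma>" using hx by auto
  then obtain a b r' where r': "strict_mono r'" "collapses (\<lambda>n. h (r (r' n))) a b"
    by (rule collapsing_subsequence[OF r(2)])
  have "inj (\<lambda>n. h (r (r' n)))"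
    using inj_compose[OF r(2) strict_mono_imp_inj_on[OF r'(1)]] by (simp add: o_def)
  from ex[OF this _ r'(2), of "\<lambda>n. x (r (r' n))"] hx obtain C where
    C: "\<exists>\<^sub>F n in sequentially. \<tau> (h (r (r' n))) (x (r (r' n))) \<le> mg (h (r (r' n))) + C" by auto
  have "strict_mono (\<lambda>n. r (r' n))" using r(1) r'(1) by (simp add: strict_mono_def)
  then have le: "n \<le> r (r' n)" for n by (rule strict_mono_imp_increasing)
  have "\<forall>\<^sub>F n in sequentially. C \<le> real n" using filterlim_real_sequentially by (simp add: filterlim_at_top)
  then have "\<forall>\<^sub>F n in sequentially. \<not> \<tau> (h (r (r' n))) (x (r (r' n))) \<le> mg (h (r (r' n))) + C"
  proof eventually_elim
    case (elim n)
    have "real n \<le> real (r (r' n))" using le[of n] by simp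
    then show ?case using hx(3)[of "r (r' n)"] elim by linarith
  qed
  with C show False by (simp add: frequently_def)
qed

lemma cocycle_upper_bound:
  assumes "closed K" "K \<inter> limit_set \<Gamma> = {}"
  shows "\<exists>C. \<forall>\<gamma>\<in>\<Gamma>. \<forall>x\<in>K. \<sigma> \<gamma> x \<le> mag \<gamma> + C"
proof (rule uniform_upper_bound)
  show "\<exists>C. \<forall>x. \<bar>\<sigma> \<gamma> x\<bar> \<le> C" if "\<gamma> \<in> \<Gamma>" for \<gamma> using cocycle_bounded[OF that] by metis
  fix g a b and x :: "nat \<Rightarrow> 'm" assume g: "inj g" "range g \<subseteq> \<Gamma>" "collapses g a b" "\<And>n. x n \<in> K"
  have "b \<notin> K" using collapses_limit_points[OF g(2,3)] assms(2) by blast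
  from cocycle_near_mag[OF g(1-3) assms(1) this] obtain C where
    "\<forall>\<^sub>F n in sequentially. \<forall>y\<in>K. mag (g n) - C \<le> \<sigma> (g n) y \<and> \<sigma> (g n) y \<le> mag (g n) + C" by blast
  then have "\<forall>\<^sub>F n in sequentially. \<sigma> (g n) (x n) \<le> mag (g n) + C"
    by (rule eventually_mono) (use g(4) in auto)
  then show "\<exists>C. \<exists>\<^sub>F n in sequentially. \<sigma> (g n) (x n) \<le> mag (g n) + C"
    by (meson eventually_frequently trivial_limit_sequentially)
qed

text \<open>Fix \<open>z \<noteq> a\<close> and evaluate the equation for \<open>G\<close> at the point \<open>x\<close> of \<open>K\<close> and at \<open>y = \<gamma>\<^sup>-\<^sup>1 z\<close>. It
  expresses \<open>\<sigma>'(\<gamma>,x)\<close> through \<open>\<sigma>(\<gamma>\<^sup>-\<^sup>1,z)\<close>, which is comparable to the magnitude of the inverse,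
  and through values of \<open>G\<close> that stay bounded.\<close>

lemma dual_cocycle_upper_bound:
  assumes "closed K" "K \<inter> limit_set \<Gamma> = {}"
  shows "\<exists>C. \<forall>\<gamma>\<in>\<Gamma>. \<forall>x\<in>K. \<sigma>' \<gamma> x \<le> mag (inv \<gamma>) + C"
proof (rule uniform_upper_bound)
  show "\<exists>C. \<forall>x. \<bar>\<sigma>' \<gamma> x\<bar> \<le> C" if "\<gamma> \<in> \<Gamma>" for \<gamma> using cocycle_bounded[OF that] by metis
  fix g a b and x :: "nat \<Rightarrow> 'm" assume g: "inj g" "range g \<subseteq> \<Gamma>" "collapses g a b" "\<And>n. x n \<in> K"
  obtain x0 r where r: "strict_mono r" "(\<lambda>n. x (r n)) \<longlonglongrightarrow> x0" by (rule convergent_subsequence)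
  have x0: "x0 \<in> K" using closed_sequentially[OF assms(1), of "\<lambda>n. x (r n)"] r g(4) by auto
  have bK: "b \<notin> K" using collapses_limit_points[OF g(2,3)] assms(2) by blast
  obtain z where z: "z \<noteq> a" using third_point by blast
  have ci: "collapses (\<lambda>n. inv (g n)) b a" by (rule collapses_inv_in[OF g(2,3)])
  obtain C where C: "\<forall>\<^sub>F n in sequentially. \<forall>y\<in>{z}. mag (inv (g n)) - C \<le> \<sigma> (inv (g n)) y \<and> \<sigma> (inv (g n)) y \<le> mag (inv (g n)) + C"
    by (rule cocycle_near_mag[OF inj_inv_sequence[OF g(1,2)] inv_sequence_in[OF g(2)] ci, of "{z}"]) (use z in auto)
  define k where "k n = g (r n)" for n
  define y where "y n = inv (k n) z" for n
  have kG: "k n \<in> \<Gamma>" for n using g(2) by (auto simp: k_def)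
  have ck: "collapses k a b" using collapses_subseq[OF g(3) r(1)] by (simp add: k_def[abs_def])
  have cki: "collapses (\<lambda>n. inv (k n)) b a" using collapses_subseq[OF ci r(1)] by (simp add: k_def[abs_def])
  have ylim: "y \<longlonglongrightarrow> b" unfolding y_def[abs_def] by (rule collapses_tendsto_const[OF cki z])
  have "x0 \<noteq> b" using x0 bK by auto
  have kx: "(\<lambda>n. k n (x (r n))) \<longlonglongrightarrow> a" by (rule collapses_tendsto[OF ck r(2) \<open>x0 \<noteq> b\<close>])
  have l: "(\<lambda>n. G (k n (x (r n)), z) - G (x (r n), y n)) \<longlonglongrightarrow> G (a, z) - G (x0, b)"
    by (intro tendsto_diff tendsto_G kx r(2) ylim tendsto_const) (use z \<open>x0 \<noteq> b\<close> in auto)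
  define D where "D = G (a, z) - G (x0, b) + 1"
  have e1: "\<forall>\<^sub>F n in sequentially. G (k n (x (r n)), z) - G (x (r n), y n) < D"
    using order_tendstoD(2)[OF l, of D] by (simp add: D_def)
  have e2: "\<forall>\<^sub>F n in sequentially. x (r n) \<noteq> y n"
  proof -
    have "\<forall>\<^sub>F n in sequentially. (x (r n), y n) \<in> distinct_pairs UNIV"
      using topological_tendstoD[OF tendsto_Pair[OF r(2) ylim] open_distinct_pairs] \<open>x0 \<noteq> b\<close>
      by (auto simp: distinct_pairs_def)
    then show ?thesis by (simp add: distinct_pairs_def)
  qed
  have e3: "\<forall>\<^sub>F n in sequentially. \<sigma> (inv (k n)) z \<le> mag (inv (k n)) + C"
    using eventually_subseq[OF r(1) C] by (auto simp: k_def elim: eventually_mono)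
  from e1 e2 e3 have ev: "\<forall>\<^sub>F n in sequentially. \<sigma>' (g (r n)) (x (r n)) \<le> mag (inv (g (r n))) + (C + D)"
  proof eventually_elim
    case (elim n)
    have "\<sigma>' (k n) (x (r n)) + \<sigma> (k n) (y n) = G (k n (x (r n)), z) - G (x (r n), y n)"
      using gps_eq[OF kG elim(2)] kG[of n] by (simp add: y_def)
    moreover have "\<sigma> (k n) (y n) = - \<sigma> (inv (k n)) z" using cocycle_inv'[OF kG] by (simp add: y_def)
    ultimately show ?case using elim by (simp add: k_def)
  qed
  have "\<exists>\<^sub>F n in sequentially. \<sigma>' (g n) (x n) \<le> mag (inv (g n)) + (C + D)"
  proof (rule ccontr)
    assume "\<not> ?thesis"
    then have "\<forall>\<^sub>F n in sequentially. \<not> \<sigma>' (g n) (x n) \<le> mag (inv (g n)) + (C + D)"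
      by (simp add: not_frequently)
    from eventually_subseq[OF r(1) this] ev have "\<forall>\<^sub>F n in sequentially. False"
      by eventually_elim simp
    then show False by simp
  qed
  then show "\<exists>C. \<exists>\<^sub>F n in sequentially. \<sigma>' (g n) (x n) \<le> mag (inv (g n)) + C" by blast
qed

end

section \<open>Patterson--Sullivan measures\<close>

context compact_convergence_group begin

lemma measurable_in: "\<gamma> \<in> \<Gamma> \<Longrightarrow> \<gamma> \<in> borel_measurable borel"
  using cont_in by (simp add: borel_measurable_continuous_onI)

text \<open>The transformation rule in the form of a change of variables. It is obtained from the density of the
  push-forward under \<open>inv \<gamma>\<close>.\<close>

lemma PS_nn_integral:
  assumes ps: "PS_measure \<Gamma> \<tau> \<beta> \<nu>" and c: "continuous_on UNIV (\<tau> \<gamma>)" and \<gamma>: "\<gamma> \<in> \<Gamma>"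
    and f: "f \<in> borel_measurable borel"
  shows "(\<integral>\<^sup>+x. ennreal (exp (- \<beta> * \<tau> \<gamma> x)) * f (\<gamma> x) \<partial>\<nu>) = (\<integral>\<^sup>+x. f x \<partial>\<nu>)"
proof -
  interpret prob_space \<nu> using ps by (simp add: PS_measure_def)
  have sets: "sets \<nu> = sets borel" using ps by (simp add: PS_measure_def)
  note [measurable_cong] = sets
  have i: "inv \<gamma> \<in> \<Gamma>" using \<gamma> by (rule inv_in)
  note [measurable] = measurable_in[OF i] measurable_in[OF \<gamma>] f borel_measurable_continuous_onI[OF c]
  let ?N = "distr \<nu> borel (inv \<gamma>)"
  have N: "absolutely_continuous \<nu> ?N"
    "AE x in \<nu>. RN_deriv \<nu> ?N x = ennreal (exp (- \<beta> * \<tau> \<gamma> x))"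
    using ps i \<gamma> unfolding PS_measure_def by force+
  have "density \<nu> (RN_deriv \<nu> ?N) = ?N"
    using N(1) by (intro density_RN_deriv) (auto simp: sets)
  moreover have "density \<nu> (RN_deriv \<nu> ?N) = density \<nu> (\<lambda>x. ennreal (exp (- \<beta> * \<tau> \<gamma> x)))"
    by (rule density_cong) (use N(2) in simp_all)
  ultimately have eq: "density \<nu> (\<lambda>x. ennreal (exp (- \<beta> * \<tau> \<gamma> x))) = ?N" by simp
  have "(\<integral>\<^sup>+x. ennreal (exp (- \<beta> * \<tau> \<gamma> x)) * f (\<gamma> x) \<partial>\<nu>) =
      (\<integral>\<^sup>+x. f (\<gamma> x) \<partial>density \<nu> (\<lambda>x. ennreal (exp (- \<beta> * \<tau> \<gamma> x))))"
    by (rule nn_integral_density[symmetric]; measurable)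
  also have "\<dots> = (\<integral>\<^sup>+x. f (\<gamma> (inv \<gamma> x)) \<partial>\<nu>)"
    unfolding eq by (rule nn_integral_distr; measurable)
  also have "\<dots> = (\<integral>\<^sup>+x. f x \<partial>\<nu>)" using \<gamma> by simp
  finally show ?thesis .
qed

end

lemma measure_cball_tendsto:
  fixes z :: "'a::metric_space"
  assumes "finite_measure \<nu>" "sets \<nu> = sets borel"
  shows "(\<lambda>n. measure \<nu> (cball z (inverse (Suc n)))) \<longlonglongrightarrow> measure \<nu> {z}"
proof -
  interpret finite_measure \<nu> by fact
  have eq: "(\<Inter>n. cball z (inverse (real (Suc n)))) = {z}"
  proof
    show "(\<Inter>n. cball z (inverse (real (Suc n)))) \<subseteq> {z}"
    proof
      fix x assume "x \<in> (\<Inter>n. cball z (inverse (real (Suc n))))"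
      then have le: "dist z x \<le> inverse (real (Suc n))" for n by auto
      have "dist z x \<le> 0"
        by (rule LIMSEQ_le_const[OF LIMSEQ_inverse_real_of_nat]) (use le in auto)
      then show "x \<in> {z}" by simp
    qed
  qed auto
  have "(\<lambda>n. measure \<nu> (cball z (inverse (real (Suc n))))) \<longlonglongrightarrow> measure \<nu> (\<Inter>n. cball z (inverse (real (Suc n))))"
  proof (rule finite_Lim_measure_decseq)
    show "range (\<lambda>n. cball z (inverse (real (Suc n)))) \<subseteq> sets \<nu>" by (auto simp: assms(2))
    show "decseq (\<lambda>n. cball z (inverse (real (Suc n))))"
      unfolding decseq_def
      by (auto intro!: subset_cball le_imp_inverse_le)
  qed
  then show ?thesis by (simp only: eq)
qed

text \<open>The number of atoms of mass at least \<open>c\<close> is at most the total mass divided by \<open>c\<close>.\<close>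

lemma finite_heavy_atoms:
  fixes M :: "'a :: t1_space measure"
  assumes "finite_measure M" "c > 0" "sets M = sets borel"
  shows "finite {w. measure M {w} \<ge> c}"
proof (rule ccontr)
  interpret finite_measure M by fact
  assume inf: "infinite {w. measure M {w} \<ge> c}"
  obtain n :: nat where n: "measure M (space M) < real n * c"
    using reals_Archimedean3[OF assms(2)] by blast
  obtain F where F: "F \<subseteq> {w. measure M {w} \<ge> c}" "finite F" "card F = n"
    using infinite_arbitrarily_large[OF inf] by blast
  have "real n * c = (\<Sum>w\<in>F. c)" using F by simp
  also have "\<dots> \<le> (\<Sum>w\<in>F. measure M {w})" using F by (intro sum_mono) auto
  also have "\<dots> = measure M (\<Union>w\<in>F. {w})"
    using F by (intro finite_measure_finite_Union[symmetric]) (auto simp: assms(3) disjoint_family_on_def)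
  also have "\<dots> \<le> measure M (space M)" by (rule bounded_measure)
  finally show False using n by simp
qed

context gps_system begin

lemma delta_nonneg: "0 \<le> \<delta>"
proof -
  have "ereal 0 \<le> Limsup at_top (\<lambda>R::real. log_card {\<gamma>\<in>\<Gamma>. mag \<gamma> \<le> R} / ereal R)"
  proof (rule le_Limsup)
    have "\<forall>\<^sub>F R in at_top. 1 \<le> R \<and> mag id \<le> (R::real)"
      by (intro eventually_conj eventually_ge_at_top)
    then show "\<forall>\<^sub>F R::real in at_top. ereal 0 \<le> log_card {\<gamma>\<in>\<Gamma>. mag \<gamma> \<le> R} / ereal R"
    proof eventually_elim
      case (elim R)
      have ne: "{\<gamma>\<in>\<Gamma>. mag \<gamma> \<le> R} \<noteq> {}" using elim id_in by blast
      then have "card {\<gamma>\<in>\<Gamma>. mag \<gamma> \<le> R} \<ge> 1" using finite_mag[of R] by (simp add: Suc_le_eq card_gt_0_iff)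
      then show ?case using ne finite_mag[of R] elim by (simp add: log_card_def)
    qed
  qed simp
  also have "\<dots> = ereal \<delta>" using exponent by (simp add: critical_exponent_def)
  finally show ?thesis by simp
qed

text \<open>The measure class is invariant, so the position of a full atom would be a global fixed point.\<close>

lemma PS_not_dirac:
  assumes ps: "PS_measure \<Gamma> \<tau> \<beta> \<nu>" and c: "\<And>\<gamma>. \<gamma> \<in> \<Gamma> \<Longrightarrow> continuous_on UNIV (\<tau> \<gamma>)"
  shows "measure \<nu> {p} < 1"
proof (rule ccontr)
  assume neg: "\<not> measure \<nu> {p} < 1"
  interpret prob_space \<nu> using ps by (simp add: PS_measure_def)
  have sets: "sets \<nu> = sets borel" using ps by (simp add: PS_measure_def)
  note [measurable_cong] = sets
  have one: "measure \<nu> {p} = 1" using neg prob_le_1[of "{p}"] by simp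
  have "\<gamma> p = p" if \<gamma>: "\<gamma> \<in> \<Gamma>" for \<gamma>
  proof (rule ccontr)
    assume ne: "\<gamma> p \<noteq> p"
    note [measurable] = measurable_in[OF \<gamma>] borel_measurable_continuous_onI[OF c[OF \<gamma>]]
    have "(\<integral>\<^sup>+x. ennreal (exp (- \<beta> * \<tau> \<gamma> p)) * indicator {p} x \<partial>\<nu>)
        \<le> (\<integral>\<^sup>+x. ennreal (exp (- \<beta> * \<tau> \<gamma> x)) * indicator {\<gamma> p} (\<gamma> x) \<partial>\<nu>)"
      by (rule nn_integral_mono) (auto simp: indicator_def)
    also have "\<dots> = (\<integral>\<^sup>+x. indicator {\<gamma> p} x \<partial>\<nu>)"
      by (rule PS_nn_integral[OF ps c[OF \<gamma>] \<gamma>]) auto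
    also have "\<dots> = emeasure \<nu> {\<gamma> p}" by (simp add: sets)
    also have "(\<integral>\<^sup>+x. ennreal (exp (- \<beta> * \<tau> \<gamma> p)) * indicator {p} x \<partial>\<nu>) = ennreal (exp (- \<beta> * \<tau> \<gamma> p)) * emeasure \<nu> {p}"
      by (simp add: sets nn_integral_cmult_indicator)
    finally have "exp (- \<beta> * \<tau> \<gamma> p) \<le> measure \<nu> {\<gamma> p}" using one by (simp add: emeasure_eq_measure)
    then have pos: "0 < measure \<nu> {\<gamma> p}" by (rule less_le_trans[OF exp_gt_zero])
    have "measure \<nu> {p} + measure \<nu> {\<gamma> p} = measure \<nu> ({p} \<union> {\<gamma> p})"
      using ne by (intro finite_measure_Union[symmetric]) (auto simp: sets)
    also have "\<dots> \<le> 1" by (rule prob_le_1)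
    finally show False using pos one by simp
  qed
  then show False using no_global_fixed_point by blast
qed

text \<open>For exponent zero the measure would be invariant. A sequence collapsing the complement of \<open>b\<close> to
  \<open>z\<close> then squeezes almost all mass into small balls around \<open>z\<close> and \<open>b\<close>, so there are atoms, and the atoms
  that are at least as heavy as a given one form a finite invariant set.\<close>

lemma delta_pos:
  assumes ps: "PS_measure \<Gamma> \<sigma> \<delta> \<mu>"
  shows "0 < \<delta>"
proof (rule ccontr)
  assume "\<not> ?thesis"
  then have zero: "\<delta> = 0" using delta_nonneg by simp
  interpret prob_space \<mu> using ps by (simp add: PS_measure_def)
  have sets: "sets \<mu> = sets borel" using ps by (simp add: PS_measure_def)
  note [measurable_cong] = sets
  have sp: "space \<mu> = UNIV" using sets_eq_imp_space_eq[OF sets] by simp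
  have invariant: "measure \<mu> (\<gamma> -` A) = measure \<mu> A" if \<gamma>: "\<gamma> \<in> \<Gamma>" and A: "A \<in> sets borel" for \<gamma> A
  proof -
    note [measurable] = measurable_in[OF \<gamma>] A
    have pre: "\<gamma> -` A \<in> sets borel" using measurable_sets[OF measurable_in[OF \<gamma>] A] by simp
    have "emeasure \<mu> (\<gamma> -` A) = (\<integral>\<^sup>+x. indicator A (\<gamma> x) \<partial>\<mu>)"
    proof -
      have "(\<integral>\<^sup>+x. indicator A (\<gamma> x) \<partial>\<mu>) = (\<integral>\<^sup>+x. indicator (\<gamma> -` A) x \<partial>\<mu>)"
        by (simp add: indicator_def)
      then show ?thesis using pre by (simp add: sets)
    qed
    also have "\<dots> = (\<integral>\<^sup>+x. ennreal (exp (- \<delta> * \<sigma> \<gamma> x)) * indicator A (\<gamma> x) \<partial>\<mu>)" by (simp add: zero)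
    also have "\<dots> = (\<integral>\<^sup>+x. indicator A x \<partial>\<mu>)"
      by (rule PS_nn_integral[OF ps cocycle_cont(1)[OF \<gamma>] \<gamma>]) auto
    also have "\<dots> = emeasure \<mu> A" by (simp add: sets A)
    finally show ?thesis by (simp add: emeasure_eq_measure)
  qed
  obtain z where "z \<in> limit_set \<Gamma>" using limit_set_not_covered by blast
  then obtain b g where g: "range g \<subseteq> \<Gamma>" "collapses g z b" by (auto simp: limit_set_iff)
  have balls: "1 \<le> measure \<mu> (cball z e) + measure \<mu> (cball b e)" if e: "e > 0" for e
  proof -
    obtain n where n: "\<forall>w. e \<le> dist w b \<longrightarrow> dist (g n w) z < e"
      using collapsesD[OF g(2) e] by (auto simp: eventually_sequentially)
    have gn: "g n \<in> \<Gamma>" using g(1) by auto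
    have "UNIV - cball b e \<subseteq> g n -` cball z e" using n by (auto simp: dist_commute less_imp_le)
    then have "measure \<mu> (UNIV - cball b e) \<le> measure \<mu> (g n -` cball z e)"
      using measurable_sets[OF measurable_in[OF gn], of "cball z e"] by (intro finite_measure_mono) (auto simp: sets)
    also have "\<dots> = measure \<mu> (cball z e)" by (rule invariant[OF gn]) auto
    finally show ?thesis using prob_compl[of "cball b e"] by (simp add: sets sp)
  qed
  have "1 \<le> measure \<mu> {z} + measure \<mu> {b}"
    by (rule LIMSEQ_le_const[OF tendsto_add[OF measure_cball_tendsto[OF finite_measure_axioms sets]
          measure_cball_tendsto[OF finite_measure_axioms sets]]]) (use balls in auto)
  then obtain w where w: "measure \<mu> {w} > 0"
    by (metis add_nonneg_eq_0_iff measure_nonneg not_one_le_zero order.order_iff_strict)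
  define P where "P = {v. measure \<mu> {v} \<ge> measure \<mu> {w}}"
  show False
  proof (rule no_finite_invariant_set)
    show "finite P" unfolding P_def by (rule finite_heavy_atoms[OF finite_measure_axioms w sets])
    show "P \<noteq> {}" by (auto simp: P_def)
    fix \<gamma> v assume \<gamma>: "\<gamma> \<in> \<Gamma>" and "v \<in> P"
    moreover have "\<gamma> -` {\<gamma> v} = {v}" using \<gamma> by auto
    then have "measure \<mu> {\<gamma> v} = measure \<mu> {v}" using invariant[OF \<gamma>, of "{\<gamma> v}"] by simp
    ultimately show "\<gamma> v \<in> P" by (simp add: P_def)
  qed
qed

lemma finite_returns_off_limit_set:
  assumes "closed K" "K \<inter> limit_set \<Gamma> = {}"
  shows "finite {\<gamma>\<in>\<Gamma>. \<exists>x\<in>K. \<gamma> x \<in> K}"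
proof (rule ccontr)
  assume "infinite {\<gamma>\<in>\<Gamma>. \<exists>x\<in>K. \<gamma> x \<in> K}"
  then obtain g a b where g: "inj g" "range g \<subseteq> {\<gamma>\<in>\<Gamma>. \<exists>x\<in>K. \<gamma> x \<in> K}" "collapses g a b"
    by (rule infinite_collapsing_sequence) auto
  have gG: "range g \<subseteq> \<Gamma>" using g(2) by auto
  have "\<forall>n. \<exists>x. x \<in> K \<and> g n x \<in> K" using g(2) by blast
  then obtain x where x: "\<And>n. x n \<in> K" "\<And>n. g n (x n) \<in> K" by metis
  obtain x0 r where r: "strict_mono r" "(\<lambda>n. x (r n)) \<longlonglongrightarrow> x0" by (rule convergent_subsequence)
  have x0: "x0 \<in> K" using closed_sequentially[OF assms(1), of "\<lambda>n. x (r n)"] r x(1) by auto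
  have ab: "a \<in> limit_set \<Gamma>" "b \<in> limit_set \<Gamma>" using collapses_limit_points[OF gG g(3)] by auto
  have "(\<lambda>n. g (r n) (x (r n))) \<longlonglongrightarrow> a"
    by (rule collapses_tendsto[OF collapses_subseq[OF g(3) r(1)] r(2)]) (use x0 ab assms(2) in auto)
  then have "a \<in> K" using closed_sequentially[OF assms(1), of "\<lambda>n. g (r n) (x (r n))"] x(2) by auto
  then show False using ab assms(2) by blast
qed

text \<open>The translates of \<open>K\<close> overlap with bounded multiplicity, so their masses have a finite sum. Each
  translate has mass at least a constant times \<open>exp (- \<delta> mg \<gamma>)\<close> times the mass of \<open>K\<close>. As the series
  of these exponentials diverges, \<open>K\<close> is a null set.\<close>

lemma PS_null_off_limit_set:
  assumes ps: "PS_measure \<Gamma> \<tau> \<delta> \<nu>" and c: "\<And>\<gamma>. \<gamma> \<in> \<Gamma> \<Longrightarrow> continuous_on UNIV (\<tau> \<gamma>)"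
    and ub: "\<And>K. closed K \<Longrightarrow> K \<inter> limit_set \<Gamma> = {} \<Longrightarrow> \<exists>C. \<forall>\<gamma>\<in>\<Gamma>. \<forall>x\<in>K. \<tau> \<gamma> x \<le> mg \<gamma> + C"
    and div: "(\<integral>\<^sup>+\<gamma>. ennreal (exp (- \<delta> * mg \<gamma>)) \<partial>count_space \<Gamma>) = \<infinity>"
    and K: "closed K" "K \<inter> limit_set \<Gamma> = {}"
  shows "emeasure \<nu> K = 0"
proof (rule ccontr)
  assume neg: "emeasure \<nu> K \<noteq> 0"
  interpret prob_space \<nu> using ps by (simp add: PS_measure_def)
  have sets: "sets \<nu> = sets borel" using ps by (simp add: PS_measure_def)
  note [measurable_cong] = sets
  note [measurable] = borel_closed[OF K(1)]
  define F where "F = {\<gamma>\<in>\<Gamma>. \<exists>x\<in>K. \<gamma> x \<in> K}"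
  have finF: "finite F" unfolding F_def by (rule finite_returns_off_limit_set[OF K])
  obtain C where C: "\<And>\<gamma> x. \<gamma> \<in> \<Gamma> \<Longrightarrow> x \<in> K \<Longrightarrow> \<tau> \<gamma> x \<le> mg \<gamma> + C" using ub[OF K] by blast
  define I :: "('m \<Rightarrow> 'm) \<Rightarrow> 'm \<Rightarrow> ennreal" where "I \<gamma> x = indicator K (inv \<gamma> x)" for \<gamma> x
  have [measurable]: "I \<gamma> \<in> borel_measurable borel" if "\<gamma> \<in> \<Gamma>" for \<gamma>
    using measurable_in[OF inv_in[OF that]] unfolding I_def[abs_def] by measurable
  have I_meas: "I \<gamma> \<in> borel_measurable \<nu>" if "\<gamma> \<in> \<Gamma>" for \<gamma>
    using measurable_in[OF inv_in[OF that]] unfolding I_def[abs_def] by measurable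
  have mult: "(\<integral>\<^sup>+\<gamma>. I \<gamma> x \<partial>count_space \<Gamma>) \<le> of_nat (card F)" for x
  proof -
    define S where "S = {\<gamma>\<in>\<Gamma>. inv \<gamma> x \<in> K}"
    have "finite S \<and> card S \<le> card F"
    proof (cases "S = {}")
      case False
      then obtain \<gamma>0 where 0: "\<gamma>0 \<in> \<Gamma>" "inv \<gamma>0 x \<in> K" by (auto simp: S_def)
      have "inj_on (\<lambda>\<gamma>. inv \<gamma>0 \<circ> \<gamma>) S"
      proof (rule inj_onI)
        fix \<alpha> \<beta> assume "inv \<gamma>0 \<circ> \<alpha> = inv \<gamma>0 \<circ> \<beta>"
        then show "\<alpha> = \<beta>" using 0(1) by (metis comp_assoc inv_comp_id(2) id_comp)
      qed
      moreover have "(\<lambda>\<gamma>. inv \<gamma>0 \<circ> \<gamma>) ` S \<subseteq> F"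
      proof
        fix \<beta> assume "\<beta> \<in> (\<lambda>\<gamma>. inv \<gamma>0 \<circ> \<gamma>) ` S"
        then obtain \<gamma> where \<gamma>: "\<gamma> \<in> \<Gamma>" "inv \<gamma> x \<in> K" "\<beta> = inv \<gamma>0 \<circ> \<gamma>" by (auto simp: S_def)
        then have "\<beta> (inv \<gamma> x) \<in> K" using 0 by simp
        then show "\<beta> \<in> F" unfolding F_def using \<gamma> 0 comp_in inv_in by blast
      qed
      ultimately show ?thesis using finF by (meson card_inj_on_le inj_on_finite)
    qed simp
    moreover have "(\<integral>\<^sup>+\<gamma>. I \<gamma> x \<partial>count_space \<Gamma>) = (\<integral>\<^sup>+\<gamma>. indicator S \<gamma> \<partial>count_space \<Gamma>)"
      by (rule nn_integral_cong) (auto simp: I_def S_def indicator_def)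
    then have "(\<integral>\<^sup>+\<gamma>. I \<gamma> x \<partial>count_space \<Gamma>) = emeasure (count_space \<Gamma>) S"
      by (simp add: S_def)
    ultimately show ?thesis by (simp add: emeasure_count_space_finite S_def)
  qed
  have low: "ennreal (exp (- \<delta> * mg \<gamma>)) * (ennreal (exp (- \<delta> * C)) * emeasure \<nu> K) \<le> (\<integral>\<^sup>+x. I \<gamma> x \<partial>\<nu>)"
    if \<gamma>: "\<gamma> \<in> \<Gamma>" for \<gamma>
  proof -
    note [measurable] = borel_measurable_continuous_onI[OF c[OF \<gamma>]] measurable_in[OF \<gamma>]
    have "ennreal (exp (- \<delta> * mg \<gamma>)) * (ennreal (exp (- \<delta> * C)) * emeasure \<nu> K)
        = (\<integral>\<^sup>+x. ennreal (exp (- \<delta> * (mg \<gamma> + C))) * indicator K x \<partial>\<nu>)"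
      using nn_integral_cmult_indicator[of K \<nu> "ennreal (exp (- \<delta> * (mg \<gamma> + C)))"]
      by (simp add: sets algebra_simps exp_diff exp_minus ennreal_mult[symmetric] mult.assoc[symmetric] divide_inverse)
    also have "\<dots> \<le> (\<integral>\<^sup>+x. ennreal (exp (- \<delta> * \<tau> \<gamma> x)) * I \<gamma> (\<gamma> x) \<partial>\<nu>)"
    proof (rule nn_integral_mono)
      fix x
      show "ennreal (exp (- \<delta> * (mg \<gamma> + C))) * indicator K x \<le> ennreal (exp (- \<delta> * \<tau> \<gamma> x)) * I \<gamma> (\<gamma> x)"
        using C[OF \<gamma>, of x] delta_nonneg \<gamma>
        by (auto simp: I_def indicator_def intro!: ennreal_leI mult_left_mono)
    qed
    also have "\<dots> = (\<integral>\<^sup>+x. I \<gamma> x \<partial>\<nu>)"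
      by (rule PS_nn_integral[OF ps c[OF \<gamma>] \<gamma>]) (use \<gamma> in measurable)
    finally show ?thesis .
  qed
  have "(\<integral>\<^sup>+\<gamma>. ennreal (exp (- \<delta> * mg \<gamma>)) * (ennreal (exp (- \<delta> * C)) * emeasure \<nu> K) \<partial>count_space \<Gamma>)
      \<le> (\<integral>\<^sup>+\<gamma>. (\<integral>\<^sup>+x. I \<gamma> x \<partial>\<nu>) \<partial>count_space \<Gamma>)"
    using low by (intro nn_integral_mono) auto
  also have "\<dots> = (\<integral>\<^sup>+x. (\<integral>\<^sup>+\<gamma>. I \<gamma> x \<partial>count_space \<Gamma>) \<partial>\<nu>)"
    by (rule nn_integral_count_space_nn_integral[OF countable_group, symmetric]) (simp add: I_meas)
  also have "\<dots> \<le> (\<integral>\<^sup>+x. of_nat (card F) \<partial>\<nu>)" by (intro nn_integral_mono mult)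
  also have "\<dots> = of_nat (card F)" by (simp add: emeasure_space_1)
  also have "(\<integral>\<^sup>+\<gamma>. ennreal (exp (- \<delta> * mg \<gamma>)) * (ennreal (exp (- \<delta> * C)) * emeasure \<nu> K) \<partial>count_space \<Gamma>)
      = \<infinity> * (ennreal (exp (- \<delta> * C)) * emeasure \<nu> K)"
    using div by (subst nn_integral_multc) simp_all
  also have "\<dots> = \<infinity>" using neg by (simp add: ennreal_top_mult ennreal_eq_0_iff)
  finally show False by (simp add: top_unique)
qed

lemma PS_AE_limit_set:
  assumes ps: "PS_measure \<Gamma> \<tau> \<delta> \<nu>" and c: "\<And>\<gamma>. \<gamma> \<in> \<Gamma> \<Longrightarrow> continuous_on UNIV (\<tau> \<gamma>)"
    and ub: "\<And>K. closed K \<Longrightarrow> K \<inter> limit_set \<Gamma> = {} \<Longrightarrow> \<exists>C. \<forall>\<gamma>\<in>\<Gamma>. \<forall>x\<in>K. \<tau> \<gamma> x \<le> mg \<gamma> + C"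
    and div: "(\<integral>\<^sup>+\<gamma>. ennreal (exp (- \<delta> * mg \<gamma>)) \<partial>count_space \<Gamma>) = \<infinity>"
  shows "AE x in \<nu>. x \<in> limit_set \<Gamma>"
proof -
  have sets: "sets \<nu> = sets borel" using ps by (simp add: PS_measure_def)
  define K where "K n = {x. inverse (real (Suc n)) \<le> infdist x (limit_set \<Gamma>)}" for n
  have ne: "limit_set \<Gamma> \<noteq> {}" using limit_set_not_covered by blast
  have clK: "closed (K n)" for n unfolding K_def by (intro closed_Collect_le continuous_intros)
  have disj: "K n \<inter> limit_set \<Gamma> = {}" for n by (auto simp: K_def)
  have null: "K n \<in> null_sets \<nu>" for n
  proof (rule null_setsI)
    show "emeasure \<nu> (K n) = 0" by (rule PS_null_off_limit_set[OF ps c ub div clK disj])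
    show "K n \<in> sets \<nu>" unfolding sets by (rule borel_closed[OF clK])
  qed
  have "(\<Union>n. K n) \<in> null_sets \<nu>" using null by auto
  then show ?thesis
  proof (rule AE_I')
    show "{x \<in> space \<nu>. x \<notin> limit_set \<Gamma>} \<subseteq> (\<Union>n. K n)"
    proof
      fix x assume "x \<in> {x \<in> space \<nu>. x \<notin> limit_set \<Gamma>}"
      then have "infdist x (limit_set \<Gamma>) > 0"
        using in_closed_iff_infdist_zero[OF closed_limit_set ne] infdist_nonneg[of x "limit_set \<Gamma>"]
        by (metis (no_types, lifting) mem_Collect_eq order_le_less)
      then obtain n where "inverse (real (Suc n)) < infdist x (limit_set \<Gamma>)" using reals_Archimedean by blast
      then have "x \<in> K n" unfolding K_def by simp
      then show "x \<in> (\<Union>n. K n)" by (rule UN_I[OF UNIV_I])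
    qed
  qed
qed

end

lemma infsum_eq_nn_integral_count_space:
  fixes f :: "'a \<Rightarrow> ennreal"
  assumes "countable A"
  shows "infsum f A = (\<integral>\<^sup>+x. f x \<partial>count_space A)"
    "(\<integral>\<^sup>+x. f x \<partial>count_space A) = (SUP F\<in>{F. finite F \<and> F \<subseteq> A}. sum f F)"
proof -
  have le: "sum f F \<le> (\<integral>\<^sup>+x. f x \<partial>count_space A)" if "finite F" "F \<subseteq> A" for F
  proof -
    have "(\<integral>\<^sup>+x. f x * indicator F x \<partial>count_space A) = (\<Sum>x\<in>F. f x * indicator F x)"
      using that by (intro nn_integral_count_space') auto
    also have "\<dots> = sum f F" by (intro sum.cong) auto
    finally have "sum f F = (\<integral>\<^sup>+x. f x * indicator F x \<partial>count_space A)" ..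
    also have "\<dots> \<le> (\<integral>\<^sup>+x. f x \<partial>count_space A)" by (intro nn_integral_mono) (auto simp: indicator_def)
    finally show ?thesis .
  qed
  show 2: "(\<integral>\<^sup>+x. f x \<partial>count_space A) = (SUP F\<in>{F. finite F \<and> F \<subseteq> A}. sum f F)"
  proof (rule antisym)
    show "(SUP F\<in>{F. finite F \<and> F \<subseteq> A}. sum f F) \<le> (\<integral>\<^sup>+x. f x \<partial>count_space A)"
      using le by (intro SUP_least) auto
    show "(\<integral>\<^sup>+x. f x \<partial>count_space A) \<le> (SUP F\<in>{F. finite F \<and> F \<subseteq> A}. sum f F)"
    proof (cases "finite A")
      case True
      then show ?thesis by (auto simp: nn_integral_count_space_finite intro!: SUP_upper)
    next
      case False
      have bij: "bij_betw (from_nat_into A) UNIV A" using bij_betw_from_nat_into[OF assms False] .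
      have "(\<integral>\<^sup>+x. f x \<partial>count_space A) = (\<integral>\<^sup>+n. f (from_nat_into A n) \<partial>count_space UNIV)"
        by (rule nn_integral_bij_count_space[OF bij, symmetric])
      also have "\<dots> = (\<Sum>n. f (from_nat_into A n))" by (rule nn_integral_count_space_nat)
      also have "\<dots> = (SUP n. \<Sum>i<n. f (from_nat_into A i))" by (rule suminf_eq_SUP)
      also have "\<dots> \<le> (SUP F\<in>{F. finite F \<and> F \<subseteq> A}. sum f F)"
      proof (rule SUP_least)
        fix n :: nat
        have "inj_on (from_nat_into A) {..<n}" using bij inj_on_subset by (auto simp: bij_betw_def)
        then have "(\<Sum>i<n. f (from_nat_into A i)) = sum f (from_nat_into A ` {..<n})"
          by (simp add: sum.reindex)
        also have "\<dots> \<le> (SUP F\<in>{F. finite F \<and> F \<subseteq> A}. sum f F)"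
          using bij by (intro SUP_upper) (auto simp: bij_betw_def)
        finally show "(\<Sum>i<n. f (from_nat_into A i)) \<le> (SUP F\<in>{F. finite F \<and> F \<subseteq> A}. sum f F)" .
      qed
      finally show ?thesis .
    qed
  qed
  show "infsum f A = (\<integral>\<^sup>+x. f x \<partial>count_space A)"
    unfolding 2 by (rule nonneg_infsum_complete) simp
qed

context gps_system begin

lemma poincare_divergence:
  "(\<integral>\<^sup>+\<gamma>. ennreal (exp (- \<delta> * mag \<gamma>)) \<partial>count_space \<Gamma>) = \<infinity>"
  "(\<integral>\<^sup>+\<gamma>. ennreal (exp (- \<delta> * mag (inv \<gamma>))) \<partial>count_space \<Gamma>) = \<infinity>"
proof -
  show 1: "(\<integral>\<^sup>+\<gamma>. ennreal (exp (- \<delta> * mag \<gamma>)) \<partial>count_space \<Gamma>) = \<infinity>"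
    using divergent by (simp add: poincare_series_def infsum_eq_nn_integral_count_space[OF countable_group])
  have "bij_betw inv \<Gamma> \<Gamma>"
    by (rule bij_betw_byWitness[of _ inv]) (auto simp: inv_in)
  from nn_integral_bij_count_space[OF this, of "\<lambda>\<gamma>. ennreal (exp (- \<delta> * mag \<gamma>))"] 1
  show "(\<integral>\<^sup>+\<gamma>. ennreal (exp (- \<delta> * mag (inv \<gamma>))) \<partial>count_space \<Gamma>) = \<infinity>" by simp
qed

lemma PS_AE:
  "PS_measure \<Gamma> \<sigma> \<delta> \<mu> \<Longrightarrow> AE x in \<mu>. x \<in> limit_set \<Gamma>"
  "PS_measure \<Gamma> \<sigma>' \<delta> \<mu>' \<Longrightarrow> AE x in \<mu>'. x \<in> limit_set \<Gamma>"
  by (rule PS_AE_limit_set[OF _ _ cocycle_upper_bound poincare_divergence(1)], simp_all add: cocycle_cont)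
    (rule PS_AE_limit_set[OF _ _ dual_cocycle_upper_bound poincare_divergence(2)], simp_all add: cocycle_cont)

section \<open>Closing almost periodic orbits\<close>

text \<open>The right-hand side is the limit of \<open>G(x,y) + \<sigma>(\<gamma>,y)\<close> when \<open>x\<close> tends to the repelling point: the
  period is what this quantity measures, up to the value of \<open>G\<close> at the pair of fixed points.\<close>

definition shifted_period :: "('m \<Rightarrow> 'm) \<Rightarrow> real" where
  "shifted_period \<gamma> = period \<sigma> \<gamma> + G (repelling \<gamma>, attracting \<gamma>)"

text \<open>The points \<open>x\<close> range over the preimage of \<open>A0\<close>, since the correlations are evaluated after a change
  of variables in the first coordinate.\<close>

definition well_approximated :: "real \<Rightarrow> 'm set \<Rightarrow> 'm set \<Rightarrow> ('m \<Rightarrow> 'm) \<Rightarrow> bool" where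
  "well_approximated \<eta> A0 B0 \<gamma> \<longleftrightarrow> loxodromic \<gamma> \<and> (\<forall>x y. \<gamma> x \<in> A0 \<and> y \<in> B0 \<longrightarrow>
     dist x (repelling \<gamma>) < \<eta> \<and> dist (\<gamma> y) (attracting \<gamma>) < \<eta> \<and>
     \<bar>G (x, y) + \<sigma> \<gamma> y - shifted_period \<gamma>\<bar> < \<eta>)"

text \<open>The equation for \<open>G\<close> at the repelling point, once for \<open>y\<close> and once for the attracting point, where
  the right-hand side vanishes.\<close>

lemma loxodromic_cocycle:
  assumes "\<gamma> \<in> \<Gamma>" "loxodromic \<gamma>" "y \<noteq> repelling \<gamma>"
  shows "\<sigma> \<gamma> y = period \<sigma> \<gamma> + G (repelling \<gamma>, \<gamma> y) - G (repelling \<gamma>, y)"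
  using gps_eq[OF assms(1), of "repelling \<gamma>" y] gps_eq[OF assms(1), of "repelling \<gamma>" "attracting \<gamma>"]
    loxodromicD(2-4)[OF assms(2)] assms by (simp add: period_def)

lemma eventually_well_approximated:
  assumes g: "range g \<subseteq> \<Gamma>" "collapses g a b" "a \<noteq> b"
    and cl: "closed A0" "closed B0" "a \<notin> A0" "b \<notin> B0" and \<eta>: "\<eta> > 0"
  shows "\<forall>\<^sub>F n in sequentially. well_approximated \<eta> A0 B0 (g n)"
proof (rule ccontr)
  assume "\<not> ?thesis"
  then have fr: "\<exists>\<^sub>F n in sequentially. \<not> well_approximated \<eta> A0 B0 (g n)" by (simp add: not_eventually)
  note lox = collapses_imp_loxodromic[OF g]
  have "\<exists>\<^sub>F n in sequentially. \<not> well_approximated \<eta> A0 B0 (g n) \<and> loxodromic (g n)"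
    using frequently_eventually_conj[OF fr lox(1)] by (simp add: conj_commute)
  then obtain r :: "nat \<Rightarrow> nat" where r: "strict_mono r"
    "\<And>n. \<not> well_approximated \<eta> A0 B0 (g (r n)) \<and> loxodromic (g (r n))"
    using frequently_subsequence[of "\<lambda>k n. \<not> well_approximated \<eta> A0 B0 (g n) \<and> loxodromic (g n)"] by metis
  define bad where "bad \<gamma> x y \<longleftrightarrow> \<not> (dist x (repelling \<gamma>) < \<eta> \<and> dist (\<gamma> y) (attracting \<gamma>) < \<eta> \<and>
     \<bar>G (x, y) + \<sigma> \<gamma> y - shifted_period \<gamma>\<bar> < \<eta>)" for \<gamma> x y
  have "\<forall>n. \<exists>x y. g (r n) x \<in> A0 \<and> y \<in> B0 \<and> bad (g (r n)) x y"
    using r(2) unfolding well_approximated_def bad_def by blast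
  then obtain x y where xy: "\<And>n. g (r n) (x n) \<in> A0" "\<And>n. y n \<in> B0" "\<And>n. bad (g (r n)) (x n) (y n)" by metis
  obtain y0 r1 where r1: "strict_mono r1" "(\<lambda>n. y (r1 n)) \<longlonglongrightarrow> y0" by (rule convergent_subsequence)
  obtain w0 r2 where r2: "strict_mono r2" "(\<lambda>n. g (r (r1 (r2 n))) (x (r1 (r2 n)))) \<longlonglongrightarrow> w0"
    by (rule convergent_subsequence[of "\<lambda>n. g (r (r1 n)) (x (r1 n))"])
  define s where "s n = r1 (r2 n)" for n
  define k where "k n = g (r (s n))" for n
  define X where "X n = x (s n)" for n
  define Y where "Y n = y (s n)" for n
  have mono: "strict_mono (\<lambda>n. r (s n))" using r(1) r1(1) r2(1) by (simp add: strict_mono_def s_def)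
  have kG: "k n \<in> \<Gamma>" for n using g(1) by (auto simp: k_def)
  have klox: "loxodromic (k n)" for n using r(2) by (simp add: k_def)
  have ck: "collapses k a b" using collapses_subseq[OF g(2) mono] by (simp add: k_def[abs_def])
  have Yl: "Y \<longlonglongrightarrow> y0" using LIMSEQ_subseq_LIMSEQ[OF r1(2) r2(1)] by (simp add: Y_def[abs_def] s_def o_def)
  have y0: "y0 \<in> B0" using closed_sequentially[OF cl(2) _ Yl] xy(2) by (auto simp: Y_def)
  have wl: "(\<lambda>n. k n (X n)) \<longlonglongrightarrow> w0" using r2(2) by (simp add: k_def X_def s_def)
  have w0: "w0 \<in> A0" using closed_sequentially[OF cl(1) _ wl] xy(1) by (auto simp: k_def X_def)
  have "(\<lambda>n. inv (k n) (k n (X n))) \<longlonglongrightarrow> b"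
    by (rule collapses_tendsto[OF collapses_inv_in[OF _ ck] wl]) (use kG w0 cl in auto)
  then have Xl: "X \<longlonglongrightarrow> b" using kG by simp
  have kYl: "(\<lambda>n. k n (Y n)) \<longlonglongrightarrow> a" by (rule collapses_tendsto[OF ck Yl]) (use y0 cl in auto)
  have al: "(\<lambda>n. attracting (k n)) \<longlonglongrightarrow> a" and rl: "(\<lambda>n. repelling (k n)) \<longlonglongrightarrow> b"
    using LIMSEQ_subseq_LIMSEQ[OF lox(2) mono] LIMSEQ_subseq_LIMSEQ[OF lox(3) mono] by (simp_all add: k_def o_def)
  have yb: "y0 \<noteq> b" using y0 cl by auto
  have "(\<lambda>n. G (X n, Y n) + G (repelling (k n), k n (Y n)) - G (repelling (k n), Y n) - G (repelling (k n), attracting (k n)))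
      \<longlonglongrightarrow> G (b, y0) + G (b, a) - G (b, y0) - G (b, a)"
    by (intro tendsto_add tendsto_diff tendsto_G Xl Yl rl al kYl) (use yb g(3) in auto)
  then have "(\<lambda>n. G (X n, Y n) + G (repelling (k n), k n (Y n)) - G (repelling (k n), Y n) - G (repelling (k n), attracting (k n))) \<longlonglongrightarrow> 0"
    by simp
  from tendstoD[OF this \<eta>] have 1: "\<forall>\<^sub>F n in sequentially. \<bar>G (X n, Y n) + G (repelling (k n), k n (Y n)) - G (repelling (k n), Y n) - G (repelling (k n), attracting (k n))\<bar> < \<eta>"
    by (simp add: dist_real_def)
  have 2: "\<forall>\<^sub>F n in sequentially. Y n \<noteq> repelling (k n)"
  proof -
    have "\<forall>\<^sub>F n in sequentially. (Y n, repelling (k n)) \<in> distinct_pairs UNIV"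
      using topological_tendstoD[OF tendsto_Pair[OF Yl rl] open_distinct_pairs] yb
      by (auto simp: distinct_pairs_def)
    then show ?thesis by (simp add: distinct_pairs_def)
  qed
  have 3: "\<forall>\<^sub>F n in sequentially. dist (X n) (repelling (k n)) < \<eta>"
    using tendstoD[OF tendsto_dist[OF Xl rl] \<eta>] by (simp add: dist_real_def)
  have 4: "\<forall>\<^sub>F n in sequentially. dist (k n (Y n)) (attracting (k n)) < \<eta>"
    using tendstoD[OF tendsto_dist[OF kYl al] \<eta>] by (simp add: dist_real_def)
  from 1 2 3 4 have "\<forall>\<^sub>F n in sequentially. False"
  proof eventually_elim
    case (elim n)
    have "bad (k n) (X n) (Y n)" using xy(3) by (simp add: k_def X_def Y_def)
    then show ?case
      using elim loxodromic_cocycle[OF kG klox elim(2)] by (simp add: bad_def shifted_period_def algebra_simps)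
  qed
  then show False by simp
qed

text \<open>Infinitely many exceptions would contain a sequence collapsing to \<open>a\<close> off \<open>b\<close>. Either kind of
  exception forces \<open>a \<in> B\<close> and \<open>b \<in> A\<close>, after which \<open>eventually_well_approximated\<close> applies. For
  the first kind, the other possibility is that the fixed points accumulate at \<open>a\<close> and \<open>b\<close> in the wrong
  order. For the second kind it is that the elements contract backwards; then \<open>\<sigma>(\<gamma>,y)\<close> tends to
  \<open>-\<infinity>\<close>, against the lower bound \<open>C0\<close>.\<close>

lemma finite_not_well_approximated:
  assumes cl: "closed A" "closed A0" "closed B" "closed B0"
    and disj: "A \<inter> B0 = {}" "A0 \<inter> B = {}" "A \<inter> B = {}" and \<eta>: "\<eta> > 0"
  shows "finite {\<gamma>\<in>\<Gamma>. loxodromic \<gamma> \<and> repelling \<gamma> \<in> A \<and> attracting \<gamma> \<in> B \<and> \<not> well_approximated \<eta> A0 B0 \<gamma>}"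
    (is "finite ?S1")
    and "finite {\<gamma>\<in>\<Gamma>. (\<exists>x\<in>A. \<exists>y\<in>B0. \<gamma> x \<in> A0 \<and> \<gamma> y \<in> B \<and> C0 \<le> \<sigma> \<gamma> y) \<and> \<not> well_approximated \<eta> A0 B0 \<gamma>}"
    (is "finite ?S2")
proof -
  show "finite ?S1"
  proof (rule ccontr)
    assume "infinite ?S1"
    then obtain g a b where g: "inj g" "range g \<subseteq> ?S1" "collapses g a b"
      by (rule infinite_collapsing_sequence) auto
    have gG: "range g \<subseteq> \<Gamma>" using g(2) by auto
    have gn: "g n \<in> \<Gamma>" "loxodromic (g n)" "repelling (g n) \<in> A" "attracting (g n) \<in> B"
      "\<not> well_approximated \<eta> A0 B0 (g n)" for n using g(2) by auto
    obtain p r1 where r1: "strict_mono r1" "(\<lambda>n. repelling (g (r1 n))) \<longlonglongrightarrow> p"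
      by (rule convergent_subsequence[of "\<lambda>n. repelling (g n)"])
    obtain q r2 where r2: "strict_mono r2" "(\<lambda>n. attracting (g (r1 (r2 n)))) \<longlonglongrightarrow> q"
      by (rule convergent_subsequence[of "\<lambda>n. attracting (g (r1 n))"])
    define k where "k n = g (r1 (r2 n))" for n
    have mono: "strict_mono (\<lambda>n. r1 (r2 n))" using r1(1) r2(1) by (simp add: strict_mono_def)
    have ck: "collapses k a b" using collapses_subseq[OF g(3) mono] by (simp add: k_def[abs_def])
    have kG: "range k \<subseteq> \<Gamma>" using gn by (auto simp: k_def)
    have pl: "(\<lambda>n. repelling (k n)) \<longlonglongrightarrow> p" using LIMSEQ_subseq_LIMSEQ[OF r1(2) r2(1)] by (simp add: k_def o_def)
    have ql: "(\<lambda>n. attracting (k n)) \<longlonglongrightarrow> q" using r2(2) by (simp add: k_def)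
    have pA: "p \<in> A" using closed_sequentially[OF cl(1) _ pl] gn by (auto simp: k_def)
    have qB: "q \<in> B" using closed_sequentially[OF cl(3) _ ql] gn by (auto simp: k_def)
    have pq: "p \<noteq> q" using pA qB disj by auto
    have p': "p = a" if "p \<noteq> b"
    proof -
      have "(\<lambda>n. k n (repelling (k n))) = (\<lambda>n. repelling (k n))"
        by (simp add: k_def loxodromicD(4)[OF gn(2)])
      with collapses_tendsto[OF ck pl that] pl show ?thesis using LIMSEQ_unique by metis
    qed
    have q': "q = a" if "q \<noteq> b"
    proof -
      have "(\<lambda>n. k n (attracting (k n))) = (\<lambda>n. attracting (k n))"
        by (simp add: k_def loxodromicD(3)[OF gn(2)])
      with collapses_tendsto[OF ck ql that] ql show ?thesis using LIMSEQ_unique by metis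
    qed
    have ab: "a \<noteq> b" using p' q' pq by metis
    have "(\<lambda>n. attracting (k n)) \<longlonglongrightarrow> a" by (rule collapses_imp_loxodromic(2)[OF kG ck ab])
    then have "q = a" using ql LIMSEQ_unique by blast
    then have "p = b" using p' pq by metis
    have "\<forall>\<^sub>F n in sequentially. well_approximated \<eta> A0 B0 (k n)"
      by (rule eventually_well_approximated[OF kG ck ab cl(2,4) _ _ \<eta>])
        (use pA qB disj \<open>q = a\<close> \<open>p = b\<close> in auto)
    then show False using gn(5) by (simp add: k_def)
  qed
  show "finite ?S2"
  proof (rule ccontr)
    assume "infinite ?S2"
    then obtain g a b where g: "inj g" "range g \<subseteq> ?S2" "collapses g a b"
      by (rule infinite_collapsing_sequence) auto
    have gG: "range g \<subseteq> \<Gamma>" using g(2) by auto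
    have gn: "g n \<in> \<Gamma>" "\<not> well_approximated \<eta> A0 B0 (g n)" for n using g(2) by auto
    have "\<forall>n. \<exists>x y. x \<in> A \<and> y \<in> B0 \<and> g n x \<in> A0 \<and> g n y \<in> B \<and> C0 \<le> \<sigma> (g n) y" using g(2) by blast
    then obtain x y where xy: "\<And>n. x n \<in> A" "\<And>n. y n \<in> B0" "\<And>n. g n (x n) \<in> A0" "\<And>n. g n (y n) \<in> B"
      "\<And>n. C0 \<le> \<sigma> (g n) (y n)" by metis
    have land: "a \<in> D" if "closed C" "closed D" "b \<notin> C" "\<And>n. z n \<in> C" "\<And>n. g n (z n) \<in> D" for C D z
    proof -
      obtain z0 r where r: "strict_mono r" "(\<lambda>n. z (r n)) \<longlonglongrightarrow> z0" by (rule convergent_subsequence)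
      have "z0 \<in> C" using closed_sequentially[OF that(1), of "\<lambda>n. z (r n)"] r that(4) by auto
      then have "(\<lambda>n. g (r n) (z (r n))) \<longlonglongrightarrow> a"
        using that(3) by (intro collapses_tendsto[OF collapses_subseq[OF g(3) r(1)] r(2)]) auto
      then show ?thesis using closed_sequentially[OF that(2), of "\<lambda>n. g (r n) (z (r n))"] that(5) by auto
    qed
    have bA: "b \<in> A"
    proof (rule ccontr)
      assume "b \<notin> A"
      then have "a \<in> A0" using land[OF cl(1,2) _ xy(1,3)] by simp
      then have "a \<notin> B" using disj by auto
      have "\<forall>\<^sub>F n in sequentially. \<forall>y\<in>B. 1 - C0 \<le> \<sigma> (inv (g n)) y"
        by (rule cocycle_at_top[OF inj_inv_sequence[OF g(1) gG] inv_sequence_in[OF gG]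
              collapses_inv_in[OF gG g(3)] cl(3) \<open>a \<notin> B\<close>])
      then obtain n where "1 - C0 \<le> \<sigma> (inv (g n)) (g n (y n))"
        using xy(4) by (auto simp: eventually_sequentially)
      then show False using cocycle_inv(1)[OF gn(1)] xy(5)[of n] by simp
    qed
    then have "b \<notin> B0" using disj by auto
    then have aB: "a \<in> B" using land[OF cl(4,3) _ xy(2,4)] by simp
    have "\<forall>\<^sub>F n in sequentially. well_approximated \<eta> A0 B0 (g n)"
      by (rule eventually_well_approximated[OF gG g(3) _ cl(2,4) _ _ \<eta>]) (use bA aB disj in auto)
    then show False using gn(2) by simp
  qed
qed

text \<open>Proper discontinuity of the action on triples: as \<open>X\<close> and \<open>Y\<close> are disjoint, a collapsing sequence or
  its inverse has \<open>|\<sigma>|\<close> tending to infinity on the returning points.\<close>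

lemma finite_returns:
  assumes cl: "closed X" "closed Y" "X \<inter> Y = {}"
  shows "finite {\<gamma>\<in>\<Gamma>. \<exists>x\<in>X. \<exists>y\<in>Y. \<gamma> x \<in> X \<and> \<gamma> y \<in> Y \<and> \<bar>\<sigma> \<gamma> y\<bar> \<le> R}" (is "finite ?S")
proof (rule ccontr)
  assume "infinite ?S"
  then obtain g a b where g: "inj g" "range g \<subseteq> ?S" "collapses g a b"
    by (rule infinite_collapsing_sequence) auto
  have gG: "range g \<subseteq> \<Gamma>" using g(2) by auto
  then have gn: "g n \<in> \<Gamma>" for n by auto
  have "\<forall>n. \<exists>x y. x \<in> X \<and> y \<in> Y \<and> g n x \<in> X \<and> g n y \<in> Y \<and> \<bar>\<sigma> (g n) y\<bar> \<le> R" using g(2) by blast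
  then obtain x y where xy: "\<And>n. x n \<in> X" "\<And>n. y n \<in> Y" "\<And>n. g n (x n) \<in> X" "\<And>n. g n (y n) \<in> Y"
    "\<And>n. \<bar>\<sigma> (g n) (y n)\<bar> \<le> R" by metis
  show False
  proof (cases "b \<in> Y")
    case False
    then have "\<forall>\<^sub>F n in sequentially. \<forall>y\<in>Y. R + 1 \<le> \<sigma> (g n) y" by (rule cocycle_at_top[OF g(1) gG g(3) cl(2)])
    then obtain n where "R + 1 \<le> \<sigma> (g n) (y n)" using xy(2) by (auto simp: eventually_sequentially)
    then show False using xy(5)[of n] by simp
  next
    case True
    then have bX: "b \<notin> X" using cl by auto
    obtain z0 r where r: "strict_mono r" "(\<lambda>n. x (r n)) \<longlonglongrightarrow> z0" by (rule convergent_subsequence)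
    have "z0 \<in> X" using closed_sequentially[OF cl(1), of "\<lambda>n. x (r n)"] r xy(1) by auto
    then have "(\<lambda>n. g (r n) (x (r n))) \<longlonglongrightarrow> a"
      using bX by (intro collapses_tendsto[OF collapses_subseq[OF g(3) r(1)] r(2)]) auto
    then have "a \<in> X" using closed_sequentially[OF cl(1), of "\<lambda>n. g (r n) (x (r n))"] xy(3) by auto
    then have "a \<notin> Y" using cl by auto
    then have "\<forall>\<^sub>F n in sequentially. \<forall>y\<in>Y. R + 1 \<le> \<sigma> (inv (g n)) y"
      by (rule cocycle_at_top[OF inj_inv_sequence[OF g(1) gG] inv_sequence_in[OF gG]
              collapses_inv_in[OF gG g(3)] cl(2)])
    then obtain n where "R + 1 \<le> \<sigma> (inv (g n)) (g n (y n))" using xy(4) by (auto simp: eventually_sequentially)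
    then show False using cocycle_inv(1)[OF gn] xy(5)[of n] by simp
  qed
qed

lemma finite_short_loxodromics:
  assumes K: "compact K" "K \<subseteq> distinct_pairs UNIV"
  shows "finite {\<gamma>\<in>\<Gamma>. loxodromic \<gamma> \<and> (repelling \<gamma>, attracting \<gamma>) \<in> K \<and> period \<sigma> \<gamma> \<le> T}" (is "finite ?S")
proof (rule ccontr)
  assume "infinite ?S"
  then obtain g :: "nat \<Rightarrow> _" where g: "inj g" "range g \<subseteq> ?S" using infinite_countable_subset by blast
  have "filterlim (\<lambda>n. period \<sigma> (g n)) at_top sequentially"
    using proper[unfolded proper_cocycle_def, rule_format, of g] g K by blast
  then have "\<forall>\<^sub>F n in sequentially. T + 1 \<le> period \<sigma> (g n)" by (simp add: filterlim_at_top)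
  then obtain n where "T + 1 \<le> period \<sigma> (g n)" by (auto simp: eventually_sequentially)
  moreover have "period \<sigma> (g n) \<le> T" using g(2) by auto
  ultimately show False by simp
qed

section \<open>Orbit sums on the flow space\<close>

definition orbit_sum :: "('m \<times> 'm \<times> real \<Rightarrow> ennreal) \<Rightarrow> 'm \<times> 'm \<times> real \<Rightarrow> ennreal" where
  "orbit_sum f v = (\<integral>\<^sup>+\<gamma>. f (cover_action \<sigma> \<gamma> v) \<partial>count_space \<Gamma>)"

text \<open>A point of the quotient is an orbit; any of its elements may be used, by \<open>orbit_sum_invariant\<close>.\<close>

definition orbit_fun :: "('m \<times> 'm \<times> real \<Rightarrow> ennreal) \<Rightarrow> ('m \<times> 'm \<times> real) set \<Rightarrow> ennreal" where
  "orbit_fun f c = orbit_sum f (SOME v. v \<in> c)"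

lemma cover_action_comp:
  "\<alpha> \<in> \<Gamma> \<Longrightarrow> \<beta> \<in> \<Gamma> \<Longrightarrow> cover_action \<sigma> \<alpha> (cover_action \<sigma> \<beta> v) = cover_action \<sigma> (\<alpha> \<circ> \<beta>) v"
  by (cases v) (simp add: cover_action_def cocycle_comp)

lemma cover_action_id: "cover_action \<sigma> id v = v"
  by (cases v) (simp add: cover_action_def cocycle_id)

lemma bij_betw_right_mult: "\<gamma> \<in> \<Gamma> \<Longrightarrow> bij_betw (\<lambda>\<alpha>. \<alpha> \<circ> \<gamma>) \<Gamma> \<Gamma>"
  by (rule bij_betw_byWitness[of _ "\<lambda>\<alpha>. \<alpha> \<circ> inv \<gamma>"]) (auto simp: comp_in inv_in comp_assoc)

lemma orbit_sum_invariant: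
  assumes "\<gamma> \<in> \<Gamma>"
  shows "orbit_sum f (cover_action \<sigma> \<gamma> v) = orbit_sum f v"
proof -
  have "orbit_sum f (cover_action \<sigma> \<gamma> v) = (\<integral>\<^sup>+\<alpha>. f (cover_action \<sigma> (\<alpha> \<circ> \<gamma>) v) \<partial>count_space \<Gamma>)"
    unfolding orbit_sum_def by (rule nn_integral_cong) (simp add: cover_action_comp assms)
  also have "\<dots> = orbit_sum f v"
    unfolding orbit_sum_def by (rule nn_integral_bij_count_space[OF bij_betw_right_mult[OF assms]])
  finally show ?thesis .
qed

lemma orbit_fun_orbit: "orbit_fun f (orbit_of \<Gamma> \<sigma> v) = orbit_sum f v"
proof -
  have "v \<in> orbit_of \<Gamma> \<sigma> v" using cover_action_id[of v] id_in by (force simp: orbit_of_def)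
  then have "(SOME w. w \<in> orbit_of \<Gamma> \<sigma> v) \<in> orbit_of \<Gamma> \<sigma> v" by (rule someI)
  then obtain \<gamma> where "\<gamma> \<in> \<Gamma>" "(SOME w. w \<in> orbit_of \<Gamma> \<sigma> v) = cover_action \<sigma> \<gamma> v" by (auto simp: orbit_of_def)
  then show ?thesis by (simp add: orbit_fun_def orbit_sum_invariant)
qed

lemma cover_flow_action: "cover_flow t (cover_action \<sigma> \<gamma> v) = cover_action \<sigma> \<gamma> (cover_flow t v)"
  by (cases v) (simp add: cover_flow_def cover_action_def)

lemma quotient_flow_orbit: "quotient_flow t (orbit_of \<Gamma> \<sigma> v) = orbit_of \<Gamma> \<sigma> (cover_flow t v)"
  by (simp add: quotient_flow_def orbit_of_def image_image cover_flow_action)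

lemma quotient_flow_inverse: "quotient_flow t (quotient_flow (- t) c) = c" "quotient_flow (- t) (quotient_flow t c) = c"
  by (auto simp: quotient_flow_def image_image cover_flow_def case_prod_unfold)

lemma cover_flow_in: "v \<in> cover_space \<Gamma> \<Longrightarrow> cover_flow t v \<in> cover_space \<Gamma>"
  by (auto simp: cover_space_def cover_flow_def)

lemma quotient_flow_in: "c \<in> flow_space \<Gamma> \<sigma> \<Longrightarrow> quotient_flow t c \<in> flow_space \<Gamma> \<sigma>"
  by (auto simp: flow_space_def quotient_flow_orbit cover_flow_in)

definition off_diagonal :: "('m \<times> 'm \<times> real) set" where
  "off_diagonal = {(x, y, s). x \<noteq> y}"

lemma cover_action_off_diagonal: "\<gamma> \<in> \<Gamma> \<Longrightarrow> v \<in> off_diagonal \<Longrightarrow> cover_action \<sigma> \<gamma> v \<in> off_diagonal"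
  by (auto simp: off_diagonal_def cover_action_def)

lemma cover_space_off_diagonal: "cover_space \<Gamma> \<subseteq> off_diagonal"
  by (auto simp: off_diagonal_def cover_space_def distinct_pairs_def)

lemma continuous_on_cover_action:
  assumes "\<gamma> \<in> \<Gamma>" shows "continuous_on S (cover_action \<sigma> \<gamma>)"
proof -
  have 1: "continuous_on S (\<lambda>v. \<gamma> (fst v))" "continuous_on S (\<lambda>v. \<gamma> (fst (snd v)))" "continuous_on S (\<lambda>v. \<sigma> \<gamma> (fst (snd v)))"
    for S :: "('m \<times> 'm \<times> real) set"
    by (auto intro!: continuous_on_compose2[OF cont_in[OF assms]] continuous_on_compose2[OF cocycle_cont(1)[OF assms]] continuous_intros)
  then show ?thesis by (auto simp: cover_action_def case_prod_unfold intro!: continuous_intros 1)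
qed

text \<open>An orbit sum of a nonnegative continuous function is a supremum of continuous functions, hence lower
  semicontinuous. This gives measurability with respect to the Borel sets of the quotient without
  any fundamental domain.\<close>

lemma openin_orbit_sum_greater:
  fixes f :: "'m \<times> 'm \<times> real \<Rightarrow> real"
  assumes f: "continuous_on off_diagonal f"
  shows "openin (top_of_set (cover_space \<Gamma>)) {v\<in>cover_space \<Gamma>. y < orbit_sum (\<lambda>v. ennreal (f v)) v}"
proof -
  have eq: "{v\<in>cover_space \<Gamma>. y < orbit_sum (\<lambda>v. ennreal (f v)) v} =
     (\<Union>F\<in>{F. finite F \<and> F \<subseteq> \<Gamma>}. cover_space \<Gamma> \<inter> (\<lambda>v. \<Sum>\<gamma>\<in>F. ennreal (f (cover_action \<sigma> \<gamma> v))) -` {y<..})"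
    by (auto simp: orbit_sum_def infsum_eq_nn_integral_count_space(2)[OF countable_group] less_SUP_iff)
  show ?thesis
    unfolding eq
  proof (rule openin_Union, clarify)
    fix F assume F: "finite F" "F \<subseteq> \<Gamma>"
    have "continuous_on (cover_space \<Gamma>) (\<lambda>v. f (cover_action \<sigma> \<gamma> v))" if "\<gamma> \<in> \<Gamma>" for \<gamma>
      using cover_action_off_diagonal[OF that] cover_space_off_diagonal
      by (intro continuous_on_compose2[OF f continuous_on_cover_action[OF that]]) auto
    then have "continuous_on (cover_space \<Gamma>) (\<lambda>v. \<Sum>\<gamma>\<in>F. ennreal (f (cover_action \<sigma> \<gamma> v)))"
      using F by (intro continuous_on_sum continuous_on_ennreal) auto
    then show "openin (top_of_set (cover_space \<Gamma>)) (cover_space \<Gamma> \<inter> (\<lambda>v. \<Sum>\<gamma>\<in>F. ennreal (f (cover_action \<sigma> \<gamma> v))) -` {y<..})"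
      by (rule continuous_openin_preimage_gen) simp
  qed
qed

lemma orbit_sum_measurable:
  fixes f :: "'m \<times> 'm \<times> real \<Rightarrow> real"
  assumes f: "continuous_on off_diagonal f"
  shows "orbit_sum (\<lambda>v. ennreal (f v)) \<in> borel_measurable (restrict_space borel (cover_space \<Gamma>))"
proof (rule borel_measurableI_greater)
  fix y
  obtain W where "open W" "{v\<in>cover_space \<Gamma>. y < orbit_sum (\<lambda>v. ennreal (f v)) v} = cover_space \<Gamma> \<inter> W"
    using openin_orbit_sum_greater[OF f, of y] by (auto simp: openin_open)
  then show "{v \<in> space (restrict_space borel (cover_space \<Gamma>)). y < orbit_sum (\<lambda>v. ennreal (f v)) v}
      \<in> sets (restrict_space borel (cover_space \<Gamma>))"
    by (auto simp: space_restrict_space sets_restrict_space)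
qed

lemma orbit_fun_measurable:
  fixes f :: "'m \<times> 'm \<times> real \<Rightarrow> real"
  assumes f: "continuous_on off_diagonal f"
  shows "orbit_fun (\<lambda>v. ennreal (f v)) \<in> borel_measurable (flow_space_borel \<Gamma> \<sigma>)"
proof (rule borel_measurableI_greater)
  fix y
  let ?Gen = "{W. W \<subseteq> flow_space \<Gamma> \<sigma> \<and>
         openin (top_of_set (cover_space \<Gamma>)) {v \<in> cover_space \<Gamma>. orbit_of \<Gamma> \<sigma> v \<in> W}}"
  have gen: "?Gen \<subseteq> Pow (flow_space \<Gamma> \<sigma>)" by auto
  let ?W = "{c \<in> flow_space \<Gamma> \<sigma>. y < orbit_fun (\<lambda>v. ennreal (f v)) c}"
  have "{v \<in> cover_space \<Gamma>. orbit_of \<Gamma> \<sigma> v \<in> ?W} = {v\<in>cover_space \<Gamma>. y < orbit_sum (\<lambda>v. ennreal (f v)) v}"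
    by (auto simp: orbit_fun_orbit flow_space_def)
  then have "?W \<in> ?Gen" using openin_orbit_sum_greater[OF f, of y] by auto
  then have "?W \<in> sets (flow_space_borel \<Gamma> \<sigma>)"
    unfolding flow_space_borel_def using gen by (simp add: sets_measure_of sigma_sets.Basic)
  moreover have "space (flow_space_borel \<Gamma> \<sigma>) = flow_space \<Gamma> \<sigma>"
    unfolding flow_space_borel_def using gen by (simp add: space_measure_of_conv)
  ultimately show "{c \<in> space (flow_space_borel \<Gamma> \<sigma>). y < orbit_fun (\<lambda>v. ennreal (f v)) c} \<in> sets (flow_space_borel \<Gamma> \<sigma>)"
    by simp
qed

text \<open>If one translate of \<open>v\<close> lies in the support of \<open>f\<close>, the group elements that bring \<open>v\<close> there differ from
  it by elements that return the support to itself.\<close>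

lemma orbit_sum_bounded:
  fixes f :: "'m \<times> 'm \<times> real \<Rightarrow> real"
  assumes cl: "closed X" "closed Y" "X \<inter> Y = {}"
    and supp: "\<And>x y s. f (x, y, s) \<noteq> 0 \<Longrightarrow> x \<in> X \<and> y \<in> Y \<and> \<bar>s\<bar> \<le> R"
    and bd: "\<And>v. f v \<le> C"
  obtains N :: nat where "\<And>v. orbit_sum (\<lambda>v. ennreal (f v)) v \<le> ennreal C * of_nat N"
proof -
  define F where "F = {\<gamma>\<in>\<Gamma>. \<exists>x\<in>X. \<exists>y\<in>Y. \<gamma> x \<in> X \<and> \<gamma> y \<in> Y \<and> \<bar>\<sigma> \<gamma> y\<bar> \<le> 2 * R}"
  have finF: "finite F" unfolding F_def by (rule finite_returns[OF cl])
  have "orbit_sum (\<lambda>v. ennreal (f v)) v \<le> ennreal C * of_nat (card F)" for v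
  proof -
    define S where "S = {\<gamma>\<in>\<Gamma>. f (cover_action \<sigma> \<gamma> v) \<noteq> 0}"
    have "finite S \<and> card S \<le> card F"
    proof (cases "S = {}")
      case False
      then obtain \<gamma>0 where 0: "\<gamma>0 \<in> \<Gamma>" "f (cover_action \<sigma> \<gamma>0 v) \<noteq> 0" by (auto simp: S_def)
      obtain x0 y0 s0 where v0: "cover_action \<sigma> \<gamma>0 v = (x0, y0, s0)" by (metis prod_cases3)
      note in0 = supp[OF 0(2)[unfolded v0]]
      have "inj_on (\<lambda>\<gamma>. \<gamma> \<circ> inv \<gamma>0) S"
      proof (rule inj_onI)
        fix \<alpha> \<beta> assume "\<alpha> \<circ> inv \<gamma>0 = \<beta> \<circ> inv \<gamma>0"
        then show "\<alpha> = \<beta>" using 0(1) by (metis comp_assoc inv_comp_id(1) comp_id)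
      qed
      moreover have "(\<lambda>\<gamma>. \<gamma> \<circ> inv \<gamma>0) ` S \<subseteq> F"
      proof
        fix \<beta> assume "\<beta> \<in> (\<lambda>\<gamma>. \<gamma> \<circ> inv \<gamma>0) ` S"
        then obtain \<gamma> where \<gamma>: "\<gamma> \<in> \<Gamma>" "f (cover_action \<sigma> \<gamma> v) \<noteq> 0" "\<beta> = \<gamma> \<circ> inv \<gamma>0" by (auto simp: S_def)
        have \<beta>: "\<beta> \<in> \<Gamma>" using \<gamma> 0 comp_in inv_in by auto
        have "\<beta> \<circ> \<gamma>0 = \<gamma>" using \<gamma>(3) 0(1) by (simp add: comp_assoc)
        then have "cover_action \<sigma> \<gamma> v = cover_action \<sigma> \<beta> (x0, y0, s0)"
          unfolding v0[symmetric] by (simp add: cover_action_comp \<beta> 0(1))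
        then have "\<beta> x0 \<in> X \<and> \<beta> y0 \<in> Y \<and> \<bar>s0 + \<sigma> \<beta> y0\<bar> \<le> R"
          using supp \<gamma>(2) by (simp add: cover_action_def)
        moreover from this have "\<bar>\<sigma> \<beta> y0\<bar> \<le> 2 * R" using in0 by linarith
        ultimately show "\<beta> \<in> F" unfolding F_def using in0 \<beta> by blast
      qed
      ultimately show ?thesis using finF by (meson card_inj_on_le inj_on_finite)
    qed simp
    moreover have "orbit_sum (\<lambda>v. ennreal (f v)) v \<le> (\<integral>\<^sup>+\<gamma>. ennreal C * indicator S \<gamma> \<partial>count_space \<Gamma>)"
      unfolding orbit_sum_def by (rule nn_integral_mono) (auto simp: S_def indicator_def bd intro: ennreal_leI)
    then have "orbit_sum (\<lambda>v. ennreal (f v)) v \<le> ennreal C * emeasure (count_space \<Gamma>) S"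
      by (simp add: S_def nn_integral_cmult_indicator)
    moreover have "S \<subseteq> \<Gamma>" by (auto simp: S_def)
    ultimately show ?thesis
      by (simp add: emeasure_count_space_finite) (meson dual_order.trans mult_left_mono of_nat_mono zero_le)
  qed
  then show ?thesis using that by blast
qed

end

section \<open>Mixing for functions\<close>

text \<open>The function \<open>\<lfloor>n y\<rfloor> / n\<close> for \<open>0 \<le> y \<le> K\<close>, written as a sum of indicators so that mixing for sets
  applies term by term.\<close>

definition staircase :: "nat \<Rightarrow> nat \<Rightarrow> real \<Rightarrow> real" where
  "staircase K n y = (\<Sum>k\<in>{1..K * n}. if real k \<le> real n * y then 1 else 0) / real n"

lemma staircase_bounds:
  assumes "n \<ge> 1" "0 \<le> y" "y \<le> real K"
  shows "0 \<le> staircase K n y" "staircase K n y \<le> y" "y \<le> staircase K n y + 1 / real n"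
proof -
  have ny: "0 \<le> real n * y" using assms by simp
  have "real n * y \<le> real n * real K" using assms by (intro mult_left_mono) auto
  then have le: "real n * y \<le> real (K * n)" by (simp add: mult.commute)
  have "k \<le> K * n" if "real k \<le> real n * y" for k
    using order_trans[OF that le] by (simp only: of_nat_le_iff)
  then have "{k\<in>{1..K * n}. real k \<le> real n * y} = {1..nat \<lfloor>real n * y\<rfloor>}"
    using ny by (auto simp: le_nat_iff le_floor_iff)
  then have "(\<Sum>k\<in>{1..K * n}. if real k \<le> real n * y then 1 else 0) = real (nat \<lfloor>real n * y\<rfloor>)"
    by (simp add: sum.If_cases Int_def)
  then have eq: "staircase K n y = real_of_int \<lfloor>real n * y\<rfloor> / real n"
    using ny by (simp add: staircase_def)
  have n0: "0 < real n" using assms by simp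
  show "0 \<le> staircase K n y" using ny by (simp add: eq)
  have "real_of_int \<lfloor>real n * y\<rfloor> / real n \<le> real n * y / real n"
    by (intro divide_right_mono) auto
  then show "staircase K n y \<le> y" using n0 by (simp add: eq)
  have "real n * y / real n \<le> (real_of_int \<lfloor>real n * y\<rfloor> + 1) / real n"
    by (intro divide_right_mono) linarith+
  then show "y \<le> staircase K n y + 1 / real n" using n0 by (simp add: eq add_divide_distrib)
qed

lemma (in finite_measure) integral_diff_bound:
  fixes f g :: "'a \<Rightarrow> real"
  assumes "integrable M f" "integrable M g" "\<And>x. x \<in> space M \<Longrightarrow> \<bar>f x - g x\<bar> \<le> c"
  shows "\<bar>(\<integral>x. f x \<partial>M) - (\<integral>x. g x \<partial>M)\<bar> \<le> c * measure M (space M)"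
proof -
  have "\<bar>(\<integral>x. f x \<partial>M) - (\<integral>x. g x \<partial>M)\<bar> = \<bar>\<integral>x. f x - g x \<partial>M\<bar>" using assms by simp
  also have "\<dots> \<le> (\<integral>x. \<bar>f x - g x\<bar> \<partial>M)" by (rule integral_abs_bound)
  also have "\<dots> \<le> (\<integral>x. c \<partial>M)" using assms by (intro integral_mono) auto
  finally show ?thesis by (simp add: mult.commute)
qed

text \<open>A function \<open>G\<close> that is continuous off the diagonal becomes Borel measurable when its values on the
  diagonal are changed to zero.\<close>

locale bms_system = gps_system \<Gamma> \<sigma> \<sigma>' G d mag \<delta>
  for \<Gamma> :: "('m :: {metric_space, second_countable_topology} \<Rightarrow> 'm) set"
    and \<sigma> \<sigma>' :: "('m \<Rightarrow> 'm) \<Rightarrow> 'm \<Rightarrow> real"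
    and G :: "'m \<times> 'm \<Rightarrow> real"
    and d :: "('m \<Rightarrow> 'm) + 'm \<Rightarrow> ('m \<Rightarrow> 'm) + 'm \<Rightarrow> real"
    and mag :: "('m \<Rightarrow> 'm) \<Rightarrow> real"
    and \<delta> :: real +
  fixes \<mu> \<mu>' :: "'m measure"
    and m :: "('m \<times> 'm \<times> real) set measure"
  assumes ps: "PS_measure \<Gamma> \<sigma> \<delta> \<mu>" and ps': "PS_measure \<Gamma> \<sigma>' \<delta> \<mu>'"
    and bms: "BMS_measure \<Gamma> \<sigma> G \<delta> \<mu>' \<mu> m"
    and fin_m: "finite_measure m" and mix: "mixing m"
    and G_borel: "G \<in> borel_measurable borel"
begin

sublocale m: finite_measure m by (rule fin_m)

abbreviation "mass \<equiv> measure m (space m)"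

abbreviation "cover_measure \<equiv> cover_BMS_measure \<Gamma> G \<delta> \<mu>' \<mu>"

lemma space_m: "space m = flow_space \<Gamma> \<sigma>" and sets_m: "sets m = sets (flow_space_borel \<Gamma> \<sigma>)"
  using bms by (auto simp: BMS_measure_def)

text \<open>Mixing for sets gives the limit for staircase approximations of both functions, and these are
  uniformly close to the functions, uniformly in \<open>t\<close>.\<close>

lemma mixing_bounded_functions:
  fixes F1 F2 :: "('m \<times> 'm \<times> real) set \<Rightarrow> real" and K :: nat
  assumes meas: "F1 \<in> borel_measurable m" "F2 \<in> borel_measurable m"
    "\<And>t. (\<lambda>c. F2 (quotient_flow (- t) c)) \<in> borel_measurable m"
    and bd: "\<And>c. 0 \<le> F1 c" "\<And>c. F1 c \<le> real K" "\<And>c. 0 \<le> F2 c" "\<And>c. F2 c \<le> real K"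
  shows "((\<lambda>t. \<integral>c. F1 c * F2 (quotient_flow (- t) c) \<partial>m) \<longlongrightarrow>
    (\<integral>c. F1 c \<partial>m) * (\<integral>c. F2 c \<partial>m) / mass) at_top"
proof (rule tendstoI)
  fix e :: real assume e: "e > 0"
  define I where "I t = (\<integral>c. F1 c * F2 (quotient_flow (- t) c) \<partial>m)" for t
  \<comment> \<open>Replacing both functions by their staircases changes the integrals and the limit by at most
    \<open>2 K mass / n\<close> each; the summand 1 keeps the bound strict if \<open>K mass = 0\<close>.\<close>
  define n :: nat where "n = nat \<lceil>(8 * real K * mass + 1) / e\<rceil> + 1"
  have n1: "n \<ge> 1" by (simp add: n_def)
  have "(8 * real K * mass + 1) / e < real n" unfolding n_def by linarith
  then have small: "2 * real K / real n * mass < e / 4"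
  proof -
    have "8 * real K * mass + 1 < real n * e" using \<open>_ < real n\<close> e by (simp add: field_simps)
    then have "8 * real K * mass < real n * e" by simp
    then show ?thesis using n1 by (simp add: field_simps)
  qed
  define q where "q = staircase K n"
  have qb: "0 \<le> q y" "q y \<le> y" "y \<le> q y + 1 / real n" "\<bar>q y\<bar> \<le> real K" if "0 \<le> y" "y \<le> real K" for y
    using staircase_bounds[OF n1 that] that by (simp_all add: q_def)
  have [measurable]: "q \<in> borel_measurable borel" unfolding q_def staircase_def[abs_def] by measurable
  note [measurable] = meas
  define A where "A k = {c\<in>space m. real k \<le> real n * F1 c}" for k :: nat
  define B where "B k = {c\<in>space m. real k \<le> real n * F2 c}" for k :: nat
  define D where "D t k = {c\<in>space m. real k \<le> real n * F2 (quotient_flow (- t) c)}" for t and k :: nat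
  have [measurable]: "A k \<in> sets m" "B k \<in> sets m" "D t k \<in> sets m" for k t
    unfolding A_def B_def D_def by measurable
  have DB: "D t k = quotient_flow t ` B k" for t k
  proof (intro set_eqI iffI)
    fix c assume "c \<in> D t k"
    then have "quotient_flow (- t) c \<in> B k" by (auto simp: D_def B_def space_m quotient_flow_in)
    then show "c \<in> quotient_flow t ` B k" by (metis image_eqI quotient_flow_inverse(1))
  next
    fix c assume "c \<in> quotient_flow t ` B k"
    then show "c \<in> D t k" by (auto simp: D_def B_def space_m quotient_flow_in quotient_flow_inverse)
  qed
  have int1: "integrable m (\<lambda>c. q (F1 c))"
    by (rule m.integrable_const_bound[of _ "real K"])
      (use qb(4) bd in auto)
  have int2: "integrable m (\<lambda>c. q (F2 c))"
    by (rule m.integrable_const_bound[of _ "real K"])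
      (use qb(4) bd in auto)
  have intF: "integrable m F1" "integrable m F2"
    by (rule m.integrable_const_bound[of _ "real K"]; use bd in auto)+
  have prod_le: "0 \<le> x * y - q x * q y \<and> x * y - q x * q y \<le> 2 * real K / real n \<and> \<bar>q x * q y\<bar> \<le> real K * real K \<and> \<bar>x * y\<bar> \<le> real K * real K"
    if "0 \<le> x" "x \<le> real K" "0 \<le> y" "y \<le> real K" for x y
  proof -
    note x = qb[OF that(1,2)] and y = qb[OF that(3,4)]
    have 1: "q x * q y \<le> x * y" using x y that by (intro mult_mono) auto
    have 2: "x * y \<le> real K * real K" using that by (intro mult_mono) auto
    have "x * y - q x * q y = x * (y - q y) + (x - q x) * q y" by (simp add: algebra_simps)
    also have "\<dots> \<le> real K * (1 / real n) + 1 / real n * real K"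
      using x y that by (intro add_mono mult_mono) auto
    finally show ?thesis using 1 2 x y that by (simp add: abs_mult)
  qed
  have expand: "(\<integral>c. q (F1 c) * q (F2 (quotient_flow (- t) c)) \<partial>m) =
      (\<Sum>k\<in>{1..K * n}. \<Sum>l\<in>{1..K * n}. measure m (A k \<inter> quotient_flow t ` B l)) / (real n * real n)" for t
  proof -
    have "(\<integral>c. q (F1 c) * q (F2 (quotient_flow (- t) c)) \<partial>m) =
       (\<integral>c. (\<Sum>k\<in>{1..K * n}. \<Sum>l\<in>{1..K * n}. indicator (A k \<inter> D t l) c) / (real n * real n) \<partial>m)"
    proof (rule Bochner_Integration.integral_cong)
      fix c assume "c \<in> space m"
      then have "indicator (A k \<inter> D t l) c = (if real k \<le> real n * F1 c then 1 else 0) *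
          (if real l \<le> real n * F2 (quotient_flow (- t) c) then 1 else (0::real))" for k l
        by (simp add: A_def D_def)
      then show "q (F1 c) * q (F2 (quotient_flow (- t) c)) =
          (\<Sum>k\<in>{1..K * n}. \<Sum>l\<in>{1..K * n}. indicator (A k \<inter> D t l) c) / (real n * real n)"
        unfolding q_def staircase_def times_divide_times_eq sum_product by simp
    qed simp
    also have "\<dots> = (\<Sum>k\<in>{1..K * n}. \<Sum>l\<in>{1..K * n}. measure m (A k \<inter> D t l)) / (real n * real n)"
      by (simp add: m.emeasure_eq_measure)
    finally show ?thesis by (simp add: DB)
  qed
  have ex1: "(\<integral>c. q (F1 c) \<partial>m) = (\<Sum>k\<in>{1..K * n}. measure m (A k)) / real n"
  proof -
    have "(\<integral>c. q (F1 c) \<partial>m) = (\<integral>c. (\<Sum>k\<in>{1..K * n}. indicator (A k) c) / real n \<partial>m)"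
    proof (rule Bochner_Integration.integral_cong)
      fix c assume "c \<in> space m"
      then have "indicator (A k) c = (if real k \<le> real n * F1 c then 1 else (0::real))" for k
        by (simp add: A_def)
      then show "q (F1 c) = (\<Sum>k\<in>{1..K * n}. indicator (A k) c) / real n"
        unfolding q_def staircase_def by simp
    qed simp
    then show ?thesis by (simp add: m.emeasure_eq_measure)
  qed
  have ex2: "(\<integral>c. q (F2 c) \<partial>m) = (\<Sum>k\<in>{1..K * n}. measure m (B k)) / real n"
  proof -
    have "(\<integral>c. q (F2 c) \<partial>m) = (\<integral>c. (\<Sum>k\<in>{1..K * n}. indicator (B k) c) / real n \<partial>m)"
    proof (rule Bochner_Integration.integral_cong)
      fix c assume "c \<in> space m"
      then have "indicator (B k) c = (if real k \<le> real n * F2 c then 1 else (0::real))" for k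
        by (simp add: B_def)
      then show "q (F2 c) = (\<Sum>k\<in>{1..K * n}. indicator (B k) c) / real n"
        unfolding q_def staircase_def by simp
    qed simp
    then show ?thesis by (simp add: m.emeasure_eq_measure)
  qed
  define L where "L = (\<integral>c. q (F1 c) \<partial>m) * (\<integral>c. q (F2 c) \<partial>m) / mass"
  have "((\<lambda>t. \<integral>c. q (F1 c) * q (F2 (quotient_flow (- t) c)) \<partial>m) \<longlongrightarrow>
      (\<Sum>k\<in>{1..K * n}. \<Sum>l\<in>{1..K * n}. measure m (A k) * measure m (B l) / mass) / (real n * real n)) at_top"
    unfolding expand using mix n1 unfolding mixing_def by (intro tendsto_intros) auto
  also have "(\<Sum>k\<in>{1..K * n}. \<Sum>l\<in>{1..K * n}. measure m (A k) * measure m (B l) / mass) / (real n * real n) = L"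
    by (simp add: L_def ex1 ex2 sum_product sum_divide_distrib mult.commute[of mass])
  finally have lim: "((\<lambda>t. \<integral>c. q (F1 c) * q (F2 (quotient_flow (- t) c)) \<partial>m) \<longlongrightarrow> L) at_top" .
  have close: "\<bar>I t - (\<integral>c. q (F1 c) * q (F2 (quotient_flow (- t) c)) \<partial>m)\<bar> \<le> 2 * real K / real n * mass" for t
    unfolding I_def
  proof (rule m.integral_diff_bound)
    show "integrable m (\<lambda>c. F1 c * F2 (quotient_flow (- t) c))"
      by (rule m.integrable_const_bound[of _ "real K * real K"]) (use prod_le bd in auto)
    show "integrable m (\<lambda>c. q (F1 c) * q (F2 (quotient_flow (- t) c)))"
      by (rule m.integrable_const_bound[of _ "real K * real K"]) (use prod_le bd in auto)
    show "\<bar>F1 x * F2 (quotient_flow (- t) x) - q (F1 x) * q (F2 (quotient_flow (- t) x))\<bar> \<le> 2 * real K / real n" for x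
      using prod_le[of "F1 x" "F2 (quotient_flow (- t) x)"] bd by auto
  qed
  have L_close: "\<bar>(\<integral>c. F1 c \<partial>m) * (\<integral>c. F2 c \<partial>m) / mass - L\<bar> \<le> 2 * real K / real n * mass"
  proof (cases "mass = 0")
    case False
    then have mp: "mass > 0" by (simp add: less_le)
    define a b a' b' where "a = (\<integral>c. F1 c \<partial>m)" "b = (\<integral>c. F2 c \<partial>m)" "a' = (\<integral>c. q (F1 c) \<partial>m)" "b' = (\<integral>c. q (F2 c) \<partial>m)"
    have 1: "\<bar>a - a'\<bar> \<le> 1 / real n * mass" unfolding a_b_a'_b'_def
      by (rule m.integral_diff_bound[OF intF(1) int1]) (use qb bd in \<open>smt (verit)\<close>)
    have 2: "\<bar>b - b'\<bar> \<le> 1 / real n * mass" unfolding a_b_a'_b'_def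
      by (rule m.integral_diff_bound[OF intF(2) int2]) (use qb bd in \<open>smt (verit)\<close>)
    have 3: "\<bar>a\<bar> \<le> real K * mass" using m.integral_diff_bound[OF intF(1) integrable_zero, of "real K"] bd
      by (simp add: a_b_a'_b'_def)
    have 4: "\<bar>b'\<bar> \<le> real K * mass" using m.integral_diff_bound[OF int2 integrable_zero, of "real K"] bd qb
      by (simp add: a_b_a'_b'_def)
    have "\<bar>a * b - a' * b'\<bar> = \<bar>a * (b - b') + (a - a') * b'\<bar>" by (simp add: algebra_simps)
    also have "\<dots> \<le> \<bar>a\<bar> * \<bar>b - b'\<bar> + \<bar>a - a'\<bar> * \<bar>b'\<bar>" by (metis abs_mult abs_triangle_ineq)
    also have "\<dots> \<le> (real K * mass) * (1 / real n * mass) + (1 / real n * mass) * (real K * mass)"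
      using 1 2 3 4 by (intro add_mono mult_mono) auto
    also have "\<dots> = 2 * real K / real n * mass * mass" by (simp add: algebra_simps)
    finally have "\<bar>a * b - a' * b'\<bar> / mass \<le> 2 * real K / real n * mass" using mp by (simp add: pos_divide_le_eq)
    then have "\<bar>a * b / mass - a' * b' / mass\<bar> \<le> 2 * real K / real n * mass"
      using mp by (simp add: diff_divide_distrib[symmetric] abs_divide)
    then show ?thesis by (simp add: L_def a_b_a'_b'_def)
  qed (simp add: L_def)
  have "e / 4 > 0" using e by simp
  from tendstoD[OF lim this]
  show "\<forall>\<^sub>F t in at_top. dist (\<integral>c. F1 c * F2 (quotient_flow (- t) c) \<partial>m) ((\<integral>c. F1 c \<partial>m) * (\<integral>c. F2 c \<partial>m) / mass) < e"
  proof eventually_elim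
    case (elim t)
    show ?case using elim close[of t] L_close small e unfolding dist_real_def I_def by linarith
  qed
qed

definition test_function :: "('m \<times> 'm \<times> real \<Rightarrow> real) \<Rightarrow> bool" where
  "test_function f \<longleftrightarrow> continuous_on off_diagonal f \<and> (\<forall>v. 0 \<le> f v) \<and>
     (\<exists>X Y R C. closed X \<and> closed Y \<and> X \<inter> Y = {} \<and> (\<forall>v. f v \<le> C) \<and>
        (\<forall>x y s. f (x, y, s) \<noteq> 0 \<longrightarrow> x \<in> X \<and> y \<in> Y \<and> \<bar>s\<bar> \<le> R))"

lemma test_function_bound:
  assumes "test_function f"
  obtains N :: nat where "\<And>c. orbit_fun (\<lambda>v. ennreal (f v)) c \<le> of_nat N"
proof -
  obtain X Y R C where *: "closed X" "closed Y" "X \<inter> Y = {}" "\<And>v. f v \<le> C"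
    "\<And>x y s. f (x, y, s) \<noteq> 0 \<Longrightarrow> x \<in> X \<and> y \<in> Y \<and> \<bar>s\<bar> \<le> R" "\<And>v. 0 \<le> f v"
    using assms unfolding test_function_def by blast
  obtain N :: nat where N: "\<And>v. orbit_sum (\<lambda>v. ennreal (f v)) v \<le> ennreal C * of_nat N"
    by (rule orbit_sum_bounded[of X Y f R C, OF *(1-3,5,4)]) blast+
  have "0 \<le> C" using *(4,6) order_trans by blast
  obtain N' :: nat where "C * real N \<le> real N'" using real_arch_simple by blast
  then have "ennreal C * of_nat N \<le> of_nat N'"
    using \<open>0 \<le> C\<close> by (simp add: ennreal_of_nat_eq_real_of_nat ennreal_mult[symmetric] ennreal_leI)
  then show ?thesis using that N order_trans unfolding orbit_fun_def by blast
qed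

lemma continuous_on_cover_flow: "continuous_on S (cover_flow t :: 'm \<times> 'm \<times> real \<Rightarrow> _)"
  by (auto simp: cover_flow_def case_prod_unfold intro!: continuous_intros)

lemma continuous_on_flowed:
  "continuous_on off_diagonal h \<Longrightarrow> continuous_on off_diagonal (\<lambda>v. h (cover_flow t v))"
  by (rule continuous_on_compose2[OF _ continuous_on_cover_flow]) (auto simp: off_diagonal_def cover_flow_def)

lemma measurable_on_cover:
  fixes f :: "'m \<times> 'm \<times> real \<Rightarrow> real"
  assumes "continuous_on off_diagonal f"
  shows "(\<lambda>v. ennreal (f v)) \<in> borel_measurable (restrict_space borel (cover_space \<Gamma>))"
  using borel_measurable_continuous_on_restrict[OF continuous_on_subset[OF assms cover_space_off_diagonal]] by measurable

lemma BMS_integral: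
  assumes "f \<in> borel_measurable (restrict_space borel (cover_space \<Gamma>))"
    and "\<And>v. v \<in> cover_space \<Gamma> \<Longrightarrow> F (orbit_of \<Gamma> \<sigma> v) = orbit_sum f v"
  shows "(\<integral>\<^sup>+c. F c \<partial>m) = (\<integral>\<^sup>+v. f v \<partial>cover_measure)"
proof -
  have "F (orbit_of \<Gamma> \<sigma> v) = (\<Sum>\<^sub>\<infinity>\<gamma>\<in>\<Gamma>. f (cover_action \<sigma> \<gamma> v))" if "v \<in> cover_space \<Gamma>" for v
    using assms(2)[OF that] by (simp add: orbit_sum_def infsum_eq_nn_integral_count_space(1)[OF countable_group])
  then show ?thesis using bms assms(1) unfolding BMS_measure_def by blast
qed

lemma sets_PS: "sets \<mu> = sets borel" "sets \<mu>' = sets borel" "prob_space \<mu>" "prob_space \<mu>'"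
  using ps ps' by (auto simp: PS_measure_def)

lemma sets_cover_measure: "sets cover_measure = sets (restrict_space borel (cover_space \<Gamma>))"
proof -
  have "sets (\<mu>' \<Otimes>\<^sub>M (\<mu> \<Otimes>\<^sub>M lborel)) = sets (borel \<Otimes>\<^sub>M (borel \<Otimes>\<^sub>M borel))"
    by (intro sets_pair_measure_cong) (auto simp: sets_PS)
  also have "\<dots> = sets borel" by (simp only: borel_prod)
  finally show ?thesis unfolding cover_BMS_measure_def sets_density sets_restrict_space by (rule arg_cong)
qed

text \<open>Unfolding: the product of the two orbit sums is itself the orbit sum of \<open>f\<close> times the second orbit
  sum, which is invariant. Expanding that invariant factor inside the integral over the cover gives the
  sum over the group.\<close>

lemma mixing_test_functions:
  assumes f: "test_function f" and h: "test_function h"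
  shows "((\<lambda>t. \<integral>\<^sup>+\<gamma>. (\<integral>\<^sup>+v. ennreal (f v) * ennreal (h (cover_flow (- t) (cover_action \<sigma> \<gamma> v))) \<partial>cover_measure) \<partial>count_space \<Gamma>)
     \<longlongrightarrow> ennreal (enn2real (\<integral>\<^sup>+v. f v \<partial>cover_measure) * enn2real (\<integral>\<^sup>+v. h v \<partial>cover_measure) / mass)) at_top"
proof -
  have cf: "continuous_on off_diagonal f" and ch: "continuous_on off_diagonal h"
    and nn: "\<And>v. 0 \<le> f v" "\<And>v. 0 \<le> h v"
    using f h by (auto simp: test_function_def)
  obtain N1 :: nat where N1: "\<And>c. orbit_fun (\<lambda>v. ennreal (f v)) c \<le> of_nat N1" by (rule test_function_bound[OF f]) blast
  obtain N2 :: nat where N2: "\<And>c. orbit_fun (\<lambda>v. ennreal (h v)) c \<le> of_nat N2" by (rule test_function_bound[OF h]) blast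
  define K where "K = max N1 N2"
  have K1: "orbit_fun (\<lambda>v. ennreal (f v)) c \<le> of_nat K" and K2: "orbit_fun (\<lambda>v. ennreal (h v)) c \<le> of_nat K" for c
    by (rule order_trans[OF N1 of_nat_mono], simp add: K_def) (rule order_trans[OF N2 of_nat_mono], simp add: K_def)
  define F1 where "F1 c = enn2real (orbit_fun (\<lambda>v. ennreal (f v)) c)" for c
  define F2 where "F2 c = enn2real (orbit_fun (\<lambda>v. ennreal (h v)) c)" for c
  have F1: "ennreal (F1 c) = orbit_fun (\<lambda>v. ennreal (f v)) c" "0 \<le> F1 c" "F1 c \<le> real K" for c
  proof -
    show "ennreal (F1 c) = orbit_fun (\<lambda>v. ennreal (f v)) c"
      using K1[of c] by (simp add: F1_def ennreal_enn2real_if) (metis ennreal_of_nat_neq_top neq_top_trans)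
    then have "ennreal (F1 c) \<le> ennreal (real K)" using K1[of c] by (simp add: ennreal_of_nat_eq_real_of_nat)
    then show "F1 c \<le> real K" by simp
  qed (simp add: F1_def)
  have F2: "ennreal (F2 c) = orbit_fun (\<lambda>v. ennreal (h v)) c" "0 \<le> F2 c" "F2 c \<le> real K" for c
  proof -
    show "ennreal (F2 c) = orbit_fun (\<lambda>v. ennreal (h v)) c"
      using K2[of c] by (simp add: F2_def ennreal_enn2real_if) (metis ennreal_of_nat_neq_top neq_top_trans)
    then have "ennreal (F2 c) \<le> ennreal (real K)" using K2[of c] by (simp add: ennreal_of_nat_eq_real_of_nat)
    then show "F2 c \<le> real K" by simp
  qed (simp add: F2_def)
  have ms: "borel_measurable m = borel_measurable (flow_space_borel \<Gamma> \<sigma>)"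
    by (rule measurable_cong_sets) (auto simp: sets_m)
  have mF1: "F1 \<in> borel_measurable m"
    unfolding F1_def[abs_def] ms using orbit_fun_measurable[OF cf] by measurable
  have mF2: "F2 \<in> borel_measurable m"
    unfolding F2_def[abs_def] ms using orbit_fun_measurable[OF ch] by measurable
  have sum_flow: "orbit_sum (\<lambda>v. ennreal (h (cover_flow t v))) v = orbit_sum (\<lambda>v. ennreal (h v)) (cover_flow t v)" for t v
    by (simp add: orbit_sum_def cover_flow_action)
  have flowed: "F2 (quotient_flow t c) = enn2real (orbit_fun (\<lambda>v. ennreal (h (cover_flow t v))) c)" if "c \<in> space m" for c t
    using that by (auto simp: space_m flow_space_def F2_def quotient_flow_orbit orbit_fun_orbit sum_flow)
  have mF2t: "(\<lambda>c. F2 (quotient_flow (- t) c)) \<in> borel_measurable m" for t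
  proof -
    have "(\<lambda>c. enn2real (orbit_fun (\<lambda>v. ennreal (h (cover_flow (- t) v))) c)) \<in> borel_measurable m"
      unfolding ms using orbit_fun_measurable[OF continuous_on_flowed[OF ch, of "- t"]] by measurable
    then show ?thesis by (subst measurable_cong[OF flowed]) auto
  qed
  have lim: "((\<lambda>t. \<integral>c. F1 c * F2 (quotient_flow (- t) c) \<partial>m) \<longlongrightarrow> (\<integral>c. F1 c \<partial>m) * (\<integral>c. F2 c \<partial>m) / mass) at_top"
    by (rule mixing_bounded_functions[OF mF1 mF2 mF2t F1(2,3) F2(2,3)])
  have int1: "(\<integral>c. F1 c \<partial>m) = enn2real (\<integral>\<^sup>+v. f v \<partial>cover_measure)"
  proof -
    have "(\<integral>\<^sup>+v. f v \<partial>cover_measure) = (\<integral>\<^sup>+c. ennreal (F1 c) \<partial>m)"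
      by (rule BMS_integral[symmetric, OF measurable_on_cover[OF cf]]) (simp add: F1 orbit_fun_orbit)
    then show ?thesis using mF1 F1(2) by (simp add: integral_eq_nn_integral)
  qed
  have int2: "(\<integral>c. F2 c \<partial>m) = enn2real (\<integral>\<^sup>+v. h v \<partial>cover_measure)"
  proof -
    have "(\<integral>\<^sup>+v. h v \<partial>cover_measure) = (\<integral>\<^sup>+c. ennreal (F2 c) \<partial>m)"
      by (rule BMS_integral[symmetric, OF measurable_on_cover[OF ch]]) (simp add: F2 orbit_fun_orbit)
    then show ?thesis using mF2 F2(2) by (simp add: integral_eq_nn_integral)
  qed
  have corr: "ennreal (\<integral>c. F1 c * F2 (quotient_flow (- t) c) \<partial>m) =
     (\<integral>\<^sup>+\<gamma>. (\<integral>\<^sup>+v. ennreal (f v) * ennreal (h (cover_flow (- t) (cover_action \<sigma> \<gamma> v))) \<partial>cover_measure) \<partial>count_space \<Gamma>)" for t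
  proof -
    define S where "S = orbit_sum (\<lambda>v. ennreal (h (cover_flow (- t) v)))"
    have mS: "S \<in> borel_measurable (restrict_space borel (cover_space \<Gamma>))"
      unfolding S_def by (rule orbit_sum_measurable[OF continuous_on_flowed[OF ch]])
    have bdp: "F1 c * F2 c' \<le> real K * real K" for c c'
      using F1(2,3) F2(2,3) by (intro mult_mono) auto
    have "integrable m (\<lambda>c. F1 c * F2 (quotient_flow (- t) c))"
      by (rule m.integrable_const_bound[of _ "real K * real K"]) (use mF1 mF2t F1 F2 bdp in \<open>auto simp: abs_mult\<close>)
    then have "ennreal (\<integral>c. F1 c * F2 (quotient_flow (- t) c) \<partial>m) = (\<integral>\<^sup>+c. ennreal (F1 c * F2 (quotient_flow (- t) c)) \<partial>m)"
      by (intro nn_integral_eq_integral[symmetric]) (auto simp: F1 F2)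
    also have "\<dots> = (\<integral>\<^sup>+v. ennreal (f v) * S v \<partial>cover_measure)"
    proof (rule BMS_integral)
      show "(\<lambda>v. ennreal (f v) * S v) \<in> borel_measurable (restrict_space borel (cover_space \<Gamma>))"
        using measurable_on_cover[OF cf] mS by measurable
      fix v assume v: "v \<in> cover_space \<Gamma>"
      have Sv: "S (cover_action \<sigma> \<gamma> v) = S v" if "\<gamma> \<in> \<Gamma>" for \<gamma>
        unfolding S_def by (rule orbit_sum_invariant[OF that])
      have "ennreal (F1 (orbit_of \<Gamma> \<sigma> v) * F2 (quotient_flow (- t) (orbit_of \<Gamma> \<sigma> v)))
          = orbit_sum (\<lambda>v. ennreal (f v)) v * S v"
        by (simp add: ennreal_mult F1 F2 quotient_flow_orbit orbit_fun_orbit S_def sum_flow)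
      also have "\<dots> = orbit_sum (\<lambda>v. ennreal (f v) * S v) v"
        unfolding orbit_sum_def
        by (subst nn_integral_multc[symmetric]) (auto intro!: nn_integral_cong simp: Sv)
      finally show "ennreal (F1 (orbit_of \<Gamma> \<sigma> v) * F2 (quotient_flow (- t) (orbit_of \<Gamma> \<sigma> v)))
          = orbit_sum (\<lambda>v. ennreal (f v) * S v) v" .
    qed
    also have "\<dots> = (\<integral>\<^sup>+v. (\<integral>\<^sup>+\<gamma>. ennreal (f v) * ennreal (h (cover_flow (- t) (cover_action \<sigma> \<gamma> v))) \<partial>count_space \<Gamma>) \<partial>cover_measure)"
      unfolding S_def orbit_sum_def
      by (subst nn_integral_cmult) auto
    also have "\<dots> = (\<integral>\<^sup>+\<gamma>. (\<integral>\<^sup>+v. ennreal (f v) * ennreal (h (cover_flow (- t) (cover_action \<sigma> \<gamma> v))) \<partial>cover_measure) \<partial>count_space \<Gamma>)"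
    proof (rule nn_integral_count_space_nn_integral[OF countable_group])
      fix \<gamma> assume \<gamma>: "\<gamma> \<in> \<Gamma>"
      have "continuous_on off_diagonal (\<lambda>v. h (cover_flow (- t) (cover_action \<sigma> \<gamma> v)))"
        using cover_action_off_diagonal[OF \<gamma>]
        by (intro continuous_on_compose2[OF continuous_on_flowed[OF ch] continuous_on_cover_action[OF \<gamma>]]) auto
      from measurable_on_cover[OF this] measurable_on_cover[OF cf]
      show "(\<lambda>v. ennreal (f v) * ennreal (h (cover_flow (- t) (cover_action \<sigma> \<gamma> v)))) \<in> borel_measurable cover_measure"
        unfolding measurable_cong_sets[OF sets_cover_measure refl] by measurable
    qed
    finally show ?thesis .
  qed
  have "((\<lambda>t. ennreal (\<integral>c. F1 c * F2 (quotient_flow (- t) c) \<partial>m)) \<longlongrightarrow> ennreal ((\<integral>c. F1 c \<partial>m) * (\<integral>c. F2 c \<partial>m) / mass)) at_top"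
    by (rule tendsto_ennrealI[OF lim])
  then show ?thesis unfolding corr int1 int2 .
qed

end

section \<open>Correlations of product functions\<close>

lemma nn_integral_lborel_shift:
  fixes f :: "real \<Rightarrow> ennreal"
  assumes "f \<in> borel_measurable borel"
  shows "(\<integral>\<^sup>+s. f (s + a) \<partial>lborel) = (\<integral>\<^sup>+s. f s \<partial>lborel)"
  using nn_integral_real_affine[OF assms, of 1 a] by (simp add: add.commute)

context bms_system begin

text \<open>The factor \<open>exp (- \<delta> G)\<close> cancels the density of the measure on the cover, and the time shift by \<open>G\<close>
  makes the correlations depend on \<open>G(x,y) + \<sigma>(\<gamma>,y)\<close>.\<close>

definition left_test :: "('m \<Rightarrow> real) \<Rightarrow> ('m \<Rightarrow> real) \<Rightarrow> (real \<Rightarrow> real) \<Rightarrow> 'm \<times> 'm \<times> real \<Rightarrow> real" where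
  "left_test u v k = (\<lambda>(x, y, s). u x * v y * exp (- \<delta> * G (x, y)) * k (s - G (x, y)))"

definition right_test :: "('m \<Rightarrow> real) \<Rightarrow> ('m \<Rightarrow> real) \<Rightarrow> (real \<Rightarrow> real) \<Rightarrow> 'm \<times> 'm \<times> real \<Rightarrow> real" where
  "right_test u v k = (\<lambda>(x, y, s). u x * v y * exp (- \<delta> * G (x, y)) * k s)"

lemma continuous_on_G_off_diagonal:
  "continuous_on off_diagonal (\<lambda>z. G (fst z, fst (snd z)))"
proof (rule continuous_on_compose2[where g = G])
  show "continuous_on (distinct_pairs UNIV) G" using gps by (simp add: continuous_GPS_system_def)
  show "continuous_on off_diagonal (\<lambda>z. (fst z, fst (snd z)))" by (intro continuous_intros)
  show "(\<lambda>z. (fst z, fst (snd z))) ` off_diagonal \<subseteq> distinct_pairs UNIV"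
    by (auto simp: off_diagonal_def distinct_pairs_def)
qed

lemma bounded_continuous:
  assumes "continuous_on UNIV (u :: 'm \<Rightarrow> real)"
  obtains C where "C \<ge> 0" "\<And>x. \<bar>u x\<bar> \<le> C"
proof -
  have "bounded (range u)" using compact_continuous_image[OF assms cpt] compact_imp_bounded by blast
  then obtain C where "\<And>x. \<bar>u x\<bar> \<le> C" by (auto simp: bounded_iff)
  then show ?thesis using that[of "max C 0"] by (meson max.cobounded2 max.coboundedI1)
qed

lemma test_function_tests:
  assumes u: "continuous_on UNIV u" "\<And>x. 0 \<le> u x" "\<And>x. u x \<noteq> 0 \<Longrightarrow> x \<in> A"
    and v: "continuous_on UNIV v" "\<And>x. 0 \<le> v x" "\<And>x. v x \<noteq> 0 \<Longrightarrow> x \<in> B"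
    and cl: "closed A" "closed B" "A \<inter> B = {}"
    and k: "continuous_on UNIV k" "\<And>s. 0 \<le> k s" "\<And>s. k s \<le> c" "\<And>s. k s \<noteq> 0 \<Longrightarrow> \<bar>s\<bar> \<le> R"
  shows "test_function (left_test u v k)" "test_function (right_test u v k)"
proof -
  obtain Cu where Cu: "Cu \<ge> 0" "\<And>x. \<bar>u x\<bar> \<le> Cu" by (rule bounded_continuous[OF u(1)]) blast
  obtain Cv where Cv: "Cv \<ge> 0" "\<And>x. \<bar>v x\<bar> \<le> Cv" by (rule bounded_continuous[OF v(1)]) blast
  obtain CG where CG: "CG \<ge> 0" "\<And>x y. x \<in> A \<Longrightarrow> y \<in> B \<Longrightarrow> \<bar>G (x, y)\<bar> \<le> CG" by (rule G_bounded[OF cl]) blast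
  have c0: "c \<ge> 0" using k(2,3) order_trans by blast
  define D where "D = Cu * Cv * exp (\<delta> * CG) * c"
  have D0: "D \<ge> 0" using Cu Cv c0 by (simp add: D_def)
  have bd: "u x * v y * exp (- \<delta> * G (x, y)) * k s \<le> D" for x y s
  proof (cases "u x \<noteq> 0 \<and> v y \<noteq> 0")
    case True
    then have "- \<delta> * G (x, y) \<le> \<delta> * CG"
      using CG(2)[of x y] u(3) v(3) delta_nonneg mult_left_mono[of "- G (x,y)" CG \<delta>] by auto
    then show ?thesis unfolding D_def
      using Cu Cv CG u(2)[of x] v(2)[of y] k(2,3)[of s] Cu(2)[of x] Cv(2)[of y] by (intro mult_mono) auto
  qed (use D0 in auto)
  have supp: "x \<in> A \<and> y \<in> B" if "u x * v y * exp (- \<delta> * G (x, y)) * k s \<noteq> 0" for x y s using that u(3) v(3) by auto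
  have "continuous_on off_diagonal (left_test u v k)"
    unfolding left_test_def case_prod_unfold
    by (intro continuous_intros continuous_on_G_off_diagonal continuous_on_compose2[OF u(1)]
        continuous_on_compose2[OF v(1)] continuous_on_compose2[OF k(1)]) auto
  moreover have "\<bar>s\<bar> \<le> R + CG" if "left_test u v k (x, y, s) \<noteq> 0" for x y s
  proof -
    have "\<bar>s - G (x, y)\<bar> \<le> R" using that k(4) by (auto simp: left_test_def)
    then show ?thesis using CG(2)[of x y] supp[of x y "s - G (x, y)"] that by (auto simp: left_test_def)
  qed
  ultimately show "test_function (left_test u v k)"
    unfolding test_function_def using u v k cl bd supp
    by (intro conjI exI[of _ A] exI[of _ B] exI[of _ "R + CG"] exI[of _ D]) (auto simp: left_test_def)
  have "continuous_on off_diagonal (right_test u v k)"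
    unfolding right_test_def case_prod_unfold
    by (intro continuous_intros continuous_on_G_off_diagonal continuous_on_compose2[OF u(1)]
        continuous_on_compose2[OF v(1)] continuous_on_compose2[OF k(1)]) auto
  then show "test_function (right_test u v k)"
    unfolding test_function_def using u v k cl bd supp
    by (intro conjI exI[of _ A] exI[of _ B] exI[of _ R] exI[of _ D]) (auto simp: right_test_def)
qed

lemma cover_space_borel: "cover_space \<Gamma> \<in> sets borel"
proof -
  have "open {v :: 'm \<times> 'm \<times> real. fst v \<noteq> fst (snd v)}" by (intro open_Collect_neq continuous_intros)
  moreover have "closed (limit_set \<Gamma> \<times> (limit_set \<Gamma> \<times> (UNIV :: real set)))"
    by (intro closed_Times closed_limit_set) simp
  ultimately have "(limit_set \<Gamma> \<times> (limit_set \<Gamma> \<times> (UNIV :: real set))) \<inter> {v. fst v \<noteq> fst (snd v)} \<in> sets borel"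
    by (intro sets.Int borel_closed borel_open)
  also have "(limit_set \<Gamma> \<times> (limit_set \<Gamma> \<times> (UNIV :: real set))) \<inter> {v. fst v \<noteq> fst (snd v)} = cover_space \<Gamma>"
    by (auto simp: cover_space_def distinct_pairs_def)
  finally show ?thesis .
qed

lemma borel_pairG: "(\<lambda>v::'m \<times> 'm \<times> real. G (fst v, fst (snd v))) \<in> borel_measurable borel"
proof -
  have "(\<lambda>v::'m \<times> 'm \<times> real. (fst v, fst (snd v))) \<in> borel_measurable borel"
    by (intro borel_measurable_continuous_onI continuous_intros)
  from measurable_compose[OF this G_borel] show ?thesis by simp
qed

text \<open>Almost every pair consists of limit points, so the restriction to the limit set can be dropped from the
  iterated integral.\<close>

lemma cover_integral:
  fixes g :: "'m \<times> 'm \<times> real \<Rightarrow> ennreal"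
  assumes g[measurable]: "g \<in> borel_measurable borel" and diag: "\<And>x s. g (x, x, s) = 0"
  shows "(\<integral>\<^sup>+v. g v \<partial>cover_measure) =
    (\<integral>\<^sup>+x. (\<integral>\<^sup>+y. (\<integral>\<^sup>+s. ennreal (exp (\<delta> * G (x, y))) * g (x, y, s) \<partial>lborel) \<partial>\<mu>) \<partial>\<mu>')"
proof -
  interpret \<mu>: prob_space \<mu> by (rule sets_PS)
  interpret \<mu>': prob_space \<mu>' by (rule sets_PS)
  note [measurable_cong] = sets_PS(1,2)
  note [measurable] = G_borel cover_space_borel
  have sp: "sets (\<mu>' \<Otimes>\<^sub>M (\<mu> \<Otimes>\<^sub>M lborel)) = sets borel"
  proof -
    have "sets (\<mu>' \<Otimes>\<^sub>M (\<mu> \<Otimes>\<^sub>M lborel)) = sets (borel \<Otimes>\<^sub>M (borel \<Otimes>\<^sub>M borel))"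
      by (intro sets_pair_measure_cong) (auto simp: sets_PS)
    also have "\<dots> = sets borel" by (simp only: borel_prod)
    finally show ?thesis .
  qed
  have mp: "f \<in> borel_measurable (\<mu>' \<Otimes>\<^sub>M (\<mu> \<Otimes>\<^sub>M lborel))" if "f \<in> borel_measurable borel" for f :: "_ \<Rightarrow> ennreal"
    using that unfolding measurable_cong_sets[OF sp refl] .
  define E where "E v = ennreal (exp (\<delta> * G (fst v, fst (snd v))))" for v :: "'m \<times> 'm \<times> real"
  have mE: "E \<in> borel_measurable borel" unfolding E_def[abs_def] using borel_pairG by measurable
  have Eg: "(\<lambda>v. E v * g v) \<in> borel_measurable borel" using mE g by measurable
  have Egi: "(\<lambda>v. E v * g v * indicator (cover_space \<Gamma>) v) \<in> borel_measurable borel" using Eg by measurable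
  have E_eq: "(\<lambda>(x, y, t). ennreal (exp (\<delta> * G (x, y)))) = E" by (auto simp: E_def fun_eq_iff)
  have res: "f \<in> borel_measurable (restrict_space (\<mu>' \<Otimes>\<^sub>M (\<mu> \<Otimes>\<^sub>M lborel)) (cover_space \<Gamma>))"
    if "f \<in> borel_measurable borel" for f :: "_ \<Rightarrow> ennreal"
    using measurable_restrict_space1[OF mp[OF that]] .
  have "(\<integral>\<^sup>+v. g v \<partial>cover_measure) = (\<integral>\<^sup>+v. E v * g v \<partial>restrict_space (\<mu>' \<Otimes>\<^sub>M (\<mu> \<Otimes>\<^sub>M lborel)) (cover_space \<Gamma>))"
    unfolding cover_BMS_measure_def E_eq by (rule nn_integral_density[OF res[OF mE] res[OF g]])
  also have "\<dots> = (\<integral>\<^sup>+v. E v * g v * indicator (cover_space \<Gamma>) v \<partial>(\<mu>' \<Otimes>\<^sub>M (\<mu> \<Otimes>\<^sub>M lborel)))"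
  proof (rule nn_integral_restrict_space)
    show "cover_space \<Gamma> \<inter> space (\<mu>' \<Otimes>\<^sub>M (\<mu> \<Otimes>\<^sub>M lborel)) \<in> sets (\<mu>' \<Otimes>\<^sub>M (\<mu> \<Otimes>\<^sub>M lborel))"
      using cover_space_borel sets.Int[of "cover_space \<Gamma>"] sets.top sp by metis
  qed
  also have "\<dots> = (\<integral>\<^sup>+x. (\<integral>\<^sup>+w. E (x, w) * g (x, w) * indicator (cover_space \<Gamma>) (x, w) \<partial>(\<mu> \<Otimes>\<^sub>M lborel)) \<partial>\<mu>')"
  proof -
    have "sigma_finite_measure (\<mu> \<Otimes>\<^sub>M (lborel :: real measure))"
      by (rule sigma_finite_pair_measure) unfold_locales
    from sigma_finite_measure.nn_integral_fst[OF this mp[OF Egi]] show ?thesis by simp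
  qed
  also have "\<dots> = (\<integral>\<^sup>+x. (\<integral>\<^sup>+y. (\<integral>\<^sup>+s. E (x, y, s) * g (x, y, s) * indicator (cover_space \<Gamma>) (x, y, s) \<partial>lborel) \<partial>\<mu>) \<partial>\<mu>')"
  proof (rule nn_integral_cong)
    fix x
    have "(\<lambda>w. E (x, w) * g (x, w) * indicator (cover_space \<Gamma>) (x, w)) \<in> borel_measurable (\<mu> \<Otimes>\<^sub>M lborel)"
      using measurable_compose[OF measurable_Pair1'[of x \<mu>' "\<mu> \<Otimes>\<^sub>M lborel"] mp[OF Egi]]
      using sets_eq_imp_space_eq[OF sets_PS(2)] by simp
    from lborel.nn_integral_fst[OF this, symmetric]
    show "(\<integral>\<^sup>+w. E (x, w) * g (x, w) * indicator (cover_space \<Gamma>) (x, w) \<partial>(\<mu> \<Otimes>\<^sub>M lborel)) =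
       (\<integral>\<^sup>+y. (\<integral>\<^sup>+s. E (x, y, s) * g (x, y, s) * indicator (cover_space \<Gamma>) (x, y, s) \<partial>lborel) \<partial>\<mu>)"
      by simp
  qed
  also have "\<dots> = (\<integral>\<^sup>+x. (\<integral>\<^sup>+y. (\<integral>\<^sup>+s. ennreal (exp (\<delta> * G (x, y))) * g (x, y, s) \<partial>lborel) \<partial>\<mu>) \<partial>\<mu>')"
  proof (rule nn_integral_cong_AE)
    show "AE x in \<mu>'. (\<integral>\<^sup>+y. (\<integral>\<^sup>+s. E (x, y, s) * g (x, y, s) * indicator (cover_space \<Gamma>) (x, y, s) \<partial>lborel) \<partial>\<mu>) =
       (\<integral>\<^sup>+y. (\<integral>\<^sup>+s. ennreal (exp (\<delta> * G (x, y))) * g (x, y, s) \<partial>lborel) \<partial>\<mu>)"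
      using PS_AE(2)[OF ps']
    proof eventually_elim
      case (elim x)
      show ?case
      proof (rule nn_integral_cong_AE)
        show "AE y in \<mu>. (\<integral>\<^sup>+s. E (x, y, s) * g (x, y, s) * indicator (cover_space \<Gamma>) (x, y, s) \<partial>lborel) =
          (\<integral>\<^sup>+s. ennreal (exp (\<delta> * G (x, y))) * g (x, y, s) \<partial>lborel)"
          using PS_AE(1)[OF ps]
        proof eventually_elim
          case (elim y)
          then show ?case using \<open>x \<in> limit_set \<Gamma>\<close> diag
            by (intro nn_integral_cong) (auto simp: E_def indicator_def cover_space_def distinct_pairs_def)
        qed
      qed
    qed
  qed
  finally show ?thesis .
qed

lemma product_integral:
  assumes [measurable]: "a \<in> borel_measurable borel" "b \<in> borel_measurable borel"
  shows "(\<integral>\<^sup>+x. (\<integral>\<^sup>+y. a x * b y * c \<partial>\<mu>) \<partial>\<mu>') = (\<integral>\<^sup>+x. a x \<partial>\<mu>') * (\<integral>\<^sup>+y. b y \<partial>\<mu>) * (c::ennreal)"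
proof -
  note [measurable_cong] = sets_PS(1,2)
  have "(\<integral>\<^sup>+x. (\<integral>\<^sup>+y. a x * b y * c \<partial>\<mu>) \<partial>\<mu>') = (\<integral>\<^sup>+x. a x * ((\<integral>\<^sup>+y. b y \<partial>\<mu>) * c) \<partial>\<mu>')"
    by (intro nn_integral_cong) (simp add: mult.assoc nn_integral_cmult nn_integral_multc)
  also have "\<dots> = (\<integral>\<^sup>+x. a x \<partial>\<mu>') * ((\<integral>\<^sup>+y. b y \<partial>\<mu>) * c)" by (rule nn_integral_multc) measurable
  finally show ?thesis by (simp add: mult.assoc)
qed

lemma borel_tests:
  assumes [measurable]: "u \<in> borel_measurable borel" "v \<in> borel_measurable borel" "k \<in> borel_measurable borel"
  shows "left_test u v k \<in> borel_measurable borel" "right_test u v k \<in> borel_measurable borel"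
proof -
  have [measurable]: "(\<lambda>v::'m \<times> 'm \<times> real. fst v) \<in> borel_measurable borel"
    "(\<lambda>v::'m \<times> 'm \<times> real. fst (snd v)) \<in> borel_measurable borel"
    "(\<lambda>v::'m \<times> 'm \<times> real. snd (snd v)) \<in> borel_measurable borel"
    by (intro borel_measurable_continuous_onI continuous_intros)+
  note [measurable] = borel_pairG
  show "left_test u v k \<in> borel_measurable borel" unfolding left_test_def case_prod_unfold by measurable
  show "right_test u v k \<in> borel_measurable borel" unfolding right_test_def case_prod_unfold by measurable
qed

lemma integral_tests:
  assumes u: "u \<in> borel_measurable borel" "\<And>x. 0 \<le> u x"
    and v: "v \<in> borel_measurable borel" "\<And>x. 0 \<le> v x" and uv: "\<And>x. u x * v x = 0"
    and k: "k \<in> borel_measurable borel" "\<And>s. 0 \<le> k s"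
  shows "(\<integral>\<^sup>+w. ennreal (left_test u v k w) \<partial>cover_measure) =
      (\<integral>\<^sup>+x. ennreal (u x) \<partial>\<mu>') * (\<integral>\<^sup>+y. ennreal (v y) \<partial>\<mu>) * (\<integral>\<^sup>+s. ennreal (k s) \<partial>lborel)"
    and "(\<integral>\<^sup>+w. ennreal (right_test u v k w) \<partial>cover_measure) =
      (\<integral>\<^sup>+x. ennreal (u x) \<partial>\<mu>') * (\<integral>\<^sup>+y. ennreal (v y) \<partial>\<mu>) * (\<integral>\<^sup>+s. ennreal (k s) \<partial>lborel)"
proof -
  note [measurable] = u(1) v(1) k(1)
  have in1: "(\<integral>\<^sup>+s. ennreal (exp (\<delta> * G (x, y))) * ennreal (left_test u v k (x, y, s)) \<partial>lborel)
      = ennreal (u x) * ennreal (v y) * (\<integral>\<^sup>+s. ennreal (k s) \<partial>lborel)" for x y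
  proof -
    have "(\<integral>\<^sup>+s. ennreal (exp (\<delta> * G (x, y))) * ennreal (left_test u v k (x, y, s)) \<partial>lborel)
      = (\<integral>\<^sup>+s. ennreal (u x * v y) * ennreal (k (s + (- G (x, y)))) \<partial>lborel)"
      using u v k by (intro nn_integral_cong) (simp add: left_test_def ennreal_mult[symmetric] exp_minus_inverse del: ennreal_mult')
    also have "\<dots> = ennreal (u x * v y) * (\<integral>\<^sup>+s. ennreal (k (s + (- G (x, y)))) \<partial>lborel)"
      by (rule nn_integral_cmult) measurable
    also have "(\<integral>\<^sup>+s. ennreal (k (s + (- G (x, y)))) \<partial>lborel) = (\<integral>\<^sup>+s. ennreal (k s) \<partial>lborel)"
      by (rule nn_integral_lborel_shift) measurable
    finally show ?thesis using u v by (simp add: ennreal_mult)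
  qed
  have in2: "(\<integral>\<^sup>+s. ennreal (exp (\<delta> * G (x, y))) * ennreal (right_test u v k (x, y, s)) \<partial>lborel)
      = ennreal (u x) * ennreal (v y) * (\<integral>\<^sup>+s. ennreal (k s) \<partial>lborel)" for x y
  proof -
    have "(\<integral>\<^sup>+s. ennreal (exp (\<delta> * G (x, y))) * ennreal (right_test u v k (x, y, s)) \<partial>lborel)
      = (\<integral>\<^sup>+s. ennreal (u x * v y) * ennreal (k s) \<partial>lborel)"
      using u v k by (intro nn_integral_cong) (simp add: right_test_def ennreal_mult[symmetric] exp_minus_inverse del: ennreal_mult')
    also have "\<dots> = ennreal (u x * v y) * (\<integral>\<^sup>+s. ennreal (k s) \<partial>lborel)"
      by (rule nn_integral_cmult) measurable
    finally show ?thesis using u v by (simp add: ennreal_mult)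
  qed
  have dl: "ennreal (left_test u v k (x, x, s)) = 0" "ennreal (right_test u v k (x, x, s)) = 0" for x s
    using uv[of x] by (auto simp: left_test_def right_test_def)
  have m: "(\<lambda>w. ennreal (left_test u v k w)) \<in> borel_measurable borel" "(\<lambda>w. ennreal (right_test u v k w)) \<in> borel_measurable borel"
    using borel_tests[OF u(1) v(1) k(1)] by measurable
  show "(\<integral>\<^sup>+w. ennreal (left_test u v k w) \<partial>cover_measure) =
      (\<integral>\<^sup>+x. ennreal (u x) \<partial>\<mu>') * (\<integral>\<^sup>+y. ennreal (v y) \<partial>\<mu>) * (\<integral>\<^sup>+s. ennreal (k s) \<partial>lborel)"
    unfolding cover_integral[OF m(1) dl(1)] in1 by (rule product_integral) measurable
  show "(\<integral>\<^sup>+w. ennreal (right_test u v k w) \<partial>cover_measure) =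
      (\<integral>\<^sup>+x. ennreal (u x) \<partial>\<mu>') * (\<integral>\<^sup>+y. ennreal (v y) \<partial>\<mu>) * (\<integral>\<^sup>+s. ennreal (k s) \<partial>lborel)"
    unfolding cover_integral[OF m(2) dl(2)] in2 by (rule product_integral) measurable
qed

definition correlation where
  "correlation u v0 u0 v k1 k2 \<gamma> T = (\<integral>\<^sup>+w. ennreal (left_test u v0 k1 w) *
     ennreal (right_test u0 v k2 (cover_flow (- T) (cover_action \<sigma> \<gamma> w))) \<partial>cover_measure)"

text \<open>The time integral that is left in a correlation, as a function of the difference \<open>\<tau>\<close> of
  \<open>G(x,y) + \<sigma>(\<gamma>,y)\<close> and \<open>T\<close>.\<close>

definition overlap :: "(real \<Rightarrow> real) \<Rightarrow> (real \<Rightarrow> real) \<Rightarrow> real \<Rightarrow> ennreal" where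
  "overlap k \<phi> \<tau> = (\<integral>\<^sup>+s. ennreal (k s * exp (\<delta> * s) * \<phi> (s + \<tau>)) \<partial>lborel)"

text \<open>The density \<open>exp (\<delta> G)\<close> cancels against the first test function. The factor
  \<open>exp (- \<delta> G(\<gamma>x,\<gamma>y))\<close> of the second one equals
  \<open>exp (- \<delta> \<sigma>'(\<gamma>,x)) exp (- \<delta> (G(x,y) + \<sigma>(\<gamma>,y)))\<close>; its first part is the Jacobian of
  \<open>\<gamma>\<close> with respect to \<open>\<mu>'\<close>, its second part is compensated by the exponential in the second time
  profile, up to \<open>exp (- \<delta> T)\<close>.\<close>

lemma correlation_eq:
  assumes \<gamma>: "\<gamma> \<in> \<Gamma>"
    and u: "u \<in> borel_measurable borel" "\<And>x. 0 \<le> u x"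
    and v0: "v0 \<in> borel_measurable borel" "\<And>x. 0 \<le> v0 x" and uv: "\<And>x. u x * v0 x = 0"
    and u0: "u0 \<in> borel_measurable borel" "\<And>x. 0 \<le> u0 x"
    and v: "v \<in> borel_measurable borel" "\<And>x. 0 \<le> v x"
    and k: "k \<in> borel_measurable borel" "\<And>s. 0 \<le> k s"
    and \<phi>: "\<phi> \<in> borel_measurable borel" "\<And>s. 0 \<le> \<phi> s"
  shows "correlation u v0 u0 v k (\<lambda>s. exp (\<delta> * s) * \<phi> s) \<gamma> T =
    (\<integral>\<^sup>+x. (\<integral>\<^sup>+y. ennreal (exp (- \<delta> * \<sigma>' \<gamma> x)) * ennreal (u0 (\<gamma> x)) * ennreal (v0 y) *
       (ennreal (u x * v (\<gamma> y) * exp (- \<delta> * T)) * overlap k \<phi> (G (x, y) + \<sigma> \<gamma> y - T)) \<partial>\<mu>) \<partial>\<mu>')"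
proof -
  note [measurable] = u(1) v0(1) u0(1) v(1) k(1) \<phi>(1)
  let ?k2 = "\<lambda>s. exp (\<delta> * s) * \<phi> s"
  have m1: "left_test u v0 k \<in> borel_measurable borel" by (rule borel_tests) measurable
  have m2: "right_test u0 v ?k2 \<in> borel_measurable borel" by (rule borel_tests) measurable
  have m3: "(\<lambda>w. cover_flow (- T) (cover_action \<sigma> \<gamma> w)) \<in> borel_measurable borel"
    by (intro borel_measurable_continuous_onI continuous_on_compose2[OF continuous_on_cover_flow continuous_on_cover_action[OF \<gamma>]])
      auto
  have m: "(\<lambda>w. ennreal (left_test u v0 k w) * ennreal (right_test u0 v ?k2 (cover_flow (- T) (cover_action \<sigma> \<gamma> w)))) \<in> borel_measurable borel"
    using m1 measurable_compose[OF m3 m2] by measurable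
  have diag: "ennreal (left_test u v0 k (x, x, s)) * ennreal (right_test u0 v ?k2 (cover_flow (- T) (cover_action \<sigma> \<gamma> (x, x, s)))) = 0" for x s
    using uv[of x] by (auto simp: left_test_def)
  have inner: "(\<integral>\<^sup>+s. ennreal (exp (\<delta> * G (x, y))) * (ennreal (left_test u v0 k (x, y, s)) * ennreal (right_test u0 v ?k2 (cover_flow (- T) (cover_action \<sigma> \<gamma> (x, y, s))))) \<partial>lborel)
     = ennreal (exp (- \<delta> * \<sigma>' \<gamma> x)) * ennreal (u0 (\<gamma> x)) * ennreal (v0 y) *
       (ennreal (u x * v (\<gamma> y) * exp (- \<delta> * T)) * overlap k \<phi> (G (x, y) + \<sigma> \<gamma> y - T))" for x y
  proof (cases "x = y")
    case True
    then show ?thesis using uv[of x] by (auto simp: left_test_def)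
  next
    case False
    define \<theta> where "\<theta> = G (x, y) + \<sigma> \<gamma> y"
    have G\<gamma>: "G (\<gamma> x, \<gamma> y) = \<sigma>' \<gamma> x + \<theta>" using gps_eq[OF \<gamma> False] by (simp add: \<theta>_def)
    define c where "c = exp (- \<delta> * \<sigma>' \<gamma> x) * u0 (\<gamma> x) * v0 y * (u x * v (\<gamma> y) * exp (- \<delta> * T))"
    have c0: "0 \<le> c" using u v0 u0 v by (simp add: c_def)
    have pt: "ennreal (exp (\<delta> * G (x, y))) * (ennreal (left_test u v0 k (x, y, s)) * ennreal (right_test u0 v ?k2 (cover_flow (- T) (cover_action \<sigma> \<gamma> (x, y, s)))))
       = ennreal c * ennreal (k (s + (- G (x, y))) * exp (\<delta> * (s + (- G (x, y)))) * \<phi> (s + (- G (x, y)) + (\<theta> - T)))" for s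
    proof -
      have "exp (\<delta> * G (x, y)) * (left_test u v0 k (x, y, s) * right_test u0 v ?k2 (cover_flow (- T) (cover_action \<sigma> \<gamma> (x, y, s))))
        = (u x * v0 y * u0 (\<gamma> x) * v (\<gamma> y) * k (s - G (x, y)) * \<phi> (s + \<sigma> \<gamma> y - T)) *
          (exp (\<delta> * G (x, y)) * exp (- \<delta> * G (x, y)) * exp (- \<delta> * G (\<gamma> x, \<gamma> y)) * exp (\<delta> * (s + \<sigma> \<gamma> y - T)))"
        by (simp add: left_test_def right_test_def cover_flow_def cover_action_def)
      also have "exp (\<delta> * G (x, y)) * exp (- \<delta> * G (x, y)) * exp (- \<delta> * G (\<gamma> x, \<gamma> y)) * exp (\<delta> * (s + \<sigma> \<gamma> y - T))
        = exp (- \<delta> * \<sigma>' \<gamma> x) * exp (- \<delta> * T) * exp (\<delta> * (s + (- G (x, y))))"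
        by (simp only: exp_add[symmetric] G\<gamma> \<theta>_def) (simp add: algebra_simps)
      also have "s + \<sigma> \<gamma> y - T = s + (- G (x, y)) + (\<theta> - T)" by (simp add: \<theta>_def)
      finally have eq: "exp (\<delta> * G (x, y)) * (left_test u v0 k (x, y, s) * right_test u0 v ?k2 (cover_flow (- T) (cover_action \<sigma> \<gamma> (x, y, s))))
        = c * (k (s + (- G (x, y))) * exp (\<delta> * (s + (- G (x, y)))) * \<phi> (s + (- G (x, y)) + (\<theta> - T)))"
        by (simp add: c_def algebra_simps)
      have n1: "0 \<le> left_test u v0 k (x, y, s)" using u v0 k by (simp add: left_test_def)
      have n2: "0 \<le> right_test u0 v ?k2 (cover_flow (- T) (cover_action \<sigma> \<gamma> (x, y, s)))"
        using u0 v \<phi> by (simp add: right_test_def cover_flow_def cover_action_def)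
      have "ennreal (exp (\<delta> * G (x, y))) * (ennreal (left_test u v0 k (x, y, s)) * ennreal (right_test u0 v ?k2 (cover_flow (- T) (cover_action \<sigma> \<gamma> (x, y, s)))))
        = ennreal (exp (\<delta> * G (x, y)) * (left_test u v0 k (x, y, s) * right_test u0 v ?k2 (cover_flow (- T) (cover_action \<sigma> \<gamma> (x, y, s)))))"
        using n1 n2 by (simp add: ennreal_mult)
      also have "\<dots> = ennreal (c * (k (s + (- G (x, y))) * exp (\<delta> * (s + (- G (x, y)))) * \<phi> (s + (- G (x, y)) + (\<theta> - T))))"
        unfolding eq ..
      finally show ?thesis using c0 by (simp add: ennreal_mult')
    qed
    have "(\<integral>\<^sup>+s. ennreal (exp (\<delta> * G (x, y))) * (ennreal (left_test u v0 k (x, y, s)) * ennreal (right_test u0 v ?k2 (cover_flow (- T) (cover_action \<sigma> \<gamma> (x, y, s))))) \<partial>lborel)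
      = ennreal c * (\<integral>\<^sup>+s. ennreal (k (s + (- G (x, y))) * exp (\<delta> * (s + (- G (x, y)))) * \<phi> (s + (- G (x, y)) + (\<theta> - T))) \<partial>lborel)"
      unfolding pt by (rule nn_integral_cmult) measurable
    also have "(\<integral>\<^sup>+s. ennreal (k (s + (- G (x, y))) * exp (\<delta> * (s + (- G (x, y)))) * \<phi> (s + (- G (x, y)) + (\<theta> - T))) \<partial>lborel)
      = overlap k \<phi> (\<theta> - T)"
      unfolding overlap_def by (rule nn_integral_lborel_shift[of "\<lambda>s. ennreal (k s * exp (\<delta> * s) * \<phi> (s + (\<theta> - T)))"]) measurable
    also have "ennreal c * overlap k \<phi> (\<theta> - T) = ennreal (exp (- \<delta> * \<sigma>' \<gamma> x)) * ennreal (u0 (\<gamma> x)) * ennreal (v0 y) *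
       (ennreal (u x * v (\<gamma> y) * exp (- \<delta> * T)) * overlap k \<phi> (\<theta> - T))"
      using u v0 u0 v by (simp add: c_def ennreal_mult mult.assoc)
    finally show ?thesis by (simp add: \<theta>_def)
  qed
  show ?thesis unfolding correlation_def cover_integral[OF m diag] inner ..
qed

text \<open>If the part of the integrand that depends on both points is bounded by a constant, the Jacobian
  turns the rest into the product of the integrals of \<open>u0\<close> and \<open>v0\<close>.\<close>

lemma correlation_bounds:
  assumes \<gamma>: "\<gamma> \<in> \<Gamma>"
    and u: "u \<in> borel_measurable borel" "\<And>x. 0 \<le> u x"
    and v0: "v0 \<in> borel_measurable borel" "\<And>x. 0 \<le> v0 x" and uv: "\<And>x. u x * v0 x = 0"
    and u0: "u0 \<in> borel_measurable borel" "\<And>x. 0 \<le> u0 x"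
    and v: "v \<in> borel_measurable borel" "\<And>x. 0 \<le> v x"
    and k: "k \<in> borel_measurable borel" "\<And>s. 0 \<le> k s"
    and \<phi>: "\<phi> \<in> borel_measurable borel" "\<And>s. 0 \<le> \<phi> s"
  shows "(\<And>x y. u0 (\<gamma> x) \<noteq> 0 \<Longrightarrow> v0 y \<noteq> 0 \<Longrightarrow>
       c \<le> ennreal (u x * v (\<gamma> y) * exp (- \<delta> * T)) * overlap k \<phi> (G (x, y) + \<sigma> \<gamma> y - T)) \<Longrightarrow>
     (\<integral>\<^sup>+x. ennreal (u0 x) \<partial>\<mu>') * (\<integral>\<^sup>+y. ennreal (v0 y) \<partial>\<mu>) * c \<le> correlation u v0 u0 v k (\<lambda>s. exp (\<delta> * s) * \<phi> s) \<gamma> T"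
    and "(\<And>x y. u0 (\<gamma> x) \<noteq> 0 \<Longrightarrow> v0 y \<noteq> 0 \<Longrightarrow>
       ennreal (u x * v (\<gamma> y) * exp (- \<delta> * T)) * overlap k \<phi> (G (x, y) + \<sigma> \<gamma> y - T) \<le> c) \<Longrightarrow>
     correlation u v0 u0 v k (\<lambda>s. exp (\<delta> * s) * \<phi> s) \<gamma> T \<le> (\<integral>\<^sup>+x. ennreal (u0 x) \<partial>\<mu>') * (\<integral>\<^sup>+y. ennreal (v0 y) \<partial>\<mu>) * c"
proof -
  note [measurable] = u0(1) v0(1) measurable_in[OF \<gamma>] borel_measurable_continuous_onI[OF cocycle_cont(2)[OF \<gamma>]]
  have eq: "(\<integral>\<^sup>+x. (\<integral>\<^sup>+y. ennreal (exp (- \<delta> * \<sigma>' \<gamma> x)) * ennreal (u0 (\<gamma> x)) * ennreal (v0 y) * c \<partial>\<mu>) \<partial>\<mu>') =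
     (\<integral>\<^sup>+x. ennreal (u0 x) \<partial>\<mu>') * (\<integral>\<^sup>+y. ennreal (v0 y) \<partial>\<mu>) * c"
  proof -
    have "(\<integral>\<^sup>+x. ennreal (exp (- \<delta> * \<sigma>' \<gamma> x)) * ennreal (u0 (\<gamma> x)) \<partial>\<mu>') = (\<integral>\<^sup>+x. ennreal (u0 x) \<partial>\<mu>')"
      by (rule PS_nn_integral[OF ps' cocycle_cont(2)[OF \<gamma>] \<gamma>]) measurable
    moreover have "(\<integral>\<^sup>+x. (\<integral>\<^sup>+y. ennreal (exp (- \<delta> * \<sigma>' \<gamma> x)) * ennreal (u0 (\<gamma> x)) * ennreal (v0 y) * c \<partial>\<mu>) \<partial>\<mu>') =
      (\<integral>\<^sup>+x. ennreal (exp (- \<delta> * \<sigma>' \<gamma> x)) * ennreal (u0 (\<gamma> x)) \<partial>\<mu>') * (\<integral>\<^sup>+y. ennreal (v0 y) \<partial>\<mu>) * c"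
      by (rule product_integral) measurable
    ultimately show ?thesis by simp
  qed
  note ce = correlation_eq[OF \<gamma> u v0 uv u0 v k \<phi>, where T = T]
  show "(\<integral>\<^sup>+x. ennreal (u0 x) \<partial>\<mu>') * (\<integral>\<^sup>+y. ennreal (v0 y) \<partial>\<mu>) * c \<le> correlation u v0 u0 v k (\<lambda>s. exp (\<delta> * s) * \<phi> s) \<gamma> T"
    if le: "\<And>x y. u0 (\<gamma> x) \<noteq> 0 \<Longrightarrow> v0 y \<noteq> 0 \<Longrightarrow>
       c \<le> ennreal (u x * v (\<gamma> y) * exp (- \<delta> * T)) * overlap k \<phi> (G (x, y) + \<sigma> \<gamma> y - T)"
    unfolding eq[symmetric] ce
  proof (intro nn_integral_mono)
    fix x y
    show "ennreal (exp (- \<delta> * \<sigma>' \<gamma> x)) * ennreal (u0 (\<gamma> x)) * ennreal (v0 y) * c \<le>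
      ennreal (exp (- \<delta> * \<sigma>' \<gamma> x)) * ennreal (u0 (\<gamma> x)) * ennreal (v0 y) *
       (ennreal (u x * v (\<gamma> y) * exp (- \<delta> * T)) * overlap k \<phi> (G (x, y) + \<sigma> \<gamma> y - T))"
    proof (cases "u0 (\<gamma> x) = 0 \<or> v0 y = 0")
      case False
      then show ?thesis by (intro mult_left_mono le) auto
    qed auto
  qed
  show "correlation u v0 u0 v k (\<lambda>s. exp (\<delta> * s) * \<phi> s) \<gamma> T \<le> (\<integral>\<^sup>+x. ennreal (u0 x) \<partial>\<mu>') * (\<integral>\<^sup>+y. ennreal (v0 y) \<partial>\<mu>) * c"
    if le: "\<And>x y. u0 (\<gamma> x) \<noteq> 0 \<Longrightarrow> v0 y \<noteq> 0 \<Longrightarrow>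
       ennreal (u x * v (\<gamma> y) * exp (- \<delta> * T)) * overlap k \<phi> (G (x, y) + \<sigma> \<gamma> y - T) \<le> c"
    unfolding eq[symmetric] ce
  proof (intro nn_integral_mono)
    fix x y
    show "ennreal (exp (- \<delta> * \<sigma>' \<gamma> x)) * ennreal (u0 (\<gamma> x)) * ennreal (v0 y) *
       (ennreal (u x * v (\<gamma> y) * exp (- \<delta> * T)) * overlap k \<phi> (G (x, y) + \<sigma> \<gamma> y - T)) \<le>
      ennreal (exp (- \<delta> * \<sigma>' \<gamma> x)) * ennreal (u0 (\<gamma> x)) * ennreal (v0 y) * c"
    proof (cases "u0 (\<gamma> x) = 0 \<or> v0 y = 0")
      case False
      then show ?thesis by (intro mult_left_mono le) auto
    qed auto
  qed
qed

end

lemma overlap_bounds_aux: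
  fixes k \<phi> :: "real \<Rightarrow> real"
  assumes "0 \<le> \<delta>" "\<And>s. 0 \<le> k s" "\<forall>s. k s \<noteq> 0 \<longrightarrow> \<bar>s\<bar> \<le> \<rho>"
    and "\<And>s. 0 \<le> \<phi> s" "\<And>s. \<phi> s \<le> 1"
  shows "k s * exp (\<delta> * s) * \<phi> (s + \<tau>) \<le> exp (\<delta> * \<rho>) * k s"
    and "(\<And>s. \<phi> s \<noteq> 0 \<Longrightarrow> a \<le> s \<and> s \<le> b) \<Longrightarrow> \<not> (a - \<rho> \<le> \<tau> \<and> \<tau> \<le> b + \<rho>) \<Longrightarrow> k s * exp (\<delta> * s) * \<phi> (s + \<tau>) = 0"
    and "(\<And>s. a \<le> s \<Longrightarrow> s \<le> b \<Longrightarrow> \<phi> s = 1) \<Longrightarrow> a + \<rho> \<le> \<tau> \<Longrightarrow> \<tau> \<le> b - \<rho> \<Longrightarrow>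
      exp (- \<delta> * \<rho>) * k s \<le> k s * exp (\<delta> * s) * \<phi> (s + \<tau>)"
proof -
  show "k s * exp (\<delta> * s) * \<phi> (s + \<tau>) \<le> exp (\<delta> * \<rho>) * k s"
  proof (cases "k s = 0")
    case False
    then have "\<delta> * s \<le> \<delta> * \<rho>" using assms(1,3) by (intro mult_left_mono) auto
    then have "k s * exp (\<delta> * s) * \<phi> (s + \<tau>) \<le> k s * exp (\<delta> * \<rho>) * 1"
      using assms by (intro mult_mono) auto
    then show ?thesis by (simp add: mult.commute)
  qed simp
  show "k s * exp (\<delta> * s) * \<phi> (s + \<tau>) = 0"
    if "\<And>s. \<phi> s \<noteq> 0 \<Longrightarrow> a \<le> s \<and> s \<le> b" "\<not> (a - \<rho> \<le> \<tau> \<and> \<tau> \<le> b + \<rho>)"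
  proof (cases "k s = 0")
    case False
    then have "\<bar>s\<bar> \<le> \<rho>" using assms(3) by simp
    then have "\<not> (a \<le> s + \<tau> \<and> s + \<tau> \<le> b)" using that(2) by linarith
    then show ?thesis using that(1) by auto
  qed simp
  show "exp (- \<delta> * \<rho>) * k s \<le> k s * exp (\<delta> * s) * \<phi> (s + \<tau>)"
    if "\<And>s. a \<le> s \<Longrightarrow> s \<le> b \<Longrightarrow> \<phi> s = 1" "a + \<rho> \<le> \<tau>" "\<tau> \<le> b - \<rho>"
  proof (cases "k s = 0")
    case False
    then have s: "\<bar>s\<bar> \<le> \<rho>" using assms(3) by simp
    then have "\<delta> * (- \<rho>) \<le> \<delta> * s" using assms(1) by (intro mult_left_mono) auto
    then have "k s * exp (- \<delta> * \<rho>) \<le> k s * exp (\<delta> * s)" using assms by (intro mult_left_mono) auto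
    moreover have "\<phi> (s + \<tau>) = 1" using s that by (intro that(1)) auto
    ultimately show ?thesis by (simp add: mult.commute)
  qed simp
qed

context bms_system begin

lemma overlap_bounds:
  fixes k \<phi> :: "real \<Rightarrow> real"
  assumes k[measurable]: "k \<in> borel_measurable borel" and "\<And>s. 0 \<le> k s" "\<And>s. k s \<noteq> 0 \<Longrightarrow> \<bar>s\<bar> \<le> \<rho>"
    and "\<And>s. 0 \<le> \<phi> s" "\<And>s. \<phi> s \<le> 1"
  shows "overlap k \<phi> \<tau> \<le> ennreal (exp (\<delta> * \<rho>)) * (\<integral>\<^sup>+s. ennreal (k s) \<partial>lborel)"
    and "(\<And>s. \<phi> s \<noteq> 0 \<Longrightarrow> a \<le> s \<and> s \<le> b) \<Longrightarrow> \<not> (a - \<rho> \<le> \<tau> \<and> \<tau> \<le> b + \<rho>) \<Longrightarrow> overlap k \<phi> \<tau> = 0"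
    and "(\<And>s. a \<le> s \<Longrightarrow> s \<le> b \<Longrightarrow> \<phi> s = 1) \<Longrightarrow> a + \<rho> \<le> \<tau> \<Longrightarrow> \<tau> \<le> b - \<rho> \<Longrightarrow>
      ennreal (exp (- \<delta> * \<rho>)) * (\<integral>\<^sup>+s. ennreal (k s) \<partial>lborel) \<le> overlap k \<phi> \<tau>"
proof -
  have "\<forall>s. k s \<noteq> 0 \<longrightarrow> \<bar>s\<bar> \<le> \<rho>" using assms(3) by blast
  note aux = overlap_bounds_aux[of \<delta> k \<rho> \<phi>, OF delta_nonneg assms(2) this assms(4,5)]
  have "overlap k \<phi> \<tau> \<le> (\<integral>\<^sup>+s. ennreal (exp (\<delta> * \<rho>)) * ennreal (k s) \<partial>lborel)"
    unfolding overlap_def using aux(1)[of _ \<tau>] assms(2)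
    by (intro nn_integral_mono) (simp add: ennreal_mult[symmetric] ennreal_leI del: ennreal_mult' ennreal_mult'')
  then show "overlap k \<phi> \<tau> \<le> ennreal (exp (\<delta> * \<rho>)) * (\<integral>\<^sup>+s. ennreal (k s) \<partial>lborel)"
    by (simp add: nn_integral_cmult)
  show "overlap k \<phi> \<tau> = 0" if "\<And>s. \<phi> s \<noteq> 0 \<Longrightarrow> a \<le> s \<and> s \<le> b" "\<not> (a - \<rho> \<le> \<tau> \<and> \<tau> \<le> b + \<rho>)"
    unfolding overlap_def by (subst aux(2)[where a = a and b = b and \<tau> = \<tau>, OF that]) simp_all
  show "ennreal (exp (- \<delta> * \<rho>)) * (\<integral>\<^sup>+s. ennreal (k s) \<partial>lborel) \<le> overlap k \<phi> \<tau>"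
    if "\<And>s. a \<le> s \<Longrightarrow> s \<le> b \<Longrightarrow> \<phi> s = 1" "a + \<rho> \<le> \<tau>" "\<tau> \<le> b - \<rho>"
  proof -
    have "(\<integral>\<^sup>+s. ennreal (exp (- \<delta> * \<rho>)) * ennreal (k s) \<partial>lborel) \<le> overlap k \<phi> \<tau>"
      unfolding overlap_def using aux(3)[where a = a and b = b and \<tau> = \<tau>, OF that] assms(2)
      by (intro nn_integral_mono) (simp add: ennreal_mult[symmetric] ennreal_leI del: ennreal_mult' ennreal_mult'')
    then show ?thesis by (simp add: nn_integral_cmult)
  qed
qed

end

section \<open>Counting in a unit window\<close>

definition tent :: "real \<Rightarrow> real \<Rightarrow> real" where
  "tent \<rho> s = max 0 (\<rho> - \<bar>s\<bar>)"

text \<open>Equal to one on \<open>[a + \<rho>, b - \<rho>]\<close> and zero outside \<open>[a, b]\<close>.\<close>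

definition trapezoid :: "real \<Rightarrow> real \<Rightarrow> real \<Rightarrow> real \<Rightarrow> real" where
  "trapezoid a b \<rho> s = max 0 (min 1 (min ((s - a) / \<rho>) ((b - s) / \<rho>)))"

lemma tent_props:
  assumes "\<rho> > 0"
  shows "continuous_on UNIV (tent \<rho>)" "0 \<le> tent \<rho> s" "tent \<rho> s \<le> \<rho>" "tent \<rho> s \<noteq> 0 \<Longrightarrow> \<bar>s\<bar> \<le> \<rho>"
  using assms by (auto simp: tent_def[abs_def] intro!: continuous_intros)

lemma trapezoid_props:
  assumes "\<rho> > 0"
  shows "continuous_on UNIV (trapezoid a b \<rho>)" "0 \<le> trapezoid a b \<rho> s" "trapezoid a b \<rho> s \<le> 1"
    "trapezoid a b \<rho> s \<noteq> 0 \<Longrightarrow> a \<le> s \<and> s \<le> b"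
    "a + \<rho> \<le> s \<Longrightarrow> s \<le> b - \<rho> \<Longrightarrow> trapezoid a b \<rho> s = 1"
proof -
  show "continuous_on UNIV (trapezoid a b \<rho>)"
    unfolding trapezoid_def[abs_def] using assms by (intro continuous_intros) auto
  show "0 \<le> trapezoid a b \<rho> s" "trapezoid a b \<rho> s \<le> 1" by (auto simp: trapezoid_def)
  show "a \<le> s \<and> s \<le> b" if "trapezoid a b \<rho> s \<noteq> 0"
  proof -
    have "0 < min ((s - a) / \<rho>) ((b - s) / \<rho>)"
    proof (rule ccontr)
      assume "\<not> ?thesis"
      then have "min 1 (min ((s - a) / \<rho>) ((b - s) / \<rho>)) \<le> 0" by (simp only: min_le_iff_disj not_less) simp
      then show False using that by (simp add: trapezoid_def max_absorb1)
    qed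
    then show ?thesis using assms by (simp add: zero_less_divide_iff)
  qed
  show "trapezoid a b \<rho> s = 1" if "a + \<rho> \<le> s" "s \<le> b - \<rho>"
  proof -
    have "1 \<le> (s - a) / \<rho>" "1 \<le> (b - s) / \<rho>" using that assms by (simp_all add: le_divide_eq)
    then show ?thesis by (simp add: trapezoid_def)
  qed
qed

lemma nn_integral_exp_interval:
  assumes "\<delta> > 0" "a \<le> b"
  shows "(\<integral>\<^sup>+s. ennreal (exp (\<delta> * s)) * indicator {a..b} s \<partial>lborel) = ennreal ((exp (\<delta> * b) - exp (\<delta> * a)) / \<delta>)"
proof -
  have "(\<integral>\<^sup>+s. ennreal (exp (\<delta> * s)) * indicator {a..b} s \<partial>lborel) = ennreal (exp (\<delta> * b) / \<delta> - exp (\<delta> * a) / \<delta>)"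
    by (rule nn_integral_FTC_Icc) (use assms in \<open>auto intro!: derivative_eq_intros\<close>)
  then show ?thesis by (simp add: diff_divide_distrib)
qed

lemma tent_integral:
  assumes "\<rho> > 0"
  obtains \<kappa> where "\<kappa> > 0" "(\<integral>\<^sup>+s. ennreal (tent \<rho> s) \<partial>lborel) = ennreal \<kappa>"
proof -
  note [measurable] = borel_measurable_continuous_onI[OF tent_props(1)[OF assms]]
  have "(\<integral>\<^sup>+s. ennreal (tent \<rho> s) \<partial>lborel) \<le> (\<integral>\<^sup>+s. ennreal \<rho> * indicator {-\<rho>..\<rho>} s \<partial>lborel)"
  proof (rule nn_integral_mono)
    fix s
    show "ennreal (tent \<rho> s) \<le> ennreal \<rho> * indicator {-\<rho>..\<rho>} s"
      using tent_props(3,4)[OF assms, of s]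
      by (cases "tent \<rho> s = 0") (auto simp: indicator_def ennreal_leI abs_le_iff)
  qed
  also have "\<dots> = ennreal \<rho> * ennreal (2 * \<rho>)" using assms by (simp add: nn_integral_cmult_indicator)
  finally have fin: "(\<integral>\<^sup>+s. ennreal (tent \<rho> s) \<partial>lborel) < \<infinity>"
    by (metis ennreal_less_top ennreal_mult_less_top infinity_ennreal_def order_le_less_trans)
  have "0 < ennreal (\<rho> / 2) * ennreal \<rho>" using assms by (simp add: ennreal_zero_less_mult_iff)
  also have "\<dots> = (\<integral>\<^sup>+s. ennreal (\<rho> / 2) * indicator {-\<rho>/2..\<rho>/2} s \<partial>lborel)"
    using assms by (simp add: nn_integral_cmult_indicator)
  also have "\<dots> \<le> (\<integral>\<^sup>+s. ennreal (tent \<rho> s) \<partial>lborel)"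
    by (intro nn_integral_mono) (auto simp: indicator_def tent_def abs_if intro!: ennreal_leI)
  finally have "0 < (\<integral>\<^sup>+s. ennreal (tent \<rho> s) \<partial>lborel)" .
  then show ?thesis
    using fin that[of "enn2real (\<integral>\<^sup>+s. ennreal (tent \<rho> s) \<partial>lborel)"]
    by (simp add: enn2real_positive_iff)
qed

lemma trapezoid_exp_integral:
  assumes "\<delta> > 0" "\<rho> > 0" "a + \<rho> \<le> b - \<rho>"
  obtains I where "I \<le> (exp (\<delta> * b) - exp (\<delta> * a)) / \<delta>" "(exp (\<delta> * (b - \<rho>)) - exp (\<delta> * (a + \<rho>))) / \<delta> \<le> I" "0 \<le> I"
    "(\<integral>\<^sup>+s. ennreal (exp (\<delta> * s) * trapezoid a b \<rho> s) \<partial>lborel) = ennreal I"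
proof -
  let ?N = "\<integral>\<^sup>+s. ennreal (exp (\<delta> * s) * trapezoid a b \<rho> s) \<partial>lborel"
  note t = trapezoid_props[OF assms(2)]
  have ab: "a \<le> b" using assms by simp
  have "?N \<le> (\<integral>\<^sup>+s. ennreal (exp (\<delta> * s)) * indicator {a..b} s \<partial>lborel)"
  proof (rule nn_integral_mono)
    fix s
    show "ennreal (exp (\<delta> * s) * trapezoid a b \<rho> s) \<le> ennreal (exp (\<delta> * s)) * indicator {a..b} s"
      using t(3,4)[of a b s] by (cases "trapezoid a b \<rho> s = 0") (auto simp: indicator_def intro!: ennreal_leI mult_left_le)
  qed
  then have up: "?N \<le> ennreal ((exp (\<delta> * b) - exp (\<delta> * a)) / \<delta>)" by (simp add: nn_integral_exp_interval[OF assms(1) ab])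
  have "(\<integral>\<^sup>+s. ennreal (exp (\<delta> * s)) * indicator {a+\<rho>..b-\<rho>} s \<partial>lborel) \<le> ?N"
    using t(5) by (intro nn_integral_mono) (auto simp: indicator_def)
  then have lo: "ennreal ((exp (\<delta> * (b - \<rho>)) - exp (\<delta> * (a + \<rho>))) / \<delta>) \<le> ?N"
    by (simp add: nn_integral_exp_interval[OF assms(1,3)])
  have fin: "?N < top" using up ennreal_less_top order_le_less_trans by blast
  have eq: "?N = ennreal (enn2real ?N)" using fin by simp
  have pos: "0 \<le> (exp (\<delta> * b) - exp (\<delta> * a)) / \<delta>" using assms ab by simp
  show ?thesis
  proof (rule that[OF _ _ _ eq])
    show "enn2real ?N \<le> (exp (\<delta> * b) - exp (\<delta> * a)) / \<delta>" using up pos by (simp add: enn2real_leI)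
    show "(exp (\<delta> * (b - \<rho>)) - exp (\<delta> * (a + \<rho>))) / \<delta> \<le> enn2real ?N"
    proof -
      have "ennreal ((exp (\<delta> * (b - \<rho>)) - exp (\<delta> * (a + \<rho>))) / \<delta>) \<le> ennreal (enn2real ?N)" using lo eq by simp
      then show ?thesis by (simp only: ennreal_le_iff[OF enn2real_nonneg])
    qed
  qed simp
qed

context compact_convergence_group begin

lemma infdist_separated:
  assumes "closed A" "A \<noteq> {}" "closed B" "A \<inter> B = {}"
  obtains e where "e > 0" "\<And>x. x \<in> B \<Longrightarrow> e \<le> infdist x (A :: 'm set)"
proof (cases "B = {}")
  case True
  then show ?thesis using that[of 1] by auto
next
  case False
  have "compact B" using assms(3) cpt compact_Int_closed[of UNIV] by auto
  then obtain x0 where x0: "x0 \<in> B" "\<And>x. x \<in> B \<Longrightarrow> infdist x0 A \<le> infdist x A"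
    using continuous_attains_inf[OF _ False continuous_on_infdist[OF continuous_on_id, of B A]] by blast
  have "infdist x0 A > 0" using infdist_pos_not_in_closed[OF assms(1,2)] x0(1) assms(4) by blast
  then show ?thesis using that x0(2) by blast
qed

text \<open>A truncated distance function. It has positive integral because the complement of \<open>B\<close> has positive
  mass and is exhausted by the sets of points at distance at least \<open>1/(n+1)\<close> from \<open>B\<close>.\<close>

lemma bump_off_closed:
  fixes \<nu> :: "'m measure"
  assumes p: "prob_space \<nu>" and s: "sets \<nu> = sets borel" and B: "closed B" "B \<noteq> {}" "measure \<nu> B < 1"
  shows "\<exists>(w :: 'm \<Rightarrow> real) A0. continuous_on UNIV w \<and> (\<forall>x. 0 \<le> w x) \<and> (\<forall>x. w x \<noteq> 0 \<longrightarrow> x \<in> A0) \<and>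
    closed A0 \<and> A0 \<inter> B = {} \<and> 0 < (\<integral>x. w x \<partial>\<nu>)"
proof -
  interpret prob_space \<nu> by fact
  note [measurable_cong] = s
  have sp: "space \<nu> = UNIV" using sets_eq_imp_space_eq[OF s] by simp
  define K where "K n = {x. inverse (real (Suc n)) \<le> infdist x B}" for n
  have clK: "closed (K n)" for n unfolding K_def by (intro closed_Collect_le continuous_intros)
  have "\<exists>n. emeasure \<nu> (K n) \<noteq> 0"
  proof (rule ccontr)
    assume "\<not> ?thesis"
    then have "K n \<in> null_sets \<nu>" for n using clK by (auto simp: null_sets_def s)
    then have U: "(\<Union>n. K n) \<in> null_sets \<nu>" by auto
    have "- B \<subseteq> (\<Union>n. K n)"
    proof
      fix x assume "x \<in> - B"
      then have "0 < infdist x B" using infdist_pos_not_in_closed[OF B(1,2)] by blast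
      then obtain n where "inverse (real (Suc n)) < infdist x B" using reals_Archimedean by blast
      then have "x \<in> K n" by (simp add: K_def)
      then show "x \<in> (\<Union>n. K n)" by (rule UN_I[OF UNIV_I])
    qed
    then have "- B \<in> null_sets \<nu>"
      using U B(1) by (intro null_sets_subset[OF U]) (auto simp: s)
    then have "measure \<nu> (space \<nu> - B) = 0" by (simp add: sp measure_def null_sets_def Compl_eq_Diff_UNIV)
    then show False using prob_compl[of B] B by (simp add: s)
  qed
  then obtain n where n: "emeasure \<nu> (K n) \<noteq> 0" by blast
  \<comment> \<open>Half of the distance to \<open>B\<close>, so that \<open>w\<close> is at least \<open>min 1 r\<close> on \<open>K n\<close> and its support avoids \<open>B\<close>.\<close>
  define r where "r = inverse (real (Suc n)) / 2"
  have r: "r > 0" by (simp add: r_def)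
  define w where "w x = min 1 (max 0 (infdist x B - r))" for x
  have cw: "continuous_on UNIV w" unfolding w_def[abs_def] by (intro continuous_intros)
  note [measurable] = borel_measurable_continuous_onI[OF cw]
  have int: "integrable \<nu> w"
    by (rule integrable_const_bound[of _ 1]) (auto simp: w_def)
  have "0 < min 1 r * measure \<nu> (K n)" using n r by (simp add: emeasure_eq_measure less_le min_def)
  also have "\<dots> = (\<integral>x. min 1 r * indicator (K n) x \<partial>\<nu>)" using clK by (simp add: s)
  also have "\<dots> \<le> (\<integral>x. w x \<partial>\<nu>)"
  proof (rule integral_mono[OF _ int])
    show "integrable \<nu> (\<lambda>x. min 1 r * indicator (K n) x)"
      using clK by (intro integrable_mult_right integrable_real_indicator) (auto simp: s emeasure_eq_measure)
    show "min 1 r * indicator (K n) x \<le> w x" for x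
    proof (cases "x \<in> K n")
      case True
      then have "2 * r \<le> infdist x B" by (simp add: K_def r_def)
      then show ?thesis using r True by (auto simp: w_def)
    qed (simp add: w_def)
  qed
  finally have pos: "0 < (\<integral>x. w x \<partial>\<nu>)" .
  have clA: "closed {x. r \<le> infdist x B}" by (intro closed_Collect_le continuous_intros)
  show ?thesis
    by (intro exI[of _ w] exI[of _ "{x. r \<le> infdist x B}"]) (use cw pos r clA in \<open>auto simp: w_def\<close>)
qed

lemma nn_integral_continuous:
  assumes p: "prob_space \<nu>" and s: "sets \<nu> = sets borel" and u: "continuous_on UNIV (u :: 'm \<Rightarrow> real)" "\<And>x. 0 \<le> u x"
  shows "integrable \<nu> u" "(\<integral>\<^sup>+x. ennreal (u x) \<partial>\<nu>) = ennreal (\<integral>x. u x \<partial>\<nu>)" "0 \<le> (\<integral>x. u x \<partial>\<nu>)"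
proof -
  interpret prob_space \<nu> by fact
  note [measurable_cong] = s
  note [measurable] = borel_measurable_continuous_onI[OF u(1)]
  have "bounded (range u)" using compact_continuous_image[OF u(1) cpt] compact_imp_bounded by blast
  then obtain C where C: "\<And>x. \<bar>u x\<bar> \<le> C" by (auto simp: bounded_iff)
  show int: "integrable \<nu> u" by (rule integrable_const_bound[of _ C]) (use C in auto)
  show "(\<integral>\<^sup>+x. ennreal (u x) \<partial>\<nu>) = ennreal (\<integral>x. u x \<partial>\<nu>)"
    by (rule nn_integral_eq_integral[OF int]) (use u in auto)
  show "0 \<le> (\<integral>x. u x \<partial>\<nu>)" using u by simp
qed

text \<open>Adding a small plateau around the support gives a function \<open>w\<close> whose value at any point close
  to \<open>z\<close> dominates \<open>u z\<close>.\<close>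

lemma enlarged_function:
  assumes u: "continuous_on UNIV (u :: 'm \<Rightarrow> real)" "\<And>x. 0 \<le> u x" "{x. u x \<noteq> 0} \<subseteq> A"
    and A: "closed A" "A \<noteq> {}" and B0: "closed B0" "A \<inter> B0 = {}" and \<rho>: "\<rho> > 0"
  shows "\<exists>w A2 \<eta>. continuous_on UNIV w \<and> (\<forall>x. 0 \<le> w x) \<and> (\<forall>x. w x \<noteq> 0 \<longrightarrow> x \<in> A2) \<and> closed A2 \<and> A2 \<inter> B0 = {} \<and>
    (\<forall>x. w x \<le> u x + \<rho>) \<and> \<eta> > 0 \<and> (\<forall>x z. dist x z < \<eta> \<longrightarrow> u z \<le> w x)"
proof -
  obtain e where e: "e > 0" "\<And>x. x \<in> B0 \<Longrightarrow> e \<le> infdist x A" by (rule infdist_separated[OF A B0]) blast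
  have "uniformly_continuous_on UNIV u" by (rule compact_uniformly_continuous[OF u(1) cpt])
  then obtain \<eta>0 where \<eta>0: "\<eta>0 > 0" "\<And>x z. dist z x < \<eta>0 \<Longrightarrow> dist (u z) (u x) < \<rho>"
    using \<rho> unfolding uniformly_continuous_on_def by (metis UNIV_I)
  define \<eta> where "\<eta> = min \<eta>0 (e / 4)"
  have \<eta>: "\<eta> > 0" "\<eta> \<le> \<eta>0" "2 * \<eta> < e" using \<eta>0 e by (auto simp: \<eta>_def)
  define w where "w x = u x + \<rho> * max 0 (min 1 (2 - infdist x A / \<eta>))" for x
  define A2 where "A2 = {x. infdist x A \<le> 2 * \<eta>}"
  show ?thesis
  proof (intro exI[of _ w] exI[of _ A2] exI[of _ \<eta>] conjI allI impI)
    show "continuous_on UNIV w" unfolding w_def[abs_def] using \<eta>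
      by (intro continuous_intros u(1)) auto
    show "0 \<le> w x" for x using u(2)[of x] \<rho> by (simp add: w_def)
    show "x \<in> A2" if "w x \<noteq> 0" for x
    proof (rule ccontr)
      assume "x \<notin> A2"
      then have gt: "2 * \<eta> < infdist x A" by (simp add: A2_def)
      then have "x \<notin> A" using \<eta> by (auto simp: A2_def)
      then have "u x = 0" using u(3) by blast
      moreover have "2 - infdist x A / \<eta> \<le> 0" using gt \<eta> by (simp add: le_divide_eq)
      ultimately show False using that by (simp add: w_def)
    qed
    show "closed A2" unfolding A2_def by (intro closed_Collect_le continuous_intros)
    show "A2 \<inter> B0 = {}" using e \<eta> by (force simp: A2_def)
    have "max 0 (min 1 (2 - infdist x A / \<eta>)) \<le> 1" for x by simp
    then show "w x \<le> u x + \<rho>" for x unfolding w_def using \<rho> mult_left_le[of "max 0 (min 1 (2 - infdist x A / \<eta>))" \<rho>] by simp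
    show "\<eta> > 0" by fact
    show "u z \<le> w x" if "dist x z < \<eta>" for x z
    proof (cases "u z = 0")
      case True
      then show ?thesis using u(2)[of x] \<rho> by (simp add: w_def)
    next
      case False
      then have "infdist x A \<le> dist x z" using u(3) by (intro infdist_le) auto
      then have "1 \<le> 2 - infdist x A / \<eta>" using that \<eta> by (simp add: divide_le_eq)
      then have "w x = u x + \<rho>" by (simp add: w_def)
      moreover have "\<bar>u x - u z\<bar> < \<rho>" using \<eta>0(2)[of x z] that \<eta> by (simp add: dist_real_def)
      ultimately show ?thesis by linarith
    qed
  qed
qed

text \<open>The counterpart of \<open>enlarged_function\<close>: lowering \<open>u\<close> by \<open>\<rho>\<close> compensates its oscillation on small
  balls.\<close>

lemma reduced_function:
  assumes u: "continuous_on UNIV (u :: 'm \<Rightarrow> real)" and \<rho>: "\<rho> > 0"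
  shows "\<exists>w \<eta>. continuous_on UNIV w \<and> (\<forall>x. 0 \<le> w x) \<and> (\<forall>x. w x \<noteq> 0 \<longrightarrow> u x \<noteq> 0) \<and>
    (\<forall>x. u x - \<rho> \<le> w x) \<and> \<eta> > 0 \<and> (\<forall>x z. 0 \<le> u z \<longrightarrow> dist x z < \<eta> \<longrightarrow> w x \<le> u z)"
proof -
  have "uniformly_continuous_on UNIV u" by (rule compact_uniformly_continuous[OF u(1) cpt])
  then obtain \<eta> where \<eta>: "\<eta> > 0" "\<And>x z. dist z x < \<eta> \<Longrightarrow> dist (u z) (u x) < \<rho>"
    using \<rho> unfolding uniformly_continuous_on_def by (metis UNIV_I)
  show ?thesis
  proof (intro exI[of _ "\<lambda>x. max 0 (u x - \<rho>)"] exI[of _ \<eta>] conjI allI impI)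
    show "continuous_on UNIV (\<lambda>x. max 0 (u x - \<rho>))" by (intro continuous_intros u)
    show "max 0 (u x - \<rho>) \<le> u z" if "0 \<le> u z" "dist x z < \<eta>" for x z
      using \<eta>(2)[OF that(2)] that(1) by (simp add: dist_real_def)
  qed (use \<rho> \<eta> in auto)
qed

end

context bms_system begin

lemma delta_positive: "\<delta> > 0"
  by (rule delta_pos[OF ps])

lemma overlap_tent_trapezoid:
  assumes \<rho>: "\<rho> > 0" and \<kappa>: "(\<integral>\<^sup>+s. ennreal (tent \<rho> s) \<partial>lborel) = ennreal \<kappa>"
  shows "overlap (tent \<rho>) (trapezoid a b \<rho>) \<tau> \<le> ennreal (exp (\<delta> * \<rho>)) * ennreal \<kappa>"
    and "\<not> (a - \<rho> \<le> \<tau> \<and> \<tau> \<le> b + \<rho>) \<Longrightarrow> overlap (tent \<rho>) (trapezoid a b \<rho>) \<tau> = 0"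
    and "a + \<rho> + \<rho> \<le> \<tau> \<Longrightarrow> \<tau> \<le> b - \<rho> - \<rho> \<Longrightarrow>
      ennreal (exp (- \<delta> * \<rho>)) * ennreal \<kappa> \<le> overlap (tent \<rho>) (trapezoid a b \<rho>) \<tau>"
proof -
  note t = tent_props[OF \<rho>] and z = trapezoid_props[OF \<rho>]
  note mt = borel_measurable_continuous_onI[OF t(1)]
  show "overlap (tent \<rho>) (trapezoid a b \<rho>) \<tau> \<le> ennreal (exp (\<delta> * \<rho>)) * ennreal \<kappa>"
    unfolding \<kappa>[symmetric] by (rule overlap_bounds(1)[OF mt t(2) t(4) z(2,3)])
  show "overlap (tent \<rho>) (trapezoid a b \<rho>) \<tau> = 0" if "\<not> (a - \<rho> \<le> \<tau> \<and> \<tau> \<le> b + \<rho>)"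
    by (rule overlap_bounds(2)[OF mt t(2) t(4) z(2,3) z(4) that])
  show "ennreal (exp (- \<delta> * \<rho>)) * ennreal \<kappa> \<le> overlap (tent \<rho>) (trapezoid a b \<rho>) \<tau>"
    if "a + \<rho> + \<rho> \<le> \<tau>" "\<tau> \<le> b - \<rho> - \<rho>"
    unfolding \<kappa>[symmetric] by (rule overlap_bounds(3)[OF mt t(2) t(4) z(2,3) z(5) that])
qed

lemma correlation_limit:
  assumes u: "continuous_on UNIV u" "\<And>x. 0 \<le> u x" "\<And>x. u x \<noteq> 0 \<Longrightarrow> x \<in> A"
    and v0: "continuous_on UNIV v0" "\<And>x. 0 \<le> v0 x" "\<And>x. v0 x \<noteq> 0 \<Longrightarrow> x \<in> B0"
    and u0: "continuous_on UNIV u0" "\<And>x. 0 \<le> u0 x" "\<And>x. u0 x \<noteq> 0 \<Longrightarrow> x \<in> A0"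
    and v: "continuous_on UNIV v" "\<And>x. 0 \<le> v x" "\<And>x. v x \<noteq> 0 \<Longrightarrow> x \<in> B"
    and cl: "closed A" "closed B0" "A \<inter> B0 = {}" "closed A0" "closed B" "A0 \<inter> B = {}"
    and \<rho>: "\<rho> > 0"
    and \<kappa>: "(\<integral>\<^sup>+s. ennreal (tent \<rho> s) \<partial>lborel) = ennreal \<kappa>" "\<kappa> \<ge> 0"
    and I: "(\<integral>\<^sup>+s. ennreal (exp (\<delta> * s) * trapezoid a b \<rho> s) \<partial>lborel) = ennreal I" "I \<ge> 0"
  shows "((\<lambda>T. \<integral>\<^sup>+\<gamma>. correlation u v0 u0 v (tent \<rho>) (\<lambda>s. exp (\<delta> * s) * trapezoid a b \<rho> s) \<gamma> T \<partial>count_space \<Gamma>)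
    \<longlongrightarrow> ennreal ((\<integral>x. u x \<partial>\<mu>') * (\<integral>y. v0 y \<partial>\<mu>) * \<kappa> * ((\<integral>x. u0 x \<partial>\<mu>') * (\<integral>y. v y \<partial>\<mu>) * I) / mass)) at_top"
proof -
  let ?k2 = "\<lambda>s. exp (\<delta> * s) * trapezoid a b \<rho> s"
  note t = tent_props[OF \<rho>] and z = trapezoid_props[OF \<rho>]
  have ck2: "continuous_on UNIV ?k2" by (intro continuous_intros z)
  have nk2: "0 \<le> ?k2 s" for s using z(2) by simp
  have bk2: "?k2 s \<le> exp (\<delta> * b)" for s
  proof (cases "trapezoid a b \<rho> s = 0")
    case False
    then have "\<delta> * s \<le> \<delta> * b" using z(4) delta_nonneg by (intro mult_left_mono) auto
    then show ?thesis using z(2,3)[of a b s] mult_mono[of "exp (\<delta> * s)" "exp (\<delta> * b)" "trapezoid a b \<rho> s" 1] by simp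
  qed simp
  have sk2: "\<bar>s\<bar> \<le> \<bar>a\<bar> + \<bar>b\<bar>" if "?k2 s \<noteq> 0" for s
    using z(4)[of a b s] that by fastforce
  have f: "test_function (left_test u v0 (tent \<rho>))"
    by (rule test_function_tests(1)[OF u v0 cl(1,2,3) t])
  have h: "test_function (right_test u0 v ?k2)"
    by (rule test_function_tests(2)[OF u0 v cl(4,5,6) ck2 nk2 bk2 sk2])
  note m = borel_measurable_continuous_onI
  have uv: "u x * v0 x = 0" for x using u(3) v0(3) cl(3) by (metis IntI emptyE mult_eq_0_iff)
  have uv': "u0 x * v x = 0" for x using u0(3) v(3) cl(6) by (metis IntI emptyE mult_eq_0_iff)
  note nc = nn_integral_continuous[OF sets_PS(3,1)] and nc' = nn_integral_continuous[OF sets_PS(4,2)]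
  have "(\<integral>\<^sup>+w. ennreal (left_test u v0 (tent \<rho>) w) \<partial>cover_measure) =
      ennreal ((\<integral>x. u x \<partial>\<mu>') * (\<integral>y. v0 y \<partial>\<mu>) * \<kappa>)"
    using integral_tests(1)[OF m[OF u(1)] u(2) m[OF v0(1)] v0(2) uv m[OF t(1)] t(2)]
      nc(2,3)[OF v0(1,2)] nc'(2,3)[OF u(1,2)] \<kappa> by (simp add: ennreal_mult)
  then have 1: "enn2real (\<integral>\<^sup>+w. ennreal (left_test u v0 (tent \<rho>) w) \<partial>cover_measure) =
      (\<integral>x. u x \<partial>\<mu>') * (\<integral>y. v0 y \<partial>\<mu>) * \<kappa>"
    using nc(3)[OF v0(1,2)] nc'(3)[OF u(1,2)] \<kappa> by simp
  have "(\<integral>\<^sup>+w. ennreal (right_test u0 v ?k2 w) \<partial>cover_measure) =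
      ennreal ((\<integral>x. u0 x \<partial>\<mu>') * (\<integral>y. v y \<partial>\<mu>) * I)"
    using integral_tests(2)[OF m[OF u0(1)] u0(2) m[OF v(1)] v(2) uv' m[OF ck2] nk2]
      nc(2,3)[OF v(1,2)] nc'(2,3)[OF u0(1,2)] I by (simp add: ennreal_mult)
  then have 2: "enn2real (\<integral>\<^sup>+w. ennreal (right_test u0 v ?k2 w) \<partial>cover_measure) =
      (\<integral>x. u0 x \<partial>\<mu>') * (\<integral>y. v y \<partial>\<mu>) * I"
    using nc(3)[OF v(1,2)] nc'(3)[OF u0(1,2)] I by simp
  show ?thesis using mixing_test_functions[OF f h] unfolding 1 2 correlation_def .
qed

definition weight :: "('m \<Rightarrow> real) \<Rightarrow> ('m \<Rightarrow> real) \<Rightarrow> ('m \<Rightarrow> 'm) \<Rightarrow> real" where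
  "weight u v \<gamma> = u (repelling \<gamma>) * v (attracting \<gamma>)"

definition carriers :: "('m \<Rightarrow> real) \<Rightarrow> ('m \<Rightarrow> real) \<Rightarrow> ('m \<Rightarrow> 'm) set" where
  "carriers u v = {\<gamma>\<in>\<Gamma>. loxodromic \<gamma> \<and> u (repelling \<gamma>) \<noteq> 0 \<and> v (attracting \<gamma>) \<noteq> 0}"

lemma finite_carriers:
  assumes "\<And>x. u x \<noteq> 0 \<Longrightarrow> x \<in> A" "\<And>x. v x \<noteq> 0 \<Longrightarrow> x \<in> B" "closed A" "closed B" "A \<inter> B = {}"
  shows "finite {\<gamma>\<in>carriers u v. shifted_period \<gamma> \<le> T}" "finite {\<gamma>\<in>carriers u v. period \<sigma> \<gamma> \<le> T}"
proof -
  have K: "compact (A \<times> B)" "A \<times> B \<subseteq> distinct_pairs UNIV"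
    using assms cpt compact_Int_closed[of UNIV] by (auto intro!: compact_Times simp: distinct_pairs_def)
  obtain C where C: "\<And>x y. x \<in> A \<Longrightarrow> y \<in> B \<Longrightarrow> \<bar>G (x, y)\<bar> \<le> C"
    by (rule G_bounded[OF assms(3-5)]) blast
  have fin: "finite {\<gamma>\<in>\<Gamma>. loxodromic \<gamma> \<and> (repelling \<gamma>, attracting \<gamma>) \<in> A \<times> B \<and> period \<sigma> \<gamma> \<le> R}" for R
    by (rule finite_short_loxodromics[OF K])
  show "finite {\<gamma>\<in>carriers u v. period \<sigma> \<gamma> \<le> T}"
    by (rule finite_subset[OF _ fin[of T]]) (use assms in \<open>auto simp: carriers_def\<close>)
  show "finite {\<gamma>\<in>carriers u v. shifted_period \<gamma> \<le> T}"
  proof (rule finite_subset[OF _ fin[of "T + C"]], clarify)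
    fix \<gamma> assume \<gamma>: "\<gamma> \<in> carriers u v" "shifted_period \<gamma> \<le> T"
    then have in': "repelling \<gamma> \<in> A" "attracting \<gamma> \<in> B" using assms by (auto simp: carriers_def)
    have "period \<sigma> \<gamma> \<le> T + C" using C[OF in'] \<gamma>(2) by (simp add: shifted_period_def)
    then show "\<gamma> \<in> \<Gamma> \<and> loxodromic \<gamma> \<and> (repelling \<gamma>, attracting \<gamma>) \<in> A \<times> B \<and> period \<sigma> \<gamma> \<le> T + C"
      using \<gamma> in' by (auto simp: carriers_def)
  qed
qed

definition window_sum :: "('m \<Rightarrow> real) \<Rightarrow> ('m \<Rightarrow> real) \<Rightarrow> real \<Rightarrow> real" where
  "window_sum u v T = (\<Sum>\<gamma>\<in>{\<gamma>\<in>carriers u v. T - 1 < shifted_period \<gamma> \<and> shifted_period \<gamma> \<le> T}. weight u v \<gamma>)"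

lemma eventually_beyond_finite:
  assumes "finite E"
  shows "\<forall>\<^sub>F T in at_top. \<forall>\<gamma>\<in>E. h \<gamma> < (T::real)"
  using assms by (simp add: eventually_ball_finite_distrib eventually_gt_at_top)

end

text \<open>The functions \<open>u\<close> and \<open>v\<close> weight the repelling and the attracting point of the elements to be counted;
  \<open>u0\<close> and \<open>v0\<close> are auxiliary: their integrals appear on both sides of the comparison and cancel.\<close>

locale counting_box = bms_system \<Gamma> \<sigma> \<sigma>' G d mag \<delta> \<mu> \<mu>' m
  for \<Gamma> :: "('m :: {metric_space, second_countable_topology} \<Rightarrow> 'm) set"
    and \<sigma> \<sigma>' G d mag \<delta> \<mu> \<mu>' m +
  fixes u v u0 v0 :: "'m \<Rightarrow> real" and A B A0 B0 :: "'m set"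
  assumes u: "continuous_on UNIV u" "\<And>x. 0 \<le> u x" "\<And>x. u x \<noteq> 0 \<Longrightarrow> x \<in> A"
    and v: "continuous_on UNIV v" "\<And>x. 0 \<le> v x" "\<And>x. v x \<noteq> 0 \<Longrightarrow> x \<in> B"
    and u0: "continuous_on UNIV u0" "\<And>x. 0 \<le> u0 x" "\<And>x. u0 x \<noteq> 0 \<Longrightarrow> x \<in> A0"
    and v0: "continuous_on UNIV v0" "\<And>x. 0 \<le> v0 x" "\<And>x. v0 x \<noteq> 0 \<Longrightarrow> x \<in> B0"
    and cl: "closed A" "closed B" "closed A0" "closed B0"
    and ne: "A \<noteq> {}" "B \<noteq> {}"
    and disj: "A \<inter> B0 = {}" "A0 \<inter> B = {}" "A \<inter> B = {}"
    and pos: "0 < (\<integral>x. u0 x \<partial>\<mu>')" "0 < (\<integral>y. v0 y \<partial>\<mu>)"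
begin

lemma uA: "{x. u x \<noteq> 0} \<subseteq> A" and vB: "{x. v x \<noteq> 0} \<subseteq> B"
  using u(3) v(3) by auto

text \<open>Every element in the window is well approximated, apart from finitely many that leave the window as
  \<open>T\<close> grows. For well approximated elements, the correlation of slightly enlarged functions is at least
  the weight times constants. So the window sum is bounded by the limit that mixing provides.\<close>

lemma window_upper_bound:
  assumes \<rho>: "\<rho> > 0"
  shows "\<forall>\<^sub>F T in at_top. exp (- \<delta> * T) * window_sum u v T \<le>
     exp (\<delta> * \<rho>) * (((\<integral>x. u x \<partial>\<mu>') + \<rho>) * ((\<integral>y. v y \<partial>\<mu>) + \<rho>) *
       ((exp (\<delta> * (3 * \<rho>)) - exp (\<delta> * (- 1 - 3 * \<rho>))) / \<delta>) / mass) + \<rho>"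
proof -
  obtain u2 A2 \<eta>1 where u2: "continuous_on UNIV u2" "\<And>x. 0 \<le> u2 x" "\<And>x. u2 x \<noteq> 0 \<Longrightarrow> x \<in> A2"
    and A2: "closed A2" "A2 \<inter> B0 = {}" and u2': "\<And>x. u2 x \<le> u x + \<rho>" and \<eta>1: "\<eta>1 > 0" "\<And>x z. dist x z < \<eta>1 \<Longrightarrow> u z \<le> u2 x"
    using enlarged_function[OF u(1,2) uA cl(1) ne(1) cl(4) disj(1) \<rho>] by blast
  have disj2: "B \<inter> A0 = {}" using disj by auto
  obtain v2 B2 \<eta>2 where v2: "continuous_on UNIV v2" "\<And>x. 0 \<le> v2 x" "\<And>x. v2 x \<noteq> 0 \<Longrightarrow> x \<in> B2"
    and B2: "closed B2" "B2 \<inter> A0 = {}" and v2': "\<And>x. v2 x \<le> v x + \<rho>" and \<eta>2: "\<eta>2 > 0" "\<And>x z. dist x z < \<eta>2 \<Longrightarrow> v z \<le> v2 x"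
    using enlarged_function[OF v(1,2) vB cl(2) ne(2) cl(3) disj2 \<rho>] by blast
  define \<eta> where "\<eta> = min \<rho> (min \<eta>1 \<eta>2)"
  have \<eta>: "\<eta> > 0" "\<eta> \<le> \<rho>" "\<eta> \<le> \<eta>1" "\<eta> \<le> \<eta>2" using \<rho> \<eta>1 \<eta>2 by (auto simp: \<eta>_def)
  \<comment> \<open>The plateau of the trapezoid must contain \<open>[-1, 0]\<close> with margins \<open>\<rho>\<close> for the width of the tent
    and \<open>\<eta> \<le> \<rho>\<close> for the approximation of the shifted period.\<close>
  define a b where "a = - 1 - 3 * \<rho>" and "b = 3 * \<rho>"
  obtain \<kappa> where \<kappa>: "\<kappa> > 0" "(\<integral>\<^sup>+s. ennreal (tent \<rho> s) \<partial>lborel) = ennreal \<kappa>" by (rule tent_integral[OF \<rho>])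
  have abr: "a + \<rho> \<le> b - \<rho>" using \<rho> by (simp add: a_def b_def)
  obtain I where I: "I \<le> (exp (\<delta> * b) - exp (\<delta> * a)) / \<delta>" "0 \<le> I"
    "(\<integral>\<^sup>+s. ennreal (exp (\<delta> * s) * trapezoid a b \<rho> s) \<partial>lborel) = ennreal I"
    by (rule trapezoid_exp_integral[OF delta_positive \<rho> abr]) blast
  define corr where "corr \<gamma> T = correlation u2 v0 u0 v2 (tent \<rho>) (\<lambda>s. exp (\<delta> * s) * trapezoid a b \<rho> s) \<gamma> T" for \<gamma> T
  define \<alpha> where "\<alpha> = (\<integral>x. u0 x \<partial>\<mu>') * (\<integral>y. v0 y \<partial>\<mu>)"
  have \<alpha>: "\<alpha> > 0" using pos by (simp add: \<alpha>_def)
  define Lim where "Lim = (\<integral>x. u2 x \<partial>\<mu>') * (\<integral>y. v0 y \<partial>\<mu>) * \<kappa> * ((\<integral>x. u0 x \<partial>\<mu>') * (\<integral>y. v2 y \<partial>\<mu>) * I) / mass"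
  have A0B2: "A0 \<inter> B2 = {}" using B2 by auto
  have lim: "((\<lambda>T. \<integral>\<^sup>+\<gamma>. corr \<gamma> T \<partial>count_space \<Gamma>) \<longlongrightarrow> ennreal Lim) at_top"
    unfolding corr_def Lim_def
    by (rule correlation_limit[OF u2 v0 u0 v2 A2(1) cl(4) A2(2) cl(3) B2(1) A0B2 \<rho> \<kappa>(2) less_imp_le[OF \<kappa>(1)] I(3,2)])
  note nc = nn_integral_continuous[OF sets_PS(3,1)] and nc' = nn_integral_continuous[OF sets_PS(4,2)]
  interpret P: prob_space \<mu> by (rule sets_PS)
  interpret P': prob_space \<mu>' by (rule sets_PS)
  have Lim0: "0 \<le> Lim" unfolding Lim_def
    using nc(3)[OF v0(1,2)] nc(3)[OF v2(1,2)] nc'(3)[OF u0(1,2)] nc'(3)[OF u2(1,2)] \<kappa> I by simp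
  note mb = borel_measurable_continuous_onI and tz = tent_props(1,2)[OF \<rho>] trapezoid_props(1,2)[OF \<rho>]
  have bnd: "ennreal (\<alpha> * exp (- \<delta> * \<rho>) * \<kappa> * exp (- \<delta> * T) * weight u v \<gamma>) \<le> corr \<gamma> T"
    if \<gamma>: "\<gamma> \<in> \<Gamma>" "well_approximated \<eta> A0 B0 \<gamma>" "T - 1 < shifted_period \<gamma>" "shifted_period \<gamma> \<le> T" for \<gamma> T
  proof -
    have wn: "0 \<le> weight u v \<gamma>" using u v by (simp add: weight_def)
    define c where "c = ennreal (weight u v \<gamma> * exp (- \<delta> * T)) * (ennreal (exp (- \<delta> * \<rho>)) * ennreal \<kappa>)"
    have uv2: "u2 x * v0 x = 0" for x using u2(3) v0(3) A2(2) by (metis IntI emptyE mult_eq_0_iff)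
    have "(\<integral>\<^sup>+x. ennreal (u0 x) \<partial>\<mu>') * (\<integral>\<^sup>+y. ennreal (v0 y) \<partial>\<mu>) * c \<le> corr \<gamma> T"
      unfolding corr_def
    proof (rule correlation_bounds(1)[OF \<gamma>(1) mb[OF u2(1)] u2(2) mb[OF v0(1)] v0(2) uv2 mb[OF u0(1)] u0(2) mb[OF v2(1)] v2(2)
        mb[OF tz(1)] tz(2) mb[OF tz(3)] tz(4)])
      fix x y assume "u0 (\<gamma> x) \<noteq> 0" "v0 y \<noteq> 0"
      then have xy: "\<gamma> x \<in> A0" "y \<in> B0" using u0 v0 by auto
      then have ap: "dist x (repelling \<gamma>) < \<eta>" "dist (\<gamma> y) (attracting \<gamma>) < \<eta>"
        "\<bar>G (x, y) + \<sigma> \<gamma> y - shifted_period \<gamma>\<bar> < \<eta>" using \<gamma>(2) unfolding well_approximated_def by blast+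
      have "weight u v \<gamma> \<le> u2 x * v2 (\<gamma> y)"
        unfolding weight_def using \<eta>1(2)[of x "repelling \<gamma>"] \<eta>2(2)[of "\<gamma> y" "attracting \<gamma>"] ap \<eta> u v u2 v2
        by (intro mult_mono) auto
      then have 1: "ennreal (weight u v \<gamma> * exp (- \<delta> * T)) \<le> ennreal (u2 x * v2 (\<gamma> y) * exp (- \<delta> * T))"
        by (intro ennreal_leI mult_right_mono) auto
      have 2: "ennreal (exp (- \<delta> * \<rho>)) * ennreal \<kappa> \<le> overlap (tent \<rho>) (trapezoid a b \<rho>) (G (x, y) + \<sigma> \<gamma> y - T)"
        using ap(3) \<eta> \<gamma>(3,4) unfolding a_def b_def by (intro overlap_tent_trapezoid(3)[OF \<rho> \<kappa>(2)]) linarith+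
      show "c \<le> ennreal (u2 x * v2 (\<gamma> y) * exp (- \<delta> * T)) * overlap (tent \<rho>) (trapezoid a b \<rho>) (G (x, y) + \<sigma> \<gamma> y - T)"
        unfolding c_def by (intro mult_mono 1 2) auto
    qed
    also have "(\<integral>\<^sup>+x. ennreal (u0 x) \<partial>\<mu>') * (\<integral>\<^sup>+y. ennreal (v0 y) \<partial>\<mu>) * c = ennreal (\<alpha> * exp (- \<delta> * \<rho>) * \<kappa> * exp (- \<delta> * T) * weight u v \<gamma>)"
      using wn \<kappa> pos by (simp add: nc(2)[OF v0(1,2)] nc'(2)[OF u0(1,2)] c_def \<alpha>_def ennreal_mult[symmetric] ac_simps del: ennreal_mult' ennreal_mult'')
    finally show ?thesis .
  qed
  define E where "E = {\<gamma>\<in>\<Gamma>. loxodromic \<gamma> \<and> repelling \<gamma> \<in> A \<and> attracting \<gamma> \<in> B \<and> \<not> well_approximated \<eta> A0 B0 \<gamma>}"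
  have finE: "finite E" unfolding E_def
    by (rule finite_not_well_approximated(1)[OF cl(1,3,2,4) disj \<eta>(1)])
  define \<beta> where "\<beta> = \<alpha> * exp (- \<delta> * \<rho>) * \<kappa>"
  have \<beta>: "\<beta> > 0" using \<alpha> \<kappa> by (simp add: \<beta>_def)
  have "ennreal Lim < ennreal (Lim + \<beta> * \<rho>)" using Lim0 \<beta> \<rho> by (intro ennreal_lessI) (auto intro: add_nonneg_pos)
  from order_tendstoD(2)[OF lim this] eventually_beyond_finite[OF finE, of "\<lambda>\<gamma>. shifted_period \<gamma> + 1"]
  show ?thesis
  proof eventually_elim
    case (elim T)
    define N where "N = {\<gamma>\<in>carriers u v. T - 1 < shifted_period \<gamma> \<and> shifted_period \<gamma> \<le> T}"
    have finN: "finite N" unfolding N_def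
      by (rule finite_subset[OF _ finite_carriers(1)[OF u(3) v(3) cl(1,2) disj(3), where T = T]]) auto
    have NG: "N \<subseteq> \<Gamma>" by (auto simp: N_def carriers_def)
    have good: "well_approximated \<eta> A0 B0 \<gamma>" if "\<gamma> \<in> N" for \<gamma>
    proof (rule ccontr)
      assume "\<not> well_approximated \<eta> A0 B0 \<gamma>"
      then have "\<gamma> \<in> E" using that u v by (auto simp: E_def N_def carriers_def)
      then show False using elim(2) that by (force simp: N_def)
    qed
    have wn: "0 \<le> weight u v \<gamma>" for \<gamma> using u v by (simp add: weight_def)
    have "ennreal (\<beta> * (exp (- \<delta> * T) * window_sum u v T)) = (\<Sum>\<gamma>\<in>N. ennreal (\<beta> * exp (- \<delta> * T) * weight u v \<gamma>))"
      using \<beta> wn by (subst sum_ennreal) (auto simp: window_sum_def N_def sum_distrib_left mult.assoc)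
    also have "\<dots> \<le> (\<Sum>\<gamma>\<in>N. corr \<gamma> T)"
      using bnd good NG by (intro sum_mono) (auto simp: N_def \<beta>_def)
    also have "\<dots> \<le> (\<integral>\<^sup>+\<gamma>. corr \<gamma> T \<partial>count_space \<Gamma>)"
      unfolding infsum_eq_nn_integral_count_space(2)[OF countable_group] using finN NG by (intro SUP_upper) auto
    also have "\<dots> \<le> ennreal (Lim + \<beta> * \<rho>)" using elim(1) by simp
    finally have "\<beta> * (exp (- \<delta> * T) * window_sum u v T) \<le> Lim + \<beta> * \<rho>"
      using Lim0 \<beta> \<rho> by (subst (asm) ennreal_le_iff) auto
    also have "Lim = \<beta> * (exp (\<delta> * \<rho>) * ((\<integral>x. u2 x \<partial>\<mu>') * (\<integral>y. v2 y \<partial>\<mu>) * I / mass))"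
      by (simp add: Lim_def \<beta>_def \<alpha>_def exp_minus field_simps)
    finally have "\<beta> * (exp (- \<delta> * T) * window_sum u v T) \<le> \<beta> * (exp (\<delta> * \<rho>) * ((\<integral>x. u2 x \<partial>\<mu>') * (\<integral>y. v2 y \<partial>\<mu>) * I / mass) + \<rho>)"
      by (simp add: distrib_left)
    then have "exp (- \<delta> * T) * window_sum u v T \<le> exp (\<delta> * \<rho>) * ((\<integral>x. u2 x \<partial>\<mu>') * (\<integral>y. v2 y \<partial>\<mu>) * I / mass) + \<rho>"
      using \<beta> by (simp only: mult_le_cancel_left_pos)
    also have "\<dots> \<le> exp (\<delta> * \<rho>) * (((\<integral>x. u x \<partial>\<mu>') + \<rho>) * ((\<integral>y. v y \<partial>\<mu>) + \<rho>) * ((exp (\<delta> * b) - exp (\<delta> * a)) / \<delta>) / mass) + \<rho>"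
    proof -
      have "(\<integral>x. u2 x \<partial>\<mu>') \<le> (\<integral>x. u x + \<rho> \<partial>\<mu>')"
        using nc'(1)[OF u2(1,2)] nc'(1)[OF u(1,2)] u2' by (intro integral_mono) auto
      also have "\<dots> = (\<integral>x. u x \<partial>\<mu>') + \<rho>" using nc'(1)[OF u(1,2)] by (simp add: P'.prob_space)
      finally have 1: "(\<integral>x. u2 x \<partial>\<mu>') \<le> (\<integral>x. u x \<partial>\<mu>') + \<rho>" .
      have "(\<integral>x. v2 x \<partial>\<mu>) \<le> (\<integral>x. v x + \<rho> \<partial>\<mu>)"
        using nc(1)[OF v2(1,2)] nc(1)[OF v(1,2)] v2' by (intro integral_mono) auto
      also have "\<dots> = (\<integral>x. v x \<partial>\<mu>) + \<rho>" using nc(1)[OF v(1,2)] by (simp add: P.prob_space)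
      finally have 2: "(\<integral>x. v2 x \<partial>\<mu>) \<le> (\<integral>x. v x \<partial>\<mu>) + \<rho>" .
      have "(\<integral>x. u2 x \<partial>\<mu>') * (\<integral>y. v2 y \<partial>\<mu>) * I \<le> ((\<integral>x. u x \<partial>\<mu>') + \<rho>) * ((\<integral>y. v y \<partial>\<mu>) + \<rho>) * ((exp (\<delta> * b) - exp (\<delta> * a)) / \<delta>)"
        using 1 2 I nc'(3)[OF u2(1,2)] nc(3)[OF v2(1,2)] by (intro mult_mono) auto
      then show ?thesis by (intro add_right_mono mult_left_mono divide_right_mono) auto
    qed
    finally show ?case by (simp add: a_def b_def)
  qed
qed

text \<open>The correlation of slightly reduced functions is at most the weight times constants, and it vanishes
  unless the shifted period lies in the window. An element that is not well approximated contributes only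
  if it belongs to a finite set, and then only for bounded \<open>T\<close>.\<close>

lemma window_lower_bound:
  assumes \<rho>: "\<rho> > 0" "\<rho> < 1/8"
  shows "\<forall>\<^sub>F T in at_top. exp (- \<delta> * \<rho>) * (max 0 ((\<integral>x. u x \<partial>\<mu>') - \<rho>) * max 0 ((\<integral>y. v y \<partial>\<mu>) - \<rho>) *
       ((exp (\<delta> * (- 3 * \<rho>)) - exp (\<delta> * (- 1 + 3 * \<rho>))) / \<delta>) / mass) - \<rho> \<le> exp (- \<delta> * T) * window_sum u v T"
proof -
  obtain u1 \<eta>1 where u1: "continuous_on UNIV u1" "\<And>x. 0 \<le> u1 x" "\<And>x. u1 x \<noteq> 0 \<Longrightarrow> u x \<noteq> 0"
    and u1': "\<And>x. u x - \<rho> \<le> u1 x" and \<eta>1: "\<eta>1 > 0" "\<And>x z. 0 \<le> u z \<Longrightarrow> dist x z < \<eta>1 \<Longrightarrow> u1 x \<le> u z"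
    using reduced_function[OF u(1) \<rho>(1)] by blast
  obtain v1 \<eta>2 where v1: "continuous_on UNIV v1" "\<And>x. 0 \<le> v1 x" "\<And>x. v1 x \<noteq> 0 \<Longrightarrow> v x \<noteq> 0"
    and v1': "\<And>x. v x - \<rho> \<le> v1 x" and \<eta>2: "\<eta>2 > 0" "\<And>x z. 0 \<le> v z \<Longrightarrow> dist x z < \<eta>2 \<Longrightarrow> v1 x \<le> v z"
    using reduced_function[OF v(1) \<rho>(1)] by blast
  have u1A: "u1 x \<noteq> 0 \<Longrightarrow> x \<in> A" for x using u1(3) u(3) by blast
  have v1B: "v1 x \<noteq> 0 \<Longrightarrow> x \<in> B" for x using v1(3) v(3) by blast
  define \<eta> where "\<eta> = min \<rho> (min \<eta>1 \<eta>2)"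
  have \<eta>: "\<eta> > 0" "\<eta> \<le> \<rho>" "\<eta> \<le> \<eta>1" "\<eta> \<le> \<eta>2" using \<rho> \<eta>1 \<eta>2 by (auto simp: \<eta>_def)
  \<comment> \<open>Now the support of the trapezoid, widened by the same two margins, must stay inside \<open>[-1, 0]\<close>.\<close>
  define a b where "a = - 1 + 2 * \<rho>" and "b = - 2 * \<rho>"
  obtain \<kappa> where \<kappa>: "\<kappa> > 0" "(\<integral>\<^sup>+s. ennreal (tent \<rho> s) \<partial>lborel) = ennreal \<kappa>" by (rule tent_integral[OF \<rho>(1)])
  have abr: "a + \<rho> \<le> b - \<rho>" using \<rho> by (simp add: a_def b_def)
  obtain I where I: "(exp (\<delta> * (b - \<rho>)) - exp (\<delta> * (a + \<rho>))) / \<delta> \<le> I" "0 \<le> I"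
    "(\<integral>\<^sup>+s. ennreal (exp (\<delta> * s) * trapezoid a b \<rho> s) \<partial>lborel) = ennreal I"
    by (rule trapezoid_exp_integral[OF delta_positive \<rho>(1) abr]) blast
  define corr where "corr \<gamma> T = correlation u1 v0 u0 v1 (tent \<rho>) (\<lambda>s. exp (\<delta> * s) * trapezoid a b \<rho> s) \<gamma> T" for \<gamma> T
  define \<alpha> where "\<alpha> = (\<integral>x. u0 x \<partial>\<mu>') * (\<integral>y. v0 y \<partial>\<mu>)"
  have \<alpha>: "\<alpha> > 0" using pos by (simp add: \<alpha>_def)
  define Lim where "Lim = (\<integral>x. u1 x \<partial>\<mu>') * (\<integral>y. v0 y \<partial>\<mu>) * \<kappa> * ((\<integral>x. u0 x \<partial>\<mu>') * (\<integral>y. v1 y \<partial>\<mu>) * I) / mass"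
  have lim: "((\<lambda>T. \<integral>\<^sup>+\<gamma>. corr \<gamma> T \<partial>count_space \<Gamma>) \<longlongrightarrow> ennreal Lim) at_top"
    unfolding corr_def Lim_def
    by (rule correlation_limit[OF u1(1,2) u1A v0 u0 v1(1,2) v1B cl(1,4) disj(1) cl(3,2) disj(2) \<rho>(1) \<kappa>(2) less_imp_le[OF \<kappa>(1)] I(3,2)])
  note nc = nn_integral_continuous[OF sets_PS(3,1)] and nc' = nn_integral_continuous[OF sets_PS(4,2)]
  interpret P: prob_space \<mu> by (rule sets_PS)
  interpret P': prob_space \<mu>' by (rule sets_PS)
  have Lim0: "0 \<le> Lim" unfolding Lim_def
    using nc(3)[OF v0(1,2)] nc(3)[OF v1(1,2)] nc'(3)[OF u0(1,2)] nc'(3)[OF u1(1,2)] \<kappa> I by simp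
  have uv1: "u1 x * v0 x = 0" for x using u1A v0(3) disj(1) by (metis IntI emptyE mult_eq_0_iff)
  note mb = borel_measurable_continuous_onI and tz = tent_props(1,2)[OF \<rho>(1)] trapezoid_props(1,2)[OF \<rho>(1)]
  have corr_le: "corr \<gamma> T \<le> (\<integral>\<^sup>+x. ennreal (u0 x) \<partial>\<mu>') * (\<integral>\<^sup>+y. ennreal (v0 y) \<partial>\<mu>) * c"
    if "\<gamma> \<in> \<Gamma>" and le: "\<And>x y. u0 (\<gamma> x) \<noteq> 0 \<Longrightarrow> v0 y \<noteq> 0 \<Longrightarrow>
       ennreal (u1 x * v1 (\<gamma> y) * exp (- \<delta> * T)) * overlap (tent \<rho>) (trapezoid a b \<rho>) (G (x, y) + \<sigma> \<gamma> y - T) \<le> c" for \<gamma> T c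
    unfolding corr_def
  proof (rule correlation_bounds(2)[OF that(1) mb[OF u1(1)] u1(2) mb[OF v0(1)] v0(2) uv1 mb[OF u0(1)] u0(2) mb[OF v1(1)] v1(2)
        mb[OF tz(1)] tz(2) mb[OF tz(3)] tz(4)])
    fix x y assume "u0 (\<gamma> x) \<noteq> 0" "v0 y \<noteq> 0"
    then show "ennreal (u1 x * v1 (\<gamma> y) * exp (- \<delta> * T)) * overlap (tent \<rho>) (trapezoid a b \<rho>) (G (x, y) + \<sigma> \<gamma> y - T) \<le> c"
      by (rule le)
  qed
  have ov0: "overlap (tent \<rho>) (trapezoid a b \<rho>) \<tau> = 0" if "\<not> (a - \<rho> \<le> \<tau> \<and> \<tau> \<le> b + \<rho>)" for \<tau>
    by (rule overlap_tent_trapezoid(2)[OF \<rho>(1) \<kappa>(2) that])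
  have ov1: "overlap (tent \<rho>) (trapezoid a b \<rho>) \<tau> \<le> ennreal (exp (\<delta> * \<rho>)) * ennreal \<kappa>" for \<tau>
    by (rule overlap_tent_trapezoid(1)[OF \<rho>(1) \<kappa>(2)])
  have wn: "0 \<le> weight u v \<gamma>" for \<gamma> using u v by (simp add: weight_def)
  define N where "N T = {\<gamma>\<in>carriers u v. T - 1 < shifted_period \<gamma> \<and> shifted_period \<gamma> \<le> T}" for T
  have bnd: "corr \<gamma> T \<le> (if \<gamma> \<in> N T then ennreal (\<alpha> * exp (\<delta> * \<rho>) * \<kappa> * exp (- \<delta> * T) * weight u v \<gamma>) else 0)"
    if \<gamma>: "\<gamma> \<in> \<Gamma>" "well_approximated \<eta> A0 B0 \<gamma>" for \<gamma> T
  proof -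
    define c where "c = (if \<gamma> \<in> N T then ennreal (weight u v \<gamma> * exp (- \<delta> * T)) * (ennreal (exp (\<delta> * \<rho>)) * ennreal \<kappa>) else 0)"
    have "corr \<gamma> T \<le> (\<integral>\<^sup>+x. ennreal (u0 x) \<partial>\<mu>') * (\<integral>\<^sup>+y. ennreal (v0 y) \<partial>\<mu>) * c"
    proof (rule corr_le[OF \<gamma>(1)])
      fix x y assume "u0 (\<gamma> x) \<noteq> 0" "v0 y \<noteq> 0"
      then have xy: "\<gamma> x \<in> A0" "y \<in> B0" using u0 v0 by auto
      then have ap: "dist x (repelling \<gamma>) < \<eta>" "dist (\<gamma> y) (attracting \<gamma>) < \<eta>"
        "\<bar>G (x, y) + \<sigma> \<gamma> y - shifted_period \<gamma>\<bar> < \<eta>" "loxodromic \<gamma>" using \<gamma>(2) unfolding well_approximated_def by blast+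
      have le1: "u1 x \<le> u (repelling \<gamma>)" "v1 (\<gamma> y) \<le> v (attracting \<gamma>)"
        using \<eta>1(2)[of "repelling \<gamma>" x] \<eta>2(2)[of "attracting \<gamma>" "\<gamma> y"] ap \<eta> u v by auto
      have le2: "u1 x * v1 (\<gamma> y) \<le> weight u v \<gamma>"
        unfolding weight_def using le1 u1 v1 u v by (intro mult_mono) auto
      show "ennreal (u1 x * v1 (\<gamma> y) * exp (- \<delta> * T)) * overlap (tent \<rho>) (trapezoid a b \<rho>) (G (x, y) + \<sigma> \<gamma> y - T) \<le> c"
      proof (cases "\<gamma> \<in> N T")
        case True
        have "ennreal (u1 x * v1 (\<gamma> y) * exp (- \<delta> * T)) \<le> ennreal (weight u v \<gamma> * exp (- \<delta> * T))"
          using le2 by (intro ennreal_leI mult_right_mono) auto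
        then show ?thesis using True ov1 unfolding c_def by (simp add: mult_mono)
      next
        case False
        have "weight u v \<gamma> = 0 \<or> \<not> (T - 1 < shifted_period \<gamma> \<and> shifted_period \<gamma> \<le> T)"
          using False \<gamma>(1) ap(4) by (auto simp: N_def carriers_def weight_def)
        then show ?thesis
        proof
          assume "weight u v \<gamma> = 0"
          moreover have "0 \<le> u1 x * v1 (\<gamma> y)" using u1 v1 by simp
          ultimately have "u1 x * v1 (\<gamma> y) = 0" using le2 by linarith
          then show ?thesis by auto
        next
          assume "\<not> (T - 1 < shifted_period \<gamma> \<and> shifted_period \<gamma> \<le> T)"
          then have "\<not> (a - \<rho> \<le> G (x, y) + \<sigma> \<gamma> y - T \<and> G (x, y) + \<sigma> \<gamma> y - T \<le> b + \<rho>)"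
            using ap(3) \<eta> unfolding a_def b_def by linarith
          then show ?thesis using ov0 by simp
        qed
      qed
    qed
    also have "(\<integral>\<^sup>+x. ennreal (u0 x) \<partial>\<mu>') * (\<integral>\<^sup>+y. ennreal (v0 y) \<partial>\<mu>) * c =
      (if \<gamma> \<in> N T then ennreal (\<alpha> * exp (\<delta> * \<rho>) * \<kappa> * exp (- \<delta> * T) * weight u v \<gamma>) else 0)"
      using wn[of \<gamma>] \<kappa> pos by (simp add: nc(2)[OF v0(1,2)] nc'(2)[OF u0(1,2)] c_def \<alpha>_def ennreal_mult[symmetric] ac_simps del: ennreal_mult' ennreal_mult'')
    finally show ?thesis .
  qed
  obtain CG where CG: "\<And>x y. x \<in> A \<Longrightarrow> y \<in> B0 \<Longrightarrow> \<bar>G (x, y)\<bar> \<le> CG" by (rule G_bounded[OF cl(1,4) disj(1)]) blast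
  \<comment> \<open>A nonzero overlap at a time \<open>T > 0\<close> forces \<open>G(x,y) + \<sigma>(\<gamma>,y) > -1\<close>, which gives the lower bound
    on \<open>\<sigma>\<close> that excludes elements contracting backwards.\<close>
  define E where "E = {\<gamma>\<in>\<Gamma>. (\<exists>x\<in>A. \<exists>y\<in>B0. \<gamma> x \<in> A0 \<and> \<gamma> y \<in> B \<and> (- 1 - CG) \<le> \<sigma> \<gamma> y) \<and> \<not> well_approximated \<eta> A0 B0 \<gamma>}"
  have finE: "finite E" unfolding E_def
    by (rule finite_not_well_approximated(2)[OF cl(1,3,2,4) disj \<eta>(1)])
  have "\<exists>C. \<forall>y. \<bar>\<sigma> \<gamma> y\<bar> \<le> C" if "\<gamma> \<in> \<Gamma>" for \<gamma> by (rule cocycle_bounded[OF that]) blast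
  then obtain C\<sigma> where C\<sigma>: "\<And>\<gamma> y. \<gamma> \<in> \<Gamma> \<Longrightarrow> \<bar>\<sigma> \<gamma> y\<bar> \<le> C\<sigma> \<gamma>" by metis
  have zero: "corr \<gamma> T = 0" if \<gamma>: "\<gamma> \<in> \<Gamma>" "\<not> well_approximated \<eta> A0 B0 \<gamma>"
    and T: "0 < T" "\<gamma> \<in> E \<longrightarrow> CG + C\<sigma> \<gamma> + 1 < T" for \<gamma> T
  proof -
    have "corr \<gamma> T \<le> (\<integral>\<^sup>+x. ennreal (u0 x) \<partial>\<mu>') * (\<integral>\<^sup>+y. ennreal (v0 y) \<partial>\<mu>) * 0"
    proof (rule corr_le[OF \<gamma>(1)])
      fix x y assume "u0 (\<gamma> x) \<noteq> 0" "v0 y \<noteq> 0"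
      then have xy: "\<gamma> x \<in> A0" "y \<in> B0" using u0 v0 by auto
      show "ennreal (u1 x * v1 (\<gamma> y) * exp (- \<delta> * T)) * overlap (tent \<rho>) (trapezoid a b \<rho>) (G (x, y) + \<sigma> \<gamma> y - T) \<le> 0"
      proof (cases "u1 x * v1 (\<gamma> y) = 0")
        case False
        then have in': "x \<in> A" "\<gamma> y \<in> B" using u1A v1B by auto
        have "\<not> a - \<rho> \<le> G (x, y) + \<sigma> \<gamma> y - T"
        proof
          assume le: "a - \<rho> \<le> G (x, y) + \<sigma> \<gamma> y - T"
          have "- 1 - CG \<le> \<sigma> \<gamma> y" using le CG[OF in'(1) xy(2)] T(1) \<rho> by (simp add: a_def)
          then have "\<gamma> \<in> E" unfolding E_def using \<gamma> xy in' by blast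
          then have "CG + C\<sigma> \<gamma> + 1 < T" using T(2) by simp
          then show False using le CG[OF in'(1) xy(2)] C\<sigma>[OF \<gamma>(1), of y] \<rho> by (simp add: a_def)
        qed
        then show ?thesis using ov0 by simp
      qed auto
    qed
    then show ?thesis by simp
  qed
  define \<beta> where "\<beta> = \<alpha> * exp (\<delta> * \<rho>) * \<kappa>"
  have \<beta>: "\<beta> > 0" using \<alpha> \<kappa> by (simp add: \<beta>_def)
  have ev: "\<forall>\<^sub>F T in at_top. Lim - \<beta> * \<rho> < 0 \<or> ennreal (Lim - \<beta> * \<rho>) < (\<integral>\<^sup>+\<gamma>. corr \<gamma> T \<partial>count_space \<Gamma>)"
  proof (cases "Lim - \<beta> * \<rho> < 0")
    case False
    have "0 < \<beta> * \<rho>" using \<beta> \<rho> by simp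
    with False have "ennreal (Lim - \<beta> * \<rho>) < ennreal Lim" by (intro ennreal_lessI) linarith+
    from order_tendstoD(1)[OF lim this] show ?thesis by (rule eventually_mono) simp
  qed simp
  from ev eventually_beyond_finite[OF finE, of "\<lambda>\<gamma>. CG + C\<sigma> \<gamma> + 1"] eventually_gt_at_top[of "0::real"]
  show ?thesis
  proof eventually_elim
    case (elim T)
    have finN: "finite (N T)" unfolding N_def
      by (rule finite_subset[OF _ finite_carriers(1)[OF u(3) v(3) cl(1,2) disj(3), where T = T]]) auto
    have NG: "N T \<subseteq> \<Gamma>" by (auto simp: N_def carriers_def)
    have "(\<integral>\<^sup>+\<gamma>. corr \<gamma> T \<partial>count_space \<Gamma>) \<le>
        (\<integral>\<^sup>+\<gamma>. (if \<gamma> \<in> N T then ennreal (\<beta> * exp (- \<delta> * T) * weight u v \<gamma>) else 0) \<partial>count_space \<Gamma>)"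
    proof (rule nn_integral_mono)
      fix \<gamma> assume "\<gamma> \<in> space (count_space \<Gamma>)"
      then have "\<gamma> \<in> \<Gamma>" by simp
      then show "corr \<gamma> T \<le> (if \<gamma> \<in> N T then ennreal (\<beta> * exp (- \<delta> * T) * weight u v \<gamma>) else 0)"
        using bnd[of \<gamma> T] zero[of \<gamma> T] elim by (cases "well_approximated \<eta> A0 B0 \<gamma>") (auto simp: \<beta>_def)
    qed
    also have "\<dots> = (\<Sum>\<gamma>\<in>N T. (if \<gamma> \<in> N T then ennreal (\<beta> * exp (- \<delta> * T) * weight u v \<gamma>) else 0))"
      by (rule nn_integral_count_space'[OF finN _ NG]) auto
    also have "\<dots> = (\<Sum>\<gamma>\<in>N T. ennreal (\<beta> * exp (- \<delta> * T) * weight u v \<gamma>))" by (intro sum.cong) auto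
    also have "\<dots> = ennreal (\<beta> * (exp (- \<delta> * T) * window_sum u v T))"
      using \<beta> wn by (subst sum_ennreal) (auto simp: window_sum_def N_def sum_distrib_left mult.assoc)
    finally have le: "(\<integral>\<^sup>+\<gamma>. corr \<gamma> T \<partial>count_space \<Gamma>) \<le> ennreal (\<beta> * (exp (- \<delta> * T) * window_sum u v T))" .
    have W0: "0 \<le> window_sum u v T" unfolding window_sum_def by (intro sum_nonneg wn)
    have "Lim - \<beta> * \<rho> \<le> \<beta> * (exp (- \<delta> * T) * window_sum u v T)"
    proof (cases "Lim - \<beta> * \<rho> < 0")
      case True
      have "0 \<le> \<beta> * (exp (- \<delta> * T) * window_sum u v T)" using \<beta> W0 by simp
      then show ?thesis using True by linarith
    next
      case False
      then have "ennreal (Lim - \<beta> * \<rho>) < (\<integral>\<^sup>+\<gamma>. corr \<gamma> T \<partial>count_space \<Gamma>)" using elim(1) by simp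
      also note le
      finally show ?thesis using False by (subst (asm) ennreal_less_iff) auto
    qed
    moreover have "Lim = \<beta> * (exp (- \<delta> * \<rho>) * ((\<integral>x. u1 x \<partial>\<mu>') * (\<integral>y. v1 y \<partial>\<mu>) * I / mass))"
      by (simp add: Lim_def \<beta>_def \<alpha>_def exp_minus field_simps)
    ultimately have "\<beta> * (exp (- \<delta> * \<rho>) * ((\<integral>x. u1 x \<partial>\<mu>') * (\<integral>y. v1 y \<partial>\<mu>) * I / mass) - \<rho>) \<le> \<beta> * (exp (- \<delta> * T) * window_sum u v T)"
      by (simp add: right_diff_distrib)
    then have "exp (- \<delta> * \<rho>) * ((\<integral>x. u1 x \<partial>\<mu>') * (\<integral>y. v1 y \<partial>\<mu>) * I / mass) - \<rho> \<le> exp (- \<delta> * T) * window_sum u v T"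
      using \<beta> by (simp only: mult_le_cancel_left_pos)
    moreover have "exp (- \<delta> * \<rho>) * (max 0 ((\<integral>x. u x \<partial>\<mu>') - \<rho>) * max 0 ((\<integral>y. v y \<partial>\<mu>) - \<rho>) *
       ((exp (\<delta> * (b - \<rho>)) - exp (\<delta> * (a + \<rho>))) / \<delta>) / mass) - \<rho>
       \<le> exp (- \<delta> * \<rho>) * ((\<integral>x. u1 x \<partial>\<mu>') * (\<integral>y. v1 y \<partial>\<mu>) * I / mass) - \<rho>"
    proof -
      have "(\<integral>x. u x - \<rho> \<partial>\<mu>') \<le> (\<integral>x. u1 x \<partial>\<mu>')"
        using nc'(1)[OF u1(1,2)] nc'(1)[OF u(1,2)] u1' by (intro integral_mono) auto
      then have 1: "max 0 ((\<integral>x. u x \<partial>\<mu>') - \<rho>) \<le> (\<integral>x. u1 x \<partial>\<mu>')"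
        using nc'(1)[OF u(1,2)] nc'(3)[OF u1(1,2)] by (simp add: P'.prob_space)
      have "(\<integral>x. v x - \<rho> \<partial>\<mu>) \<le> (\<integral>x. v1 x \<partial>\<mu>)"
        using nc(1)[OF v1(1,2)] nc(1)[OF v(1,2)] v1' by (intro integral_mono) auto
      then have 2: "max 0 ((\<integral>x. v x \<partial>\<mu>) - \<rho>) \<le> (\<integral>x. v1 x \<partial>\<mu>)"
        using nc(1)[OF v(1,2)] nc(3)[OF v1(1,2)] by (simp add: P.prob_space)
      have pI: "0 \<le> (exp (\<delta> * (b - \<rho>)) - exp (\<delta> * (a + \<rho>))) / \<delta>"
        using abr delta_positive by (simp add: mult_left_mono)
      have "max 0 ((\<integral>x. u x \<partial>\<mu>') - \<rho>) * max 0 ((\<integral>y. v y \<partial>\<mu>) - \<rho>) * ((exp (\<delta> * (b - \<rho>)) - exp (\<delta> * (a + \<rho>))) / \<delta>)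
         \<le> (\<integral>x. u1 x \<partial>\<mu>') * (\<integral>y. v1 y \<partial>\<mu>) * I"
        using 1 2 I pI nc'(3)[OF u1(1,2)] nc(3)[OF v1(1,2)] by (intro mult_mono) auto
      then show ?thesis by (intro diff_right_mono mult_left_mono divide_right_mono) auto
    qed
    moreover have "b - \<rho> = - 3 * \<rho>" "a + \<rho> = - 1 + 3 * \<rho>" by (simp_all add: a_def b_def)
    ultimately show ?case by (simp only:)
  qed
qed

lemma window_limit:
  "((\<lambda>T. exp (- \<delta> * T) * window_sum u v T) \<longlongrightarrow>
     (\<integral>x. u x \<partial>\<mu>') * (\<integral>y. v y \<partial>\<mu>) * ((1 - exp (- \<delta>)) / \<delta>) / mass) at_top"
proof -
  let ?l = "(\<integral>x. u x \<partial>\<mu>') * (\<integral>y. v y \<partial>\<mu>) * ((1 - exp (- \<delta>)) / \<delta>) / mass"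
  define Up where "Up \<rho> = exp (\<delta> * \<rho>) * (((\<integral>x. u x \<partial>\<mu>') + \<rho>) * ((\<integral>y. v y \<partial>\<mu>) + \<rho>) *
       ((exp (\<delta> * (3 * \<rho>)) - exp (\<delta> * (- 1 - 3 * \<rho>))) / \<delta>) / mass) + \<rho>" for \<rho>
  define Lo where "Lo \<rho> = exp (- \<delta> * \<rho>) * (max 0 ((\<integral>x. u x \<partial>\<mu>') - \<rho>) * max 0 ((\<integral>y. v y \<partial>\<mu>) - \<rho>) *
       ((exp (\<delta> * (- 3 * \<rho>)) - exp (\<delta> * (- 1 + 3 * \<rho>))) / \<delta>) / mass) - \<rho>" for \<rho>
  have n: "0 \<le> (\<integral>x. u x \<partial>\<mu>')" "0 \<le> (\<integral>y. v y \<partial>\<mu>)" using u v by simp_all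
  have cU: "isCont Up 0"
  proof (cases "mass = 0")
    case True then show ?thesis unfolding Up_def[abs_def] by (simp add: continuous_ident)
  next
    case False then show ?thesis unfolding Up_def[abs_def] using delta_positive by (intro continuous_intros) auto
  qed
  have cL: "isCont Lo 0"
  proof (cases "mass = 0")
    case True then show ?thesis unfolding Lo_def[abs_def] by (simp add: continuous_ident continuous_minus)
  next
    case False then show ?thesis unfolding Lo_def[abs_def] using delta_positive by (intro continuous_intros) auto
  qed
  have U0: "Up 0 = ?l" and L0: "Lo 0 = ?l" using n by (simp_all add: Up_def Lo_def)
  show ?thesis
  proof (rule tendstoI)
    fix e :: real assume e: "e > 0"
    have 1: "\<forall>\<^sub>F \<rho> in at_right 0. dist (Up \<rho>) ?l < e"
      using tendstoD[OF isContD[OF cU] e] U0 unfolding at_within_def by (auto simp: eventually_inf_principal eventually_at_filter elim: eventually_mono)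
    have 2: "\<forall>\<^sub>F \<rho> in at_right 0. dist (Lo \<rho>) ?l < e"
      using tendstoD[OF isContD[OF cL] e] L0 by (auto simp: eventually_at_filter elim: eventually_mono)
    have 3: "\<forall>\<^sub>F \<rho>::real in at_right 0. 0 < \<rho> \<and> \<rho> < 1/8"
      by (rule eventually_at_rightI[of 0 "1/8"]) auto
    obtain \<rho> where \<rho>: "dist (Up \<rho>) ?l < e" "dist (Lo \<rho>) ?l < e" "0 < \<rho>" "\<rho> < 1/8"
      using eventually_happens[OF eventually_conj[OF 1 eventually_conj[OF 2 3]]] by auto
    from window_upper_bound[OF \<rho>(3)] window_lower_bound[OF \<rho>(3,4)]
    show "\<forall>\<^sub>F T in at_top. dist (exp (- \<delta> * T) * window_sum u v T) ?l < e"
    proof eventually_elim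
      case (elim T)
      show ?case using elim \<rho>(1,2) unfolding dist_real_def Up_def[symmetric] Lo_def[symmetric] by linarith
    qed
  qed
qed

end

section \<open>From windows to periods\<close>

text \<open>The error \<open>r(T) = q(T) - l\<close> satisfies \<open>r(T) = c r(T-1)\<close> up to small terms; iterating down to a fixed
  unit interval, where \<open>r\<close> is bounded, makes it small.\<close>

lemma geometric_recursion_limit:
  fixes q :: "real \<Rightarrow> real"
  assumes c: "0 \<le> c" "c < 1"
    and lim: "((\<lambda>T. q T - c * q (T - 1)) \<longlongrightarrow> (1 - c) * l) at_top"
    and bdd: "\<And>a. \<exists>M. \<forall>T. a \<le> T \<and> T \<le> a + 1 \<longrightarrow> \<bar>q T\<bar> \<le> M"
  shows "(q \<longlongrightarrow> l) at_top"
proof (rule tendstoI)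
  fix e :: real assume e: "e > 0"
  define e' where "e' = (1 - c) * e / 2"
  have e': "e' > 0" using e c by (simp add: e'_def)
  define r where "r T = q T - l" for T
  from tendstoD[OF lim e'] obtain T0 where T0: "\<And>T. T \<ge> T0 \<Longrightarrow> \<bar>r T - c * r (T - 1)\<bar> < e'"
    by (auto simp: eventually_at_top_linorder dist_real_def r_def algebra_simps)
  obtain M0 where "\<forall>T. T0 - 1 \<le> T \<and> T \<le> T0 - 1 + 1 \<longrightarrow> \<bar>q T\<bar> \<le> M0" using bdd by blast
  then have "\<bar>r T\<bar> \<le> M0 + \<bar>l\<bar>" if "T0 - 1 \<le> T" "T \<le> T0" for T
    using that by (force simp: r_def)
  then obtain M where M: "\<And>T. T0 - 1 \<le> T \<Longrightarrow> T \<le> T0 \<Longrightarrow> \<bar>r T\<bar> \<le> M" by blast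
  have step: "\<bar>r T\<bar> \<le> c ^ n * M + e / 2" if "T0 - 1 + real n \<le> T" "T \<le> T0 + real n" for n T
    using that
  proof (induction n arbitrary: T)
    case 0
    then show ?case using M[of T] e by simp
  next
    case (Suc n)
    then have "\<bar>r (T - 1)\<bar> \<le> c ^ n * M + e / 2" by (intro Suc.IH) auto
    then have "c * \<bar>r (T - 1)\<bar> \<le> c * (c ^ n * M + e / 2)" using c by (intro mult_left_mono) auto
    moreover have "\<bar>r T\<bar> \<le> \<bar>r T - c * r (T - 1)\<bar> + c * \<bar>r (T - 1)\<bar>"
      using c abs_triangle_ineq[of "r T - c * r (T - 1)" "c * r (T - 1)"] by (simp add: abs_mult)
    moreover have "\<bar>r T - c * r (T - 1)\<bar> < e'" using Suc.prems by (intro T0) auto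
    ultimately show ?case by (simp add: e'_def field_simps)
  qed
  have "(\<lambda>n. c ^ n * M) \<longlonglongrightarrow> 0 * M" using c by (intro tendsto_mult LIMSEQ_power_zero) auto
  then have "(\<lambda>n. c ^ n * M) \<longlonglongrightarrow> 0" by simp
  from tendstoD[OF this, of "e/2"] e have "\<forall>\<^sub>F n in sequentially. dist (c ^ n * M) 0 < e / 2" by simp
  then obtain n0 where n0: "\<And>n. n \<ge> n0 \<Longrightarrow> c ^ n * M < e / 2"
    by (force simp: eventually_sequentially dist_real_def)
  show "\<forall>\<^sub>F T in at_top. dist (q T) l < e"
    unfolding eventually_at_top_linorder
  proof (intro exI allI impI)
    fix T assume T: "T0 + real n0 \<le> T"
    define n where "n = nat \<lfloor>T - T0 + 1\<rfloor>"
    have n: "T0 - 1 + real n \<le> T" "T \<le> T0 + real n" using T unfolding n_def by linarith+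
    have "n \<ge> n0" using T unfolding n_def by linarith
    then have "\<bar>r T\<bar> < e" using step[OF n] n0[of n] by simp
    then show "dist (q T) l < e" by (simp add: r_def dist_real_def)
  qed
qed

context counting_box begin

definition shifted_count :: "real \<Rightarrow> real" where
  "shifted_count T = (\<Sum>\<gamma>\<in>{\<gamma>\<in>carriers u v. shifted_period \<gamma> \<le> T}. weight u v \<gamma>)"

definition box_mass :: real where
  "box_mass = (\<integral>x. u x \<partial>\<mu>') * (\<integral>y. v y \<partial>\<mu>) / mass"

lemma fin_shifted: "finite {\<gamma>\<in>carriers u v. shifted_period \<gamma> \<le> T}"
  by (rule finite_carriers(1)[OF u(3) v(3) cl(1,2) disj(3)])

lemma fin_period: "finite {\<gamma>\<in>carriers u v. period \<sigma> \<gamma> \<le> T}"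
  by (rule finite_carriers(2)[OF u(3) v(3) cl(1,2) disj(3)])

lemma weight_nonneg: "0 \<le> weight u v \<gamma>"
  using u v by (simp add: weight_def)

lemma shifted_count_mono: "S \<le> T \<Longrightarrow> shifted_count S \<le> shifted_count T"
  unfolding shifted_count_def by (rule sum_mono2[OF fin_shifted]) (auto simp: weight_nonneg)

lemma shifted_count_limit:
  "((\<lambda>T. \<delta> * exp (- \<delta> * T) * shifted_count T) \<longlongrightarrow> box_mass) at_top"
proof (rule geometric_recursion_limit[where c = "exp (- \<delta>)"])
  have rec: "\<delta> * exp (- \<delta> * T) * shifted_count T - exp (- \<delta>) * (\<delta> * exp (- \<delta> * (T - 1)) * shifted_count (T - 1))
      = \<delta> * (exp (- \<delta> * T) * window_sum u v T)" for T
  proof -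
    have "{\<gamma>\<in>carriers u v. shifted_period \<gamma> \<le> T} =
       {\<gamma>\<in>carriers u v. shifted_period \<gamma> \<le> T - 1} \<union> {\<gamma>\<in>carriers u v. T - 1 < shifted_period \<gamma> \<and> shifted_period \<gamma> \<le> T}"
      by auto
    moreover have "sum (weight u v) ({\<gamma>\<in>carriers u v. shifted_period \<gamma> \<le> T - 1} \<union> {\<gamma>\<in>carriers u v. T - 1 < shifted_period \<gamma> \<and> shifted_period \<gamma> \<le> T})
       = shifted_count (T - 1) + window_sum u v T"
      unfolding shifted_count_def window_sum_def
      by (rule sum.union_disjoint[OF fin_shifted finite_subset[OF _ fin_shifted[of T]]]) auto
    ultimately have c: "shifted_count T = shifted_count (T - 1) + window_sum u v T"
      by (simp add: shifted_count_def)
    have "exp (- \<delta>) * exp (- \<delta> * (T - 1)) = exp (- \<delta> * T)"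
      by (simp add: exp_add[symmetric] algebra_simps)
    then have eq: "exp (- \<delta>) * (\<delta> * exp (- \<delta> * (T - 1)) * shifted_count (T - 1)) = \<delta> * exp (- \<delta> * T) * shifted_count (T - 1)"
      by (metis (no_types, opaque_lifting) mult.assoc mult.commute)
    show ?thesis by (simp only: c eq) (simp add: algebra_simps)
  qed
  have "((\<lambda>T. \<delta> * (exp (- \<delta> * T) * window_sum u v T)) \<longlongrightarrow> \<delta> * ((\<integral>x. u x \<partial>\<mu>') * (\<integral>y. v y \<partial>\<mu>) * ((1 - exp (- \<delta>)) / \<delta>) / mass)) at_top"
    by (intro tendsto_mult tendsto_const window_limit)
  also have "\<delta> * ((\<integral>x. u x \<partial>\<mu>') * (\<integral>y. v y \<partial>\<mu>) * ((1 - exp (- \<delta>)) / \<delta>) / mass) = (1 - exp (- \<delta>)) * box_mass"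
    using delta_positive by (simp add: box_mass_def)
  finally show "((\<lambda>T. \<delta> * exp (- \<delta> * T) * shifted_count T - exp (- \<delta>) * (\<delta> * exp (- \<delta> * (T - 1)) * shifted_count (T - 1)))
     \<longlongrightarrow> (1 - exp (- \<delta>)) * box_mass) at_top" unfolding rec .
  show "\<exists>M. \<forall>T. a \<le> T \<and> T \<le> a + 1 \<longrightarrow> \<bar>\<delta> * exp (- \<delta> * T) * shifted_count T\<bar> \<le> M" for a
  proof (intro exI allI impI)
    fix T assume T: "a \<le> T \<and> T \<le> a + 1"
    have "0 \<le> shifted_count T" for T unfolding shifted_count_def by (intro sum_nonneg weight_nonneg)
    moreover have "exp (- \<delta> * T) \<le> exp (- \<delta> * a)" using T delta_positive by simp
    ultimately show "\<bar>\<delta> * exp (- \<delta> * T) * shifted_count T\<bar> \<le> \<delta> * exp (- \<delta> * a) * shifted_count (a + 1)"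
      using T delta_positive shifted_count_mono[of T "a + 1"] by (simp add: abs_mult mult_mono)
  qed
qed (use delta_positive in auto)

text \<open>For the counted elements the shifted period differs from the period by \<open>g\<close> up to \<open>\<epsilon>\<close>.\<close>

lemma period_count_bounds:
  assumes G: "\<And>x y. x \<in> A \<Longrightarrow> y \<in> B \<Longrightarrow> \<bar>G (x, y) - g\<bar> \<le> \<epsilon>" and e: "e > 0"
  shows "\<forall>\<^sub>F T in at_top. exp (\<delta> * (g - \<epsilon>)) * box_mass - e \<le>
      \<delta> * exp (- \<delta> * T) * (\<Sum>\<gamma>\<in>{\<gamma>\<in>carriers u v. period \<sigma> \<gamma> \<le> T}. weight u v \<gamma>) \<and>
      \<delta> * exp (- \<delta> * T) * (\<Sum>\<gamma>\<in>{\<gamma>\<in>carriers u v. period \<sigma> \<gamma> \<le> T}. weight u v \<gamma>) \<le> exp (\<delta> * (g + \<epsilon>)) * box_mass + e"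
proof -
  let ?S = "\<lambda>T. \<Sum>\<gamma>\<in>{\<gamma>\<in>carriers u v. period \<sigma> \<gamma> \<le> T}. weight u v \<gamma>"
  have Gc: "\<bar>G (repelling \<gamma>, attracting \<gamma>) - g\<bar> \<le> \<epsilon>" if "\<gamma> \<in> carriers u v" for \<gamma>
    using that u(3) v(3) by (intro G) (auto simp: carriers_def)
  have lim: "((\<lambda>T. \<delta> * exp (- \<delta> * T) * shifted_count (T + s)) \<longlongrightarrow> exp (\<delta> * s) * box_mass) at_top" for s
  proof -
    have "((\<lambda>T. \<delta> * exp (- \<delta> * (T + s)) * shifted_count (T + s)) \<longlongrightarrow> box_mass) at_top"
      by (rule filterlim_compose[OF shifted_count_limit]) (subst add.commute, rule filterlim_tendsto_add_at_top[OF tendsto_const filterlim_ident])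
    then have "((\<lambda>T. exp (\<delta> * s) * (\<delta> * exp (- \<delta> * (T + s)) * shifted_count (T + s))) \<longlongrightarrow> exp (\<delta> * s) * box_mass) at_top"
      by (intro tendsto_mult tendsto_const)
    moreover have eq: "exp (\<delta> * s) * (\<delta> * exp (- \<delta> * (T + s)) * shifted_count (T + s)) = \<delta> * exp (- \<delta> * T) * shifted_count (T + s)" for T
    proof -
      have "exp (\<delta> * s) * exp (- \<delta> * (T + s)) = exp (- \<delta> * T)" by (simp add: exp_add[symmetric] algebra_simps)
      then show ?thesis by (metis (no_types, opaque_lifting) mult.assoc mult.commute)
    qed
    ultimately show ?thesis by (simp only: eq)
  qed
  have lo: "shifted_count (T + (g - \<epsilon>)) \<le> ?S T" for T
    unfolding shifted_count_def
  proof (rule sum_mono2[OF fin_period])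
    show "{\<gamma> \<in> carriers u v. shifted_period \<gamma> \<le> T + (g - \<epsilon>)} \<subseteq> {\<gamma> \<in> carriers u v. period \<sigma> \<gamma> \<le> T}"
    proof clarify
      fix \<gamma> assume "\<gamma> \<in> carriers u v" "shifted_period \<gamma> \<le> T + (g - \<epsilon>)"
      then show "period \<sigma> \<gamma> \<le> T" using Gc[of \<gamma>] unfolding shifted_period_def by linarith
    qed
  qed (rule weight_nonneg)
  have hi: "?S T \<le> shifted_count (T + (g + \<epsilon>))" for T
    unfolding shifted_count_def
  proof (rule sum_mono2[OF fin_shifted])
    show "{\<gamma> \<in> carriers u v. period \<sigma> \<gamma> \<le> T} \<subseteq> {\<gamma> \<in> carriers u v. shifted_period \<gamma> \<le> T + (g + \<epsilon>)}"
    proof clarify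
      fix \<gamma> assume "\<gamma> \<in> carriers u v" "period \<sigma> \<gamma> \<le> T"
      then show "shifted_period \<gamma> \<le> T + (g + \<epsilon>)" using Gc[of \<gamma>] unfolding shifted_period_def by linarith
    qed
  qed (rule weight_nonneg)
  from tendstoD[OF lim[of "g - \<epsilon>"] e] tendstoD[OF lim[of "g + \<epsilon>"] e] show ?thesis
  proof eventually_elim
    case (elim T)
    have "\<delta> * exp (- \<delta> * T) * shifted_count (T + (g - \<epsilon>)) \<le> \<delta> * exp (- \<delta> * T) * ?S T"
      using lo delta_positive by (intro mult_left_mono) auto
    moreover have "\<delta> * exp (- \<delta> * T) * ?S T \<le> \<delta> * exp (- \<delta> * T) * shifted_count (T + (g + \<epsilon>))"
      using hi delta_positive by (intro mult_left_mono) auto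
    ultimately show ?case using elim unfolding dist_real_def by linarith
  qed
qed

end

section \<open>Equidistribution\<close>

context compact_convergence_group begin

text \<open>Otherwise balls of full measure with radii tending to zero would accumulate at a point of full
  measure.\<close>

lemma balls_not_full:
  fixes \<nu> :: "'m measure"
  assumes p: "prob_space \<nu>" and s: "sets \<nu> = sets borel" and nd: "\<And>z. measure \<nu> {z} < 1"
  obtains r where "r > 0" "\<And>z. measure \<nu> (cball z r) < 1"
proof (rule ccontr)
  assume neg: "\<not> thesis"
  note goal = that
  have ex: "\<exists>z. \<not> measure \<nu> (cball z r) < 1" if r: "r > 0" for r using neg goal[OF r] by blast
  interpret prob_space \<nu> by fact
  have "\<forall>n. \<exists>z. measure \<nu> (cball z (inverse (real (Suc n)))) \<ge> 1"
    using ex by (simp add: not_less)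
  then obtain z where z: "\<And>n. measure \<nu> (cball (z n) (inverse (real (Suc n)))) \<ge> 1" by metis
  obtain p r where r: "strict_mono (r::nat\<Rightarrow>nat)" "(\<lambda>n. z (r n)) \<longlonglongrightarrow> p" by (rule convergent_subsequence)
  have one: "1 \<le> measure \<nu> (cball p (inverse (real (Suc k))))" for k
  proof -
    have e: "inverse (real (Suc k)) / 2 > 0" by simp
    have "(\<lambda>n. inverse (real (Suc (r n)))) \<longlonglongrightarrow> 0"
      using LIMSEQ_subseq_LIMSEQ[OF LIMSEQ_inverse_real_of_nat r(1)] by (simp add: o_def)
    from eventually_conj[OF tendstoD[OF this e] tendstoD[OF r(2) e]]
    obtain n where n: "inverse (real (Suc (r n))) < inverse (real (Suc k)) / 2" "dist (z (r n)) p < inverse (real (Suc k)) / 2"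
      by (auto simp: eventually_sequentially dist_real_def)
    have "cball (z (r n)) (inverse (real (Suc (r n)))) \<subseteq> cball p (inverse (real (Suc k)))"
    proof
      fix x assume "x \<in> cball (z (r n)) (inverse (real (Suc (r n))))"
      then have "dist (z (r n)) x \<le> inverse (real (Suc (r n)))" by simp
      then show "x \<in> cball p (inverse (real (Suc k)))"
        using n dist_triangle[of p x "z (r n)"] by (simp add: dist_commute)
    qed
    then have "measure \<nu> (cball (z (r n)) (inverse (real (Suc (r n))))) \<le> measure \<nu> (cball p (inverse (real (Suc k))))"
      by (intro finite_measure_mono) (auto simp: s)
    then show ?thesis using z[of "r n"] by simp
  qed
  have "1 \<le> measure \<nu> {p}"
    by (rule LIMSEQ_le_const[OF measure_cball_tendsto[OF finite_measure_axioms s]]) (use one in auto)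
  then show False using nd[of p] by simp
qed

lemma partition_of_unity:
  assumes \<rho>: "\<rho> > 0"
  shows "\<exists>(Z :: 'm set) (p :: 'm \<Rightarrow> 'm \<Rightarrow> real). finite Z \<and> (\<forall>z. continuous_on UNIV (p z)) \<and>
    (\<forall>z x. 0 \<le> p z x) \<and> (\<forall>z x. p z x \<noteq> 0 \<longrightarrow> x \<in> cball z \<rho>) \<and> (\<forall>x. (\<Sum>z\<in>Z. p z x) = 1)"
proof -
  have cover: "(UNIV :: 'm set) \<subseteq> (\<Union>z\<in>UNIV. ball z \<rho>)" using \<rho> by (auto intro!: exI[of _ _])
  have op: "open (ball z \<rho>)" if "z \<in> UNIV" for z :: 'm by simp
  obtain Z where "Z \<subseteq> (UNIV :: 'm set)" and Z: "finite Z" "UNIV \<subseteq> (\<Union>z\<in>Z. ball z \<rho>)"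
    by (rule compactE_image[OF cpt op cover])
  define b where "b z x = max 0 (\<rho> - dist x z)" for z x :: 'm
  define S where "S x = (\<Sum>z\<in>Z. b z x)" for x
  have cb: "continuous_on UNIV (b z)" for z unfolding b_def[abs_def] by (intro continuous_intros)
  have b0: "0 \<le> b z x" for z x by (simp add: b_def)
  have cS: "continuous_on UNIV S" unfolding S_def[abs_def] by (intro continuous_intros cb)
  have S0: "S x > 0" for x
  proof -
    have "x \<in> (\<Union>z\<in>Z. ball z \<rho>)" using Z(2) by blast
    then obtain z where z: "z \<in> Z" "dist z x < \<rho>" by auto
    then have "0 < b z x" by (simp add: b_def dist_commute)
    also have "\<dots> \<le> S x" unfolding S_def using Z(1) z b0 by (intro member_le_sum) auto
    finally show ?thesis .
  qed
  show ?thesis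
  proof (intro exI[of _ Z] exI[of _ "\<lambda>z x. b z x / S x"] conjI allI impI)
    show "continuous_on UNIV (\<lambda>x. b z x / S x)" for z
      using S0 by (intro continuous_on_divide cb cS) (metis less_irrefl)
    show "0 \<le> b z x / S x" for z x using b0[of z x] S0[of x] by simp
    show "x \<in> cball z \<rho>" if "b z x / S x \<noteq> 0" for z x
      using that by (auto simp: b_def dist_commute max_def split: if_splits)
    show "(\<Sum>z\<in>Z. b z x / S x) = 1" for x
      using S0[of x] by (simp add: sum_divide_distrib[symmetric] S_def[symmetric])
  qed (rule Z(1))
qed

end

context bms_system begin

lemma prob_pair: "prob_space (\<mu>' \<Otimes>\<^sub>M \<mu>)"
proof -
  interpret \<mu>: prob_space \<mu> by (rule sets_PS)
  interpret \<mu>': prob_space \<mu>' by (rule sets_PS)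
  interpret pair_prob_space \<mu>' \<mu> ..
  show ?thesis by (rule prob_space_axioms)
qed

lemma sets_pair: "sets (\<mu>' \<Otimes>\<^sub>M \<mu>) = sets (borel :: ('m \<times> 'm) measure)"
proof -
  have "sets (\<mu>' \<Otimes>\<^sub>M \<mu>) = sets (borel \<Otimes>\<^sub>M borel)"
    by (intro sets_pair_measure_cong) (auto simp: sets_PS)
  then show ?thesis by (simp only: borel_prod)
qed

lemma integral_product:
  assumes u: "continuous_on UNIV (u :: 'm \<Rightarrow> real)" "\<And>x. 0 \<le> u x" and v: "continuous_on UNIV (v :: 'm \<Rightarrow> real)" "\<And>x. 0 \<le> v x"
  shows "integrable (\<mu>' \<Otimes>\<^sub>M \<mu>) (\<lambda>z. u (fst z) * v (snd z))"
    "(\<integral>z. u (fst z) * v (snd z) \<partial>(\<mu>' \<Otimes>\<^sub>M \<mu>)) = (\<integral>x. u x \<partial>\<mu>') * (\<integral>y. v y \<partial>\<mu>)"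
proof -
  interpret \<mu>: prob_space \<mu> by (rule sets_PS)
  interpret \<mu>': prob_space \<mu>' by (rule sets_PS)
  interpret pair_prob_space \<mu>' \<mu> ..
  obtain Cu where Cu: "Cu \<ge> 0" "\<And>x. \<bar>u x\<bar> \<le> Cu" by (rule bounded_continuous[OF u(1)]) blast
  obtain Cv where Cv: "Cv \<ge> 0" "\<And>x. \<bar>v x\<bar> \<le> Cv" by (rule bounded_continuous[OF v(1)]) blast
  have "continuous_on UNIV (\<lambda>z. u (fst z) * v (snd z))"
    by (intro continuous_intros continuous_on_compose2[OF u(1)] continuous_on_compose2[OF v(1)]) auto
  then have m: "(\<lambda>z. u (fst z) * v (snd z)) \<in> borel_measurable (\<mu>' \<Otimes>\<^sub>M \<mu>)"
    unfolding measurable_cong_sets[OF sets_pair refl] by (rule borel_measurable_continuous_onI)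
  show int: "integrable (\<mu>' \<Otimes>\<^sub>M \<mu>) (\<lambda>z. u (fst z) * v (snd z))"
    by (rule P.integrable_const_bound[of _ "Cu * Cv"])
      (use Cu Cv m in \<open>auto simp: abs_mult intro!: mult_mono\<close>)
  have "(\<integral>z. u (fst z) * v (snd z) \<partial>(\<mu>' \<Otimes>\<^sub>M \<mu>)) = (\<integral>x. (\<integral>y. u x * v y \<partial>\<mu>) \<partial>\<mu>')"
    using integral_fst'[OF int] by simp
  then show "(\<integral>z. u (fst z) * v (snd z) \<partial>(\<mu>' \<Otimes>\<^sub>M \<mu>)) = (\<integral>x. u x \<partial>\<mu>') * (\<integral>y. v y \<partial>\<mu>)" by simp
qed

text \<open>Restricting to pairs of fixed points at distance at least \<open>\<kappa>\<close> keeps the sum finite. For functions that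
  vanish on all closer pairs it is the integral against the normalized counting measure.\<close>

definition counting :: "real \<Rightarrow> ('m \<times> 'm \<Rightarrow> real) \<Rightarrow> real \<Rightarrow> real" where
  "counting \<kappa> f T = \<delta> * exp (- \<delta> * T) *
     (\<Sum>\<gamma>\<in>{\<gamma>\<in>\<Gamma>. loxodromic \<gamma> \<and> \<kappa> \<le> dist (repelling \<gamma>) (attracting \<gamma>) \<and> period \<sigma> \<gamma> \<le> T}.
       f (repelling \<gamma>, attracting \<gamma>))"

definition limit_functional :: "('m \<times> 'm \<Rightarrow> real) \<Rightarrow> real" where
  "limit_functional f = (\<integral>z. exp (\<delta> * G z) / mass * f z \<partial>(\<mu>' \<Otimes>\<^sub>M \<mu>))"

lemma closed_far_pairs: "closed {z :: 'm \<times> 'm. \<kappa> \<le> dist (fst z) (snd z)}"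
  by (intro closed_Collect_le continuous_intros)

lemma compact_far_pairs: "compact {z :: 'm \<times> 'm. \<kappa> \<le> dist (fst z) (snd z)}"
  using compact_Int_closed[OF compact_Times[OF cpt cpt] closed_far_pairs] by (simp add: UNIV_Times_UNIV)

lemma far_pairs_distinct: "\<kappa> > 0 \<Longrightarrow> {z :: 'm \<times> 'm. \<kappa> \<le> dist (fst z) (snd z)} \<subseteq> distinct_pairs UNIV"
  by (auto simp: distinct_pairs_def)

lemma finite_counted:
  assumes "\<kappa> > 0"
  shows "finite {\<gamma>\<in>\<Gamma>. loxodromic \<gamma> \<and> \<kappa> \<le> dist (repelling \<gamma>) (attracting \<gamma>) \<and> period \<sigma> \<gamma> \<le> T}"
  by (rule finite_subset[OF _ finite_short_loxodromics[OF compact_far_pairs far_pairs_distinct[OF assms], of T]]) auto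

lemma integrable_weighted_product:
  assumes u: "continuous_on UNIV (u :: 'm \<Rightarrow> real)" "\<And>x. 0 \<le> u x"
    and v: "continuous_on UNIV (v :: 'm \<Rightarrow> real)" "\<And>x. 0 \<le> v x"
    and bd: "\<And>z. u (fst z) * v (snd z) \<noteq> 0 \<Longrightarrow> G z \<le> C"
  shows "integrable (\<mu>' \<Otimes>\<^sub>M \<mu>) (\<lambda>z. exp (\<delta> * G z) / mass * (u (fst z) * v (snd z)))"
proof (rule Bochner_Integration.integrable_bound[OF integrable_mult_right[OF integral_product(1)[OF u v], of "exp (\<delta> * C) / mass"]])
  have "(\<lambda>z. u (fst z) * v (snd z)) \<in> borel_measurable (\<mu>' \<Otimes>\<^sub>M \<mu>)" using integral_product(1)[OF u v] by blast
  moreover have "G \<in> borel_measurable (\<mu>' \<Otimes>\<^sub>M \<mu>)" using G_borel unfolding measurable_cong_sets[OF sets_pair refl] .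
  ultimately show "(\<lambda>z. exp (\<delta> * G z) / mass * (u (fst z) * v (snd z))) \<in> borel_measurable (\<mu>' \<Otimes>\<^sub>M \<mu>)" by measurable
  have "\<bar>exp (\<delta> * G z) / mass * (u (fst z) * v (snd z))\<bar> \<le> \<bar>exp (\<delta> * C) / mass * (u (fst z) * v (snd z))\<bar>" for z
  proof (cases "u (fst z) * v (snd z) = 0")
    case False
    then have "exp (\<delta> * G z) / mass \<le> exp (\<delta> * C) / mass"
      using bd[OF False] delta_positive by (intro divide_right_mono) auto
    then show ?thesis unfolding abs_mult by (intro mult_right_mono) auto
  qed (simp only: mult_zero_right abs_zero order_refl)
  then show "AE z in \<mu>' \<Otimes>\<^sub>M \<mu>. norm (exp (\<delta> * G z) / mass * (u (fst z) * v (snd z)))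
      \<le> norm (exp (\<delta> * C) / mass * (u (fst z) * v (snd z)))" by simp
qed

text \<open>Both numbers lie between \<open>exp (\<delta> (g - \<epsilon>)) / mass\<close> and \<open>exp (\<delta> (g + \<epsilon>)) / mass\<close> times the
  product of the integrals of \<open>u\<close> and \<open>v\<close>, the first one up to \<open>e\<close>.\<close>

lemma product_counting_error:
  fixes A B :: "'m set"
  assumes u: "continuous_on UNIV u" "\<And>x. 0 \<le> u x" "\<And>x. u x \<noteq> 0 \<Longrightarrow> x \<in> A"
    and v: "continuous_on UNIV v" "\<And>x. 0 \<le> v x" "\<And>x. v x \<noteq> 0 \<Longrightarrow> x \<in> B"
    and cl: "closed A" "closed B" and ne: "A \<noteq> {}" "B \<noteq> {}"
    and small: "measure \<mu> A < 1" "measure \<mu>' B < 1"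
    and far: "\<kappa> > 0" "\<And>x y. x \<in> A \<Longrightarrow> y \<in> B \<Longrightarrow> \<kappa> \<le> dist x y"
    and osc: "\<And>x y. x \<in> A \<Longrightarrow> y \<in> B \<Longrightarrow> \<bar>G (x, y) - g\<bar> \<le> \<epsilon>" and e: "e > 0"
  shows "\<forall>\<^sub>F T in at_top. \<bar>counting \<kappa> (\<lambda>z. u (fst z) * v (snd z)) T - limit_functional (\<lambda>z. u (fst z) * v (snd z))\<bar>
     \<le> (exp (\<delta> * (g + \<epsilon>)) - exp (\<delta> * (g - \<epsilon>))) / mass * ((\<integral>x. u x \<partial>\<mu>') * (\<integral>y. v y \<partial>\<mu>)) + e"
proof -
  let ?f = "\<lambda>z. u (fst z) * v (snd z)"
  let ?c = "(\<integral>x. u x \<partial>\<mu>') * (\<integral>y. v y \<partial>\<mu>)"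
  obtain u0 :: "'m \<Rightarrow> real" and A0 where U: "continuous_on UNIV u0 \<and> (\<forall>x. 0 \<le> u0 x) \<and> (\<forall>x. u0 x \<noteq> 0 \<longrightarrow> x \<in> A0) \<and>
      closed A0 \<and> A0 \<inter> B = {} \<and> 0 < (\<integral>x. u0 x \<partial>\<mu>')"
    using bump_off_closed[OF sets_PS(4,2) cl(2) ne(2) small(2)] by (elim exE)
  obtain v0 :: "'m \<Rightarrow> real" and B0 where V: "continuous_on UNIV v0 \<and> (\<forall>x. 0 \<le> v0 x) \<and> (\<forall>x. v0 x \<noteq> 0 \<longrightarrow> x \<in> B0) \<and>
      closed B0 \<and> B0 \<inter> A = {} \<and> 0 < (\<integral>x. v0 x \<partial>\<mu>)"
    using bump_off_closed[OF sets_PS(3,1) cl(1) ne(1) small(1)] by (elim exE)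
  have dj: "A \<inter> B = {}" using far by fastforce
  have dj1: "A \<inter> B0 = {}" using V by auto
  interpret box: counting_box \<Gamma> \<sigma> \<sigma>' G d mag \<delta> \<mu> \<mu>' m u v u0 v0 A B A0 B0
    by unfold_locales (use u v U V cl ne dj dj1 in blast)+
  let ?S = "\<lambda>T. {\<gamma>\<in>carriers u v. period \<sigma> \<gamma> \<le> T}"
  have bmass: "box.box_mass = ?c / mass" by (simp add: box.box_mass_def)
  have N_eq: "counting \<kappa> ?f T = \<delta> * exp (- \<delta> * T) * (\<Sum>\<gamma>\<in>?S T. weight u v \<gamma>)" for T
  proof -
    let ?N = "{\<gamma>\<in>\<Gamma>. loxodromic \<gamma> \<and> \<kappa> \<le> dist (repelling \<gamma>) (attracting \<gamma>) \<and> period \<sigma> \<gamma> \<le> T}"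
    have "(\<Sum>\<gamma>\<in>?N. u (repelling \<gamma>) * v (attracting \<gamma>)) = (\<Sum>\<gamma>\<in>?S T. weight u v \<gamma>)"
      unfolding weight_def
    proof (rule sum.mono_neutral_right[OF finite_counted[OF far(1)]])
      show "?S T \<subseteq> ?N" using u(3) v(3) far(2) by (auto simp: carriers_def)
      show "\<forall>\<gamma>\<in>?N - ?S T. u (repelling \<gamma>) * v (attracting \<gamma>) = 0"
        by (auto simp: carriers_def)
    qed
    then show ?thesis by (simp add: counting_def)
  qed
  have Gb: "g - \<epsilon> \<le> G z \<and> G z \<le> g + \<epsilon>" if "?f z \<noteq> 0" for z
  proof -
    have "fst z \<in> A" "snd z \<in> B" using that u(3) v(3) by auto
    from osc[OF this] show ?thesis by (simp add: abs_le_iff)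
  qed
  note ip = integral_product[OF u(1,2) v(1,2)]
  have "\<And>z. ?f z \<noteq> 0 \<Longrightarrow> G z \<le> g + \<epsilon>" using Gb by blast
  from integrable_weighted_product[OF u(1,2) v(1,2) this]
  have int: "integrable (\<mu>' \<Otimes>\<^sub>M \<mu>) (\<lambda>z. exp (\<delta> * G z) / mass * ?f z)" by blast
  have lo: "exp (\<delta> * (g - \<epsilon>)) / mass * ?c \<le> limit_functional ?f"
  proof -
    have "(\<integral>z. exp (\<delta> * (g - \<epsilon>)) / mass * ?f z \<partial>(\<mu>' \<Otimes>\<^sub>M \<mu>)) \<le> limit_functional ?f"
      unfolding limit_functional_def
    proof (rule integral_mono[OF integrable_mult_right[OF ip(1)] int])
      fix z
      show "exp (\<delta> * (g - \<epsilon>)) / mass * ?f z \<le> exp (\<delta> * G z) / mass * ?f z"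
      proof (cases "?f z = 0")
        case False
        then show ?thesis using Gb[OF False] u(2) v(2) delta_positive by (intro mult_right_mono divide_right_mono) auto
      qed (simp only: mult_zero_right order_refl)
    qed
    then show ?thesis by (simp only: integral_mult_right_zero ip(2))
  qed
  have hi: "limit_functional ?f \<le> exp (\<delta> * (g + \<epsilon>)) / mass * ?c"
  proof -
    have "limit_functional ?f \<le> (\<integral>z. exp (\<delta> * (g + \<epsilon>)) / mass * ?f z \<partial>(\<mu>' \<Otimes>\<^sub>M \<mu>))"
      unfolding limit_functional_def
    proof (rule integral_mono[OF int integrable_mult_right[OF ip(1)]])
      fix z
      show "exp (\<delta> * G z) / mass * ?f z \<le> exp (\<delta> * (g + \<epsilon>)) / mass * ?f z"
      proof (cases "?f z = 0")
        case False
        then show ?thesis using Gb[OF False] u(2) v(2) delta_positive by (intro mult_right_mono divide_right_mono) auto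
      qed (simp only: mult_zero_right order_refl)
    qed
    then show ?thesis by (simp only: integral_mult_right_zero ip(2))
  qed
  have "\<forall>\<^sub>F T in at_top. exp (\<delta> * (g - \<epsilon>)) * box.box_mass - e \<le> \<delta> * exp (- \<delta> * T) * (\<Sum>\<gamma>\<in>?S T. weight u v \<gamma>) \<and>
      \<delta> * exp (- \<delta> * T) * (\<Sum>\<gamma>\<in>?S T. weight u v \<gamma>) \<le> exp (\<delta> * (g + \<epsilon>)) * box.box_mass + e"
    by (rule box.period_count_bounds[OF _ e]) (rule osc)
  then show ?thesis
  proof eventually_elim
    case (elim T)
    have "exp (\<delta> * (g - \<epsilon>)) / mass * ?c - e \<le> counting \<kappa> ?f T" "counting \<kappa> ?f T \<le> exp (\<delta> * (g + \<epsilon>)) / mass * ?c + e"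
      using elim unfolding N_eq bmass by simp_all
    moreover have "(exp (\<delta> * (g + \<epsilon>)) - exp (\<delta> * (g - \<epsilon>))) / mass * ?c =
        exp (\<delta> * (g + \<epsilon>)) / mass * ?c - exp (\<delta> * (g - \<epsilon>)) / mass * ?c"
      by (simp only: diff_divide_distrib left_diff_distrib)
    ultimately show ?case using lo hi by linarith
  qed
qed

text \<open>With a fine partition of unity \<open>p\<close>, the function \<open>F\<close> is uniformly close to the sum of
  \<open>F(z,w) p\<^sub>z(x) p\<^sub>w(y)\<close> over the pairs \<open>(z,w)\<close> of centres that are far apart. The error is controlled by
  \<open>H\<close>, the sum of these products, to which both functionals assign bounded mass. For each product the two
  functionals differ by little, by \<open>product_counting_error\<close>.\<close>

lemma counting_limit_compact:
  fixes F :: "'m \<times> 'm \<Rightarrow> real"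
  assumes \<kappa>: "\<kappa> > 0" and F: "continuous_on {(x, y). \<kappa> \<le> dist x y} F"
    and supp: "\<And>x y. F (x, y) \<noteq> 0 \<Longrightarrow> 2 * \<kappa> \<le> dist x y"
  shows "(counting \<kappa> F \<longlongrightarrow> limit_functional F) at_top"
proof (rule tendstoI)
  fix e :: real assume e: "e > 0"
  define K :: "('m \<times> 'm) set" where "K = {z. \<kappa> \<le> dist (fst z) (snd z)}"
  have K_eq: "{(x, y). \<kappa> \<le> dist x y} = K" by (auto simp: K_def)
  have clK: "closed K" unfolding K_def by (rule closed_far_pairs)
  have cK: "compact K" unfolding K_def by (rule compact_far_pairs)
  have Kd: "K \<subseteq> distinct_pairs UNIV" unfolding K_def by (rule far_pairs_distinct[OF \<kappa>])
  have cF: "continuous_on K F" using F unfolding K_eq .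
  have cG: "continuous_on K G"
    using gps Kd continuous_on_subset by (auto simp: continuous_GPS_system_def)
  have "bounded (F ` K)" "bounded (G ` K)"
    using compact_continuous_image[OF cF cK] compact_continuous_image[OF cG cK] compact_imp_bounded by blast+
  then obtain CF0 CG0 where "\<And>z. z \<in> K \<Longrightarrow> \<bar>F z\<bar> \<le> CF0" "\<And>z. z \<in> K \<Longrightarrow> \<bar>G z\<bar> \<le> CG0"
    by (auto simp: bounded_iff)
  then obtain CF CG where CF: "CF \<ge> 0" "\<And>z. z \<in> K \<Longrightarrow> \<bar>F z\<bar> \<le> CF" and CG: "\<And>z. z \<in> K \<Longrightarrow> \<bar>G z\<bar> \<le> CG"
    by (metis abs_ge_zero abs_ge_self order_trans)
  have F0: "F z = 0" if "z \<notin> K" for z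
    using that supp[of "fst z" "snd z"] \<kappa> by (cases z) (force simp: K_def)
  define Q where "Q = exp (\<delta> * CG) / mass"
  have Q0: "Q \<ge> 0" by (simp add: Q_def)
  define e1 where "e1 = min 1 (e / (4 * (CF + 1)))"
  have e1: "e1 > 0" "e1 \<le> 1" "CF * e1 \<le> e / 4"
  proof -
    show "e1 > 0" "e1 \<le> 1" using e CF by (auto simp: e1_def)
    have "e1 * (CF + 1) \<le> e / 4"
    proof -
      have "e1 * (CF + 1) \<le> e / (4 * (CF + 1)) * (CF + 1)" using CF by (intro mult_right_mono) (auto simp: e1_def)
      also have "\<dots> = e / 4"
      proof -
        have "CF + 1 \<noteq> 0" using CF by simp
        then show ?thesis by (simp add: divide_simps)
      qed
      finally show ?thesis .
    qed
    then show "CF * e1 \<le> e / 4" using \<open>e1 > 0\<close> by (simp add: algebra_simps)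
  qed
  define \<omega> where "\<omega> = e / (8 * (Q + 1))"
  have \<omega>: "\<omega> > 0" "\<omega> * (2 * Q + 2) = e / 4" using e Q0 by (auto simp: \<omega>_def field_simps)
  \<comment> \<open>If \<open>G\<close> varies by at most \<open>\<epsilon>\<close> on a box, the error in \<open>product_counting_error\<close> is at most \<open>e1\<close> times
    the product of the integrals.\<close>
  obtain \<epsilon> where \<epsilon>: "\<epsilon> > 0" "(exp (\<delta> * \<epsilon>) - exp (- \<delta> * \<epsilon>)) * Q \<le> e1"
  proof -
    have "isCont (\<lambda>t. (exp (\<delta> * t) - exp (- \<delta> * t)) * Q) 0" by (intro continuous_intros)
    from tendstoD[OF isContD[OF this] e1(1)]
    have "\<forall>\<^sub>F t in at_right 0. \<bar>(exp (\<delta> * t) - exp (- \<delta> * t)) * Q\<bar> < e1"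
      by (auto simp: eventually_at_filter dist_real_def elim: eventually_mono)
    moreover have "\<forall>\<^sub>F t::real in at_right 0. 0 < t" by (simp add: eventually_at_filter)
    ultimately obtain t where "0 < t" "\<bar>(exp (\<delta> * t) - exp (- \<delta> * t)) * Q\<bar> < e1"
      using eventually_happens[OF eventually_conj] by (metis (lifting) trivial_limit_at_right_real)
    then show ?thesis using that[of t] by simp
  qed
  define D where "D = (exp (\<delta> * \<epsilon>) - exp (- \<delta> * \<epsilon>)) * Q"
  have D: "0 \<le> D" "D \<le> e1"
  proof -
    have "- \<delta> * \<epsilon> \<le> \<delta> * \<epsilon>" using \<epsilon>(1) delta_positive mult_nonneg_nonneg[of \<delta> \<epsilon>] by simp
    then show "0 \<le> D" using Q0 by (simp add: D_def)
    show "D \<le> e1" using \<epsilon> by (simp add: D_def)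
  qed
  obtain d1 where d1: "d1 > 0" "\<And>z w. z \<in> K \<Longrightarrow> w \<in> K \<Longrightarrow> dist w z < d1 \<Longrightarrow> dist (F w) (F z) < \<omega>"
    using compact_uniformly_continuous[OF cF cK] \<omega>(1) unfolding uniformly_continuous_on_def by metis
  obtain d2 where d2: "d2 > 0" "\<And>z w. z \<in> K \<Longrightarrow> w \<in> K \<Longrightarrow> dist w z < d2 \<Longrightarrow> dist (G w) (G z) < \<epsilon>"
    using compact_uniformly_continuous[OF cG cK] \<epsilon>(1) unfolding uniformly_continuous_on_def by metis
  obtain r1 where r1: "r1 > 0" "\<And>z. measure \<mu> (cball z r1) < 1"
    by (rule balls_not_full[OF sets_PS(3,1) PS_not_dirac[OF ps cocycle_cont(1)]]) blast+
  obtain r2 where r2: "r2 > 0" "\<And>z. measure \<mu>' (cball z r2) < 1"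
    by (rule balls_not_full[OF sets_PS(4,2) PS_not_dirac[OF ps' cocycle_cont(2)]]) blast+
  define \<rho> where "\<rho> = min (min (\<kappa> / 8) (min (d1 / 4) (d2 / 4))) (min r1 r2)"
  have \<rho>: "\<rho> > 0" "\<rho> \<le> \<kappa> / 8" "\<rho> \<le> d1 / 4" "\<rho> \<le> d2 / 4" "\<rho> \<le> r1" "\<rho> \<le> r2"
    using \<kappa> d1 d2 r1 r2 by (auto simp: \<rho>_def)
  interpret \<mu>: prob_space \<mu> by (rule sets_PS)
  interpret \<mu>': prob_space \<mu>' by (rule sets_PS)
  interpret PP: prob_space "\<mu>' \<Otimes>\<^sub>M \<mu>" by (rule prob_pair)
  have bm: "measure \<mu> (cball z \<rho>) < 1" "measure \<mu>' (cball z \<rho>) < 1" for z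
  proof -
    have "measure \<mu> (cball z \<rho>) \<le> measure \<mu> (cball z r1)" using \<rho> by (intro \<mu>.finite_measure_mono) (auto simp: sets_PS)
    then show "measure \<mu> (cball z \<rho>) < 1" using r1(2)[of z] by simp
    have "measure \<mu>' (cball z \<rho>) \<le> measure \<mu>' (cball z r2)" using \<rho> by (intro \<mu>'.finite_measure_mono) (auto simp: sets_PS)
    then show "measure \<mu>' (cball z \<rho>) < 1" using r2(2)[of z] by simp
  qed
  obtain Z :: "'m set" and p :: "'m \<Rightarrow> 'm \<Rightarrow> real" where Zp: "finite Z \<and> (\<forall>z. continuous_on UNIV (p z)) \<and>
    (\<forall>z x. 0 \<le> p z x) \<and> (\<forall>z x. p z x \<noteq> 0 \<longrightarrow> x \<in> cball z \<rho>) \<and> (\<forall>x. (\<Sum>z\<in>Z. p z x) = 1)"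
    using partition_of_unity[OF \<rho>(1)] by (elim exE)
  have Z: "finite Z" and p: "\<And>z. continuous_on UNIV (p z)"
    "\<And>z x. 0 \<le> p z x" "\<And>z x. p z x \<noteq> 0 \<Longrightarrow> x \<in> cball z \<rho>" "\<And>x. (\<Sum>z\<in>Z. p z x) = 1"
    using Zp by simp_all
  \<comment> \<open>Only for these pairs of centres can the product of the two pieces meet the support of \<open>F\<close>.\<close>
  define J where "J = {(z, w). z \<in> Z \<and> w \<in> Z \<and> 2 * \<kappa> - 2 * \<rho> \<le> dist z w}"
  have finJ: "finite J" by (rule finite_subset[of _ "Z \<times> Z"]) (use Z in \<open>auto simp: J_def\<close>)
  have JK: "(x, y) \<in> K" if "(z, w) \<in> J" "x \<in> cball z \<rho>" "y \<in> cball w \<rho>" for x y z w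
  proof -
    have "dist z w \<le> dist z x + dist x y + dist y w" using dist_triangle[of z w x] dist_triangle[of x w y] by linarith
    then show ?thesis using that \<rho>(2) \<kappa> by (auto simp: J_def K_def dist_commute)
  qed
  have JK0: "(z, w) \<in> K" if "(z, w) \<in> J" for z w using JK[OF that, of z w] \<rho> by simp
  have near: "dist (x, y) (z, w) < d1" "dist (x, y) (z, w) < d2" if "x \<in> cball z \<rho>" "y \<in> cball w \<rho>" for x y z w
  proof -
    have "dist (x, y) (z, w) \<le> dist x z + dist y w"
      unfolding dist_Pair_Pair by (rule sqrt_sum_squares_le_sum) auto
    then show "dist (x, y) (z, w) < d1" "dist (x, y) (z, w) < d2" using that \<rho> by (auto simp: dist_commute)
  qed
  define H where "H x = (\<Sum>(z, w)\<in>J. p z (fst x) * p w (snd x))" for x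
  define F\<rho> where "F\<rho> x = (\<Sum>(z, w)\<in>J. F (z, w) * (p z (fst x) * p w (snd x)))" for x
  have close: "\<bar>F x - F\<rho> x\<bar> \<le> \<omega> * H x" for x
  proof -
    obtain a b where x: "x = (a, b)" by (cases x)
    have "F x = F x * ((\<Sum>z\<in>Z. p z a) * (\<Sum>w\<in>Z. p w b))" using p(4) by simp
    also have "(\<Sum>z\<in>Z. p z a) * (\<Sum>w\<in>Z. p w b) = (\<Sum>(z, w)\<in>Z \<times> Z. p z a * p w b)"
      by (simp add: sum_product sum.cartesian_product)
    also have "F x * \<dots> = (\<Sum>(z, w)\<in>Z \<times> Z. F x * (p z a * p w b))" by (simp add: sum_distrib_left case_prod_unfold)
    also have "\<dots> = (\<Sum>(z, w)\<in>J. F x * (p z a * p w b))"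
    proof (rule sum.mono_neutral_right)
      show "finite (Z \<times> Z)" using Z by simp
      show "J \<subseteq> Z \<times> Z" by (auto simp: J_def)
      show "\<forall>i\<in>Z \<times> Z - J. (case i of (z, w) \<Rightarrow> F x * (p z a * p w b)) = 0"
      proof clarify
        fix z w assume zw: "z \<in> Z" "w \<in> Z" "(z, w) \<notin> J"
        show "F x * (p z a * p w b) = 0"
        proof (rule ccontr)
          assume "F x * (p z a * p w b) \<noteq> 0"
          then have "2 * \<kappa> \<le> dist a b" "dist z a \<le> \<rho>" "dist w b \<le> \<rho>" using supp[of a b] p(3)[of z a] p(3)[of w b] x by auto
          moreover have "dist a b \<le> dist a z + dist z w + dist w b" using dist_triangle[of a b z] dist_triangle[of z b w] by linarith
          ultimately have "(z, w) \<in> J" using zw by (auto simp: J_def dist_commute)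
          then show False using zw by simp
        qed
      qed
    qed
    finally have Fx: "F x = (\<Sum>(z, w)\<in>J. F x * (p z a * p w b))" .
    have "\<bar>F x - F\<rho> x\<bar> = \<bar>\<Sum>(z, w)\<in>J. (F x - F (z, w)) * (p z a * p w b)\<bar>"
      by (subst Fx) (simp add: F\<rho>_def x sum_subtractf[symmetric] case_prod_unfold left_diff_distrib)
    also have "\<dots> \<le> (\<Sum>i\<in>J. \<bar>case i of (z, w) \<Rightarrow> (F x - F (z, w)) * (p z a * p w b)\<bar>)" by (rule sum_abs)
    also have "\<dots> \<le> (\<Sum>(z, w)\<in>J. \<omega> * (p z a * p w b))"
    proof (rule sum_mono, clarify)
      fix z w assume zw: "(z, w) \<in> J"
      show "\<bar>(F x - F (z, w)) * (p z a * p w b)\<bar> \<le> \<omega> * (p z a * p w b)"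
      proof (cases "p z a * p w b = 0")
        case False
        then have ab: "a \<in> cball z \<rho>" "b \<in> cball w \<rho>" using p(3)[of z a] p(3)[of w b] by auto
        have "dist (F x) (F (z, w)) < \<omega>" unfolding x by (rule d1(2)[OF JK0[OF zw] JK[OF zw ab] near(1)[OF ab]])
        then show ?thesis using p(2) by (simp add: abs_mult dist_real_def mult_right_mono)
      qed (simp only: mult_zero_right abs_zero)
    qed
    also have "\<dots> = \<omega> * H x" by (simp add: H_def x sum_distrib_left case_prod_unfold)
    finally show ?thesis .
  qed
  have H0: "0 \<le> H x" for x unfolding H_def using p(2) by (intro sum_nonneg) auto
  define \<psi> where "\<psi> z = (if z \<in> K then exp (\<delta> * G z) / mass else 0)" for z
  define lam where "lam \<phi> = (\<integral>z. \<psi> z * \<phi> z \<partial>(\<mu>' \<Otimes>\<^sub>M \<mu>))" for \<phi>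
  have \<psi>0: "0 \<le> \<psi> z" and \<psi>Q: "\<psi> z \<le> Q" for z
    using CG[of z] delta_positive Q0
    by (auto simp: \<psi>_def Q_def intro!: divide_right_mono)
  have Kmeas: "K \<in> sets borel" using clK by simp
  have m\<psi>: "\<psi> \<in> borel_measurable borel"
    unfolding \<psi>_def[abs_def] using G_borel Kmeas by measurable
  have mF: "F \<in> borel_measurable borel"
  proof -
    have "F = (\<lambda>z. indicator K z *\<^sub>R F z)" using F0 by (auto simp: fun_eq_iff indicator_def)
    then show ?thesis using borel_measurable_continuous_on_indicator[OF Kmeas cF] by simp
  qed
  have intb: "integrable (\<mu>' \<Otimes>\<^sub>M \<mu>) f" if "f \<in> borel_measurable borel" "\<And>z. \<bar>f z\<bar> \<le> C" for f :: "'m \<times> 'm \<Rightarrow> real" and C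
    by (rule PP.integrable_const_bound[of _ C]) (use that measurable_cong_sets[OF sets_pair refl] in auto)
  have FC: "\<bar>F z\<bar> \<le> CF" for z using CF F0[of z] by (cases "z \<in> K") auto
  have int\<psi>F: "integrable (\<mu>' \<Otimes>\<^sub>M \<mu>) (\<lambda>z. \<psi> z * F z)"
  proof (rule intb[of _ "Q * CF"])
    show "(\<lambda>z. \<psi> z * F z) \<in> borel_measurable borel" using m\<psi> mF by measurable
    show "\<bar>\<psi> z * F z\<bar> \<le> Q * CF" for z
      unfolding abs_mult using \<psi>0 \<psi>Q FC Q0 by (intro mult_mono) auto
  qed
  define f where "f i = (\<lambda>x. p (fst i) (fst x) * p (snd i) (snd x))" for i
  have fK: "x \<in> K" if "i \<in> J" "f i x \<noteq> 0" for i x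
    using JK[of "fst i" "snd i" "fst x" "snd x"] that p(3) by (simp add: f_def)
  have lamf: "limit_functional (f i) = lam (f i)" if "i \<in> J" for i
    unfolding lam_def limit_functional_def
    by (rule Bochner_Integration.integral_cong) (use fK[OF that] in \<open>auto simp: \<psi>_def\<close>)
  have int\<psi>f: "integrable (\<mu>' \<Otimes>\<^sub>M \<mu>) (\<lambda>x. \<psi> x * f i x)" if i: "i \<in> J" for i
  proof -
    have "\<And>x. f i x \<noteq> 0 \<Longrightarrow> G x \<le> CG" using CG fK[OF i] abs_le_D1 by blast
    from integrable_weighted_product[OF p(1,2) p(1,2) this[unfolded f_def]]
    have "integrable (\<mu>' \<Otimes>\<^sub>M \<mu>) (\<lambda>x. exp (\<delta> * G x) / mass * f i x)" by (simp add: f_def)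
    moreover have "exp (\<delta> * G x) / mass * f i x = \<psi> x * f i x" for x
      using fK[OF i, of x] by (auto simp: \<psi>_def)
    ultimately show ?thesis by simp
  qed
  define c where "c z w = (\<integral>x. p z x \<partial>\<mu>') * (\<integral>y. p w y \<partial>\<mu>)" for z w
  have c0: "0 \<le> c z w" for z w unfolding c_def using p(2) by simp
  have csum: "(\<Sum>(z, w)\<in>J. c z w) \<le> 1"
  proof -
    note i' = nn_integral_continuous(1)[OF sets_PS(4,2) p(1,2)] and i = nn_integral_continuous(1)[OF sets_PS(3,1) p(1,2)]
    have "(\<Sum>(z, w)\<in>J. c z w) \<le> (\<Sum>(z, w)\<in>Z \<times> Z. c z w)"
      by (rule sum_mono2) (use Z c0 in \<open>auto simp: J_def\<close>)
    also have "\<dots> = (\<Sum>z\<in>Z. \<integral>x. p z x \<partial>\<mu>') * (\<Sum>w\<in>Z. \<integral>y. p w y \<partial>\<mu>)"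
      by (simp add: c_def sum_product sum.cartesian_product)
    also have "(\<Sum>z\<in>Z. \<integral>x. p z x \<partial>\<mu>') = 1"
      using Bochner_Integration.integral_sum[of Z \<mu>' p, OF i'] p(4) by (simp add: \<mu>'.prob_space)
    also have "(\<Sum>w\<in>Z. \<integral>y. p w y \<partial>\<mu>) = 1"
      using Bochner_Integration.integral_sum[of Z \<mu> p, OF i] p(4) by (simp add: \<mu>.prob_space)
    finally show ?thesis by simp
  qed
  \<comment> \<open>The errors of all pairs in \<open>J\<close> add up to at most \<open>e1\<close>.\<close>
  define e2 where "e2 = e1 / (real (card J) + 1)"
  have e2: "e2 > 0" "real (card J) * e2 \<le> e1"
    using e1 by (auto simp: e2_def field_simps)
  have box: "\<forall>\<^sub>F T in at_top. \<bar>counting \<kappa> (f i) T - lam (f i)\<bar> \<le> D * c (fst i) (snd i) + e2" if i: "i \<in> J" for i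
  proof -
    obtain z w where zw: "i = (z, w)" "(z, w) \<in> J" using i by (cases i) auto
    have ne: "cball z \<rho> \<noteq> {}" "cball w \<rho> \<noteq> {}" using \<rho> by (auto intro: centre_in_cball[THEN iffD2])
    have far: "\<kappa> \<le> dist x y" if "x \<in> cball z \<rho>" "y \<in> cball w \<rho>" for x y
      using JK[OF zw(2) that] by (simp add: K_def)
    have Gz: "\<bar>G (x, y) - G (z, w)\<bar> \<le> \<epsilon>" if "x \<in> cball z \<rho>" "y \<in> cball w \<rho>" for x y
      using d2(2)[OF JK0[OF zw(2)] JK[OF zw(2) that] near(2)[OF that]] by (simp add: dist_real_def)
    have gap: "(exp (\<delta> * (G (z, w) + \<epsilon>)) - exp (\<delta> * (G (z, w) - \<epsilon>))) / mass \<le> D"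
    proof -
      have "exp (\<delta> * (G (z, w) + \<epsilon>)) = exp (\<delta> * \<epsilon>) * exp (\<delta> * G (z, w))"
        "exp (\<delta> * (G (z, w) - \<epsilon>)) = exp (- \<delta> * \<epsilon>) * exp (\<delta> * G (z, w))"
        by (simp_all add: exp_add[symmetric] algebra_simps)
      then have "(exp (\<delta> * (G (z, w) + \<epsilon>)) - exp (\<delta> * (G (z, w) - \<epsilon>))) / mass
          = (exp (\<delta> * \<epsilon>) - exp (- \<delta> * \<epsilon>)) * (exp (\<delta> * G (z, w)) / mass)"
        by (simp only: left_diff_distrib diff_divide_distrib times_divide_eq_right)
      also have "\<dots> \<le> D" unfolding D_def
      proof (rule mult_left_mono)
        show "exp (\<delta> * G (z, w)) / mass \<le> Q" using \<psi>Q[of "(z, w)"] JK0[OF zw(2)] by (simp add: \<psi>_def)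
        have "- \<delta> * \<epsilon> \<le> \<delta> * \<epsilon>" using \<epsilon>(1) delta_positive mult_nonneg_nonneg[of \<delta> \<epsilon>] by simp
        then show "0 \<le> exp (\<delta> * \<epsilon>) - exp (- \<delta> * \<epsilon>)" by simp
      qed
      finally show ?thesis .
    qed
    have "\<forall>\<^sub>F T in at_top. \<bar>counting \<kappa> (\<lambda>x. p z (fst x) * p w (snd x)) T - limit_functional (\<lambda>x. p z (fst x) * p w (snd x))\<bar>
        \<le> (exp (\<delta> * (G (z, w) + \<epsilon>)) - exp (\<delta> * (G (z, w) - \<epsilon>))) / mass * ((\<integral>x. p z x \<partial>\<mu>') * (\<integral>y. p w y \<partial>\<mu>)) + e2"
      by (rule product_counting_error[OF p(1-3) p(1-3) closed_cball closed_cball ne bm \<kappa> far Gz e2(1)])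
    then show ?thesis
    proof eventually_elim
      case (elim T)
      have "(exp (\<delta> * (G (z, w) + \<epsilon>)) - exp (\<delta> * (G (z, w) - \<epsilon>))) / mass * c z w \<le> D * c z w"
        using gap c0 by (rule mult_right_mono)
      then show ?case using elim lamf[OF i] by (simp add: zw(1) f_def c_def)
    qed
  qed
  have "\<forall>\<^sub>F T in at_top. \<forall>i\<in>J. \<bar>counting \<kappa> (f i) T - lam (f i)\<bar> \<le> D * c (fst i) (snd i) + e2"
    by (rule eventually_ball_finite[OF finJ]) (use box in auto)
  then have main: "\<forall>\<^sub>F T in at_top. \<bar>counting \<kappa> F T - lam F\<bar> < e"
  proof eventually_elim
    case (elim T)
    have errsum: "(\<Sum>i\<in>J. D * c (fst i) (snd i) + e2) \<le> D + e1"
    proof -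
      have "(\<Sum>i\<in>J. D * c (fst i) (snd i) + e2) = D * (\<Sum>(z, w)\<in>J. c z w) + real (card J) * e2"
        by (simp add: case_prod_unfold sum.distrib sum_distrib_left)
      also have "\<dots> \<le> D * 1 + e1" using csum D e2 by (intro add_mono mult_left_mono) auto
      finally show ?thesis by simp
    qed
    have cnt_sum: "counting \<kappa> (\<lambda>x. \<Sum>i\<in>J. b i * f i x) T = (\<Sum>i\<in>J. b i * counting \<kappa> (f i) T)" for b
      unfolding counting_def by (subst sum.swap) (simp add: sum_distrib_left ac_simps)
    have lam_sum: "lam (\<lambda>x. \<Sum>i\<in>J. b i * f i x) = (\<Sum>i\<in>J. b i * lam (f i))" for b
    proof -
      have "lam (\<lambda>x. \<Sum>i\<in>J. b i * f i x) = (\<integral>x. (\<Sum>i\<in>J. b i * (\<psi> x * f i x)) \<partial>(\<mu>' \<Otimes>\<^sub>M \<mu>))"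
        unfolding lam_def by (simp add: sum_distrib_left ac_simps)
      also have "\<dots> = (\<Sum>i\<in>J. \<integral>x. b i * (\<psi> x * f i x) \<partial>(\<mu>' \<Otimes>\<^sub>M \<mu>))"
        by (rule Bochner_Integration.integral_sum) (intro integrable_mult_right int\<psi>f)
      finally show ?thesis by (simp add: lam_def)
    qed
    have diff: "\<bar>(\<Sum>i\<in>J. b i * counting \<kappa> (f i) T) - (\<Sum>i\<in>J. b i * lam (f i))\<bar> \<le> B * (D + e1)"
      if b: "\<And>i. i \<in> J \<Longrightarrow> \<bar>b i\<bar> \<le> B" and B: "B \<ge> 0" for b B
    proof -
      have "\<bar>(\<Sum>i\<in>J. b i * counting \<kappa> (f i) T) - (\<Sum>i\<in>J. b i * lam (f i))\<bar>
        \<le> (\<Sum>i\<in>J. \<bar>b i * (counting \<kappa> (f i) T - lam (f i))\<bar>)"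
        unfolding sum_subtractf[symmetric] right_diff_distrib[symmetric] by (rule sum_abs)
      also have "\<dots> \<le> (\<Sum>i\<in>J. B * (D * c (fst i) (snd i) + e2))"
        unfolding abs_mult using b B elim by (intro sum_mono mult_mono) auto
      also have "\<dots> = B * (\<Sum>i\<in>J. D * c (fst i) (snd i) + e2)" by (simp add: sum_distrib_left)
      also have "\<dots> \<le> B * (D + e1)" using errsum B by (rule mult_left_mono)
      finally show ?thesis .
    qed
    have F\<rho>f: "F\<rho> = (\<lambda>x. \<Sum>i\<in>J. F i * f i x)" and Hf: "H = (\<lambda>x. \<Sum>i\<in>J. 1 * f i x)"
      by (auto simp: F\<rho>_def H_def f_def case_prod_unfold)
    have A1: "\<bar>counting \<kappa> F\<rho> T - lam F\<rho>\<bar> \<le> CF * (D + e1)"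
      unfolding F\<rho>f cnt_sum lam_sum using FC CF(1) by (intro diff)
    have A2: "\<bar>counting \<kappa> H T - lam H\<bar> \<le> 1 * (D + e1)"
      unfolding Hf cnt_sum lam_sum by (intro diff) auto
    have A3: "\<bar>counting \<kappa> F T - counting \<kappa> F\<rho> T\<bar> \<le> \<omega> * counting \<kappa> H T"
    proof -
      let ?N = "{\<gamma>\<in>\<Gamma>. loxodromic \<gamma> \<and> \<kappa> \<le> dist (repelling \<gamma>) (attracting \<gamma>) \<and> period \<sigma> \<gamma> \<le> T}"
      have "\<bar>counting \<kappa> F T - counting \<kappa> F\<rho> T\<bar>
          = \<delta> * exp (- \<delta> * T) * \<bar>\<Sum>\<gamma>\<in>?N. F (repelling \<gamma>, attracting \<gamma>) - F\<rho> (repelling \<gamma>, attracting \<gamma>)\<bar>"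
        using delta_positive by (simp add: counting_def sum_subtractf right_diff_distrib[symmetric] abs_mult)
      also have "\<dots> \<le> \<delta> * exp (- \<delta> * T) * (\<Sum>\<gamma>\<in>?N. \<omega> * H (repelling \<gamma>, attracting \<gamma>))"
        using delta_positive close by (intro mult_left_mono order_trans[OF sum_abs] sum_mono) auto
      also have "\<dots> = \<omega> * counting \<kappa> H T" by (simp add: counting_def sum_distrib_left ac_simps)
      finally show ?thesis .
    qed
    have int_sum: "integrable (\<mu>' \<Otimes>\<^sub>M \<mu>) (\<lambda>x. \<psi> x * (\<Sum>i\<in>J. b i * f i x))" for b
    proof -
      have "integrable (\<mu>' \<Otimes>\<^sub>M \<mu>) (\<lambda>x. \<Sum>i\<in>J. b i * (\<psi> x * f i x))"
        by (intro Bochner_Integration.integrable_sum integrable_mult_right int\<psi>f)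
      then show ?thesis by (simp add: sum_distrib_left ac_simps)
    qed
    have int\<psi>F\<rho>: "integrable (\<mu>' \<Otimes>\<^sub>M \<mu>) (\<lambda>x. \<psi> x * F\<rho> x)" unfolding F\<rho>f by (rule int_sum)
    have int\<psi>H: "integrable (\<mu>' \<Otimes>\<^sub>M \<mu>) (\<lambda>x. \<psi> x * H x)" unfolding Hf by (rule int_sum)
    have A4: "\<bar>lam F - lam F\<rho>\<bar> \<le> \<omega> * lam H"
    proof -
      have "\<bar>lam F - lam F\<rho>\<bar> = \<bar>\<integral>x. \<psi> x * F x - \<psi> x * F\<rho> x \<partial>(\<mu>' \<Otimes>\<^sub>M \<mu>)\<bar>"
        using int\<psi>F int\<psi>F\<rho> by (simp add: lam_def)
      also have "\<dots> \<le> (\<integral>x. \<bar>\<psi> x * F x - \<psi> x * F\<rho> x\<bar> \<partial>(\<mu>' \<Otimes>\<^sub>M \<mu>))" by (rule integral_abs_bound)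
      also have "\<dots> \<le> (\<integral>x. \<omega> * (\<psi> x * H x) \<partial>(\<mu>' \<Otimes>\<^sub>M \<mu>))"
      proof (rule integral_mono)
        show "integrable (\<mu>' \<Otimes>\<^sub>M \<mu>) (\<lambda>x. \<bar>\<psi> x * F x - \<psi> x * F\<rho> x\<bar>)"
          using int\<psi>F int\<psi>F\<rho> by (intro integrable_abs Bochner_Integration.integrable_diff)
        show "integrable (\<mu>' \<Otimes>\<^sub>M \<mu>) (\<lambda>x. \<omega> * (\<psi> x * H x))" using int\<psi>H by (rule integrable_mult_right)
        fix x
        have "\<bar>\<psi> x * F x - \<psi> x * F\<rho> x\<bar> = \<psi> x * \<bar>F x - F\<rho> x\<bar>"
          using \<psi>0[of x] by (simp add: right_diff_distrib[symmetric] abs_mult)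
        also have "\<dots> \<le> \<psi> x * (\<omega> * H x)" using \<psi>0 close by (intro mult_left_mono)
        finally show "\<bar>\<psi> x * F x - \<psi> x * F\<rho> x\<bar> \<le> \<omega> * (\<psi> x * H x)" by (simp add: ac_simps)
      qed
      finally show ?thesis by (simp add: lam_def)
    qed
    have H1: "H x \<le> 1" for x
    proof -
      have "H x \<le> (\<Sum>(z, w)\<in>Z \<times> Z. p z (fst x) * p w (snd x))"
        unfolding H_def by (rule sum_mono2) (use Z p(2) in \<open>auto simp: J_def\<close>)
      also have "\<dots> = (\<Sum>z\<in>Z. p z (fst x)) * (\<Sum>w\<in>Z. p w (snd x))" by (simp add: sum_product sum.cartesian_product)
      finally show ?thesis using p(4) by simp
    qed
    have A5: "lam H \<le> Q"
    proof -
      have "lam H \<le> (\<integral>x. Q \<partial>(\<mu>' \<Otimes>\<^sub>M \<mu>))"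
        unfolding lam_def
      proof (rule integral_mono[OF int\<psi>H])
        show "\<psi> x * H x \<le> Q" for x
          using mult_mono[OF \<psi>Q[of x] H1[of x] Q0 H0[of x]] by simp
      qed simp
      then show ?thesis by (simp add: PP.prob_space)
    qed
    have "\<omega> * counting \<kappa> H T \<le> \<omega> * (Q + (D + e1))" using A2 A5 \<omega>(1) by (intro mult_left_mono) auto
    moreover have "\<omega> * lam H \<le> \<omega> * Q" using A5 \<omega>(1) by (intro mult_left_mono) auto
    moreover have "\<omega> * (Q + (D + e1)) + \<omega> * Q \<le> \<omega> * (2 * Q + 2)"
    proof -
      have "\<omega> * (D + e1) \<le> \<omega> * 2" using D e1 \<omega>(1) by (intro mult_left_mono) auto
      then show ?thesis by (simp add: algebra_simps)
    qed
    moreover have "CF * (D + e1) \<le> e / 4 + e / 4"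
    proof -
      have "CF * D \<le> CF * e1" using D CF by (intro mult_left_mono) auto
      then show ?thesis using e1(3) by (simp add: distrib_left)
    qed
    ultimately show ?case using A1 A3 A4 \<omega>(2) e by linarith
  qed
  have "lam F = limit_functional F"
    unfolding lam_def limit_functional_def by (rule Bochner_Integration.integral_cong) (auto simp: \<psi>_def F0)
  then show "\<forall>\<^sub>F T in at_top. dist (counting \<kappa> F T) (limit_functional F) < e"
    using main by (simp add: dist_real_def)
qed

end

lemma scale_measure_eq_density: "scale_measure r M = density M (\<lambda>_. r)"
  by (rule measure_eqI) (simp_all add: emeasure_density nn_integral_cmult_indicator)

context bms_system begin

lemma lox_counting_integral:
  fixes f F :: "'m \<times> 'm \<Rightarrow> real"
  assumes f: "continuous_on (distinct_pairs UNIV) f"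
    and F: "\<And>z. z \<in> distinct_pairs UNIV \<Longrightarrow> F z = f z"
    and \<kappa>: "\<kappa> > 0" "\<And>x y. F (x, y) \<noteq> 0 \<Longrightarrow> \<kappa> \<le> dist x y"
  shows "integral\<^sup>L (scale_measure (ennreal (\<delta> * exp (- \<delta> * T))) (lox_counting_measure \<Gamma> \<sigma> T)) f =
    counting \<kappa> F T"
proof -
  let ?A = "{\<gamma>\<in>\<Gamma>. loxodromic \<gamma> \<and> period \<sigma> \<gamma> \<le> T}"
  let ?N = "{\<gamma>\<in>\<Gamma>. loxodromic \<gamma> \<and> \<kappa> \<le> dist (repelling \<gamma>) (attracting \<gamma>) \<and> period \<sigma> \<gamma> \<le> T}"
  let ?R = "restrict_space borel (distinct_pairs (UNIV :: 'm set))"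
  have pd: "(repelling \<gamma>, attracting \<gamma>) \<in> distinct_pairs UNIV" if "loxodromic \<gamma>" for \<gamma> :: "'m \<Rightarrow> 'm"
    using loxodromicD(2)[OF that] by (auto simp: distinct_pairs_def)
  have mf: "f \<in> borel_measurable ?R" by (rule borel_measurable_continuous_on_restrict[OF f])
  have mg: "(\<lambda>\<gamma>. (repelling \<gamma>, attracting \<gamma>)) \<in> count_space ?A \<rightarrow>\<^sub>M ?R"
    using pd by (auto simp: space_restrict_space)
  have mf': "f \<in> borel_measurable (lox_counting_measure \<Gamma> \<sigma> T)" using mf by (simp add: lox_counting_measure_def)
  have finN: "finite ?N"
    by (rule finite_counted[OF \<kappa>(1)])
  have sub: "{\<gamma>\<in>?A. f (repelling \<gamma>, attracting \<gamma>) \<noteq> 0} \<subseteq> ?N"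
    using \<kappa>(2) F pd by force
  have "integral\<^sup>L (scale_measure (ennreal (\<delta> * exp (- \<delta> * T))) (lox_counting_measure \<Gamma> \<sigma> T)) f
    = (\<integral>z. (\<delta> * exp (- \<delta> * T)) *\<^sub>R f z \<partial>lox_counting_measure \<Gamma> \<sigma> T)"
    unfolding scale_measure_eq_density using delta_nonneg by (intro integral_density mf') auto
  also have "\<dots> = \<delta> * exp (- \<delta> * T) * (\<integral>z. f z \<partial>lox_counting_measure \<Gamma> \<sigma> T)" by simp
  also have "(\<integral>z. f z \<partial>lox_counting_measure \<Gamma> \<sigma> T) = (\<integral>\<gamma>. f (repelling \<gamma>, attracting \<gamma>) \<partial>count_space ?A)"
    unfolding lox_counting_measure_def by (rule integral_distr[OF mg mf])
  also have "\<dots> = (\<Sum>\<gamma> | \<gamma> \<in> ?A \<and> f (repelling \<gamma>, attracting \<gamma>) \<noteq> 0. f (repelling \<gamma>, attracting \<gamma>))"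
    by (rule lebesgue_integral_count_space_finite_support) (rule finite_subset[OF sub finN])
  also have "\<dots> = (\<Sum>\<gamma>\<in>?N. f (repelling \<gamma>, attracting \<gamma>))"
    by (rule sum.mono_neutral_left[OF finN sub]) auto
  also have "\<dots> = (\<Sum>\<gamma>\<in>?N. F (repelling \<gamma>, attracting \<gamma>))"
    by (rule sum.cong) (use F pd in auto)
  finally show ?thesis by (simp add: counting_def)
qed

lemma limit_integral:
  fixes f F :: "'m \<times> 'm \<Rightarrow> real"
  assumes f: "continuous_on (distinct_pairs UNIV) f"
    and F: "F = (\<lambda>z. if z \<in> distinct_pairs UNIV then f z else 0)"
  shows "integral\<^sup>L (density (restrict_space (\<mu>' \<Otimes>\<^sub>M \<mu>) (distinct_pairs UNIV))
       (\<lambda>(x, y). ennreal (exp (\<delta> * G (x, y)) / mass))) f = limit_functional F"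
proof -
  let ?R = "restrict_space (\<mu>' \<Otimes>\<^sub>M \<mu>) (distinct_pairs UNIV)"
  have sR: "sets ?R = sets (restrict_space borel (distinct_pairs UNIV))"
    unfolding sets_restrict_space sets_pair ..
  have mf: "f \<in> borel_measurable ?R"
    unfolding measurable_cong_sets[OF sR refl] by (rule borel_measurable_continuous_on_restrict[OF f])
  have mG: "(\<lambda>z. exp (\<delta> * G z) / mass) \<in> borel_measurable (\<mu>' \<Otimes>\<^sub>M \<mu>)"
    unfolding measurable_cong_sets[OF sets_pair refl] using G_borel by measurable
  have eq: "(\<lambda>(x, y). ennreal (exp (\<delta> * G (x, y)) / mass)) = (\<lambda>z. ennreal (exp (\<delta> * G z) / mass))"
    by auto
  have "integral\<^sup>L (density ?R (\<lambda>z. ennreal (exp (\<delta> * G z) / mass))) f = (\<integral>z. (exp (\<delta> * G z) / mass) *\<^sub>R f z \<partial>?R)"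
    by (rule integral_density[OF mf measurable_restrict_space1[OF mG]]) auto
  also have "\<dots> = (\<integral>z. indicator (distinct_pairs UNIV) z *\<^sub>R ((exp (\<delta> * G z) / mass) *\<^sub>R f z) \<partial>(\<mu>' \<Otimes>\<^sub>M \<mu>))"
  proof (rule integral_restrict_space)
    show "distinct_pairs UNIV \<inter> space (\<mu>' \<Otimes>\<^sub>M \<mu>) \<in> sets (\<mu>' \<Otimes>\<^sub>M \<mu>)"
      using borel_open[OF open_distinct_pairs] sets.top[of "\<mu>' \<Otimes>\<^sub>M \<mu>"] sets.Int sets_pair by metis
  qed
  also have "\<dots> = (\<integral>z. exp (\<delta> * G z) / mass * F z \<partial>(\<mu>' \<Otimes>\<^sub>M \<mu>))"
    by (rule Bochner_Integration.integral_cong) (auto simp: F)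
  finally show ?thesis unfolding eq limit_functional_def .
qed

lemma counting_vague_limit:
  "vague_limit_on (distinct_pairs UNIV)
    (\<lambda>T. scale_measure (ennreal (\<delta> * exp (- \<delta> * T))) (lox_counting_measure \<Gamma> \<sigma> T))
    (density (restrict_space (\<mu>' \<Otimes>\<^sub>M \<mu>) (distinct_pairs UNIV))
       (\<lambda>(x, y). ennreal (exp (\<delta> * G (x, y)) / mass)))"
  unfolding vague_limit_on_def
proof (intro allI impI)
  fix f :: "'m \<times> 'm \<Rightarrow> real" assume "compactly_supported_on (distinct_pairs UNIV) f"
  then obtain K where f: "continuous_on (distinct_pairs UNIV) f"
    and K: "compact K" "K \<subseteq> distinct_pairs UNIV" "\<And>z. z \<in> distinct_pairs UNIV \<Longrightarrow> z \<notin> K \<Longrightarrow> f z = 0"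
    unfolding compactly_supported_on_def by blast
  obtain \<kappa> where \<kappa>: "\<kappa> > 0" "\<And>z. z \<in> K \<Longrightarrow> 2 * \<kappa> \<le> dist (fst z) (snd z)"
  proof (cases "K = {}")
    case False
    have "continuous_on K (\<lambda>z. dist (fst z) (snd z))" by (intro continuous_intros)
    from continuous_attains_inf[OF K(1) False this]
    obtain z0 where z0: "z0 \<in> K" "\<And>z. z \<in> K \<Longrightarrow> dist (fst z0) (snd z0) \<le> dist (fst z) (snd z)" by blast
    have "dist (fst z0) (snd z0) > 0" using z0(1) K(2) by (auto simp: distinct_pairs_def)
    then show ?thesis using that[of "dist (fst z0) (snd z0) / 2"] z0(2) by auto
  qed (use that[of 1] in auto)
  define F where "F = (\<lambda>z. if z \<in> distinct_pairs UNIV then f z else 0)"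
  have supp: "2 * \<kappa> \<le> dist x y" if "F (x, y) \<noteq> 0" for x y
  proof -
    have "(x, y) \<in> K" using that K(3) by (auto simp: F_def split: if_splits)
    then show ?thesis using \<kappa>(2) by force
  qed
  have sub: "{(x, y). \<kappa> \<le> dist x y} \<subseteq> distinct_pairs (UNIV :: 'm set)"
    using \<kappa>(1) by (auto simp: distinct_pairs_def)
  have "continuous_on {(x, y). \<kappa> \<le> dist x y} F"
    using continuous_on_subset[OF f sub] by (rule continuous_on_eq) (use sub in \<open>auto simp: F_def\<close>)
  from counting_limit_compact[OF \<kappa>(1) this supp]
  have lim: "(counting \<kappa> F \<longlongrightarrow> limit_functional F) at_top" .
  have supp': "\<kappa> \<le> dist x y" if "F (x, y) \<noteq> 0" for x y using supp[OF that] \<kappa>(1) by simp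
  have Ff: "F z = f z" if "z \<in> distinct_pairs UNIV" for z using that by (simp add: F_def)
  have eq: "integral\<^sup>L (scale_measure (ennreal (\<delta> * exp (- \<delta> * T))) (lox_counting_measure \<Gamma> \<sigma> T)) f =
    counting \<kappa> F T" for T
    by (rule lox_counting_integral[OF f Ff \<kappa>(1) supp'])
  show "((\<lambda>T. integral\<^sup>L (scale_measure (ennreal (\<delta> * exp (- \<delta> * T))) (lox_counting_measure \<Gamma> \<sigma> T)) f) \<longlongrightarrow>
     integral\<^sup>L (density (restrict_space (\<mu>' \<Otimes>\<^sub>M \<mu>) (distinct_pairs UNIV))
       (\<lambda>(x, y). ennreal (exp (\<delta> * G (x, y)) / mass))) f) at_top"
    unfolding limit_integral[OF f F_def] eq by (rule lim)
qed

end

lemma density_cong_on_space: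
  assumes "\<And>x. x \<in> space M \<Longrightarrow> f x = g x"
  shows "density M f = density M g"
proof -
  have "(\<integral>\<^sup>+ x. f x * indicator A x \<partial>M) = (\<integral>\<^sup>+ x. g x * indicator A x \<partial>M)" for A
    by (rule nn_integral_cong) (simp add: assms)
  then show ?thesis by (simp add: density_def)
qed

theorem theorem1p5:
  fixes \<Gamma> :: "('m :: {metric_space, second_countable_topology} \<Rightarrow> 'm) set"
    and \<sigma> \<sigma>' :: "('m \<Rightarrow> 'm) \<Rightarrow> 'm \<Rightarrow> real"
    and G :: "'m \<times> 'm \<Rightarrow> real"
    and d :: "('m \<Rightarrow> 'm) + 'm \<Rightarrow> ('m \<Rightarrow> 'm) + 'm \<Rightarrow> real"
    and mag :: "('m \<Rightarrow> 'm) \<Rightarrow> real"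
    and \<delta> :: real
    and \<mu> \<mu>' :: "'m measure"
    and m :: "('m \<times> 'm \<times> real) set measure"
  assumes "compact (UNIV :: 'm set)"
    and "convergence_group \<Gamma>" and "non_elementary \<Gamma>"
    and "continuous_GPS_system \<Gamma> \<sigma> \<sigma>' G"
    and "compactifying_metric \<Gamma> d" and "magnitude_function \<Gamma> d \<sigma> mag"
    and "critical_exponent \<Gamma> mag = ereal \<delta>"
    and "poincare_series \<Gamma> mag \<delta> = \<infinity>"
    and "PS_measure \<Gamma> \<sigma> \<delta> \<mu>" and "PS_measure \<Gamma> \<sigma>' \<delta> \<mu>'"
    and "BMS_measure \<Gamma> \<sigma> G \<delta> \<mu>' \<mu> m"
    and "finite_measure m" and "mixing m"
  shows "vague_limit_on (distinct_pairs UNIV)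
    (\<lambda>T. scale_measure (ennreal (\<delta> * exp (- \<delta> * T))) (lox_counting_measure \<Gamma> \<sigma> T))
    (density (restrict_space (\<mu>' \<Otimes>\<^sub>M \<mu>) (distinct_pairs UNIV))
       (\<lambda>(x, y). ennreal (exp (\<delta> * G (x, y)) / measure m (space m))))"
proof -
  interpret G: gps_system \<Gamma> \<sigma> \<sigma>' G d mag \<delta>
    by unfold_locales (fact assms)+
  \<comment> \<open>The hypotheses say nothing about \<open>G\<close> on the diagonal. Setting it to zero there makes it Borel, and
    the flow space, the measures and the limit only see pairs of distinct points.\<close>
  define G0 where "G0 z = (if z \<in> distinct_pairs UNIV then G z else 0)" for z
  have G0: "G0 (x, y) = G (x, y)" if "x \<noteq> y" for x y using that by (simp add: G0_def distinct_pairs_def)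
  have contG: "continuous_on (distinct_pairs UNIV) G" using assms(4) by (simp add: continuous_GPS_system_def)
  have contG0: "continuous_on (distinct_pairs UNIV) G0"
    using contG by (rule continuous_on_eq) (simp add: G0_def)
  have "G0 = (\<lambda>z. indicator (distinct_pairs UNIV) z *\<^sub>R G z)" by (auto simp: G0_def fun_eq_iff indicator_def)
  then have G0_borel: "G0 \<in> borel_measurable borel"
    using borel_measurable_continuous_on_indicator[OF borel_open[OF G.open_distinct_pairs] contG] by simp
  have gps0: "continuous_GPS_system \<Gamma> \<sigma> \<sigma>' G0"
    using assms(4) contG0 G.eq_iff G0 unfolding continuous_GPS_system_def by auto
  have "space (restrict_space (\<mu>' \<Otimes>\<^sub>M (\<mu> \<Otimes>\<^sub>M lborel)) (cover_space \<Gamma>)) \<subseteq> cover_space \<Gamma>"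
    by (simp add: space_restrict_space)
  then have "cover_BMS_measure \<Gamma> G0 \<delta> \<mu>' \<mu> = cover_BMS_measure \<Gamma> G \<delta> \<mu>' \<mu>"
    unfolding cover_BMS_measure_def
    by (intro density_cong_on_space) (auto simp: cover_space_def distinct_pairs_def G0)
  then have bms0: "BMS_measure \<Gamma> \<sigma> G0 \<delta> \<mu>' \<mu> m" using assms(11) by (simp add: BMS_measure_def)
  interpret B: bms_system \<Gamma> \<sigma> \<sigma>' G0 d mag \<delta> \<mu> \<mu>' m
    by (intro bms_system.intro gps_system.intro compact_convergence_group.intro gps_system_axioms.intro bms_system_axioms.intro)
      (fact assms gps0 bms0 G0_borel)+
  have "density (restrict_space (\<mu>' \<Otimes>\<^sub>M \<mu>) (distinct_pairs UNIV)) (\<lambda>(x, y). ennreal (exp (\<delta> * G0 (x, y)) / measure m (space m)))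
     = density (restrict_space (\<mu>' \<Otimes>\<^sub>M \<mu>) (distinct_pairs UNIV)) (\<lambda>(x, y). ennreal (exp (\<delta> * G (x, y)) / measure m (space m)))"
    by (rule density_cong_on_space) (auto simp: space_restrict_space G0_def)
  with B.counting_vague_limit show ?thesis by simp
qed

end
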